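(* Fix a positive integer $r$, let $$F_{0,2}(x_1,x_2)=\sum_{\mu_1,\mu_2\ge1}\frac{1}{\mu_1\mu_2}\,\mathcal{H}^r_{0,2}(\mu_1,\mu_2)\,x_1^{\mu_1}x_2^{\mu_2},$$ where $\mathcal{H}^r_{0,2}(\mu_1,\mu_2)$ is the number of arrowed $r$-Hurwitz graphs of genus $0$ with two vertices and ordered partition $d=\mu_1+\mu_2$, and let $x(z)=z\,e^{-z^r}$. Then there is the following closed formula for $F_{0,2}$ in the $z$-coordinates: $$F_{0,2}\big(x(z_1),x(z_2)\big)=\log\frac{z_1-z_2}{x(z_1)-x(z_2)}-(z_1^r+z_2^r).$$
   Context: Cell graphs. A connected cell graph of topological type $(g,n)$ is the 1-skeleton of a cell decomposition of a connected closed oriented surface of genus $g$ with $n$ labeled 0-cells. A 0-cell is called a vertex, a 1-cell an edge, and a 2-cell a face. Two cell graphs are identified if there is a homeomorphism of the surfaces that brings one cell decomposition to the other, keeping the labeling of 0-cells. $r$-Hurwitz graphs. Fix a positive integer $r$. An $r$-Hurwitz graph $(\gamma,D)$ of type $(g,n,d)$ consists of the following data. (a) $\gamma$ is a connected cell graph of type $(g,n)$, with $n$ labeled vertices. (b) $d$ is divisible by $r$, and $\gamma$ has $m=d/r$ unlabeled faces and $s$ unlabeled edges, where $s=2g-2+\frac dr+n$. (c) $D$ is a configuration of $d=rm$ unlabeled dots on the graph subject to the following conditions. (1) The set of $d$ dots is grouped into $m$ subsets of $r$ dots, each of which is equipped with a cyclic order. (2) Every face of $\gamma$ has $r$ cyclically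 ordered dots. (3) These dots are clustered near vertices of the face. At each corner of the face, say at Vertex $i$, the dots are ordered according to the cyclic order consistent with the orientation of the face, which is chosen to be counterclockwise. (4) Let $\mu_i$ denote the total number of dots clustered at Vertex $i$. Then $\mu_i>0$ for every $i=1,\dots,n$, so that there is an ordered partition $d=\mu_1+\cdots+\mu_n$. (5) Suppose an edge $E$ connecting two distinct vertices bounds the same face twice. Let $p$ be the midpoint of $E$; it appears twice on the perimeter of the polygon representing the face, and the two occurrences are named $p$ and $p'$ (which is which does not matter). Consider the path on the perimeter of this polygon from $p$ to $p'$ in the counterclockwise orientation, and let $r'$ be the total number of dots clustered around vertices of the face, counted along the path. Then $0<r'<r$. (For example, not all $r$ dots of a face can be clustered at a vertex of degree 1; and for $r=1$ the graph $\gamma$ has no edge bounding the same face twice.) An arrowed $r$-Hurwitz graph $(\gamma,\vec D)$ has, in addition to the data $(\gamma,D)$, an arrow assigned to one of the $\mu_i$ dots at Vertex $i$ for each index $1\le i\le n$. The numbers. $\mathcal{H}_{g,n}^r(\mu_1,\dots,\mu_n)$ is the number of arrowed $r$-Hurwitz graphs for the prescribed ordered partition $d=\mu_1+\cdots+\mu_n$, counted with the automorphism weight; it is $0$ when there are no such graphs, in particular if $r$ does not divide $d$. Here $(g,n)=(0,2)$. The variable $z$ is the global coordinate of the parametrization $x=ze^{-z^r}$, $y=z^r$ of the $r$-Lambert curve $x^r=ye^{-ry}$. The function $\log\frac{z_1-z_2}{x(z_1)-x(z_2)}$ is holomorphic around $(z_1,z_2)=(0,0)\in\mathbb{C}^2$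 (with value $0$ at the origin), and the identity holds near $(0,0)$.
   Formalization: With the plain automorphism weight the formula fails (r=1, μ=(1,1): the count is 1, the formula needs 1/2); here each graph is weighted by its number of edge labelings by 1..s that increase along face boundaries between dots, divided by s! times |Aut|. *)

theory Defs
  imports "HOL-Analysis.Analysis" "HOL-Combinatorics.Permutations" "HOL-Combinatorics.Orbits"
begin

text \<open>
  A cell graph is given by its rotation system. A dart is an edge together with a choice of one of
  its two ends; the darts of a graph with \<open>s\<close> edges are \<open>{..<2 * s}\<close>. The permutation \<open>rot\<close> sends
  a dart to the next one counterclockwise around its vertex, and \<open>flip\<close> exchanges the two darts of
  an edge. The corner of a dart \<open>x\<close> is the sector between \<open>x\<close> and \<open>rot x\<close>. A corner belongs to one
  vertex and one face, and the cyclic order of the dots is forced by the orientation. As the dots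
  are unlabeled, a configuration is therefore given by the number \<open>dots x\<close> of dots in each corner.
  Vertices are labeled \<open>0, \<dots>, n - 1\<close>.

  Only graphs with at least one edge are represented. The single cell graph without edges is one
  point on the sphere, of type \<open>(g, n) = (0, 1)\<close>.
\<close>

record hurwitz_graph =
  nedges :: nat
  rot :: "nat \<Rightarrow> nat"
  flip :: "nat \<Rightarrow> nat"
  vert :: "nat \<Rightarrow> nat"
  dots :: "nat \<Rightarrow> nat"

text \<open>\<open>arrow i = (x, k)\<close>: the arrow at vertex \<open>i\<close> is on the \<open>k\<close>-th dot (from 0) in the corner of \<open>x\<close>.\<close>

record arrowed_hurwitz_graph = hurwitz_graph +
  arrow :: "nat \<Rightarrow> nat \<times> nat"

definition darts :: "('b) hurwitz_graph_scheme \<Rightarrow> nat set" where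
  "darts G = {..<2 * nedges G}"

text \<open>
  Walking along \<open>x\<close> away from its vertex with the face on the left, one arrives along \<open>flip x\<close> and
  leaves by the next dart clockwise. So the orbit of \<open>x\<close> lists the counterclockwise boundary of the
  face to the left of \<open>x\<close>, and its corners are exactly the corners of the darts of that orbit.
\<close>

definition next_dart :: "('b) hurwitz_graph_scheme \<Rightarrow> nat \<Rightarrow> nat" where
  "next_dart G x = inv (rot G) (flip G x)"

definition faces :: "('b) hurwitz_graph_scheme \<Rightarrow> nat set set" where
  "faces G = (\<lambda>x. orbit (next_dart G) x) ` darts G"

text \<open>The last conjunct is Euler's formula, written for the number of edges.\<close>

definition connected_cell_graph :: "nat \<Rightarrow> nat \<Rightarrow> ('b) hurwitz_graph_scheme \<Rightarrow> bool" where
  "connected_cell_graph g n G \<longleftrightarrow>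
     rot G permutes darts G \<and>
     flip G permutes darts G \<and>
     (\<forall>x\<in>darts G. flip G x \<noteq> x \<and> flip G (flip G x) = x) \<and>
     (\<forall>x\<in>darts G. \<forall>y\<in>darts G. (x, y) \<in> ({(u, rot G u) |u. True} \<union> {(u, flip G u) |u. True})\<^sup>*) \<and>
     vert G ` darts G = {..<n} \<and>
     (\<forall>x\<in>darts G. \<forall>y\<in>darts G. vert G x = vert G y \<longleftrightarrow> y \<in> orbit (rot G) x) \<and>
     int (nedges G) = 2 * int g - 2 + int (card (faces G)) + int n"

text \<open>
  The number of dots met on the perimeter of a face on the way from the midpoint of \<open>x\<close> to the
  midpoint of \<open>flip x\<close>; only meaningful if both darts lie on the same face.
\<close>

definition dots_between_sides :: "('b) hurwitz_graph_scheme \<Rightarrow> nat \<Rightarrow> nat" where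
  "dots_between_sides G x =
     (\<Sum>i = 1..(LEAST k. 1 \<le> k \<and> (next_dart G ^^ k) x = flip G x). dots G ((next_dart G ^^ i) x))"

definition vertex_dots :: "('b) hurwitz_graph_scheme \<Rightarrow> nat \<Rightarrow> nat" where
  "vertex_dots G i = (\<Sum>x \<in> {x \<in> darts G. vert G x = i}. dots G x)"

definition r_hurwitz_graph ::
  "nat \<Rightarrow> nat \<Rightarrow> nat \<Rightarrow> nat \<Rightarrow> ('b) hurwitz_graph_scheme \<Rightarrow> bool" where
  "r_hurwitz_graph r g n d G \<longleftrightarrow>
     connected_cell_graph g n G \<and>
     d = r * card (faces G) \<and>
     (\<forall>f\<in>faces G. (\<Sum>x\<in>f. dots G x) = r) \<and>
     (\<forall>i<n. 0 < vertex_dots G i) \<and>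
     (\<forall>x\<in>darts G. vert G x \<noteq> vert G (flip G x) \<and> flip G x \<in> orbit (next_dart G) x \<longrightarrow>
        0 < dots_between_sides G x \<and> dots_between_sides G x < r)"

definition arrowed_r_hurwitz_graph ::
  "nat \<Rightarrow> nat \<Rightarrow> nat list \<Rightarrow> arrowed_hurwitz_graph \<Rightarrow> bool" where
  "arrowed_r_hurwitz_graph r g \<mu> G \<longleftrightarrow>
     r_hurwitz_graph r g (length \<mu>) (sum_list \<mu>) G \<and>
     (\<forall>i<length \<mu>. vertex_dots G i = \<mu> ! i) \<and>
     (\<forall>i<length \<mu>. fst (arrow G i) \<in> darts G \<and> vert G (fst (arrow G i)) = i \<and>
        snd (arrow G i) < dots G (fst (arrow G i)))"

text \<open>
  Orientation-preserving homeomorphisms respecting the cell decompositions, the vertex labels, the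
  dots and the arrows, up to isotopy.
\<close>

definition isos :: "arrowed_hurwitz_graph \<Rightarrow> arrowed_hurwitz_graph \<Rightarrow> (nat \<Rightarrow> nat) set" where
  "isos G H = {p. nedges G = nedges H \<and> p permutes darts G \<and>
     (\<forall>x\<in>darts G. p (rot G x) = rot H (p x) \<and> p (flip G x) = flip H (p x) \<and>
        vert H (p x) = vert G x \<and> dots H (p x) = dots G x) \<and>
     (\<forall>i \<in> vert G ` darts G. arrow H i = apfst p (arrow G i))}"

definition iso_rel :: "nat \<Rightarrow> nat \<Rightarrow> nat list \<Rightarrow> (arrowed_hurwitz_graph \<times> arrowed_hurwitz_graph) set"
  where "iso_rel r g \<mu> = {(G, H). arrowed_r_hurwitz_graph r g \<mu> G \<and>
     arrowed_r_hurwitz_graph r g \<mu> H \<and> isos G H \<noteq> {}}"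

text \<open>
  The edges of an \<open>r\<close>-Hurwitz graph are unlabeled: they are labeled edges up to relabeling, and the
  \<open>s!\<close> relabelings are part of the automorphism weight. The labels come from the branched
  covering of the sphere described by the graph, which has poles of order \<open>\<mu>\<^sub>i\<close> at the vertices,
  a zero of order \<open>r\<close> in each face, and one simple critical point on each edge. The critical value
  on the edge labeled \<open>j\<close> is the \<open>j\<close>-th of the \<open>s\<close>-th roots of unity in counterclockwise order,
  and the dots mark the passages from the label \<open>s\<close> back to the label \<open>1\<close>. Hence an edge labeling
  is compatible with the dots iff the labels of consecutive edges on the counterclockwise boundary
  of a face increase whenever no dot lies in the corner between them.

  Arrowed graphs have only the trivial automorphism. Counting them without regard to labelings
  would give integers instead of orbifold Hurwitz numbers: for \<open>r = 1\<close>, \<open>\<mu> = (1, 1)\<close>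
  it gives 1 instead of 1/2.
\<close>

definition edge_labelings :: "('b) hurwitz_graph_scheme \<Rightarrow> (nat \<Rightarrow> nat) set" where
  "edge_labelings G = {l \<in> darts G \<rightarrow>\<^sub>E {1..nedges G}.
     l ` darts G = {1..nedges G} \<and> (\<forall>x\<in>darts G. l (flip G x) = l x)}"

definition compatible_labelings :: "('b) hurwitz_graph_scheme \<Rightarrow> (nat \<Rightarrow> nat) set" where
  "compatible_labelings G = {l \<in> edge_labelings G.
     \<forall>x\<in>darts G. dots G (next_dart G x) = 0 \<longrightarrow> l x < l (next_dart G x)}"

definition weight :: "arrowed_hurwitz_graph \<Rightarrow> real" where
  "weight G = real (card (compatible_labelings G)) / (fact (nedges G) * real (card (isos G G)))"

text \<open>\<open>hurwitz_number r g [\<mu>\<^sub>1, \<dots>, \<mu>\<^sub>n]\<close> sums over isomorphism classes; the weight is constant on them.\<close>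

definition hurwitz_number :: "nat \<Rightarrow> nat \<Rightarrow> nat list \<Rightarrow> real" where
  "hurwitz_number r g \<mu> =
     (\<Sum>C \<in> {G. arrowed_r_hurwitz_graph r g \<mu> G} // iso_rel r g \<mu>. weight (SOME G. G \<in> C))"

definition F02_term :: "nat \<Rightarrow> complex \<Rightarrow> complex \<Rightarrow> nat \<times> nat \<Rightarrow> complex" where
  "F02_term r x1 x2 = (\<lambda>(\<mu>1, \<mu>2).
     1 / (of_nat \<mu>1 * of_nat \<mu>2) * of_real (hurwitz_number r 0 [\<mu>1, \<mu>2]) * x1 ^ \<mu>1 * x2 ^ \<mu>2)"

definition F02 :: "nat \<Rightarrow> complex \<Rightarrow> complex \<Rightarrow> complex" where
  "F02 r x1 x2 = infsum (F02_term r x1 x2) ({1..} \<times> {1..})"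

definition lambert_x :: "nat \<Rightarrow> complex \<Rightarrow> complex" where
  "lambert_x r z = z * exp (- (z ^ r))"

text \<open>
  The quotient \<open>(z1 - z2) / (x(z1) - x(z2))\<close>, extended over the diagonal by its limit. Near the
  origin it is close to 1, and its principal logarithm is the holomorphic one vanishing there.
\<close>

definition inv_diff_quotient :: "nat \<Rightarrow> complex \<Rightarrow> complex \<Rightarrow> complex" where
  "inv_diff_quotient r z1 z2 =
     (if z1 = z2 then 1 / deriv (lambert_x r) z1 else (z1 - z2) / (lambert_x r z1 - lambert_x r z2))"

end

theory Submission imports Defs "HOL-Complex_Analysis.Complex_Analysis" begin

text \<open>
  The Hurwitz numbers of the annulus are computed in closed form, and their generating series is summed.

  \<^bold>\<open>Graphs as words.\<close> At each of the two vertices, number the intervals between consecutive dots, the blocks, counterclockwise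
  from the arrow. An arrowed graph with a compatible edge labeling and an orientation of its \<open>s = (\<mu>\<^sub>1 + \<mu>\<^sub>2) / r\<close> edges
  is then the same as a word of \<open>s\<close> ordered pairs of distinct blocks: the \<open>i\<close>-th pair consists of the blocks in which the \<open>i\<close>-th
  edge ends. Given the word, the cyclic order of the darts at a vertex is the order of their blocks, and within a block that
  of the edges. Let \<open>\<rho>\<close> be the permutation of the blocks that turns each vertex back by one block. The faces of the graph
  are the cycles of the product of \<open>\<rho>\<close> with the transpositions of the word, and the number of dots of a face is the length of its cycle
  (\<open>face_regular_iff\<close>). So all faces have \<open>r\<close> dots iff all cycles have length \<open>r\<close>. The graph is connected iff a letter
  joins the two vertices, and the condition on edges with the same face on both sides is automatic, because labels increase along
  face boundaries without dots. As arrowed graphs have only trivial automorphisms, the Hurwitz number is the number of words divided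
  by \<open>2\<^sup>s s!\<close> (\<open>factorizations_bij\<close>).

  \<^bold>\<open>Counting words.\<close> Every transposition cuts a cycle or joins two. Removing the first letter yields a recursion. A word of
  minimal length only cuts, and the number of such words is a product over the cycles of \<open>\<rho>\<close>
  (\<open>count_minimal_factorizations\<close>). A word that links two cycles and has two letters more than a minimal one joins
  exactly once (\<open>count_linked_factorizations\<close>). With \<open>a = \<lceil>\<mu>\<^sub>1 / r\<rceil> - 1\<close> and \<open>b = \<lfloor>\<mu>\<^sub>2 / r\<rfloor>\<close> the result is
  \<open>H(\<mu>\<^sub>1, \<mu>\<^sub>2) = r \<mu>\<^sub>1 \<mu>\<^sub>2 / (\<mu>\<^sub>1 + \<mu>\<^sub>2) * \<mu>\<^sub>1\<^sup>a / a! * \<mu>\<^sub>2\<^sup>b / b!\<close> if \<open>r\<close> divides \<open>\<mu>\<^sub>1 + \<mu>\<^sub>2\<close>, and 0 otherwise. That this satisfies the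
  recursion is an identity of Abel's type (\<open>annular_identity\<close>).

  \<^bold>\<open>Summation.\<close> The Euler operator \<open>x\<^sub>1 \<partial>\<^sub>1 + x\<^sub>2 \<partial>\<^sub>2\<close> cancels the denominator \<open>\<mu>\<^sub>1 + \<mu>\<^sub>2\<close> in the series, which then splits into
  products of the series \<open>\<Sum>\<^sub>k (i + r k)\<^sup>k / k! * x\<^sup>i\<^sup>+\<^sup>r\<^sup>k = z\<^sup>i / (1 - r z\<^sup>r)\<close> (\<open>lambert_power_series\<close>). The Euler operator applied to the
  logarithm gives the same function. Both sides vanish at the origin, hence they agree along each ray
  (\<open>annulus_series_closed_form\<close>).
\<close>

section \<open>Finite differences and Abel's identity\<close>

text \<open>Up to the factor \<open>p!\<close>, the alternating sum is the coefficient of \<open>X\<^sup>p\<close> in the series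
\<open>e\<^sup>a\<^sup>X (e\<^sup>b\<^sup>X - 1)\<^sup>n\<close>, whose lowest term is \<open>b\<^sup>n X\<^sup>n\<close>.\<close>

lemma finite_difference_power:
  fixes a b :: "'a::field_char_0"
  assumes "p \<le> n"
  shows "(\<Sum>j\<le>n. (-1)^(n-j) * of_nat (n choose j) * (a + b * of_nat j)^p)
       = (if p = n then b^n * fact n else 0)"
proof -
  have e: "fps_exp a * (fps_exp b - 1)^n = (\<Sum>j\<le>n. fps_const ((-1)^(n-j) * of_nat (n choose j)) * fps_exp (a + b * of_nat j))"
  proof -
    have "(fps_exp b - 1)^n = (fps_exp b + (-1))^n" by simp
    also have "\<dots> = (\<Sum>j\<le>n. of_nat (n choose j) * fps_exp b^j * (-1)^(n-j))"
      by (rule binomial_ring)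
    finally have *: "(fps_exp b - 1)^n = (\<Sum>j\<le>n. of_nat (n choose j) * fps_exp b^j * (-1)^(n-j))" .
    have c: "(-1::'a fps)^k = fps_const ((-1)^k)" for k
      by (induction k) (auto simp flip: fps_const_neg fps_const_mult)
    show ?thesis unfolding * sum_distrib_left
      by (intro sum.cong refl)
        (simp add: c fps_exp_add_mult fps_exp_power_mult fps_of_nat[symmetric] fps_const_mult[symmetric] mult_ac del: fps_const_mult fps_of_nat)
  qed
  have "fps_nth (fps_exp a * (fps_exp b - 1)^n) p = (\<Sum>j\<le>n. (-1)^(n-j) * of_nat (n choose j) * ((a + b * of_nat j)^p / fact p))"
    unfolding e by (simp add: fps_sum_nth)
  also have "\<dots> = (\<Sum>j\<le>n. (-1)^(n-j) * of_nat (n choose j) * (a + b * of_nat j)^p) / fact p"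
    by (simp add: sum_divide_distrib)
  finally have A: "(\<Sum>j\<le>n. (-1)^(n-j) * of_nat (n choose j) * (a + b * of_nat j)^p) = fact p * fps_nth (fps_exp a * (fps_exp b - 1)^n) p"
    by simp
  have "\<exists>h. fps_exp b - 1 = fps_X * h \<and> fps_nth h 0 = b"
    by (rule exI[of _ "fps_shift 1 (fps_exp b - 1)"]) (auto simp: fps_eq_iff)
  then obtain h where h: "fps_exp b - 1 = fps_X * h" "fps_nth h 0 = b" by blast
  have "fps_exp a * (fps_exp b - 1)^n = fps_X^n * (fps_exp a * h^n)"
    unfolding h by (simp add: power_mult_distrib mult_ac)
  then have "fps_nth (fps_exp a * (fps_exp b - 1)^n) p = (if p < n then 0 else fps_nth (fps_exp a * h^n) (p - n))"
    by (simp only: fps_X_power_mult_nth)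
  also have "\<dots> = (if p = n then b^n else 0)"
    using assms by (simp add: fps_nth_power_0 h)
  finally show ?thesis unfolding A by simp
qed

lemma alternating_binomial_step:
  fixes f :: "nat \<Rightarrow> real"
  shows "(\<Sum>j\<le>Suc n. (-1)^(Suc n-j) * of_nat (Suc n choose j) * f j)
       = (\<Sum>j\<le>n. (-1)^(n-j) * of_nat (n choose j) * (f (Suc j) - f j))"
proof -
  let ?c = "\<lambda>j. (-1)^(n-j) * real (n choose j)"
  have "(\<Sum>j\<le>Suc n. (-1)^(Suc n-j) * of_nat (Suc n choose j) * f j)
      = (-1)^(Suc n) * f 0 + (\<Sum>j\<le>n. (-1)^(n-j) * of_nat (Suc n choose Suc j) * f (Suc j))"
    by (subst sum.atMost_Suc_shift) simp
  also have "(\<Sum>j\<le>n. (-1)^(n-j) * of_nat (Suc n choose Suc j) * f (Suc j))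
      = (\<Sum>j\<le>n. ?c j * f (Suc j)) + (\<Sum>j\<le>n. (-1)^(n-j) * of_nat (n choose Suc j) * f (Suc j))"
    by (simp add: sum.distrib[symmetric] algebra_simps)
  also have "(\<Sum>j\<le>n. (-1)^(n-j) * of_nat (n choose Suc j) * f (Suc j))
       = (\<Sum>j<n. (-1)^(n-j) * of_nat (n choose Suc j) * f (Suc j))"
    by (simp add: lessThan_Suc_atMost[symmetric])
  also have "\<dots> = (\<Sum>j<n. - (?c (Suc j) * f (Suc j)))"
    by (intro sum.cong refl) (auto simp: Suc_diff_Suc[symmetric] simp del: binomial_Suc_Suc)
  also have "\<dots> = - (\<Sum>j\<le>n. ?c j * f j) + (-1)^n * f 0"
    by (cases n) (simp_all add: sum.atMost_Suc_shift lessThan_Suc_atMost sum_negf del: sum.atMost_Suc)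
  finally show ?thesis by (simp add: algebra_simps sum_subtractf)
qed

lemma alternating_binomial_reciprocal:
  assumes "k < m"
  shows "(\<Sum>j\<le>k. (-1)^(k-j) * of_nat (k choose j) * (1 / (real m - real j)))
       = fact k * fact (m - k - 1) / fact m"
  using assms
proof (induction k arbitrary: m)
  case 0
  then obtain m' where "m = Suc m'" by (cases m) auto
  then show ?case by (simp del: of_nat_Suc)
next
  case (Suc k)
  then obtain m' where m: "m = Suc m'" "k < m'" by (cases m) auto
  have "(\<Sum>j\<le>Suc k. (-1)^(Suc k-j) * of_nat (Suc k choose j) * (1 / (real m - real j)))
      = (\<Sum>j\<le>k. (-1)^(k-j) * of_nat (k choose j) * (1 / (real m' - real j)))
        - (\<Sum>j\<le>k. (-1)^(k-j) * of_nat (k choose j) * (1 / (real m - real j)))"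
    by (subst alternating_binomial_step) (simp add: sum_subtractf[symmetric] right_diff_distrib m)
  also have "\<dots> = fact k * fact (m' - k - 1) / fact m' - fact k * fact (m - k - 1) / fact m"
    using Suc.IH[of m'] Suc.IH[of m] Suc.prems m by simp
  also have "\<dots> = fact (Suc k) * fact (m - Suc k - 1) / fact m"
  proof -
    obtain d where d: "m' = Suc (k + d)" using m(2) less_imp_Suc_add by blast
    have alg: "x / u - (real d + 1) * x / ((real k + real d + 2) * u) = (real k + 1) * x / ((real k + real d + 2) * u)"
      if "u > 0" for x u :: real
    proof -
      have "real k + real d + 2 \<noteq> 0" by linarith
      with that show ?thesis by (simp add: divide_simps) (simp add: algebra_simps)
    qed
    show ?thesis unfolding m d
      using alg[of "fact (Suc (k + d))" "fact k * fact d"]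
      by (simp add: mult_ac add_ac)
  qed
  finally show ?case .
qed

text \<open>For \<open>a \<ge> 1\<close>, the coefficients of the tree function \<open>T = X e\<^sup>T\<close>.\<close>

definition tree_coeff :: "nat \<Rightarrow> real" where
  "tree_coeff a = real a ^ (a - 1) / fact a"

text \<open>Divided powers. They turn differentiation into a shift of the index, and \<open>dpow_prev\<close> makes
the shift total by sending the index 0 to the zero function.\<close>

definition dpow :: "nat \<Rightarrow> real \<Rightarrow> real" where
  "dpow k x = x ^ k / fact k"

definition dpow_prev :: "nat \<Rightarrow> real \<Rightarrow> real" where
  "dpow_prev k x = (if k = 0 then 0 else dpow (k - 1) x)"

lemma dpow_0 [simp]: "dpow 0 x = 1" "dpow_prev 0 x = 0" "k > 0 \<Longrightarrow> dpow k 0 = 0"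
  by (simp_all add: dpow_def dpow_prev_def)

lemma dpow_prev_eq: "real k * dpow k x = x * dpow_prev k x"
  by (cases k) (simp_all add: dpow_def dpow_prev_def del: of_nat_Suc)

lemma dpow_deriv [derivative_intros]:
  assumes "(f has_real_derivative f') (at x)"
  shows "((\<lambda>x. dpow k (f x)) has_real_derivative dpow_prev k (f x) * f') (at x)"
proof (cases k)
  case (Suc n)
  have "((\<lambda>x. f x ^ Suc n / fact (Suc n)) has_real_derivative (real (Suc n) * f' * f x ^ n) / fact (Suc n)) (at x)"
    by (rule DERIV_cdivide | (use DERIV_power[OF assms, of "Suc n"] in \<open>simp add: mult_ac\<close>))+
  then show ?thesis by (simp add: Suc dpow_def dpow_prev_def mult_ac del: of_nat_Suc)
qed (simp add: dpow_def dpow_prev_def)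

lemma abel_at_0:
  assumes "k \<ge> 2"
  shows "(\<Sum>a=1..k. tree_coeff a * dpow (k - a) (0 - real a)) = 0"
proof -
  have "(\<Sum>a=1..k. tree_coeff a * dpow (k - a) (0 - real a))
      = (\<Sum>a=1..k. (-1)^(k-a) * of_nat (k choose a) * (0 + 1 * of_nat a)^(k-1) / fact k)"
  proof (intro sum.cong refl)
    fix a assume a: "a \<in> {1..k}"
    have "(- real a)^(k-a) = (-1)^(k-a) * real a^(k-a)" by (rule power_minus)
    moreover have "real a^(a-1) * real a^(k-a) = real a^(k-1)"
      using a by (simp add: power_add[symmetric])
    ultimately show "tree_coeff a * dpow (k - a) (0 - real a) = (-1)^(k-a) * of_nat (k choose a) * (0 + 1 * of_nat a)^(k-1) / fact k"
      using a by (simp add: tree_coeff_def dpow_def binomial_fact field_simps)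
  qed
  also have "\<dots> = (\<Sum>a\<le>k. (-1)^(k-a) * of_nat (k choose a) * (0 + 1 * of_nat a)^(k-1) / fact k)"
    using assms by (intro sum.mono_neutral_left) (auto simp: not_less_eq_eq)
  also have "\<dots> = (\<Sum>a\<le>k. (-1)^(k-a) * of_nat (k choose a) * (0 + 1 * of_nat a)^(k-1)) / fact k"
    by (simp add: sum_divide_distrib)
  also have "\<dots> = 0"
    using assms by (subst finite_difference_power) auto
  finally show ?thesis .
qed

text \<open>Both sides have the same derivative by the identity for \<open>k - 1\<close>, so it is enough to compare them
at 0, where the left hand side is a \<open>k\<close>-th finite difference of a polynomial of degree \<open>k - 1\<close>.\<close>

lemma abel_identity: "(\<Sum>a=1..k. tree_coeff a * dpow (k - a) (x - real a)) = dpow_prev k x"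
proof (induction k arbitrary: x)
  case 0
  then show ?case by simp
next
  case (Suc k)
  show ?case
  proof (cases "k = 0")
    case True
    then show ?thesis by (simp add: tree_coeff_def dpow_prev_def)
  next
    case False
    define F where "F x = (\<Sum>a=1..Suc k. tree_coeff a * dpow (Suc k - a) (x - real a)) - dpow_prev (Suc k) x" for x
    have "(F has_real_derivative 0) (at x)" for x
    proof -
      have "(F has_real_derivative (\<Sum>a=1..Suc k. tree_coeff a * dpow_prev (Suc k - a) (x - real a)) - dpow_prev k x) (at x)"
        unfolding F_def dpow_prev_def[of "Suc k"]
        by (auto intro!: derivative_eq_intros sum.cong simp: mult_ac)
      also have "(\<Sum>a=1..Suc k. tree_coeff a * dpow_prev (Suc k - a) (x - real a)) = (\<Sum>a=1..k. tree_coeff a * dpow (k - a) (x - real a))"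
        by (simp add: dpow_prev_def Suc_diff_le)
      finally show ?thesis using Suc.IH by simp
    qed
    then have "F x = F 0" by (meson DERIV_isconst_all)
    moreover have "F 0 = 0"
      unfolding F_def using abel_at_0[of "Suc k"] False by (simp add: dpow_prev_def)
    ultimately show ?thesis by (simp add: F_def)
  qed
qed

text \<open>Abel's identity at \<open>x = m\<close>, symmetrized under \<open>a \<mapsto> m - a\<close>. Combinatorially, both sides
count rooted trees on \<open>m\<close> vertices with a distinguished edge.\<close>

lemma tree_coeff_convolution:
  assumes "m > 0"
  shows "(real m - 1) * tree_coeff m = real m / 2 * (\<Sum>a=1..<m. tree_coeff a * tree_coeff (m - a))"
proof -
  obtain k where m: "m = Suc k" using assms by (cases m) auto
  have *: "dpow (k - a) (real m - real a) = real (m - a) * tree_coeff (m - a)" if "a \<in> {1..<m}" for a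
  proof -
    have "m - a = Suc (k - a)" using that m by auto
    then show ?thesis using that by (simp add: dpow_def tree_coeff_def field_simps of_nat_diff[symmetric] del: of_nat_diff of_nat_Suc)
  qed
  have "(\<Sum>a=1..<m. tree_coeff a * (real (m - a) * tree_coeff (m - a))) = (\<Sum>a=1..k. tree_coeff a * dpow (k - a) (real m - real a))"
    by (rule sum.cong) (use * m in auto)
  also have "\<dots> = dpow_prev k (real m)" by (rule abel_identity)
  finally have 1: "(\<Sum>a=1..<m. real (m - a) * (tree_coeff a * tree_coeff (m - a))) = dpow_prev k m"
    by (simp add: mult_ac)
  have "(\<Sum>a=1..<m. real (m - a) * (tree_coeff a * tree_coeff (m - a))) = (\<Sum>a=1..<m. real a * (tree_coeff a * tree_coeff (m - a)))"
    by (rule sum.reindex_bij_witness[of _ "\<lambda>a. m - a" "\<lambda>a. m - a"]) auto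
  with 1 have "2 * dpow_prev k m = (\<Sum>a=1..<m. (real (m - a) + real a) * (tree_coeff a * tree_coeff (m - a)))"
    unfolding distrib_right sum.distrib by linarith
  also have "\<dots> = real m * (\<Sum>a=1..<m. tree_coeff a * tree_coeff (m - a))"
    unfolding sum_distrib_left by (intro sum.cong) (auto simp: of_nat_diff)
  finally have "real m / 2 * (\<Sum>a=1..<m. tree_coeff a * tree_coeff (m - a)) = dpow_prev k m" by simp
  moreover have "dpow_prev k m = (real m - 1) * tree_coeff m"
  proof (cases k)
    case (Suc j)
    have *: "real (Suc (Suc j)) - 1 = real (Suc j)" by simp
    show ?thesis unfolding m Suc by (simp add: * dpow_prev_def dpow_def tree_coeff_def del: of_nat_Suc)
  qed (simp add: m)
  ultimately show ?thesis by simp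
qed

section \<open>An Abel-type identity for two cycles\<close>

text \<open>With \<open>m = k + l + 1\<close>, the product \<open>dpow l (m - x) * annular_sum m k x\<close> at \<open>x = p / r\<close> is,
up to normalization, the convolution of disc numbers with annulus numbers that arises when a piece is cut off the cycle of length \<open>p\<close>.\<close>

definition annular_sum :: "nat \<Rightarrow> nat \<Rightarrow> real \<Rightarrow> real" where
  "annular_sum m k x = (\<Sum>a=1..k. tree_coeff a * (dpow (k - a) (x - real a) * (x - real a) / (real m - real a)))"

text \<open>Up to a polynomial in \<open>a\<close> of degree below \<open>k\<close>, which the \<open>k\<close>-th finite difference annihilates, \<open>a\<^sup>k / (m - a)\<close> is
\<open>m\<^sup>k / (m - a)\<close>; what remains is the finite difference of \<open>1 / (m - a)\<close>.\<close>

lemma annular_sum_at_0: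
  assumes "0 < k" "k < m"
  shows "annular_sum m k 0 = - (real m ^ k * fact (m - k - 1) / fact m)"
proof -
  let ?c = "\<lambda>a. (-1)^(k-a) * real (k choose a)"
  have "annular_sum m k 0 = (\<Sum>a=1..k. - (?c a * (real a^k / (real m - real a))) / fact k)"
    unfolding annular_sum_def
  proof (intro sum.cong refl)
    fix a assume a: "a \<in> {1..k}"
    have pm: "(- real a)^(k-a) = (-1)^(k-a) * real a^(k-a)" by (rule power_minus)
    have ak: "real a^k = real a^(a-1) * (real a * real a^(k-a))"
      using a by (simp add: power_add[symmetric] power_Suc[symmetric] del: power_Suc)
    have alg: "x / y * (e * z / w * - v / D) = - (e * (u / (y * w)) * (x * (v * z) / D)) / u"
      if "u \<noteq> 0" for x y z u v w e D :: real using that by simp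
    have bin: "real (k choose a) = fact k / (fact a * fact (k - a))"
      using a by (simp add: binomial_fact)
    show "tree_coeff a * (dpow (k - a) (0 - real a) * (0 - real a) / (real m - real a)) =
        - (?c a * (real a^k / (real m - real a))) / fact k"
      unfolding tree_coeff_def dpow_def bin ak diff_0 pm by (rule alg) simp
  qed
  also have "\<dots> = (\<Sum>a\<le>k. - (?c a * (real a^k / (real m - real a))) / fact k)"
    using assms by (intro sum.mono_neutral_left) (auto simp: not_less_eq_eq)
  also have "\<dots> = - (\<Sum>a\<le>k. ?c a * (real a^k / (real m - real a))) / fact k"
    by (simp add: sum_divide_distrib sum_negf)
  also have "(\<Sum>a\<le>k. ?c a * (real a^k / (real m - real a)))
     = (\<Sum>a\<le>k. real m^k * (?c a * (1 / (real m - real a))) - (\<Sum>i<k. real m^(k - Suc i) * (?c a * (0 + 1 * real a)^i)))"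
  proof (intro sum.cong refl)
    fix a assume a: "a \<in> {..k}"
    have "real m^k - real a^k = (real m - real a) * (\<Sum>i<k. real m^(k - Suc i) * real a^i)"
      by (subst power_diff_sumr2, subst sum.nat_diff_reindex[symmetric]) (simp add: mult_ac)
    then have "real a^k / (real m - real a) = real m^k * (1 / (real m - real a)) - (\<Sum>i<k. real m^(k - Suc i) * real a^i)"
      using a assms by (simp add: field_simps)
    then have "?c a * (real a^k / (real m - real a)) = ?c a * (real m^k * (1 / (real m - real a)) - (\<Sum>i<k. real m^(k - Suc i) * real a^i))"
      by (simp only:)
    then show "?c a * (real a^k / (real m - real a)) = real m^k * (?c a * (1 / (real m - real a))) - (\<Sum>i<k. real m^(k - Suc i) * (?c a * (0 + 1 * real a)^i))"
      unfolding right_diff_distrib sum_distrib_left by (simp add: mult_ac)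
  qed
  also have "\<dots> = real m^k * (fact k * fact (m - k - 1) / fact m) - (\<Sum>i<k. real m^(k - Suc i) * (\<Sum>a\<le>k. ?c a * (0 + 1 * real a)^i))"
    unfolding sum_subtractf sum_distrib_left[symmetric] alternating_binomial_reciprocal[OF assms(2)]
    by (subst sum.swap) (simp add: sum_distrib_left)
  also have "(\<Sum>i<k. real m^(k - Suc i) * (\<Sum>a\<le>k. ?c a * (0 + 1 * real a)^i)) = 0"
    by (rule sum.neutral) (use finite_difference_power[of _ k "0::real" 1] in auto)
  finally show ?thesis by (simp)
qed

text \<open>The sum \<open>B\<close> with the denominators \<open>m - a\<close> but without the numerators \<open>x - a\<close> occurs both in the derivative of
\<open>annular_sum\<close> and, through \<open>x - a = (m - a) - (m - x)\<close>, in \<open>annular_sum\<close> itself. It cancels in the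
derivative of the product because \<open>l * dpow l y = y * dpow_prev l y\<close>.\<close>

lemma annular_sum_deriv:
  assumes "m = k + l + 1"
  shows "((\<lambda>x. dpow l (real m - x) * annular_sum m k x) has_real_derivative
      (dpow l (real m - x) - dpow_prev l (real m - x)) * dpow_prev k x) (at x)"
proof -
  define B where "B = (\<Sum>a=1..k. tree_coeff a * dpow (k - a) (x - real a) / (real m - real a))"
  have A: "annular_sum m k x = dpow_prev k x - (real m - x) * B"
    unfolding annular_sum_def B_def abel_identity[symmetric] sum_distrib_left sum_subtractf[symmetric]
    by (rule sum.cong) (use assms in \<open>auto simp: field_simps\<close>)
  have "((\<lambda>x. annular_sum m k x) has_real_derivative
      (\<Sum>a=1..k. tree_coeff a * ((dpow_prev (k - a) (x - real a) * (x - real a) + dpow (k - a) (x - real a)) / (real m - real a)))) (at x)"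
    unfolding annular_sum_def
    by (rule DERIV_sum, rule DERIV_cmult, rule DERIV_cdivide) (auto intro!: derivative_eq_intros)
  also have "(\<Sum>a=1..k. tree_coeff a * ((dpow_prev (k - a) (x - real a) * (x - real a) + dpow (k - a) (x - real a)) / (real m - real a)))
     = (\<Sum>a=1..k. tree_coeff a * dpow (k - a) (x - real a) - real l * (tree_coeff a * dpow (k - a) (x - real a) / (real m - real a)))"
  proof (intro sum.cong refl)
    fix a assume a: "a \<in> {1..k}"
    have "dpow_prev (k - a) (x - real a) * (x - real a) + dpow (k - a) (x - real a) = (real (k - a) + 1) * dpow (k - a) (x - real a)"
      using dpow_prev_eq[of "k - a" "x - real a"] by (simp add: algebra_simps)
    moreover have "real (k - a) + 1 = (real m - real a) - real l" using a assms by auto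
    ultimately have *: "dpow_prev (k - a) (x - real a) * (x - real a) + dpow (k - a) (x - real a)
        = ((real m - real a) - real l) * dpow (k - a) (x - real a)" by simp
    have "t * ((M - real l) * d / M) = t * d - real l * (t * d / M)" if "M \<noteq> 0" for t d M
      using that by (simp add: field_simps)
    moreover have "real m - real a \<noteq> 0" using a assms by auto
    ultimately show "tree_coeff a * ((dpow_prev (k - a) (x - real a) * (x - real a) + dpow (k - a) (x - real a)) / (real m - real a))
       = tree_coeff a * dpow (k - a) (x - real a) - real l * (tree_coeff a * dpow (k - a) (x - real a) / (real m - real a))"
      unfolding * by blast
  qed
  also have "\<dots> = dpow_prev k x - real l * B"
    unfolding sum_subtractf abel_identity B_def by (simp add: sum_distrib_left)
  finally have D: "((\<lambda>x. annular_sum m k x) has_real_derivative dpow_prev k x - real l * B) (at x)" .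
  have "((\<lambda>x. dpow l (real m - x) * annular_sum m k x) has_real_derivative
      dpow l (real m - x) * (dpow_prev k x - real l * B) - dpow_prev l (real m - x) * annular_sum m k x) (at x)"
    by (rule derivative_eq_intros D refl)+ (simp add: algebra_simps)
  also have "dpow l (real m - x) * (dpow_prev k x - real l * B) - dpow_prev l (real m - x) * annular_sum m k x
      = (dpow l (real m - x) - dpow_prev l (real m - x)) * dpow_prev k x"
  proof -
    have "dpow l (real m - x) * (real l * B) = (real m - x) * dpow_prev l (real m - x) * B"
      using dpow_prev_eq[of l "real m - x"] by (metis mult.assoc mult.commute)
    then show ?thesis unfolding A by (simp add: algebra_simps)
  qed
  finally show ?thesis .
qed

text \<open>The difference of the two sides has derivative 0 by the previous lemma and its mirror image under \<open>x \<mapsto> m - x\<close>.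
Its constant value is read off at \<open>x = m\<close> or \<open>x = 0\<close>, where one of the divided powers vanishes unless its index is 0.\<close>

lemma annular_identity:
  assumes m: "m = k + l + 1"
  shows "dpow k x * dpow l (real m - x) = tree_coeff m + dpow l (real m - x) * annular_sum m k x
           + dpow k x * annular_sum m l (real m - x)"
proof -
  define E where "E x = dpow k x * dpow l (real m - x) - dpow l (real m - x) * annular_sum m k x
           - dpow k x * annular_sum m l (real m - x)" for x
  have d2: "((\<lambda>x. dpow k x * annular_sum m l (real m - x)) has_real_derivative
      - ((dpow k x - dpow_prev k x) * dpow_prev l (real m - x))) (at x)" for x
  proof -
    have "((\<lambda>y. dpow k (real m - y) * annular_sum m l y) has_real_derivative
      (dpow k (real m - (real m - x)) - dpow_prev k (real m - (real m - x))) * dpow_prev l (real m - x)) (at (real m - x))"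
      by (rule annular_sum_deriv) (use m in auto)
    moreover have "((\<lambda>x. real m - x) has_real_derivative -1) (at x)"
      by (auto intro!: derivative_eq_intros)
    ultimately show ?thesis
      using DERIV_chain2[where f="\<lambda>y. dpow k (real m - y) * annular_sum m l y" and g="\<lambda>x. real m - x"] by fastforce
  qed
  have "(E has_real_derivative 0) (at x)" for x
  proof -
    have "(E has_real_derivative
       (dpow_prev k x * dpow l (real m - x) - dpow k x * dpow_prev l (real m - x)) -
       (dpow l (real m - x) - dpow_prev l (real m - x)) * dpow_prev k x -
       (- ((dpow k x - dpow_prev k x) * dpow_prev l (real m - x)))) (at x)"
      unfolding E_def
      by (intro DERIV_diff annular_sum_deriv[OF m] d2) (auto intro!: derivative_eq_intros)
    then show ?thesis by (simp add: algebra_simps)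
  qed
  then have const: "E x = E y" for x y by (meson DERIV_isconst_all)
  have "E x = tree_coeff m"
  proof (cases "l = 0")
    case False
    have "E x = E m" by (rule const)
    also have "\<dots> = - (dpow k m * annular_sum m l 0)" using False by (simp add: E_def)
    also have "\<dots> = tree_coeff m"
      using False by (subst annular_sum_at_0) (auto simp: m dpow_def tree_coeff_def power_add)
    finally show ?thesis .
  next
    case l: True
    show ?thesis
    proof (cases "k = 0")
      case False
      have "E x = E 0" by (rule const)
      also have "\<dots> = - (annular_sum m k 0)" using False l by (simp add: E_def)
      also have "\<dots> = tree_coeff m"
        using False l by (subst annular_sum_at_0) (auto simp: m tree_coeff_def)
      finally show ?thesis .
    next
      case True
      with l m show ?thesis by (simp add: E_def tree_coeff_def annular_sum_def)
    qed
  qed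
  then show ?thesis by (simp add: E_def)
qed

section \<open>Disc and annulus numbers and their convolutions\<close>

text \<open>Up to the factor \<open>2\<^sup>s s!\<close>, the number of ways to cut a cycle of length \<open>L\<close> into cycles of length \<open>r\<close> by a word of
\<open>s = L / r - 1\<close> transpositions.\<close>

definition disc_coeff :: "nat \<Rightarrow> nat \<Rightarrow> real" where
  "disc_coeff r L = (if r dvd L then real L ^ (L div r - 1) / fact (L div r) else 0)"

text \<open>Up to the factor \<open>2\<^sup>s s!\<close>, the number of ways to bring two cycles of lengths \<open>p\<close> and \<open>q\<close> to cycles of length \<open>r\<close> by a word of
\<open>s = (p + q) / r\<close> transpositions that joins pieces of the two. The exponents are \<open>\<lceil>p / r\<rceil> - 1\<close> and \<open>\<lfloor>q / r\<rfloor>\<close>;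
although the formula treats \<open>p\<close> and \<open>q\<close> differently, it is symmetric, because \<open>r\<close> divides \<open>p + q\<close>.\<close>

definition annulus_coeff :: "nat \<Rightarrow> nat \<Rightarrow> nat \<Rightarrow> real" where
  "annulus_coeff r p q = (if r dvd p + q then
     real p * real q * real r / real (p + q) * dpow ((p - 1) div r) (real p) * dpow (q div r) (real q) else 0)"

lemma disc_coeff_mult:
  assumes "r > 0" "a > 0"
  shows "disc_coeff r (r * a) = real r ^ (a - 1) * tree_coeff a"
  using assms by (simp add: disc_coeff_def tree_coeff_def power_mult_distrib)

lemma sum_over_multiples:
  fixes f :: "nat \<Rightarrow> real"
  assumes "r > 0" and "\<And>x. \<not> r dvd x \<Longrightarrow> f x = 0"
  shows "(\<Sum>x=1..<n. f x) = (\<Sum>a=1..(n - 1) div r. f (r * a))"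
proof -
  have "(\<Sum>a=1..(n - 1) div r. f (r * a)) = (\<Sum>x\<in>(\<lambda>a. r * a) ` {1..(n - 1) div r}. f x)"
    using assms(1) by (subst sum.reindex) (auto simp: inj_on_def)
  also have "\<dots> = (\<Sum>x=1..<n. f x)"
  proof (rule sum.mono_neutral_left)
    show "(*) r ` {1..(n - 1) div r} \<subseteq> {1..<n}"
    proof
      fix x assume "x \<in> (*) r ` {1..(n - 1) div r}"
      then obtain a where a: "x = r * a" "1 \<le> a" "a \<le> (n - 1) div r" by (meson atLeastAtMost_iff imageE)
      then have "a * r \<le> n - 1" using assms(1) by (simp add: less_eq_div_iff_mult_less_eq)
      moreover have "x > 0" "x = a * r" using a assms(1) by simp_all
      ultimately have "1 \<le> x" "x < n" by linarith+
      then show "x \<in> {1..<n}" by simp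
    qed
    show "\<forall>i\<in>{1..<n} - (*) r ` {1..(n - 1) div r}. f i = 0"
    proof
      fix x assume x: "x \<in> {1..<n} - (*) r ` {1..(n - 1) div r}"
      have "\<not> r dvd x"
      proof
        assume "r dvd x"
        then obtain a where a: "x = r * a" by auto
        have "a * r \<le> n - 1" using x a by (auto simp: mult.commute)
        then have "a \<le> (n - 1) div r" using assms(1) by (simp add: less_eq_div_iff_mult_less_eq)
        moreover have "a \<ge> 1" using x a by (cases a) auto
        ultimately show False using x a by auto
      qed
      then show "f x = 0" by (rule assms(2))
    qed
  qed simp
  finally show ?thesis by simp
qed

text \<open>The first letter cuts the cycle into two pieces; this is the recursion for the trees whose coefficients
\<open>disc_coeff\<close> rescales.\<close>

lemma disc_coeff_convolution:
  assumes "r > 0" "L > 0"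
  shows "(real L / real r - 1) * disc_coeff r L = real L / 2 * (\<Sum>x=1..<L. disc_coeff r x * disc_coeff r (L - x))"
proof (cases "r dvd L")
  case False
  have "disc_coeff r x * disc_coeff r (L - x) = 0" if "x \<in> {1..<L}" for x
  proof (rule ccontr)
    assume "disc_coeff r x * disc_coeff r (L - x) \<noteq> 0"
    then have "r dvd x" "r dvd L - x" by (auto simp: disc_coeff_def split: if_splits)
    then have "r dvd x + (L - x)" by (rule dvd_add)
    with False that show False by simp
  qed
  then have "(\<Sum>x=1..<L. disc_coeff r x * disc_coeff r (L - x)) = 0" by (simp add: sum.neutral)
  with False show ?thesis by (simp add: disc_coeff_def)
next
  case True
  then obtain m where L: "L = r * m" by auto
  with assms have m: "m > 0" by auto
  have "(L - 1) div r = m - 1"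
  proof (rule div_nat_eqI)
    show "r * (m - 1) \<le> L - 1" using L assms m by (cases m) auto
    show "L - 1 < r * Suc (m - 1)" using L assms m by (cases m) auto
  qed
  then have "(\<Sum>x=1..<L. disc_coeff r x * disc_coeff r (L - x)) = (\<Sum>a=1..m-1. disc_coeff r (r * a) * disc_coeff r (L - r * a))"
    by (subst sum_over_multiples[OF assms(1)]) (auto simp: disc_coeff_def)
  also have "\<dots> = (\<Sum>a=1..<m. real r ^ (m - 2) * (tree_coeff a * tree_coeff (m - a)))"
  proof (rule sum.cong)
    fix a assume a: "a \<in> {1..<m}"
    have "L - r * a = r * (m - a)" by (simp add: L diff_mult_distrib2)
    moreover have p: "real r^(m - 2) = real r^(a - 1) * real r^(m - a - 1)"
      using a by (simp add: power_add[symmetric])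
    ultimately show "disc_coeff r (r * a) * disc_coeff r (L - r * a) = real r ^ (m - 2) * (tree_coeff a * tree_coeff (m - a))"
      using assms a unfolding p by (simp add: disc_coeff_mult)
  qed (use m in auto)
  also have "\<dots> = real r ^ (m - 2) * (\<Sum>a=1..<m. tree_coeff a * tree_coeff (m - a))"
    by (simp add: sum_distrib_left)
  finally have S: "(\<Sum>x=1..<L. disc_coeff r x * disc_coeff r (L - x)) = \<dots>" .
  show ?thesis
  proof (cases "m = 1")
    case True
    then show ?thesis using assms unfolding S by (simp add: L)
  next
    case False
    then have "real r ^ (m - 1) = real r * real r ^ (m - 2)"
      using m by (simp add: power_Suc[symmetric] Suc_diff_Suc numeral_2_eq_2 del: power_Suc)
    then show ?thesis
      using tree_coeff_convolution[OF m] assms m unfolding S by (simp add: L disc_coeff_mult)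
  qed
qed

text \<open>The powers of \<open>r\<close> are collected so that \<open>p / r\<close> becomes the variable of the Abel-type identity.\<close>

lemma annulus_coeff_normal_form:
  assumes "r > 0" "p > 0" "q > 0" "p + q = r * m"
    and k: "k = (p - 1) div r" and l: "l = q div r"
  shows "m = k + l + 1"
    and "annulus_coeff r p q = real p * real q / real m * real r ^ (m - 1) * (dpow k (real p / real r) * dpow l (real q / real r))"
proof -
  have "(r * m - 1 - q) div r + q div r = m - 1"
  proof -
    define b where "b = q mod r"
    have q: "q = r * l + b" "b < r" using assms(1) by (auto simp: l b_def)
    have "l < m"
    proof (rule ccontr)
      assume "\<not> l < m"
      then have "r * m \<le> r * l" by simp
      with q assms show False by linarith
    qed
    then obtain e where e: "m = Suc (l + e)" using less_imp_Suc_add by blast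
    have "(r * m - 1 - q) div r = e"
      by (rule div_nat_eqI) (use q e in \<open>auto simp: algebra_simps\<close>)
    then show ?thesis using e l by simp
  qed
  moreover have "p - 1 = r * m - 1 - q" using assms(2,4) by linarith
  moreover have "m > 0" using assms(2,4) by (cases m) auto
  ultimately show m: "m = k + l + 1" unfolding k l by simp
  have x: "dpow j (real x) = real r ^ j * dpow j (real x / real r)" for j x
    using assms(1) by (simp add: dpow_def power_divide)
  have "real (p + q) = real r * real m" unfolding assms(4) by simp
  then have "real p * real q * real r / real (p + q) = real p * real q / real m"
    using assms(1) by simp
  then have "annulus_coeff r p q = real p * real q / real m * (dpow k (real p) * dpow l (real q))"
    using assms(4) by (simp add: annulus_coeff_def k l del: of_nat_add)
  also have "\<dots> = real p * real q / real m * real r ^ (m - 1) * (dpow k (real p / real r) * dpow l (real q / real r))"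
    unfolding x[of k p] x[of l q] by (simp add: m power_add)
  finally show "annulus_coeff r p q = \<dots>" .
qed

lemma div_diff_multiple: "(n - r * a) div r = n div r - a" if "r * a \<le> n" "r > 0" for n r a :: nat
proof -
  from that(1) obtain c where "n = r * a + c" by (auto simp: le_iff_add)
  then show ?thesis using that by simp
qed

lemma disc_annulus_product:
  assumes "r > 0" "a > 0" "a < m"
  shows "disc_coeff r (r * a) * (u * (real r * y) / (real m - real a) * real r ^ (m - a - 1) * w)
     = u * real r ^ (m - 1) * (tree_coeff a * (w * y / (real m - real a)))"
proof -
  have "m - 1 = (a - 1) + Suc (m - a - 1)" using assms by simp
  then have "real r ^ (m - 1) = real r ^ (a - 1) * (real r * real r ^ (m - a - 1))"
    by (metis power_add power_Suc)
  then show ?thesis using assms by (simp add: disc_coeff_mult)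
qed

lemma annulus_convolution_left:
  assumes "r > 0" "p > 0" "q > 0" "p + q = r * m"
    and k: "k = (p - 1) div r" and l: "l = q div r"
  shows "(\<Sum>x=1..<p. disc_coeff r x * annulus_coeff r (p - x) q)
       = real q * real r ^ (m - 1) * (dpow l (real q / real r) * annular_sum m k (real p / real r))"
proof -
  have "(\<Sum>x=1..<p. disc_coeff r x * annulus_coeff r (p - x) q) = (\<Sum>a=1..k. disc_coeff r (r * a) * annulus_coeff r (p - r * a) q)"
    unfolding k by (rule sum_over_multiples) (simp_all add: assms(1) disc_coeff_def)
  also have "\<dots> = (\<Sum>a=1..k. real q * real r ^ (m - 1) * (dpow l (real q / real r) *
        (tree_coeff a * (dpow (k - a) (real p / real r - real a) * (real p / real r - real a) / (real m - real a)))))"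
  proof (intro sum.cong refl)
    fix a assume a: "a \<in> {1..k}"
    have "a * r \<le> p - 1" using a assms(1) unfolding k by (simp add: less_eq_div_iff_mult_less_eq)
    then have pa: "r * a < p" "r * a \<le> p - 1" using assms(2) by (simp_all add: mult.commute)
    have am: "a < m"
    proof -
      have "r * a < r * m" using pa assms(4) by linarith
      then show ?thesis by simp
    qed
    have k': "k - a = (p - r * a - 1) div r"
      using div_diff_multiple[OF pa(2) assms(1)] by (simp add: k diff_commute)
    have s: "p - r * a + q = r * (m - a)" using pa assms(4) by (simp add: diff_mult_distrib2)
    define y where "y = real p / real r - real a"
    have y: "real (p - r * a) = real r * y" "real (p - r * a) / real r = y"
      using pa assms(1) by (simp_all add: y_def of_nat_diff field_simps)
    have "annulus_coeff r (p - r * a) q = real q * (real r * y) / (real m - real a) * real r ^ (m - a - 1) * (dpow (k - a) y * dpow l (real q / real r))"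
      using annulus_coeff_normal_form(2)[OF assms(1) _ assms(3) s k' l] pa am unfolding y by (simp add: mult.commute)
    then show "disc_coeff r (r * a) * annulus_coeff r (p - r * a) q =
        real q * real r ^ (m - 1) * (dpow l (real q / real r) *
        (tree_coeff a * (dpow (k - a) (real p / real r - real a) * (real p / real r - real a) / (real m - real a))))"
      using disc_annulus_product[of r a m "real q" y "dpow (k - a) y * dpow l (real q / real r)"] assms(1) a am
      unfolding y_def[symmetric] by (simp add: mult_ac)
  qed
  finally show ?thesis unfolding annular_sum_def sum_distrib_left .
qed

text \<open>The exponent on this side is \<open>q div r\<close> instead of \<open>(q - 1) div r\<close>. If \<open>r\<close> divides \<open>q\<close>, the sum in
\<open>annular_sum\<close> has one more index, and its term contains the factor \<open>q / r - a = 0\<close>.\<close>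

lemma annulus_convolution_right:
  assumes "r > 0" "p > 0" "q > 0" "p + q = r * m"
    and k: "k = (p - 1) div r" and l: "l = q div r"
  shows "(\<Sum>x=1..<q. disc_coeff r x * annulus_coeff r p (q - x))
       = real p * real r ^ (m - 1) * (dpow k (real p / real r) * annular_sum m l (real q / real r))"
proof -
  let ?f = "\<lambda>a. real p * real r ^ (m - 1) * (dpow k (real p / real r) *
        (tree_coeff a * (dpow (l - a) (real q / real r - real a) * (real q / real r - real a) / (real m - real a))))"
  have "(\<Sum>x=1..<q. disc_coeff r x * annulus_coeff r p (q - x)) = (\<Sum>a=1..(q - 1) div r. disc_coeff r (r * a) * annulus_coeff r p (q - r * a))"
    by (rule sum_over_multiples) (simp_all add: assms(1) disc_coeff_def)
  also have "\<dots> = (\<Sum>a=1..(q - 1) div r. ?f a)"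
  proof (intro sum.cong refl)
    fix a assume a: "a \<in> {1..(q - 1) div r}"
    have "a * r \<le> q - 1" using a assms(1) by (simp add: less_eq_div_iff_mult_less_eq)
    then have qa: "r * a < q" "r * a \<le> q" using assms(3) by (simp_all add: mult.commute)
    have am: "a < m"
    proof -
      have "r * a < r * m" using qa assms(4) by linarith
      then show ?thesis by simp
    qed
    have l': "l - a = (q - r * a) div r"
      using div_diff_multiple[OF qa(2) assms(1)] by (simp add: l)
    have s: "p + (q - r * a) = r * (m - a)" using qa assms(4) by (simp add: diff_mult_distrib2)
    define y where "y = real q / real r - real a"
    have y: "real (q - r * a) = real r * y" "real (q - r * a) / real r = y"
      using qa assms(1) by (simp_all add: y_def of_nat_diff field_simps)
    have "annulus_coeff r p (q - r * a) = real p * (real r * y) / (real m - real a) * real r ^ (m - a - 1) * (dpow k (real p / real r) * dpow (l - a) y)"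
      using annulus_coeff_normal_form(2)[OF assms(1,2) _ s k l'] qa am unfolding y by simp
    then show "disc_coeff r (r * a) * annulus_coeff r p (q - r * a) = ?f a"
      using disc_annulus_product[of r a m "real p" y "dpow k (real p / real r) * dpow (l - a) y"] assms(1) a am
      unfolding y_def[symmetric] by (simp add: mult_ac)
  qed
  also have "\<dots> = (\<Sum>a=1..l. ?f a)"
  proof (rule sum.mono_neutral_left)
    show "{1..(q - 1) div r} \<subseteq> {1..l}" by (simp add: l div_le_mono)
    show "\<forall>a\<in>{1..l} - {1..(q - 1) div r}. ?f a = 0"
    proof
      fix a assume "a \<in> {1..l} - {1..(q - 1) div r}"
      then have a: "a \<le> q div r" "\<not> a \<le> (q - 1) div r" by (auto simp: l)
      have "a * r \<le> q" using a(1) assms(1) by (simp add: less_eq_div_iff_mult_less_eq)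
      moreover have "\<not> a * r \<le> q - 1" using a(2) less_eq_div_iff_mult_less_eq[OF assms(1)] by blast
      ultimately have "q = a * r" by linarith
      then have "real q / real r - real a = 0" using assms(1) by simp
      then show "?f a = 0" by simp
    qed
  qed simp
  finally show ?thesis unfolding annular_sum_def sum_distrib_left .
qed

text \<open>The cut-and-join recursion for the annulus numbers: the first letter joins the two cycles (first term) or
cuts a piece off one of them that is not linked to the other cycle any more (the two sums).\<close>

lemma annulus_convolution:
  assumes "r > 0" "p > 0" "q > 0"
  shows "real (p + q) / real r * annulus_coeff r p q =
     real p * real q * disc_coeff r (p + q)
     + real p * (\<Sum>x=1..<p. disc_coeff r x * annulus_coeff r (p - x) q)
     + real q * (\<Sum>x=1..<q. disc_coeff r x * annulus_coeff r p (q - x))"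
proof (cases "r dvd p + q")
  case False
  have "disc_coeff r x * annulus_coeff r (p - x) q = 0" if "x \<in> {1..<p}" for x
  proof (rule ccontr)
    assume "disc_coeff r x * annulus_coeff r (p - x) q \<noteq> 0"
    then have "r dvd x" "r dvd (p - x + q)" by (auto simp: disc_coeff_def annulus_coeff_def split: if_splits)
    then have "r dvd x + (p - x + q)" by (rule dvd_add)
    with False that show False by simp
  qed
  moreover have "disc_coeff r x * annulus_coeff r p (q - x) = 0" if "x \<in> {1..<q}" for x
  proof (rule ccontr)
    assume "disc_coeff r x * annulus_coeff r p (q - x) \<noteq> 0"
    then have "r dvd x" "r dvd (p + (q - x))" by (auto simp: disc_coeff_def annulus_coeff_def split: if_splits)
    then have "r dvd x + (p + (q - x))" by (rule dvd_add)
    with False that show False by simp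
  qed
  ultimately show ?thesis using False by (simp add: disc_coeff_def annulus_coeff_def sum.neutral)
next
  case True
  then obtain m where m: "p + q = r * m" by auto
  define k l where "k = (p - 1) div r" and "l = q div r"
  define x where "x = real p / real r"
  have y: "real q / real r = real m - x"
  proof -
    have "real p + real q = real r * real m" using m by (metis of_nat_add of_nat_mult)
    then show ?thesis using assms(1) by (simp add: x_def field_simps)
  qed
  have nf: "annulus_coeff r p q = real p * real q / real m * real r ^ (m - 1) * (dpow k x * dpow l (real m - x))"
    using annulus_coeff_normal_form[OF assms m k_def l_def] by (simp add: x_def y)
  have mk: "m = k + l + 1" using annulus_coeff_normal_form(1)[OF assms m k_def l_def] .
  have s1: "(\<Sum>x=1..<p. disc_coeff r x * annulus_coeff r (p - x) q) =
     real q * real r ^ (m - 1) * (dpow l (real m - x) * annular_sum m k x)"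
    using annulus_convolution_left[OF assms m k_def l_def] by (simp add: x_def y)
  have s2: "(\<Sum>x=1..<q. disc_coeff r x * annulus_coeff r p (q - x)) =
     real p * real r ^ (m - 1) * (dpow k x * annular_sum m l (real m - x))"
    using annulus_convolution_right[OF assms m k_def l_def] by (simp add: x_def y)
  have m0: "m > 0" using mk by simp
  have "disc_coeff r (p + q) = real r ^ (m - 1) * tree_coeff m"
    unfolding m using assms m0 by (intro disc_coeff_mult)
  moreover have "real (p + q) / real r = real m" using assms(1) unfolding m by simp
  ultimately show ?thesis
    unfolding s1 s2 nf using annular_identity[OF mk, of x] m0 by (simp add: algebra_simps)
qed

section \<open>Power series in the coordinate of the Lambert curve\<close>

lemma has_sum_by_fibers:
  fixes f :: "'a \<Rightarrow> complex" and h :: "'a \<Rightarrow> nat"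
  assumes "(f has_sum S) A" and "\<And>n. finite {x\<in>A. h x = n}"
  shows "((\<lambda>n. \<Sum>x | x \<in> A \<and> h x = n. f x) has_sum S) UNIV"
proof -
  have "((\<lambda>(n, x). f x) has_sum S) (SIGMA n:UNIV. {x\<in>A. h x = n})"
    using assms(1) by (subst has_sum_reindex_bij_witness[where i="\<lambda>x. (h x, x)" and j=snd and T=A and h=f and s'=S]) auto
  moreover have "((\<lambda>x. case (n, x) of (n, x) \<Rightarrow> f x) has_sum (\<Sum>x | x \<in> A \<and> h x = n. f x)) {x\<in>A. h x = n}" for n
    unfolding prod.case using assms(2) by (rule has_sum_finite)
  ultimately show ?thesis
    using has_sum_Sigma'[where f="\<lambda>(n, x). f x" and A=UNIV and B="\<lambda>n. {x\<in>A. h x = n}" and a=S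
      and b="\<lambda>n. \<Sum>x | x \<in> A \<and> h x = n. f x"] by blast
qed

text \<open>Absolute convergence is stated with the sum because the products are summed once more over residue classes.\<close>

lemma has_sum_product_abs:
  fixes f :: "'a \<Rightarrow> complex" and g :: "'b \<Rightarrow> complex"
  assumes "(\<lambda>x. norm (f x)) summable_on A" "(\<lambda>x. norm (g x)) summable_on B" "(f has_sum a) A" "(g has_sum b) B"
  shows "(\<lambda>u. norm (case u of (x, y) \<Rightarrow> f x * g y)) summable_on A \<times> B"
    and "((\<lambda>(x, y). f x * g y) has_sum (a * b)) (A \<times> B)"
proof -
  show s: "(\<lambda>u. norm (case u of (x, y) \<Rightarrow> f x * g y)) summable_on A \<times> B"
  proof (subst Infinite_Sum.abs_summable_on_Sigma_iff, intro conjI ballI)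
    show "(\<lambda>y. norm (case (x, y) of (x, y) \<Rightarrow> f x * g y)) summable_on B" for x
      using assms(2) by (simp add: norm_mult summable_on_cmult_right)
    have "(\<lambda>x. norm (f x) * infsum (\<lambda>y. norm (g y)) B) summable_on A"
      using assms(1) by (rule summable_on_cmult_left)
    then show "(\<lambda>x. norm (\<Sum>\<^sub>\<infinity>y\<in>B. norm (case (x, y) of (x, y) \<Rightarrow> f x * g y))) summable_on A"
      by (simp add: norm_mult infsum_cmult_right' infsum_nonneg)
  qed
  show "((\<lambda>(x, y). f x * g y) has_sum (a * b)) (A \<times> B)"
  proof (rule has_sum_SigmaI)
    show "((\<lambda>y. case (x, y) of (x, y) \<Rightarrow> f x * g y) has_sum (f x * b)) B" for x
      using assms(4) by (simp add: has_sum_cmult_right)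
    show "((\<lambda>x. f x * b) has_sum a * b) A"
      using assms(3) by (rule has_sum_cmult_left)
    show "(\<lambda>(x, y). f x * g y) summable_on A \<times> B"
      using s by (rule abs_summable_summable)
  qed
qed

text \<open>From \<open>n\<^sup>n / n! \<le> e\<^sup>n\<close> with \<open>n = k + 1\<close>.\<close>

lemma shifted_power_over_factorial_bound:
  assumes "i \<le> r"
  shows "real (i + r * k) ^ k / fact k \<le> exp 1 * (real r * exp 1) ^ k"
proof -
  have pf: "real n ^ n / fact n \<le> exp (real n)" for n :: nat
  proof -
    have s: "(\<lambda>j. inverse (fact j) *\<^sub>R real n ^ j) sums exp (real n)" by (rule exp_converges)
    have "(\<Sum>j\<in>{n}. inverse (fact j) *\<^sub>R real n ^ j) \<le> exp (real n)"
      using s by (intro sum_le_suminf[OF sums_summable[OF s], unfolded sums_unique[OF s, symmetric]]) auto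
    then show ?thesis by (simp add: field_simps)
  qed
  have "real (i + r * k) \<le> real r * real (Suc k)"
    using assms by (simp add: algebra_simps)
  then have "real (i + r * k) ^ k / fact k \<le> (real r * real (Suc k)) ^ k / fact k"
    by (intro divide_right_mono power_mono) auto
  also have "\<dots> = real r ^ k * (real (Suc k) ^ Suc k / fact (Suc k))"
    by (simp add: power_mult_distrib del: of_nat_Suc)
  also have "\<dots> \<le> real r ^ k * exp (real (Suc k))"
    by (intro mult_left_mono pf) auto
  also have "exp (real (Suc k)) = exp 1 * exp 1 ^ k"
    by (simp add: exp_of_nat_mult[symmetric] exp_add[symmetric] add.commute)
  finally show ?thesis by (simp add: power_mult_distrib mult_ac)
qed

lemma lambert_series_abs_summable:
  assumes "i \<le> r" "real r * exp 1 * c < 1" "c \<ge> 0"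
  shows "(\<lambda>k. real (i + r * k) ^ k / fact k * c ^ k) summable_on UNIV"
proof -
  have "summable (\<lambda>k. exp 1 * (real r * exp 1 * c) ^ k)"
    using assms by (intro summable_mult summable_geometric) auto
  moreover have "real (i + r * k) ^ k / fact k * c ^ k \<le> exp 1 * (real r * exp 1 * c) ^ k" for k
    using mult_right_mono[OF shifted_power_over_factorial_bound[OF assms(1), of k], of "c ^ k"] assms(3)
    by (simp add: power_mult_distrib mult_ac)
  moreover have nonneg: "0 \<le> real (i + r * k) ^ k / fact k * c ^ k" for k
    using assms(3) by simp
  ultimately have "summable (\<lambda>k. real (i + r * k) ^ k / fact k * c ^ k)"
    by - (rule summable_comparison_test'[of "\<lambda>k. exp 1 * (real r * exp 1 * c) ^ k" 0],
        simp_all only: real_norm_def abs_of_nonneg[OF nonneg])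
  then show ?thesis
    using assms(3) by (subst summable_on_UNIV_nonneg_real_iff) auto
qed

text \<open>Expanding the exponential gives a double series in \<open>y\<close>. Collected by the total degree \<open>n\<close>, its coefficients are the
\<open>n\<close>-th finite differences of \<open>(i + r k)\<^sup>n\<close>, that is \<open>r\<^sup>n n!\<close>, and a geometric series in \<open>r y\<close> remains. The bound
on \<open>y\<close> gives \<open>r \<bar>y\<bar> * exp 1 * exp (r \<bar>y\<bar>) < 1\<close>, so that the double series converges absolutely.\<close>

lemma lambert_exponential_series:
  fixes y :: complex
  assumes r: "r > 0" and i: "i \<le> r" and y: "norm y < 1 / (18 * real r)"
  shows "((\<lambda>k. of_nat (i + r * k) ^ k / fact k * y ^ k * exp (- (of_nat (i + r * k) * y))) has_sum (1 / (1 - of_nat r * y))) UNIV"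
proof -
  define N where "N k = i + r * k" for k
  define f where "f = (\<lambda>(k, j). of_nat (N k) ^ k / fact k * y ^ k * ((- (of_nat (N k) * y)) ^ j / fact j))"
  have ry: "real r * norm y < 1 / 18" using y r by (simp add: field_simps)
  have expsum: "((\<lambda>j. x ^ j / fact j) has_sum exp x) UNIV" "(\<lambda>j. norm (x ^ j / fact j)) summable_on UNIV"
    "((\<lambda>j. norm (x ^ j / fact j)) has_sum exp (norm x)) UNIV" for x :: complex
  proof -
    have n: "norm (x ^ j / fact j) = norm x ^ j / fact j" for j by (simp add: norm_divide norm_power)
    have e: "(\<lambda>j. norm x ^ j / fact j) sums exp (norm x)" using exp_converges[of "norm x"] by (simp add: field_simps)
    show "((\<lambda>j. norm (x ^ j / fact j)) has_sum exp (norm x)) UNIV"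
      unfolding n using e by (intro norm_summable_imp_has_sum) (auto simp: sums_iff)
    then show "(\<lambda>j. norm (x ^ j / fact j)) summable_on UNIV" by (rule has_sum_imp_summable)
    show "((\<lambda>j. x ^ j / fact j) has_sum exp x) UNIV"
      using e exp_converges[of x] by (intro norm_summable_imp_has_sum) (auto simp: n sums_iff field_simps scaleR_conv_of_real)
  qed
  have rows: "((\<lambda>j. f (k, j)) has_sum (of_nat (N k) ^ k / fact k * y ^ k * exp (- (of_nat (N k) * y)))) UNIV" for k
    unfolding f_def prod.case by (intro has_sum_cmult_right expsum)
  have rowsn: "((\<lambda>j. norm (f (k, j))) has_sum (real (N k) ^ k / fact k * norm y ^ k * exp (real (N k) * norm y))) UNIV" for k
  proof -
    have "((\<lambda>j. norm (of_nat (N k) ^ k / fact k * y ^ k) * norm ((- (of_nat (N k) * y)) ^ j / fact j)) has_sum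
       (norm (of_nat (N k) ^ k / fact k * y ^ k) * exp (norm (- (of_nat (N k) * y))))) UNIV"
      by (intro has_sum_cmult_right expsum)
    then show ?thesis by (simp add: f_def norm_mult norm_divide norm_power)
  qed
  have abs: "(\<lambda>u. norm (f u)) summable_on UNIV \<times> UNIV"
  proof -
    have "(\<lambda>k. exp (real r * norm y) * (real (N k) ^ k / fact k * (norm y * exp (real r * norm y)) ^ k)) summable_on UNIV"
      unfolding N_def
    proof (intro summable_on_cmult_right lambert_series_abs_summable i)
      have "exp (real r * norm y) \<le> exp 1" using ry by simp
      also have "\<dots> \<le> 3" by (rule exp_le)
      finally have "exp 1 * exp (real r * norm y) \<le> 3 * 3" by (intro mult_mono exp_le) auto
      then have "real r * norm y * (exp 1 * exp (real r * norm y)) \<le> real r * norm y * 9" by (intro mult_left_mono) auto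
      also have "\<dots> < 1" using ry by simp
      finally show "real r * exp 1 * (norm y * exp (real r * norm y)) < 1" by (simp add: mult_ac)
    qed auto
    then have "(\<lambda>k. real (N k) ^ k / fact k * norm y ^ k * exp (real (N k) * norm y)) summable_on UNIV"
    proof (rule summable_on_comparison_test)
      fix k
      have "exp (real (N k) * norm y) \<le> exp (real r * norm y) * exp (real r * norm y) ^ k"
      proof -
        have "real i * norm y \<le> real r * norm y" using i by (intro mult_right_mono) auto
        then show ?thesis by (simp add: N_def exp_of_nat_mult[symmetric] exp_add[symmetric] algebra_simps)
      qed
      then have "real (N k) ^ k / fact k * norm y ^ k * exp (real (N k) * norm y) \<le> real (N k) ^ k / fact k * norm y ^ k * (exp (real r * norm y) * exp (real r * norm y) ^ k)"
        by (intro mult_left_mono) auto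
      then show "real (N k) ^ k / fact k * norm y ^ k * exp (real (N k) * norm y) \<le> exp (real r * norm y) * (real (N k) ^ k / fact k * (norm y * exp (real r * norm y)) ^ k)"
        by (simp add: power_mult_distrib mult_ac)
    qed auto
    moreover have "infsum (\<lambda>j. norm (f (k, j))) UNIV = real (N k) ^ k / fact k * norm y ^ k * exp (real (N k) * norm y)" for k
      using rowsn by (rule infsumI)
    ultimately show ?thesis
      by (subst Infinite_Sum.abs_summable_on_Sigma_iff) (use has_sum_imp_summable[OF rowsn] in \<open>simp add: infsum_nonneg\<close>)
  qed
  then obtain S where S: "(f has_sum S) (UNIV \<times> UNIV)" using abs_summable_summable summable_on_def by blast
  have "((\<lambda>k. of_nat (N k) ^ k / fact k * y ^ k * exp (- (of_nat (N k) * y))) has_sum S) UNIV"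
    using S rows by (rule has_sum_Sigma')
  moreover have "S = 1 / (1 - of_nat r * y)"
  proof -
    have set_eq: "{x \<in> UNIV \<times> UNIV. fst x + snd x = n} = (\<lambda>k. (k, n - k)) ` {..n}" for n :: nat
      by (auto simp: image_iff)
    have "((\<lambda>n. \<Sum>x | x \<in> UNIV \<times> UNIV \<and> fst x + snd x = n. f x) has_sum S) UNIV"
      by (rule has_sum_by_fibers[OF S]) (simp only: set_eq, auto)
    moreover have "(\<Sum>x | x \<in> UNIV \<times> UNIV \<and> fst x + snd x = n. f x) = (of_nat r * y) ^ n" for n
    proof -
      have "(\<Sum>x | x \<in> UNIV \<times> UNIV \<and> fst x + snd x = n. f x) = (\<Sum>k\<le>n. f (k, n - k))"
        unfolding set_eq by (subst sum.reindex) (auto simp: inj_on_def)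
      also have "\<dots> = (\<Sum>k\<le>n. y ^ n / fact n * ((-1) ^ (n - k) * of_nat (n choose k) * (of_nat i + of_nat r * of_nat k) ^ n))"
      proof (intro sum.cong refl)
        fix k assume k: "k \<in> {..n}"
        have "(of_nat (N k) :: complex) ^ k * of_nat (N k) ^ (n - k) = of_nat (N k) ^ n" "y ^ k * y ^ (n - k) = y ^ n"
          using k by (simp_all add: power_add[symmetric])
        moreover have "(- (of_nat (N k) * y)) ^ (n - k) = (-1) ^ (n - k) * of_nat (N k) ^ (n - k) * y ^ (n - k)"
          by (subst power_minus) (simp add: power_mult_distrib)
        moreover have "of_nat (N k) = (of_nat i + of_nat r * of_nat k :: complex)" by (simp add: N_def)
        ultimately show "f (k, n - k) = y ^ n / fact n * ((-1) ^ (n - k) * of_nat (n choose k) * (of_nat i + of_nat r * of_nat k) ^ n)"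
          using k by (simp add: f_def binomial_fact[of k n, where 'a=complex] field_simps)
      qed
      also have "\<dots> = y ^ n / fact n * (of_nat r ^ n * fact n)"
        unfolding sum_distrib_left[symmetric] by (subst finite_difference_power) auto
      finally show ?thesis by (simp add: power_mult_distrib)
    qed
    ultimately have "(\<lambda>n. (of_nat r * y) ^ n) sums S" by (simp add: has_sum_imp_sums)
    moreover have "(\<lambda>n. (of_nat r * y) ^ n) sums (1 / (1 - of_nat r * y))"
      by (rule geometric_sums) (use ry in \<open>simp add: norm_mult\<close>)
    ultimately show ?thesis by (rule sums_unique2)
  qed
  ultimately show ?thesis by (simp add: N_def)
qed

text \<open>Putting \<open>y = z\<^sup>r\<close> turns the exponential factors into powers of \<open>x(z) = z e\<^sup>-\<^sup>y\<close>.\<close>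

lemma lambert_power_series:
  fixes z :: complex
  assumes r: "r > 0" and i: "i \<le> r" and z: "norm (z ^ r) < 1 / (18 * real r)"
  shows "((\<lambda>k. of_nat (i + r * k) ^ k / fact k * lambert_x r z ^ (i + r * k)) has_sum (z ^ i / (1 - of_nat r * z ^ r))) UNIV"
proof -
  have "lambert_x r z ^ (i + r * k) = z ^ i * ((z ^ r) ^ k * exp (- (of_nat (i + r * k) * z ^ r)))" for k
    unfolding lambert_x_def power_mult_distrib exp_of_nat_mult[symmetric] mult_minus_right power_add power_mult
    by (simp add: exp_add[symmetric] algebra_simps)
  then show ?thesis
    using has_sum_cmult_right[OF lambert_exponential_series[OF assms], of "z ^ i"] by (simp add: mult_ac)
qed

text \<open>The coefficients of \<open>(x\<^sub>1 \<partial>\<^sub>1 + x\<^sub>2 \<partial>\<^sub>2) F\<^sub>0\<^sub>,\<^sub>2\<close>: the Euler operator multiplies by \<open>p + q\<close>, which cancels the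
denominator of \<open>annulus_coeff r p q / (p q)\<close> and leaves a product of a factor for \<open>p\<close> and a factor for \<open>q\<close>.\<close>

definition radial_annulus_coeff :: "nat \<Rightarrow> nat \<Rightarrow> nat \<Rightarrow> real" where
  "radial_annulus_coeff r p q =
     (if r dvd p + q then real r * dpow ((p - 1) div r) (real p) * dpow (q div r) (real q) else 0)"

lemma lambert_terms_summable:
  fixes x :: complex
  assumes "i \<le> r" "real r * exp 1 * norm x ^ r < 1"
  shows "(\<lambda>k. norm (of_nat (i + r * k) ^ k / fact k * x ^ (i + r * k))) summable_on UNIV"
proof -
  have "(\<lambda>k. norm x ^ i * (real (i + r * k) ^ k / fact k * (norm x ^ r) ^ k)) summable_on UNIV"
    using assms by (intro summable_on_cmult_right lambert_series_abs_summable) auto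
  moreover have "norm (of_nat (i + r * k) ^ k / fact k * x ^ (i + r * k)) = norm x ^ i * (real (i + r * k) ^ k / fact k * (norm x ^ r) ^ k)" for k
    unfolding norm_mult norm_divide norm_power norm_of_nat norm_fact power_add power_mult by simp
  ultimately show ?thesis by simp
qed

text \<open>The residue of \<open>p\<close> modulo \<open>r\<close> determines that of \<open>q\<close>, and for fixed residues the double series is a product of two
series summed by \<open>lambert_power_series\<close>.\<close>

lemma radial_annulus_series:
  fixes z1 z2 :: complex
  assumes r: "r > 0" and z: "norm (z1 ^ r) < 1 / (18 * real r)" "norm (z2 ^ r) < 1 / (18 * real r)"
    and x: "real r * exp 1 * norm x1 ^ r < 1" "real r * exp 1 * norm x2 ^ r < 1"
    and x1: "x1 = lambert_x r z1" and x2: "x2 = lambert_x r z2"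
  shows "(\<lambda>u. norm (case u of (p, q) \<Rightarrow> of_real (radial_annulus_coeff r p q) * x1 ^ p * x2 ^ q)) summable_on {1..} \<times> {1..}"
    and "((\<lambda>(p, q). of_real (radial_annulus_coeff r p q) * x1 ^ p * x2 ^ q) has_sum
       ((of_nat r * (\<Sum>i=1..<r. z1 ^ i * z2 ^ (r - i)) + of_nat r ^ 2 * z1 ^ r * z2 ^ r)
         / ((1 - of_nat r * z1 ^ r) * (1 - of_nat r * z2 ^ r)))) ({1..} \<times> {1..})"
proof -
  define a where "a x i k = of_nat (i + r * k) ^ k / fact k * x ^ (i + r * k)" for x :: complex and i k
  \<comment> \<open>Residues are taken in \<open>{1..r}\<close>; \<open>J i\<close> is the residue of \<open>q\<close> if \<open>i\<close> is that of \<open>p\<close>. For \<open>i = r\<close> the exponent \<open>q div r\<close>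
    exceeds the index of \<open>q\<close> in its residue class by 1, which produces a second factor \<open>r\<close>.\<close>
  define J where "J i = (if i < r then r - i else r)" for i
  define C where "C i = (if i < r then of_nat r else of_nat r ^ 2 :: complex)" for i
  define D where "D = (1 - of_nat r * z1 ^ r) * (1 - of_nat r * z2 ^ r)"
  let ?t = "\<lambda>(p, q). of_real (radial_annulus_coeff r p q) * x1 ^ p * x2 ^ q"
  let ?T = "{1..r} \<times> (UNIV \<times> UNIV :: (nat \<times> nat) set)"
  let ?g = "\<lambda>(i, k, l). C i * (a x1 i k * a x2 (J i) l)"
  let ?P = "{(p, q). 1 \<le> p \<and> 1 \<le> q \<and> r dvd p + q}"
  have J: "J i \<in> {1..r}" if "i \<in> {1..r}" for i using that r by (auto simp: J_def)
  have one: "(\<lambda>u. norm (case u of (k, l) \<Rightarrow> a x1 i k * a x2 (J i) l)) summable_on UNIV \<times> UNIV"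
       "((\<lambda>(k, l). a x1 i k * a x2 (J i) l) has_sum (z1 ^ i / (1 - of_nat r * z1 ^ r) * (z2 ^ J i / (1 - of_nat r * z2 ^ r)))) (UNIV \<times> UNIV)"
    if "i \<in> {1..r}" for i
  proof -
    have ij: "i \<le> r" "J i \<le> r" using that J[OF that] by auto
    have s: "(\<lambda>k. norm (a x1 i k)) summable_on UNIV" "(\<lambda>k. norm (a x2 (J i) k)) summable_on UNIV"
      unfolding a_def using ij x by (intro lambert_terms_summable; simp)+
    have h: "(a x1 i has_sum (z1 ^ i / (1 - of_nat r * z1 ^ r))) UNIV" "(a x2 (J i) has_sum (z2 ^ J i / (1 - of_nat r * z2 ^ r))) UNIV"
      unfolding a_def x1 x2 by (intro lambert_power_series r ij z)+
    show "(\<lambda>u. norm (case u of (k, l) \<Rightarrow> a x1 i k * a x2 (J i) l)) summable_on UNIV \<times> UNIV"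
      "((\<lambda>(k, l). a x1 i k * a x2 (J i) l) has_sum (z1 ^ i / (1 - of_nat r * z1 ^ r) * (z2 ^ J i / (1 - of_nat r * z2 ^ r)))) (UNIV \<times> UNIV)"
      using has_sum_product_abs[OF s h] by auto
  qed
  have Tabs: "(\<lambda>u. norm (?g u)) summable_on ?T"
  proof (subst Infinite_Sum.abs_summable_on_Sigma_iff, intro conjI ballI)
    fix i assume i: "i \<in> {1..r}"
    have "(\<lambda>u. norm (C i) * norm (case u of (k, l) \<Rightarrow> a x1 i k * a x2 (J i) l)) summable_on UNIV \<times> UNIV"
      using one(1)[OF i] by (rule summable_on_cmult_right)
    then show "(\<lambda>y. norm (?g (i, y))) summable_on UNIV \<times> UNIV"
      by (simp add: case_prod_unfold norm_mult)
  qed (simp add: summable_on_finite)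
  have Tsum: "(?g has_sum (\<Sum>i=1..r. C i * (z1 ^ i / (1 - of_nat r * z1 ^ r) * (z2 ^ J i / (1 - of_nat r * z2 ^ r))))) ?T"
  proof (rule has_sum_SigmaI)
    show "((\<lambda>y. ?g (i, y)) has_sum (C i * (z1 ^ i / (1 - of_nat r * z1 ^ r) * (z2 ^ J i / (1 - of_nat r * z2 ^ r))))) (UNIV \<times> UNIV)"
      if "i \<in> {1..r}" for i
      using has_sum_cmult_right[OF one(2)[OF that], of "C i"] by (simp add: case_prod_unfold)
    show "?g summable_on ?T" using Tabs by (rule Infinite_Sum.abs_summable_summable)
  qed (simp add: has_sum_finite)
  have total: "(\<Sum>i=1..r. C i * (z1 ^ i / (1 - of_nat r * z1 ^ r) * (z2 ^ J i / (1 - of_nat r * z2 ^ r))))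
     = (of_nat r * (\<Sum>i=1..<r. z1 ^ i * z2 ^ (r - i)) + of_nat r ^ 2 * z1 ^ r * z2 ^ r) / D"
  proof -
    have "(\<Sum>i=1..r. C i * (z1 ^ i / (1 - of_nat r * z1 ^ r) * (z2 ^ J i / (1 - of_nat r * z2 ^ r)))) = (\<Sum>i=1..r. C i * (z1 ^ i * z2 ^ J i) / D)"
      by (simp add: D_def)
    also have "\<dots> = (\<Sum>i=1..<r. C i * (z1 ^ i * z2 ^ J i) / D) + C r * (z1 ^ r * z2 ^ J r) / D"
    proof -
      have "{1..r} = insert r {1..<r}" using r by auto
      then show ?thesis by simp
    qed
    also have "(\<Sum>i=1..<r. C i * (z1 ^ i * z2 ^ J i) / D) = (\<Sum>i=1..<r. of_nat r * (z1 ^ i * z2 ^ (r - i)) / D)"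
      by (intro sum.cong refl) (auto simp: C_def J_def)
    finally show ?thesis by (simp add: C_def J_def sum_divide_distrib[symmetric] sum_distrib_left[symmetric] add_divide_distrib)
  qed
  define \<phi> where "\<phi> = (\<lambda>(i, k, l). (i + r * k, J i + r * l))"
  have bij: "bij_betw \<phi> ?T ?P"
  proof (rule bij_betw_byWitness[where f'="\<lambda>(p, q). ((p - 1) mod r + 1, (p - 1) div r, (q - 1) div r)"])
    have dm: "(i + r * k - 1) mod r + 1 = i" "(i + r * k - 1) div r = k" if "i \<in> {1..r}" for i k
    proof -
      from that obtain i' where "i = Suc i'" "i' < r" by (cases i) auto
      then show "(i + r * k - 1) mod r + 1 = i" "(i + r * k - 1) div r = k" by simp_all
    qed
    show "\<forall>u\<in>?T. (case \<phi> u of (p, q) \<Rightarrow> ((p - 1) mod r + 1, (p - 1) div r, (q - 1) div r)) = u"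
      using dm J by (auto simp: \<phi>_def)
    show "\<phi> ` ?T \<subseteq> ?P"
    proof
      fix u assume "u \<in> \<phi> ` ?T"
      then obtain i k l where i: "i \<in> {1..r}" and u: "u = (i + r * k, J i + r * l)" by (auto simp: \<phi>_def)
      have "r dvd i + J i" using i by (auto simp: J_def)
      moreover have e: "(i + r * k) + (J i + r * l) = (i + J i) + r * (k + l)" by (simp add: algebra_simps)
      ultimately have "r dvd (i + r * k) + (J i + r * l)" unfolding e by (metis dvd_add dvd_triv_left)
      then show "u \<in> ?P" using i J[OF i] u by simp
    qed
    show "(\<lambda>(p, q). ((p - 1) mod r + 1, (p - 1) div r, (q - 1) div r)) ` ?P \<subseteq> ?T"
    proof
      fix u assume "u \<in> (\<lambda>(p, q). ((p - 1) mod r + 1, (p - 1) div r, (q - 1) div r)) ` ?P"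
      then obtain p q :: nat where "u = ((p - 1) mod r + 1, (p - 1) div r, (q - 1) div r)" by auto
      then show "u \<in> ?T" using r by (simp add: Suc_le_eq)
    qed
    show "\<forall>v\<in>?P. \<phi> (case v of (p, q) \<Rightarrow> ((p - 1) mod r + 1, (p - 1) div r, (q - 1) div r)) = v"
    proof
      fix v assume "v \<in> ?P"
      then obtain p q where v: "v = (p, q)" "1 \<le> p" "1 \<le> q" "r dvd p + q" by auto
      define i j where "i = (p - 1) mod r + 1" and "j = (q - 1) mod r + 1"
      have ij: "1 \<le> i" "i \<le> r" "1 \<le> j" "j \<le> r"
        using mod_less_divisor[OF r, of "p - 1"] mod_less_divisor[OF r, of "q - 1"] by (auto simp: i_def j_def Suc_le_eq)
      have p: "p = i + r * ((p - 1) div r)" and q: "q = j + r * ((q - 1) div r)"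
        using mod_mult_div_eq[of "p - 1" r] mod_mult_div_eq[of "q - 1" r] v by (auto simp: i_def j_def)
      have "p + q = (i + j) + r * ((p - 1) div r + (q - 1) div r)"
        using p q by (simp add: algebra_simps)
      then have "r dvd i + j" using v(4) by (metis dvd_add_times_triv_right_iff mult.commute)
      then obtain e where e: "i + j = r * e" by auto
      have "e \<noteq> 0" using e ij by (intro notI) simp
      moreover have "e \<le> 2"
      proof (rule ccontr)
        assume "\<not> e \<le> 2"
        then have "r * 3 \<le> r * e" by simp
        with e ij r show False by linarith
      qed
      ultimately have "e = 1 \<or> e = 2" by auto
      then have "j = J i" using e ij r by (auto simp: J_def)
      then show "\<phi> (case v of (p, q) \<Rightarrow> ((p - 1) mod r + 1, (p - 1) div r, (q - 1) div r)) = v"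
        using p q v(1) by (simp add: \<phi>_def i_def)
    qed
  qed
  have coeff: "?t (\<phi> u) = ?g u" if "u \<in> ?T" for u
  proof -
    from that obtain i k l where u: "u = (i, k, l)" and i: "i \<in> {1..r}" by (cases u) auto
    have d: "(of_real (dpow m (real n)) :: complex) = of_nat n ^ m / fact m" for m n
      by (simp add: dpow_def)
    have in_P: "r dvd (i + r * k) + (J i + r * l)"
      using bij_betw_apply[OF bij that] by (simp add: u \<phi>_def)
    have k: "(i + r * k - 1) div r = k"
    proof -
      have "i + r * k - 1 = (i - 1) + r * k" "i - 1 < r" using i r by auto
      then show ?thesis by simp
    qed
    have l: "of_nat r * of_real (dpow ((J i + r * l) div r) (real (J i + r * l))) * x2 ^ (J i + r * l) = C i * a x2 (J i) l"
    proof (cases "i < r")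
      case True
      have "(r - i + r * l) div r = l" by (rule div_nat_eqI) (use True i r in auto)
      with True have "(J i + r * l) div r = l" by (simp add: J_def)
      then show ?thesis using True unfolding d a_def C_def by simp
    next
      case False
      then have Ji: "J i = r" by (simp add: J_def)
      then have "(J i + r * l) div r = Suc l" using r by simp
      moreover have "(of_nat (r + r * l) :: complex) ^ Suc l / fact (Suc l) = of_nat r * (of_nat (r + r * l) ^ l / fact l)"
      proof -
        have "(of_nat (r + r * l) :: complex) = of_nat r * of_nat (Suc l)" by (simp add: algebra_simps)
        then show ?thesis by (simp add: fact_Suc del: of_nat_Suc of_nat_add)
      qed
      ultimately show ?thesis using False unfolding d a_def C_def Ji by (simp add: power2_eq_square)
    qed
    have "?t (\<phi> u) = of_real (dpow k (real (i + r * k))) * x1 ^ (i + r * k) *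
       (of_nat r * of_real (dpow ((J i + r * l) div r) (real (J i + r * l))) * x2 ^ (J i + r * l))"
      using in_P k by (simp add: u \<phi>_def radial_annulus_coeff_def)
    then show ?thesis unfolding l unfolding d by (simp only: u prod.case a_def mult_ac)
  qed
  have Tabs': "(\<lambda>u. norm (?t (\<phi> u))) summable_on ?T"
    using Tabs coeff by (subst summable_on_cong[where g="\<lambda>u. norm (?g u)"]) auto
  have Tsum': "((\<lambda>u. ?t (\<phi> u)) has_sum (\<Sum>i=1..r. C i * (z1 ^ i / (1 - of_nat r * z1 ^ r) * (z2 ^ J i / (1 - of_nat r * z2 ^ r))))) ?T"
    using Tsum coeff by (subst has_sum_cong[where g="?g"]) auto
  have zero: "?t u = 0" if "u \<in> {1..} \<times> {1..} - ?P" for u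
    using that by (auto simp: radial_annulus_coeff_def split: if_splits)
  have "(\<lambda>u. norm (?t u)) summable_on ?P"
    using Tabs' summable_on_reindex_bij_betw[OF bij, of "\<lambda>u. norm (?t u)"] by simp
  then show "(\<lambda>u. norm (?t u)) summable_on {1..} \<times> {1..}"
    by (subst summable_on_cong_neutral[where T="?P" and g="\<lambda>u. norm (?t u)"]) (use zero in auto)
  have "(?t has_sum (\<Sum>i=1..r. C i * (z1 ^ i / (1 - of_nat r * z1 ^ r) * (z2 ^ J i / (1 - of_nat r * z2 ^ r))))) ?P"
    using Tsum' has_sum_reindex_bij_betw[OF bij, of ?t] by simp
  then have "(?t has_sum (\<Sum>i=1..r. C i * (z1 ^ i / (1 - of_nat r * z1 ^ r) * (z2 ^ J i / (1 - of_nat r * z2 ^ r))))) ({1..} \<times> {1..})"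
    by (subst has_sum_cong_neutral[where T="?P" and g="?t"]) (use zero in auto)
  then show "(?t has_sum
       ((of_nat r * (\<Sum>i=1..<r. z1 ^ i * z2 ^ (r - i)) + of_nat r ^ 2 * z1 ^ r * z2 ^ r)
         / ((1 - of_nat r * z1 ^ r) * (1 - of_nat r * z2 ^ r)))) ({1..} \<times> {1..})"
    unfolding total D_def .
qed

section \<open>The logarithm as the sum of the annulus series\<close>

text \<open>A multivariate power series restricted to a ray is a power series in the parameter \<open>t\<close> of the ray; the Euler operator becomes
\<open>t d/dt\<close>.\<close>

lemma radial_derivative:
  fixes f :: "'a \<Rightarrow> complex" and h :: "'a \<Rightarrow> nat"
  assumes fin: "\<And>n. finite {x\<in>A. h x = n}"
    and \<Phi>: "\<And>t. norm t < R \<Longrightarrow> ((\<lambda>x. f x * t ^ h x) has_sum \<Phi> t) A"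
    and W: "\<And>t. norm t < R \<Longrightarrow> ((\<lambda>x. of_nat (h x) * f x * t ^ h x) has_sum W t) A"
    and t: "norm t < R"
  shows "\<exists>D. (\<Phi> has_field_derivative D) (at t) \<and> t * D = W t"
proof -
  define c where "c n = (\<Sum>x | x \<in> A \<and> h x = n. f x)" for n
  have s1: "(\<lambda>n. c n * t ^ n) sums \<Phi> t" if "norm t < R" for t
  proof -
    have "(\<lambda>n. \<Sum>x | x \<in> A \<and> h x = n. f x * t ^ h x) sums \<Phi> t"
      using has_sum_by_fibers[OF \<Phi>[OF that] fin] by (rule has_sum_imp_sums)
    also have "(\<lambda>n. \<Sum>x | x \<in> A \<and> h x = n. f x * t ^ h x) = (\<lambda>n. c n * t ^ n)"
      unfolding c_def sum_distrib_right by (intro ext sum.cong) auto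
    finally show ?thesis .
  qed
  have s2: "(\<lambda>n. of_nat n * c n * t ^ n) sums W t"
  proof -
    have "(\<lambda>n. \<Sum>x | x \<in> A \<and> h x = n. of_nat (h x) * f x * t ^ h x) sums W t"
      using has_sum_by_fibers[OF W[OF t] fin] by (rule has_sum_imp_sums)
    also have "(\<lambda>n. \<Sum>x | x \<in> A \<and> h x = n. of_nat (h x) * f x * t ^ h x) = (\<lambda>n. of_nat n * c n * t ^ n)"
      unfolding c_def sum_distrib_right sum_distrib_left by (intro ext sum.cong) auto
    finally show ?thesis .
  qed
  have "((\<lambda>t. \<Sum>n. c n * t ^ n) has_field_derivative (\<Sum>n. diffs c n * t ^ n)) (at t)"
    by (rule termdiffs_strong'[OF _ t]) (use s1 sums_summable in blast)
  then have 1: "(\<Phi> has_field_derivative (\<Sum>n. diffs c n * t ^ n)) (at t)"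
    by (rule has_field_derivative_transform_within_open[where S="ball 0 R"]) (use t s1 in \<open>auto simp: sums_iff\<close>)
  have summ: "summable (\<lambda>n. diffs c n * t ^ n)"
    by (rule termdiff_converges[OF t]) (use s1 sums_summable in blast)
  have "(\<lambda>n. of_nat (Suc n) * c (Suc n) * t ^ Suc n) sums W t"
    using s2 by (subst sums_Suc_iff) simp
  moreover have "(\<lambda>n. t * (diffs c n * t ^ n)) sums (t * (\<Sum>n. diffs c n * t ^ n))"
    using summ by (intro sums_mult summable_sums)
  moreover have "(\<lambda>n. t * (diffs c n * t ^ n)) = (\<lambda>n. of_nat (Suc n) * c (Suc n) * t ^ Suc n)"
    by (simp add: diffs_def mult_ac)
  ultimately have "t * (\<Sum>n. diffs c n * t ^ n) = W t" by (metis sums_unique2)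
  with 1 show ?thesis by blast
qed

lemma lambert_x_deriv:
  "r > 0 \<Longrightarrow> (lambert_x r has_field_derivative (1 - of_nat r * z ^ r) * exp (- (z ^ r))) (at z)"
proof (cases r)
  case (Suc n)
  have "(lambert_x r has_field_derivative exp (- (z ^ r)) + z * (exp (- (z ^ r)) * - (of_nat r * z ^ (r - 1)))) (at z)"
    unfolding lambert_x_def[abs_def] by (auto intro!: derivative_eq_intros simp: algebra_simps)
  also have "exp (- (z ^ r)) + z * (exp (- (z ^ r)) * - (of_nat r * z ^ (r - 1))) = (1 - of_nat r * z ^ r) * exp (- (z ^ r))"
    by (simp add: Suc algebra_simps)
  finally show ?thesis .
qed simp

text \<open>The bounds on \<open>\<rho>\<close> and \<open>z\<^sup>r\<close> make the series above converge. The Lipschitz bound and the bound on the derivative keep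
\<open>(x(z\<^sub>1) - x(z\<^sub>2)) / (z\<^sub>1 - z\<^sub>2)\<close> and its limit on the diagonal so close to 1 that the principal logarithm is differentiable
there.\<close>

lemma lambert_x_local_inverse:
  assumes r: "r > 0"
  obtains \<delta> \<rho> g where "0 < \<delta>" "0 < \<rho>" "\<rho> \<le> 1 / (3 * real r)"
    and "\<And>z :: complex. norm z < \<delta> \<Longrightarrow> norm (z ^ r) < 1 / (18 * real r)"
    and "\<And>z w. norm z < \<delta> \<Longrightarrow> norm w < \<delta> \<Longrightarrow> norm (lambert_x r z - lambert_x r w - (z - w)) \<le> norm (z - w) / 2"
    and "\<And>z :: complex. norm z < \<delta> \<Longrightarrow> norm ((1 - of_nat r * z ^ r) * exp (- (z ^ r)) - 1) \<le> 1 / 2"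
    and "\<And>x. norm x < \<rho> \<Longrightarrow> norm (g x) < \<delta> \<and> lambert_x r (g x) = x"
    and "\<And>z. norm z < \<delta> \<Longrightarrow> g (lambert_x r z) = z"
    and "\<And>x. norm x < \<rho> \<Longrightarrow>
       (g has_field_derivative inverse ((1 - of_nat r * g x ^ r) * exp (- (g x ^ r)))) (at x)"
proof -
  define f' where "f' z = (1 - of_nat r * z ^ r) * exp (- (z ^ r))" for z :: complex
  have f: "(lambert_x r has_field_derivative f' z) (at z)" for z
    unfolding f'_def using r by (rule lambert_x_deriv)
  have "isCont f' 0" unfolding f'_def by (intro continuous_intros)
  moreover have "f' 0 = 1" by (simp add: f'_def zero_power[OF r])
  ultimately obtain d where d: "d > 0" "\<And>z. norm z < d \<Longrightarrow> norm (f' z - 1) < 1 / 2"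
    unfolding continuous_at_eps_delta by (metis dist_norm diff_zero half_gt_zero_iff zero_less_one)
  define \<delta> where "\<delta> = min d (1 / (18 * real r))"
  have \<delta>: "\<delta> > 0" "\<And>z. norm z < \<delta> \<Longrightarrow> norm (f' z - 1) \<le> 1 / 2"
    using d r by (auto simp: \<delta>_def intro: less_imp_le)
  have lip: "norm (lambert_x r z - lambert_x r w - (z - w)) \<le> norm (z - w) / 2" if "norm z < \<delta>" "norm w < \<delta>" for z w
  proof -
    have "norm ((lambert_x r z - z) - (lambert_x r w - w)) \<le> 1 / 2 * norm (z - w)"
    proof (rule field_differentiable_bound[of "ball 0 \<delta>" _ "\<lambda>z. f' z - 1"])
      show "((\<lambda>z. lambert_x r z - z) has_field_derivative f' z - 1) (at z within ball 0 \<delta>)" for z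
        using f[of z] by (auto intro!: derivative_eq_intros intro: has_field_derivative_at_within)
    qed (use that \<delta> in auto)
    then show ?thesis by (simp add: algebra_simps)
  qed
  have inj: "inj_on (lambert_x r) (ball 0 \<delta>)"
  proof (rule inj_onI)
    fix z w assume zw: "z \<in> ball 0 \<delta>" "w \<in> ball 0 \<delta>" "lambert_x r z = lambert_x r w"
    then have "norm (z - w) \<le> norm (z - w) / 2" using lip[of z w] by (simp add: norm_minus_commute)
    then show "z = w" by simp
  qed
  have hol: "lambert_x r holomorphic_on ball 0 \<delta>"
    using f by (auto simp: holomorphic_on_open)
  obtain g where g: "g holomorphic_on (lambert_x r ` ball 0 \<delta>)"
      "\<And>z. z \<in> ball 0 \<delta> \<Longrightarrow> deriv (lambert_x r) z * deriv g (lambert_x r z) = 1"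
      "\<And>z. z \<in> ball 0 \<delta> \<Longrightarrow> g (lambert_x r z) = z"
    using holomorphic_has_inverse[OF hol _ inj] by auto
  have op: "open (lambert_x r ` ball 0 \<delta>)"
    using open_mapping_thm3[OF hol _ inj] by simp
  have "0 \<in> lambert_x r ` ball 0 \<delta>"
    using \<delta> by (intro image_eqI[of _ _ 0]) (auto simp: lambert_x_def)
  then obtain \<rho>' where \<rho>': "\<rho>' > 0" "ball 0 \<rho>' \<subseteq> lambert_x r ` ball 0 \<delta>"
    using op open_contains_ball by blast
  define \<rho> where "\<rho> = min \<rho>' (1 / (3 * real r))"
  have inv: "norm (g x) < \<delta> \<and> lambert_x r (g x) = x" if "norm x < \<rho>" for x
  proof -
    have "x \<in> ball 0 \<rho>'" using that by (simp add: \<rho>_def)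
    then obtain z where "z \<in> ball 0 \<delta>" "x = lambert_x r z" using \<rho>'(2) by blast
    then show ?thesis using g(3) by simp
  qed
  show ?thesis
  proof (rule that)
    show "0 < \<delta>" "0 < \<rho>" "\<rho> \<le> 1 / (3 * real r)" using \<delta> \<rho>' r by (auto simp: \<rho>_def)
    show "norm (z ^ r) < 1 / (18 * real r)" if "norm z < \<delta>" for z :: complex
    proof -
      have "norm z < 1 / (18 * real r)" using that by (simp add: \<delta>_def)
      moreover have "1 / (18 * real r) \<le> 1" using r by (simp add: field_simps)
      ultimately have "norm z \<le> 1" by linarith
      then have "norm z ^ r \<le> norm z ^ 1" using r by (intro power_decreasing) auto
      then show ?thesis using \<open>norm z < 1 / (18 * real r)\<close> by (simp add: norm_power)
    qed
    show "norm ((1 - of_nat r * z ^ r) * exp (- (z ^ r)) - 1) \<le> 1 / 2" if "norm z < \<delta>" for z :: complex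
      using \<delta>(2)[OF that] by (simp add: f'_def)
    show "(g has_field_derivative inverse ((1 - of_nat r * g x ^ r) * exp (- (g x ^ r)))) (at x)" if "norm x < \<rho>" for x
    proof -
      have x: "g x \<in> ball 0 \<delta>" "lambert_x r (g x) = x" using inv[OF that] by auto
      then have "x \<in> lambert_x r ` ball 0 \<delta>" by force
      then have "(g has_field_derivative deriv g x) (at x)"
        using g(1) op by (simp add: holomorphic_derivI)
      moreover have "f' (g x) * deriv g x = 1" using g(2)[OF x(1)] x(2) DERIV_imp_deriv[OF f] by simp
      ultimately show ?thesis unfolding f'_def by (metis inverse_unique)
    qed
  qed (use lip inv g(3) in auto)
qed

lemma nonzero_if_close_to_1: "norm (w - 1) \<le> 1 / 2 \<Longrightarrow> w \<noteq> (0::complex) \<and> w \<notin> \<real>\<^sub>\<le>\<^sub>0"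
proof -
  assume "norm (w - 1) \<le> 1 / 2"
  then have "\<bar>Re w - 1\<bar> \<le> 1 / 2" using abs_Re_le_cmod[of "w - 1"] by simp
  then have "Re w > 0" by linarith
  then show ?thesis by (auto simp: complex_nonpos_Reals_iff)
qed

lemma radial_identity_off_diagonal:
  fixes z1 z2 :: complex
  assumes "r > 0"
  shows "(\<Sum>i=1..<r. z1 ^ i * z2 ^ (r - i)) * (z1 - z2) = z1 ^ r * z2 - z1 * z2 ^ r"
proof -
  have "z1 ^ r * z2 - z1 * z2 ^ r = z1 * z2 * (z1 ^ (r - 1) - z2 ^ (r - 1))"
    using assms by (cases r) (simp_all add: algebra_simps)
  also have "z1 ^ (r - 1) - z2 ^ (r - 1) = (z1 - z2) * (\<Sum>i<r - 1. z2 ^ (r - 1 - Suc i) * z1 ^ i)"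
    by (rule power_diff_sumr2)
  also have "z1 * z2 * ((z1 - z2) * (\<Sum>i<r - 1. z2 ^ (r - 1 - Suc i) * z1 ^ i)) = (z1 - z2) * (\<Sum>i<r - 1. z1 ^ Suc i * z2 ^ Suc (r - 1 - Suc i))"
    by (simp add: sum_distrib_left mult_ac)
  also have "(\<Sum>i<r - 1. z1 ^ Suc i * z2 ^ Suc (r - 1 - Suc i)) = (\<Sum>i=1..<r. z1 ^ i * z2 ^ (r - i))"
    by (rule sum.reindex_bij_witness[of _ "\<lambda>i. i - 1" Suc]) (auto simp: Suc_diff_Suc)
  finally show ?thesis by (simp add: mult_ac)
qed

text \<open>Both sides are compared along the ray \<open>t \<mapsto> (t x\<^sub>1, t x\<^sub>2)\<close>: they vanish at \<open>t = 0\<close>, and \<open>t d/dt\<close> yields the same function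
for both. Along the ray, \<open>\<zeta>\<^sub>i(t)\<close> with \<open>x(\<zeta>\<^sub>i(t)) = t x\<^sub>i\<close> satisfies \<open>t \<zeta>\<^sub>i' = \<zeta>\<^sub>i / (1 - r \<zeta>\<^sub>i\<^sup>r)\<close>, from which the derivative of the
logarithm is computed. On the diagonal, the quotient is the reciprocal of a derivative and is treated separately.\<close>

lemma annulus_series_closed_form:
  assumes r: "r > 0"
  obtains \<epsilon> where "\<epsilon> > 0"
    "\<And>z1 z2 :: complex. norm z1 < \<epsilon> \<Longrightarrow> norm z2 < \<epsilon> \<Longrightarrow>
      ((\<lambda>(p, q). of_real (radial_annulus_coeff r p q) / of_nat (p + q) * lambert_x r z1 ^ p * lambert_x r z2 ^ q)
        has_sum (Ln (inv_diff_quotient r z1 z2) - (z1 ^ r + z2 ^ r))) ({1..} \<times> {1..})"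
proof -
  obtain \<delta> \<rho> g where \<delta>\<rho>: "0 < \<delta>" "0 < \<rho>" "\<rho> \<le> 1 / (3 * real r)"
    and small: "\<And>z :: complex. norm z < \<delta> \<Longrightarrow> norm (z ^ r) < 1 / (18 * real r)"
    and lip: "\<And>z w. norm z < \<delta> \<Longrightarrow> norm w < \<delta> \<Longrightarrow> norm (lambert_x r z - lambert_x r w - (z - w)) \<le> norm (z - w) / 2"
    and der1: "\<And>z :: complex. norm z < \<delta> \<Longrightarrow> norm ((1 - of_nat r * z ^ r) * exp (- (z ^ r)) - 1) \<le> 1 / 2"
    and g: "\<And>x. norm x < \<rho> \<Longrightarrow> norm (g x) < \<delta> \<and> lambert_x r (g x) = x"
    and g': "\<And>z. norm z < \<delta> \<Longrightarrow> g (lambert_x r z) = z"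
    and gd: "\<And>x. norm x < \<rho> \<Longrightarrow>
       (g has_field_derivative inverse ((1 - of_nat r * g x ^ r) * exp (- (g x ^ r)))) (at x)"
    by (rule lambert_x_local_inverse[OF r]) (rule that)
  have "isCont (lambert_x r) 0" using DERIV_isCont[OF lambert_x_deriv[OF r]] .
  then obtain d where "d > 0" "\<forall>z. norm (z - 0) < d \<longrightarrow> norm (lambert_x r z - lambert_x r 0) < \<rho> / 2"
    using half_gt_zero[OF \<delta>\<rho>(2)] unfolding continuous_at_eps_delta dist_norm by blast
  then have d: "d > 0" "\<And>z. norm z < d \<Longrightarrow> norm (lambert_x r z) < \<rho> / 2"
    by (auto simp: lambert_x_def)
  show ?thesis
  proof (rule that)
    show "min d \<delta> > 0" using d \<delta>\<rho> by simp
    fix z1 z2 :: complex assume z1: "norm z1 < min d \<delta>" and z2: "norm z2 < min d \<delta>"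
    define x1 x2 where "x1 = lambert_x r z1" and "x2 = lambert_x r z2"
    define \<zeta>1 \<zeta>2 where "\<zeta>1 t = g (t * x1)" and "\<zeta>2 t = g (t * x2)" for t
    define D where "D x t = x * inverse ((1 - of_nat r * g (t * x) ^ r) * exp (- (g (t * x) ^ r)))" for x t
    have xb: "norm x1 < \<rho> / 2" "norm x2 < \<rho> / 2" using d(2) z1 z2 by (simp_all add: x1_def x2_def)
    have tx: "norm (t * x) < \<rho>" if "norm t < 2" "norm x < \<rho> / 2" for t x :: complex
    proof -
      have "norm t * norm x \<le> 2 * norm x" using that by (intro mult_right_mono) auto
      then show ?thesis using that by (simp add: norm_mult)
    qed
    have conv: "real r * exp 1 * norm x ^ r < 1" if "norm x < \<rho>" for x :: complex
    proof -
      have x: "norm x < 1 / (3 * real r)" using that \<delta>\<rho>(3) by linarith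
      moreover have "1 / (3 * real r) \<le> 1" using r by (simp add: field_simps)
      ultimately have "norm x \<le> 1" by linarith
      then have "norm x ^ r \<le> norm x ^ 1" using r by (intro power_decreasing) auto
      then have "real r * exp 1 * norm x ^ r \<le> real r * 3 * norm x"
        by (intro mult_mono exp_le) auto
      also have "\<dots> < 1" using x r by (simp add: field_simps)
      finally show ?thesis .
    qed
    have gder: "((\<lambda>t. g (t * x)) has_field_derivative D x t) (at t)"
      and gexp: "t * D x t * (1 - of_nat r * g (t * x) ^ r) = g (t * x)"
      and ginv: "norm (g (t * x)) < \<delta>" "lambert_x r (g (t * x)) = t * x"
      and gnz: "1 - of_nat r * g (t * x) ^ r \<noteq> 0"
      if "norm t < 2" "norm x < \<rho> / 2" for t x
    proof -
      have b: "norm (t * x) < \<rho>" using tx that by blast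
      show b2: "norm (g (t * x)) < \<delta>" "lambert_x r (g (t * x)) = t * x" using g[OF b] by auto
      show "((\<lambda>t. g (t * x)) has_field_derivative D x t) (at t)"
        unfolding D_def by (rule DERIV_cong[OF DERIV_chain2[where f=g and g="\<lambda>t. t * x", OF gd[OF b]]]) (auto intro!: derivative_eq_intros)
      have nz: "(1 - of_nat r * g (t * x) ^ r) * exp (- (g (t * x) ^ r)) \<noteq> 0"
        using nonzero_if_close_to_1[OF der1[OF b2(1)]] by blast
      then show nz': "1 - of_nat r * g (t * x) ^ r \<noteq> 0" by auto
      have "t * D x t * (1 - of_nat r * g (t * x) ^ r) = (t * x) / exp (- (g (t * x) ^ r))"
        using nz' by (simp add: D_def field_simps)
      also have "\<dots> = g (t * x)"
      proof -
        have "t * x = g (t * x) * exp (- (g (t * x) ^ r))" using b2(2) by (simp add: lambert_x_def)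
        then show ?thesis by (metis exp_not_eq_zero nonzero_mult_div_cancel_right)
      qed
      finally show "t * D x t * (1 - of_nat r * g (t * x) ^ r) = g (t * x)" .
    qed
    define f where "f = (\<lambda>(p, q). of_real (radial_annulus_coeff r p q) / of_nat (p + q) * x1 ^ p * x2 ^ q)"
    define A :: "(nat \<times> nat) set" where "A = {1..} \<times> {1..}"
    define h :: "nat \<times> nat \<Rightarrow> nat" where "h = (\<lambda>(p, q). p + q)"
    define W where "W t = ((of_nat r * (\<Sum>i=1..<r. \<zeta>1 t ^ i * \<zeta>2 t ^ (r - i)) + of_nat r ^ 2 * \<zeta>1 t ^ r * \<zeta>2 t ^ r)
         / ((1 - of_nat r * \<zeta>1 t ^ r) * (1 - of_nat r * \<zeta>2 t ^ r)))" for t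
    define \<Phi> where "\<Phi> t = infsum (\<lambda>u. f u * t ^ h u) A" for t
    have eulerian: "of_nat (h u) * f u * t ^ h u = (case u of (p, q) \<Rightarrow> of_real (radial_annulus_coeff r p q) * (t * x1) ^ p * (t * x2) ^ q)"
      if "u \<in> A" for u t
      using that by (auto simp: h_def f_def A_def power_add power_mult_distrib simp del: of_nat_add)
    have series: "(\<lambda>u. norm (of_nat (h u) * f u * t ^ h u)) summable_on A" "((\<lambda>u. of_nat (h u) * f u * t ^ h u) has_sum W t) A"
      if t: "norm t < 2" for t
    proof -
      note * = radial_annulus_series[OF r small small conv conv, of "\<zeta>1 t" "\<zeta>2 t" "t * x1" "t * x2"]
      have c: "norm (\<zeta>1 t) < \<delta>" "norm (\<zeta>2 t) < \<delta>" "norm (t * x1) < \<rho>" "norm (t * x2) < \<rho>"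
        "t * x1 = lambert_x r (\<zeta>1 t)" "t * x2 = lambert_x r (\<zeta>2 t)"
        unfolding \<zeta>1_def \<zeta>2_def using ginv[OF t xb(1)] ginv[OF t xb(2)] tx[OF t xb(1)] tx[OF t xb(2)] by simp_all
      show "(\<lambda>u. norm (of_nat (h u) * f u * t ^ h u)) summable_on A"
        using *(1)[OF c] eulerian unfolding A_def by (subst summable_on_cong) auto
      show "((\<lambda>u. of_nat (h u) * f u * t ^ h u) has_sum W t) A"
        using *(2)[OF c] eulerian unfolding A_def W_def by (subst has_sum_cong) auto
    qed
    have \<Phi>: "((\<lambda>u. f u * t ^ h u) has_sum \<Phi> t) A" if t: "norm t < 2" for t
    proof -
      have "(\<lambda>u. norm (f u * t ^ h u)) summable_on A"
      proof (rule Infinite_Sum.abs_summable_on_comparison_test'[OF series(1)[OF t]])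
        fix u assume "u \<in> A"
        then have "1 \<le> real (h u)" by (auto simp: A_def h_def)
        then have "1 * norm (f u * t ^ h u) \<le> real (h u) * norm (f u * t ^ h u)" by (intro mult_right_mono) auto
        then show "norm (f u * t ^ h u) \<le> norm (of_nat (h u) * f u * t ^ h u)" by (simp add: norm_mult mult.assoc)
      qed
      then have "(\<lambda>u. f u * t ^ h u) summable_on A" by (rule Infinite_Sum.abs_summable_summable)
      then show ?thesis unfolding \<Phi>_def by (rule has_sum_infsum)
    qed
    have fin: "finite {u \<in> A. h u = n}" for n
      by (rule finite_subset[of _ "{..n} \<times> {..n}"]) (auto simp: A_def h_def)
    have \<Phi>deriv: "\<exists>D. (\<Phi> has_field_derivative D) (at t) \<and> t * D = W t" if "norm t < 2" for t
    proof (rule radial_derivative[where A=A and h=h and R=2 and f=f])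
      show "finite {u \<in> A. h u = n}" for n by (rule fin)
      show "((\<lambda>u. f u * t ^ h u) has_sum \<Phi> t) A" if "norm t < 2" for t using \<Phi>[OF that] .
      show "((\<lambda>u. of_nat (h u) * f u * t ^ h u) has_sum W t) A" if "norm t < 2" for t using series(2)[OF that] .
    qed fact
    \<comment> \<open>\<open>E\<close> is the closed form at the point of the ray with parameter \<open>t\<close>. The disc of radius 2 contains the segment from
      0 to 1 in its interior.\<close>
    define Q where "Q t = (if z1 = z2 then inverse ((1 - of_nat r * \<zeta>1 t ^ r) * exp (- (\<zeta>1 t ^ r)))
        else (\<zeta>1 t - \<zeta>2 t) / (t * (x1 - x2)))" for t
    define E where "E t = (if t = 0 then 0 else Ln (Q t) - (\<zeta>1 t ^ r + \<zeta>2 t ^ r))" for t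
    have g0: "g 0 = 0" using g'[of 0] \<delta>\<rho> r by (simp add: lambert_x_def)
    have x_neq: "x1 \<noteq> x2" if "z1 \<noteq> z2"
    proof
      assume "x1 = x2"
      then have "g x1 = g x2" by simp
      then show False using g' z1 z2 that by (simp add: x1_def x2_def)
    qed
    have \<zeta>_neq: "\<zeta>1 t \<noteq> \<zeta>2 t" if "z1 \<noteq> z2" "t \<noteq> 0" "norm t < 2" for t
    proof
      assume "\<zeta>1 t = \<zeta>2 t"
      then have "t * x1 = t * x2" using ginv(2)[OF that(3) xb(1)] ginv(2)[OF that(3) xb(2)] unfolding \<zeta>1_def \<zeta>2_def by metis
      then show False using that x_neq by simp
    qed
    have Qgood: "Q t \<noteq> 0 \<and> Q t \<notin> \<real>\<^sub>\<le>\<^sub>0" if t: "t \<noteq> 0" "norm t < 2" for t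
    proof -
      have b: "norm (\<zeta>1 t) < \<delta>" "norm (\<zeta>2 t) < \<delta>"
        unfolding \<zeta>1_def \<zeta>2_def using ginv(1) t(2) xb by blast+
      have "norm (inverse (Q t) - 1) \<le> 1 / 2"
      proof (cases "z1 = z2")
        case True
        then show ?thesis using der1[OF b(1)] by (simp add: Q_def)
      next
        case False
        have ne: "\<zeta>1 t - \<zeta>2 t \<noteq> 0" using \<zeta>_neq False t by simp
        have "lambert_x r (\<zeta>1 t) - lambert_x r (\<zeta>2 t) = t * (x1 - x2)"
          unfolding \<zeta>1_def \<zeta>2_def using ginv(2) t(2) xb by (simp add: algebra_simps)
        then have "norm (t * (x1 - x2) - (\<zeta>1 t - \<zeta>2 t)) \<le> norm (\<zeta>1 t - \<zeta>2 t) / 2"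
          using lip[OF b] by simp
        moreover have e: "inverse (Q t) - 1 = (t * (x1 - x2) - (\<zeta>1 t - \<zeta>2 t)) / (\<zeta>1 t - \<zeta>2 t)"
          using False ne by (simp add: Q_def field_simps)
        ultimately show ?thesis unfolding e norm_divide using ne by (simp add: divide_simps)
      qed
      from nonzero_if_close_to_1[OF this] show ?thesis
        by (metis inverse_zero nonpos_Reals_inverse_iff)
    qed
    have Ederiv: "\<exists>D. (E has_field_derivative D) (at t) \<and> t * D = W t" if t: "t \<noteq> 0" "norm t < 2" for t
    proof -
      define a b where "a = D x1 t" and "b = D x2 t"
      have d1: "(\<zeta>1 has_field_derivative a) (at t)" and d2: "(\<zeta>2 has_field_derivative b) (at t)"
        using gder[OF t(2) xb(1)] gder[OF t(2) xb(2)] by (simp_all add: \<zeta>1_def[abs_def] \<zeta>2_def[abs_def] a_def b_def)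
      have e1: "t * a * (1 - of_nat r * \<zeta>1 t ^ r) = \<zeta>1 t" and e2: "t * b * (1 - of_nat r * \<zeta>2 t ^ r) = \<zeta>2 t"
        and n1: "1 - of_nat r * \<zeta>1 t ^ r \<noteq> 0" and n2: "1 - of_nat r * \<zeta>2 t ^ r \<noteq> 0"
        unfolding a_def b_def \<zeta>1_def \<zeta>2_def using gexp gnz t(2) xb by blast+
      define y1 y2 where "y1 = \<zeta>1 t ^ r" and "y2 = \<zeta>2 t ^ r"
      have p1: "((\<lambda>t. \<zeta>1 t ^ r) has_field_derivative of_nat r * (a * \<zeta>1 t ^ (r - 1))) (at t)"
        and p2: "((\<lambda>t. \<zeta>2 t ^ r) has_field_derivative of_nat r * (b * \<zeta>2 t ^ (r - 1))) (at t)"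
        using DERIV_power[OF d1, of r] DERIV_power[OF d2, of r] by (simp_all add: mult_ac)
      have ta: "t * a = \<zeta>1 t / (1 - of_nat r * y1)" and tb: "t * b = \<zeta>2 t / (1 - of_nat r * y2)"
        using e1 e2 n1 n2 by (simp_all add: y1_def y2_def eq_divide_eq)
      have py: "\<zeta>1 t * \<zeta>1 t ^ (r - 1) = y1" "\<zeta>2 t * \<zeta>2 t ^ (r - 1) = y2"
        using r by (simp_all add: y1_def y2_def flip: power_Suc)
      have tp1: "t * (of_nat r * (a * \<zeta>1 t ^ (r - 1))) = of_nat r * y1 / (1 - of_nat r * y1)"
      proof -
        have "t * (of_nat r * (a * \<zeta>1 t ^ (r - 1))) = of_nat r * ((t * a) * \<zeta>1 t ^ (r - 1))" by (simp add: mult_ac)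
        then show ?thesis unfolding ta using py by simp
      qed
      have tp2: "t * (of_nat r * (b * \<zeta>2 t ^ (r - 1))) = of_nat r * y2 / (1 - of_nat r * y2)"
      proof -
        have "t * (of_nat r * (b * \<zeta>2 t ^ (r - 1))) = of_nat r * ((t * b) * \<zeta>2 t ^ (r - 1))" by (simp add: mult_ac)
        then show ?thesis unfolding tb using py by simp
      qed
      have "\<exists>L. (Q has_field_derivative Q t * L) (at t) \<and>
          t * L - (of_nat r * y1 / (1 - of_nat r * y1) + of_nat r * y2 / (1 - of_nat r * y2)) = W t"
      proof (cases "z1 = z2")
        case True
        have x12: "x1 = x2" using True by (simp add: x1_def x2_def)
        have \<zeta>12: "\<zeta>1 = \<zeta>2" by (simp add: \<zeta>1_def[abs_def] \<zeta>2_def[abs_def] x12)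
        have y12: "y1 = y2" by (simp add: y1_def y2_def \<zeta>12)
        define c where "c = of_nat r * (a * \<zeta>1 t ^ (r - 1))"
        let ?L = "of_nat r * c / (1 - of_nat r * y1) + c"
        have Qeq: "Q = (\<lambda>t. inverse (1 - of_nat r * \<zeta>1 t ^ r) * exp (\<zeta>1 t ^ r))"
          by (simp add: Q_def[abs_def] True exp_minus)
        have "(Q has_field_derivative Q t * ?L) (at t)"
          unfolding Qeq using n1 by (auto intro!: derivative_eq_intros d1 simp: c_def y1_def power2_eq_square field_simps)
        moreover have "t * ?L - (of_nat r * y1 / (1 - of_nat r * y1) + of_nat r * y2 / (1 - of_nat r * y2)) = W t"
        proof -
          have "t * ?L = of_nat r * (t * c) / (1 - of_nat r * y1) + t * c" by (simp add: algebra_simps)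
          also have "t * c = of_nat r * y1 / (1 - of_nat r * y1)" unfolding c_def by (rule tp1)
          finally have 1: "t * ?L = of_nat r * (of_nat r * y1 / (1 - of_nat r * y1)) / (1 - of_nat r * y1) + of_nat r * y1 / (1 - of_nat r * y1)" .
          have "(\<Sum>i=1..<r. \<zeta>1 t ^ i * \<zeta>2 t ^ (r - i)) = (\<Sum>i=1..<r. y1)"
            by (intro sum.cong refl) (simp add: \<zeta>12[symmetric] y1_def flip: power_add)
          also have "\<dots> = (of_nat r - 1) * y1" using r by (simp add: of_nat_diff)
          finally have 2: "W t = (of_nat r * ((of_nat r - 1) * y1) + of_nat r ^ 2 * y1 * y1) / ((1 - of_nat r * y1) * (1 - of_nat r * y1))"
            unfolding W_def by (simp add: y1_def \<zeta>12)
          have alg: "R * (R * y / d) / d + R * y / d - (R * y / d + R * y / d) = (R * ((R - 1) * y) + R ^ 2 * y * y) / (d * d)"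
            if "d = 1 - R * y" "d \<noteq> 0" for R y d :: complex
          proof -
            have "R * (R * y / d) / d + R * y / d - (R * y / d + R * y / d) = (R * R * y - R * y * d) / (d * d)"
              using that(2) by (simp add: field_simps)
            also have "R * R * y - R * y * d = R * ((R - 1) * y) + R ^ 2 * y * y"
              unfolding that(1) by (simp add: algebra_simps power2_eq_square)
            finally show ?thesis .
          qed
          show ?thesis unfolding 1 2 y12[symmetric] by (rule alg) (use n1 in \<open>simp_all add: y1_def\<close>)
        qed
        ultimately show ?thesis by blast
      next
        case False
        have ne: "\<zeta>1 t - \<zeta>2 t \<noteq> 0" using \<zeta>_neq False t by simp
        have xne: "x1 - x2 \<noteq> 0" using x_neq False by simp
        let ?L = "(a - b) / (\<zeta>1 t - \<zeta>2 t) - 1 / t"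
        have Qeq: "Q = (\<lambda>t. (\<zeta>1 t - \<zeta>2 t) / (t * (x1 - x2)))" by (simp add: Q_def[abs_def] False)
        have "(Q has_field_derivative Q t * ?L) (at t)"
        proof -
          have "(Q has_field_derivative ((a - b) * (t * (x1 - x2)) - (\<zeta>1 t - \<zeta>2 t) * (x1 - x2)) / ((t * (x1 - x2)) * (t * (x1 - x2)))) (at t)"
            unfolding Qeq
          proof (intro DERIV_divide DERIV_diff d1 d2)
            show "((\<lambda>t. t * (x1 - x2)) has_field_derivative (x1 - x2)) (at t)"
              by (auto intro!: derivative_eq_intros)
          qed (use t xne in simp)
          moreover have "(c * (t * X) - u * X) / ((t * X) * (t * X)) = u / (t * X) * (c / u - 1 / t)"
            if "u \<noteq> 0" "X \<noteq> 0" for c u X :: complex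
            using that t(1) by (simp add: field_simps)
          ultimately show ?thesis unfolding Qeq using ne xne by simp
        qed
        moreover have "t * ?L - (of_nat r * y1 / (1 - of_nat r * y1) + of_nat r * y2 / (1 - of_nat r * y2)) = W t"
        proof -
          define S where "S = (\<Sum>i=1..<r. \<zeta>1 t ^ i * \<zeta>2 t ^ (r - i))"
          have S: "S * (\<zeta>1 t - \<zeta>2 t) = y1 * \<zeta>2 t - \<zeta>1 t * y2"
            unfolding S_def y1_def y2_def using r by (rule radial_identity_off_diagonal)
          have 1: "t * ?L = (\<zeta>1 t / (1 - of_nat r * y1) - \<zeta>2 t / (1 - of_nat r * y2)) / (\<zeta>1 t - \<zeta>2 t) - 1"
            using t(1) unfolding ta[symmetric] tb[symmetric] by (simp add: algebra_simps diff_divide_distrib)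
          have 2: "W t = (of_nat r * S + of_nat r ^ 2 * y1 * y2) / ((1 - of_nat r * y1) * (1 - of_nat r * y2))"
            unfolding W_def S_def y1_def y2_def by simp
          have alg: "(u / d1 - v / d2) / (u - v) - 1 - (R * y1 / d1 + R * y2 / d2) = (R * S + R ^ 2 * y1 * y2) / (d1 * d2)"
            if "d1 = 1 - R * y1" "d2 = 1 - R * y2" "d1 \<noteq> 0" "d2 \<noteq> 0" "u - v \<noteq> 0" "S * (u - v) = y1 * v - u * y2"
            for u v R d1 d2 y1 y2 S :: complex
          proof -
            have "(u / d1 - v / d2) / (u - v) = (u * d2 - v * d1) / (u - v) / (d1 * d2)"
              using that(3-5) by (simp add: field_simps)
            also have "u * d2 - v * d1 = (1 + R * S) * (u - v)"
            proof -
              have "u * d2 - v * d1 = (u - v) + R * (y1 * v - u * y2)" unfolding that(1,2) by (simp add: algebra_simps)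
              then show ?thesis unfolding that(6)[symmetric] by (simp add: algebra_simps)
            qed
            finally have "(u / d1 - v / d2) / (u - v) = (1 + R * S) / (d1 * d2)" using that(5) by simp
            moreover have "1 + (R * y1 / d1 + R * y2 / d2) = (1 - R ^ 2 * y1 * y2) / (d1 * d2)"
            proof -
              have y: "R * y1 = 1 - d1" "R * y2 = 1 - d2" using that(1,2) by simp_all
              then have "R ^ 2 * y1 * y2 = (1 - d1) * (1 - d2)" by (simp add: power2_eq_square mult_ac flip: y)
              then show ?thesis unfolding y using that(3,4) by (simp add: field_simps)
            qed
            ultimately have "(u / d1 - v / d2) / (u - v) - 1 - (R * y1 / d1 + R * y2 / d2) = (1 + R * S) / (d1 * d2) - (1 - R ^ 2 * y1 * y2) / (d1 * d2)"
              by (simp add: algebra_simps)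
            then show ?thesis by (simp add: diff_divide_distrib[symmetric])
          qed
          show ?thesis unfolding 1 2 by (rule alg) (use n1 n2 ne S in \<open>simp_all add: y1_def y2_def\<close>)
        qed
        ultimately show ?thesis by blast
      qed
      then obtain L where L: "(Q has_field_derivative Q t * L) (at t)"
          "t * L - (of_nat r * y1 / (1 - of_nat r * y1) + of_nat r * y2 / (1 - of_nat r * y2)) = W t" by blast
      define F where "F = L - (of_nat r * (a * \<zeta>1 t ^ (r - 1)) + of_nat r * (b * \<zeta>2 t ^ (r - 1)))"
      have "((\<lambda>t. Ln (Q t) - (\<zeta>1 t ^ r + \<zeta>2 t ^ r)) has_field_derivative F) (at t)"
      proof -
        have "(Ln has_field_derivative inverse (Q t)) (at (Q t))"
          using Qgood[OF t] has_field_derivative_Ln[of "Q t"] by blast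
        then have "((\<lambda>t. Ln (Q t)) has_field_derivative inverse (Q t) * (Q t * L)) (at t)"
          using L(1) by (rule DERIV_chain2)
        moreover have "inverse (Q t) * (Q t * L) = L" using Qgood[OF t] by simp
        ultimately have "((\<lambda>t. Ln (Q t)) has_field_derivative L) (at t)" by (simp only:)
        then show ?thesis unfolding F_def by (intro DERIV_diff DERIV_add p1 p2)
      qed
      then have "(E has_field_derivative F) (at t)"
        by (rule has_field_derivative_transform_within_open[where S="- {0}"]) (use t in \<open>auto simp: E_def\<close>)
      moreover have "t * F = W t" unfolding F_def right_diff_distrib distrib_left tp1 tp2 using L(2) by simp
      ultimately show ?thesis by blast
    qed
    have \<zeta>0: "\<zeta>1 0 = 0" "\<zeta>2 0 = 0" by (simp_all add: \<zeta>1_def \<zeta>2_def g0)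
    have d0: "(\<zeta>1 has_field_derivative x1) (at 0)" "(\<zeta>2 has_field_derivative x2) (at 0)"
      using gder[of 0, OF _ xb(1)] gder[of 0, OF _ xb(2)]
      by (simp_all add: \<zeta>1_def[abs_def] \<zeta>2_def[abs_def] D_def g0 zero_power[OF r])
    have cont0: "(\<zeta>1 \<longlongrightarrow> 0) (at 0)" "(\<zeta>2 \<longlongrightarrow> 0) (at 0)"
      using d0[THEN DERIV_isCont] \<zeta>0 by (simp_all add: isCont_def)
    have Qlim: "(Q \<longlongrightarrow> 1) (at 0)"
    proof (cases "z1 = z2")
      case True
      have "((\<lambda>t. inverse ((1 - of_nat r * \<zeta>1 t ^ r) * exp (- (\<zeta>1 t ^ r)))) \<longlongrightarrow> inverse ((1 - of_nat r * 0 ^ r) * exp (- (0 ^ r)))) (at 0)"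
        by (intro tendsto_intros cont0) (simp add: zero_power[OF r])
      then show ?thesis by (simp add: Q_def[abs_def] True zero_power[OF r])
    next
      case False
      have "((\<lambda>t. \<zeta>1 t - \<zeta>2 t) has_field_derivative (x1 - x2)) (at 0)" by (intro DERIV_diff d0)
      then have "((\<lambda>t. (\<zeta>1 t - \<zeta>2 t) / t) \<longlongrightarrow> (x1 - x2)) (at 0)" by (simp add: DERIV_def \<zeta>0)
      then have "((\<lambda>t. (\<zeta>1 t - \<zeta>2 t) / t / (x1 - x2)) \<longlongrightarrow> (x1 - x2) / (x1 - x2)) (at 0)"
        by (rule tendsto_divide[OF _ tendsto_const]) (use x_neq False in auto)
      then show ?thesis using x_neq False by (simp add: Q_def[abs_def])
    qed
    have Elim: "isCont E 0"
    proof -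
      have "((\<lambda>t. Ln (Q t) - (\<zeta>1 t ^ r + \<zeta>2 t ^ r)) \<longlongrightarrow> Ln 1 - (0 ^ r + 0 ^ r)) (at 0)"
        by (intro tendsto_intros tendsto_Ln Qlim cont0) auto
      then have "(E \<longlongrightarrow> 0) (at 0)"
        by (subst tendsto_cong[where g="\<lambda>t. Ln (Q t) - (\<zeta>1 t ^ r + \<zeta>2 t ^ r)"])
           (auto simp: E_def eventually_at_filter zero_power[OF r])
      then show ?thesis by (simp add: isCont_def E_def)
    qed
    have "\<Phi> 0 = 0"
      unfolding \<Phi>_def by (rule infsum_0) (auto simp: A_def h_def)
    have isc: "isCont (\<lambda>t. \<Phi> t - E t) t" if "norm t < 2" for t
      using \<Phi>deriv[OF that] Ederiv[of t] Elim that by (cases "t = 0") (auto intro!: continuous_diff dest: DERIV_isCont)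
    have "\<exists>c. \<forall>t \<in> ball 0 2. \<Phi> t - E t = c"
    proof (rule DERIV_zero_connected_constant[of "ball 0 2" "{0}" "\<lambda>t. \<Phi> t - E t"])
      show "continuous_on (ball 0 2) (\<lambda>t. \<Phi> t - E t)"
        by (rule continuous_at_imp_continuous_on) (use isc in auto)
      show "\<forall>t\<in>ball 0 2 - {0}. ((\<lambda>t. \<Phi> t - E t) has_field_derivative 0) (at t)"
      proof
        fix t :: complex assume "t \<in> ball 0 2 - {0}"
        then have t: "t \<noteq> 0" "norm t < 2" by auto
        obtain D1 D2 where D: "(\<Phi> has_field_derivative D1) (at t)" "t * D1 = W t" "(E has_field_derivative D2) (at t)" "t * D2 = W t"
          using \<Phi>deriv[OF t(2)] Ederiv[OF t] by blast
        then have "D1 = D2" using t(1) by (metis mult_left_cancel)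
        then show "((\<lambda>t. \<Phi> t - E t) has_field_derivative 0) (at t)" using DERIV_diff[OF D(1,3)] by simp
      qed
    qed auto
    then have "\<Phi> 1 - E 1 = \<Phi> 0 - E 0" by force
    then have "\<Phi> 1 = E 1" using \<open>\<Phi> 0 = 0\<close> by (simp add: E_def)
    moreover have "\<zeta>1 1 = z1" "\<zeta>2 1 = z2" using g' z1 z2 by (simp_all add: \<zeta>1_def \<zeta>2_def x1_def x2_def)
    moreover have "Q 1 = inv_diff_quotient r z1 z2"
      using calculation(2,3) DERIV_imp_deriv[OF lambert_x_deriv[OF r]]
      by (simp add: Q_def inv_diff_quotient_def x1_def x2_def inverse_eq_divide)
    ultimately have "\<Phi> 1 = Ln (inv_diff_quotient r z1 z2) - (z1 ^ r + z2 ^ r)" by (simp add: E_def)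
    then show "((\<lambda>(p, q). of_real (radial_annulus_coeff r p q) / of_nat (p + q) * lambert_x r z1 ^ p * lambert_x r z2 ^ q)
        has_sum (Ln (inv_diff_quotient r z1 z2) - (z1 ^ r + z2 ^ r))) ({1..} \<times> {1..})"
      using \<Phi>[of 1] by (simp add: f_def A_def x1_def x2_def)
  qed
qed

section \<open>Multiplying a permutation by a transposition\<close>

abbreviation transposition :: "'a \<Rightarrow> 'a \<Rightarrow> 'a \<Rightarrow> 'a" where
  "transposition \<equiv> Transposition.transpose"

lemma orbit_card_cycle:
  assumes "permutation f" "x \<in> orbit f x"
  shows "(f ^^ card (orbit f x)) x = x" "inj_on (\<lambda>n. (f ^^ n) x) {0..<card (orbit f x)}"
    "orbit f x = (\<lambda>n. (f ^^ n) x) ` {0..<card (orbit f x)}"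
proof -
  have c: "card (orbit f x) = funpow_dist1 f x x"
    using orbit_conv_funpow_dist1[OF assms(2)] card_image[OF inj_on_funpow_dist1[OF assms(2)]] by simp
  show "(f ^^ card (orbit f x)) x = x" unfolding c by (rule funpow_dist1_prop[OF assms(2)])
  show "inj_on (\<lambda>n. (f ^^ n) x) {0..<card (orbit f x)}" unfolding c by (rule inj_on_funpow_dist1[OF assms(2)])
  show "orbit f x = (\<lambda>n. (f ^^ n) x) ` {0..<card (orbit f x)}" unfolding c by (rule orbit_conv_funpow_dist1[OF assms(2)])
qed

lemma orbit_eq_if_mem: "permutation f \<Longrightarrow> y \<in> orbit f x \<Longrightarrow> orbit f y = orbit f x"
  using cyclic_on_orbit' orbit_cyclic_eq3 by metis

lemma orbit_disjoint: "permutation f \<Longrightarrow> orbit f x \<noteq> orbit f y \<Longrightarrow> orbit f x \<inter> orbit f y = {}"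
  using orbit_eq_if_mem by (metis disjoint_iff)

text \<open>A listing of an orbit that ends, rather than starts, at \<open>x\<close>. This is how the two halves of a cut cycle are listed.\<close>

lemma orbit_from_path:
  assumes "0 < d" "\<And>n. 1 \<le> n \<Longrightarrow> n \<le> d \<Longrightarrow> (f ^^ n) x = q n" "q d = x"
  shows "orbit f x = q ` {1..d}"
proof -
  have x: "(f ^^ d) x = x" using assms by simp
  have "orbit f x = {(f ^^ m) x | m. m < d}" by (rule orbit_altdef_bounded[OF x assms(1)])
  also have "\<dots> = q ` {1..d}"
  proof (intro equalityI subsetI)
    fix y assume "y \<in> {(f ^^ m) x | m. m < d}"
    then obtain m where m: "y = (f ^^ m) x" "m < d" by blast
    show "y \<in> q ` {1..d}"
    proof (cases "m = 0")
      case True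
      then show ?thesis using m assms(1,3) by (intro image_eqI[of _ _ d]) auto
    next
      case False
      then show ?thesis using m assms(2)[of m] by (intro image_eqI[of _ _ m]) auto
    qed
  next
    fix y assume "y \<in> q ` {1..d}"
    then obtain n where n: "y = q n" "1 \<le> n" "n \<le> d" by auto
    show "y \<in> {(f ^^ m) x | m. m < d}"
    proof (cases "n = d")
      case True
      then have "y = (f ^^ 0) x" using n assms(3) by simp
      then show ?thesis using assms(1) by blast
    next
      case False
      then have "y = (f ^^ n) x" "n < d" using n assms(2) by auto
      then show ?thesis by blast
    qed
  qed
  finally show ?thesis .
qed

lemma orbit_cong_outside:
  assumes "permutation f" "\<And>y. y \<in> orbit f x \<Longrightarrow> g y = f y"
  shows "orbit g x = orbit f x"
proof -
  have "(g ^^ n) x = (f ^^ n) x" for n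
  proof (induction n)
    case (Suc n)
    have "(f ^^ n) x \<in> orbit f x"
      using funpow_in_orbit[OF permutation_self_in_orbit[OF assms(1)]] .
    then show ?case using Suc assms(2) by simp
  qed simp
  then show ?thesis by (simp add: orbit_altdef)
qed

text \<open>Following \<open>\<rho> \<circ> (i j)\<close>, \<open>j\<close> is sent to \<open>\<rho> i\<close>, so that the orbit of \<open>j\<close> consists of the \<open>d\<close> elements after \<open>i\<close>, and
that of \<open>i\<close> of the rest.\<close>

lemma cut_orbits:
  assumes perm: "permutation \<rho>" and d: "0 < d" "d < card (orbit \<rho> i)" and j: "j = (\<rho> ^^ d) i"
  defines "\<rho>' \<equiv> \<rho> \<circ> transposition i j"
  shows "card (orbit \<rho>' j) = d" "card (orbit \<rho>' i) = card (orbit \<rho> i) - d"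
    "orbit \<rho>' i \<union> orbit \<rho>' j = orbit \<rho> i" "orbit \<rho>' i \<inter> orbit \<rho>' j = {}"
    "\<And>x. x \<notin> orbit \<rho> i \<Longrightarrow> orbit \<rho>' x = orbit \<rho> x"
proof -
  define L where "L = card (orbit \<rho> i)"
  define p where "p n = (\<rho> ^^ n) i" for n
  have self: "i \<in> orbit \<rho> i" by (rule permutation_self_in_orbit[OF perm])
  note oc = orbit_card_cycle[OF perm self, folded L_def]
  have pL: "p L = i" "p 0 = i" "p d = j" using oc(1) j by (simp_all add: p_def)
  have inj0: "inj_on p {0..<L}" and img0: "orbit \<rho> i = p ` {0..<L}" using oc(2,3) by (simp_all add: p_def[abs_def])
  have L: "0 < d" "d < L" using d by (simp_all add: L_def)
  have img: "orbit \<rho> i = p ` {1..L}"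
    unfolding p_def[abs_def] using orbit_from_path[of L \<rho> i p] pL L by (simp add: p_def[abs_def])
  have inj: "inj_on p {1..L}"
    by (rule eq_card_imp_inj_on) (use img[symmetric] L_def in auto)
  have ne: "p n \<noteq> i" "n \<noteq> d \<Longrightarrow> p n \<noteq> j" if "1 \<le> n" "n < L" for n
    using inj_onD[OF inj, of n L] inj_onD[OF inj, of n d] that L pL by auto
  have Suc: "\<rho> (p n) = p (Suc n)" for n by (simp add: p_def)
  have jpath: "(\<rho>' ^^ n) j = p n" if "1 \<le> n" "n \<le> d" for n
    using that
  proof (induction n rule: nat_induct_at_least)
    case base
    then show ?case using Suc[of 0] pL by (simp add: \<rho>'_def)
  next
    case (Suc n)
    then have "p n \<noteq> i" "p n \<noteq> j" using ne[of n] L by auto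
    then show ?case using Suc \<open>\<And>n. \<rho> (p n) = p (Suc n)\<close> by (simp add: \<rho>'_def transpose_apply_other)
  qed
  have ipath: "(\<rho>' ^^ n) i = p (d + n)" if "1 \<le> n" "n \<le> L - d" for n
    using that
  proof (induction n rule: nat_induct_at_least)
    case base
    then show ?case using Suc[of d] pL by (simp add: \<rho>'_def)
  next
    case (Suc n)
    then have "p (d + n) \<noteq> i" "p (d + n) \<noteq> j" using ne[of "d + n"] L by auto
    then show ?case using Suc \<open>\<And>n. \<rho> (p n) = p (Suc n)\<close> by (simp add: \<rho>'_def transpose_apply_other)
  qed
  have oj: "orbit \<rho>' j = p ` {1..d}"
    by (rule orbit_from_path) (use jpath L pL in auto)
  have "orbit \<rho>' i = (\<lambda>n. p (d + n)) ` {1..L - d}"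
    by (rule orbit_from_path) (use ipath L pL in auto)
  also have "\<dots> = p ` {d + 1..L}"
  proof -
    have "{d + 1..L} = (+) d ` {1..L - d}" using L by simp
    then show ?thesis by (simp only: image_image)
  qed
  finally have oi: "orbit \<rho>' i = p ` {d + 1..L}" .
  show "card (orbit \<rho>' j) = d"
    unfolding oj using inj_on_subset[OF inj] L by (subst card_image) auto
  show "card (orbit \<rho>' i) = card (orbit \<rho> i) - d"
    unfolding oi L_def[symmetric] using inj_on_subset[OF inj] L by (subst card_image) auto
  show "orbit \<rho>' i \<union> orbit \<rho>' j = orbit \<rho> i"
  proof -
    have "{d + 1..L} \<union> {1..d} = {1..L}" using L by auto
    then show ?thesis unfolding oi oj img by (simp only: image_Un[symmetric])
  qed
  show "orbit \<rho>' i \<inter> orbit \<rho>' j = {}"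
    unfolding oi oj using inj_on_image_Int[OF inj, of "{d+1..L}" "{1..d}"] L by auto
  show "orbit \<rho>' x = orbit \<rho> x" if "x \<notin> orbit \<rho> i" for x
  proof (rule orbit_cong_outside[OF perm])
    fix y assume y: "y \<in> orbit \<rho> x"
    have "y \<notin> orbit \<rho> i"
      using that y orbit_eq_if_mem[OF perm] permutation_self_in_orbit[OF perm] by metis
    moreover have "i \<in> orbit \<rho> i" "j \<in> orbit \<rho> i" using self funpow_in_orbit[OF self] j by auto
    ultimately show "\<rho>' y = \<rho> y" unfolding \<rho>'_def by (metis comp_apply transpose_apply_other)
  qed
qed

lemma same_orbit_funpow:
  assumes "permutation \<rho>" "j \<in> orbit \<rho> i" "i \<noteq> j"
  obtains d where "0 < d" "d < card (orbit \<rho> i)" "j = (\<rho> ^^ d) i"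
proof -
  have self: "i \<in> orbit \<rho> i" by (rule permutation_self_in_orbit[OF assms(1)])
  have "j \<in> (\<lambda>n. (\<rho> ^^ n) i) ` {0..<card (orbit \<rho> i)}"
    using orbit_card_cycle(3)[OF assms(1) self] assms(2) by blast
  then obtain d where d: "d < card (orbit \<rho> i)" "j = (\<rho> ^^ d) i" by auto
  with assms(3) have "0 < d" by (cases d) auto
  with d that show ?thesis by blast
qed

text \<open>Multiplying by the transposition again restores \<open>\<rho>\<close>. Hence, once \<open>i\<close> and \<open>j\<close> are known to lie on one cycle of
\<open>\<rho> \<circ> (i j)\<close>, this follows from the description of cuts.\<close>

lemma join_orbits:
  assumes perm: "permutation \<rho>" and ij: "j \<notin> orbit \<rho> i"
  defines "\<rho>' \<equiv> \<rho> \<circ> transposition i j"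
  shows "orbit \<rho>' i = orbit \<rho> i \<union> orbit \<rho> j" "j \<in> orbit \<rho>' i"
    "\<And>x. x \<notin> orbit \<rho> i \<union> orbit \<rho> j \<Longrightarrow> orbit \<rho>' x = orbit \<rho> x"
proof -
  have perm': "permutation \<rho>'"
    unfolding \<rho>'_def by (intro permutation_compose perm permutation_swap_id)
  have neq: "i \<noteq> j" using ij permutation_self_in_orbit[OF perm] by metis
  have i: "i \<in> orbit \<rho>' j" and j: "j \<in> orbit \<rho>' i"
  proof -
    define L where "L = card (orbit \<rho> j)"
    have self: "j \<in> orbit \<rho> j" by (rule permutation_self_in_orbit[OF perm])
    note oc = orbit_card_cycle[OF perm self, folded L_def]
    have "L > 0" unfolding L_def using finite_orbit[OF self] self by (auto simp: card_gt_0_iff)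
    have "(\<rho>' ^^ n) i = (\<rho> ^^ n) j" if "1 \<le> n" "n \<le> L" for n
      using that
    proof (induction n rule: nat_induct_at_least)
      case base
      then show ?case by (simp add: \<rho>'_def)
    next
      case (Suc n)
      have "(\<rho> ^^ n) j \<noteq> j" using inj_onD[OF oc(2), of n 0] Suc by auto
      moreover have "(\<rho> ^^ n) j \<noteq> i"
        using funpow_in_orbit[OF self] ij perm permutation_self_in_orbit[OF perm] orbit_eq_if_mem[OF perm] by metis
      ultimately show ?case using Suc by (simp add: \<rho>'_def transpose_apply_other)
    qed
    then have "j = (\<rho>' ^^ L) i" using oc(1) \<open>L > 0\<close> by (metis One_nat_def Suc_leI order_refl)
    then show "j \<in> orbit \<rho>' i" using \<open>L > 0\<close> unfolding orbit_altdef by blast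
    then show "i \<in> orbit \<rho>' j" using orbit_eq_if_mem[OF perm'] permutation_self_in_orbit[OF perm'] by metis
  qed
  show "j \<in> orbit \<rho>' i" by (rule j)
  have undo: "\<rho>' \<circ> transposition i j = \<rho>" by (simp add: \<rho>'_def comp_assoc)
  obtain d where d: "0 < d" "d < card (orbit \<rho>' i)" "j = (\<rho>' ^^ d) i"
    using same_orbit_funpow[OF perm' j neq] .
  note cut = cut_orbits[OF perm' d, unfolded undo]
  show "orbit \<rho>' i = orbit \<rho> i \<union> orbit \<rho> j" using cut(3) by simp
  show "\<And>x. x \<notin> orbit \<rho> i \<union> orbit \<rho> j \<Longrightarrow> orbit \<rho>' x = orbit \<rho> x" using cut(3,5) by simp
qed

definition cycles :: "'a set \<Rightarrow> ('a \<Rightarrow> 'a) \<Rightarrow> 'a set set" where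
  "cycles B \<rho> = orbit \<rho> ` B"

definition regular :: "nat \<Rightarrow> 'a set \<Rightarrow> ('a \<Rightarrow> 'a) \<Rightarrow> bool" where
  "regular r B \<rho> \<longleftrightarrow> (\<forall>C\<in>cycles B \<rho>. card C = r)"

context
  fixes B :: "'a set" and \<rho> :: "'a \<Rightarrow> 'a"
  assumes fin: "finite B" and per: "\<rho> permutes B"
begin

lemma perm_of_permutes: "permutation \<rho>"
  using fin per permutation_permutes by blast

lemma self_in_orbit: "x \<in> orbit \<rho> x"
  by (rule permutation_self_in_orbit[OF perm_of_permutes])

lemma finite_cycles: "finite (cycles B \<rho>)"
  using fin by (simp add: cycles_def)

lemma cycle_subset: "C \<in> cycles B \<rho> \<Longrightarrow> C \<subseteq> B"
  using permutes_orbit_subset[OF per] by (auto simp: cycles_def)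

lemma cycle_eq_orbit: "C \<in> cycles B \<rho> \<Longrightarrow> x \<in> C \<Longrightarrow> C = orbit \<rho> x"
  using orbit_eq_if_mem[OF perm_of_permutes] by (auto simp: cycles_def)

lemma cycles_disjoint: "C \<in> cycles B \<rho> \<Longrightarrow> D \<in> cycles B \<rho> \<Longrightarrow> C \<noteq> D \<Longrightarrow> C \<inter> D = {}"
  using orbit_disjoint[OF perm_of_permutes] by (auto simp: cycles_def)

lemma cycles_cover: "\<Union>(cycles B \<rho>) = B"
proof
  show "B \<subseteq> \<Union>(cycles B \<rho>)" using self_in_orbit by (auto simp: cycles_def)
qed (use cycle_subset in blast)

lemma cycle_card_pos: "C \<in> cycles B \<rho> \<Longrightarrow> 0 < card C"
  using cycle_subset fin self_in_orbit by (auto simp: cycles_def card_gt_0_iff intro: finite_subset)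

lemma sum_card_cycles: "(\<Sum>C\<in>cycles B \<rho>. card C) = card B"
proof -
  have "card (\<Union>(cycles B \<rho>)) = (\<Sum>C\<in>cycles B \<rho>. card C)"
    by (rule card_Union_disjoint)
      (use cycles_disjoint finite_subset[OF cycle_subset fin] in \<open>auto simp: pairwise_def disjnt_def\<close>)
  then show ?thesis by (simp add: cycles_cover)
qed

lemma sum_by_cycles:
  fixes G :: "'a set \<Rightarrow> real"
  shows "(\<Sum>i\<in>B. G (orbit \<rho> i)) = (\<Sum>C\<in>cycles B \<rho>. real (card C) * G C)"
proof -
  have "(\<Sum>i\<in>B. G (orbit \<rho> i)) = (\<Sum>C\<in>orbit \<rho> ` B. \<Sum>i\<in>{x\<in>B. orbit \<rho> x = C}. G (orbit \<rho> i))"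
    by (rule sum.image_gen[OF fin])
  also have "\<dots> = (\<Sum>C\<in>cycles B \<rho>. \<Sum>i\<in>C. G C)"
    unfolding cycles_def[symmetric]
  proof (intro sum.cong refl)
    fix C i assume C: "C \<in> cycles B \<rho>"
    show "{x \<in> B. orbit \<rho> x = C} = C"
      using cycle_eq_orbit[OF C] cycle_subset[OF C] self_in_orbit by auto
  qed (auto dest: cycle_eq_orbit)
  finally show ?thesis by simp
qed

lemma sum_over_orbit:
  assumes "i \<in> B"
  shows "(\<Sum>j\<in>orbit \<rho> i - {i}. G j) = (\<Sum>d=1..<card (orbit \<rho> i). G ((\<rho> ^^ d) i))"
proof -
  note oc = orbit_card_cycle[OF perm_of_permutes self_in_orbit[of i]]
  define L where "L = card (orbit \<rho> i)"
  have "L > 0" unfolding L_def using assms cycle_card_pos by (auto simp: cycles_def)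
  have "{0..<L} = insert 0 {1..<L}" using \<open>L > 0\<close> by auto
  then have "orbit \<rho> i = insert i ((\<lambda>d. (\<rho> ^^ d) i) ` {1..<L})" using oc(3) L_def by simp
  moreover have "i \<notin> (\<lambda>d. (\<rho> ^^ d) i) ` {1..<L}"
  proof
    assume "i \<in> (\<lambda>d. (\<rho> ^^ d) i) ` {1..<L}"
    then obtain d where "1 \<le> d" "d < L" "(\<rho> ^^ d) i = (\<rho> ^^ 0) i" by auto
    then show False using inj_onD[OF oc(2), of d 0] \<open>L > 0\<close> by (auto simp: L_def)
  qed
  ultimately have "orbit \<rho> i - {i} = (\<lambda>d. (\<rho> ^^ d) i) ` {1..<L}" by blast
  moreover have "inj_on (\<lambda>d. (\<rho> ^^ d) i) {1..<L}"
    by (rule inj_on_subset[OF oc(2)]) (auto simp: L_def)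
  ultimately show ?thesis by (simp add: sum.reindex L_def)
qed

lemma permutes_comp_transpose: "i \<in> B \<Longrightarrow> j \<in> B \<Longrightarrow> \<rho> \<circ> transposition i j permutes B"
  by (intro permutes_compose permutes_swap_id per)

lemma cycles_cut:
  assumes i: "i \<in> B" and d: "0 < d" "d < card (orbit \<rho> i)"
  defines "j \<equiv> (\<rho> ^^ d) i"
  defines "\<rho>' \<equiv> \<rho> \<circ> transposition i j"
  shows "cycles B \<rho>' = insert (orbit \<rho>' i) (insert (orbit \<rho>' j) (cycles B \<rho> - {orbit \<rho> i}))"
    "orbit \<rho>' i \<noteq> orbit \<rho>' j" "orbit \<rho>' i \<notin> cycles B \<rho>" "orbit \<rho>' j \<notin> cycles B \<rho>"
    "card (cycles B \<rho>') = Suc (card (cycles B \<rho>))"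
proof -
  note cut = cut_orbits[OF perm_of_permutes d j_def[THEN meta_eq_to_obj_eq], folded \<rho>'_def]
  have jC: "j \<in> orbit \<rho> i" unfolding j_def by (intro funpow_in_orbit self_in_orbit)
  have jB: "j \<in> B" using jC permutes_orbit_subset[OF per i] by auto
  have C: "orbit \<rho> i \<in> cycles B \<rho>" using i by (simp add: cycles_def)
  have per': "\<rho>' permutes B" unfolding \<rho>'_def using i jB by (rule permutes_comp_transpose)
  have perm': "permutation \<rho>'" using fin per' permutation_permutes by blast
  have in_C: "orbit \<rho>' x = orbit \<rho>' i \<or> orbit \<rho>' x = orbit \<rho>' j" if "x \<in> orbit \<rho> i" for x
    using that cut(3) orbit_eq_if_mem[OF perm'] by blast
  have out_C: "x \<notin> orbit \<rho> i" if "orbit \<rho> x \<noteq> orbit \<rho> i" for x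
    using that orbit_eq_if_mem[OF perm_of_permutes] by blast
  show eq: "cycles B \<rho>' = insert (orbit \<rho>' i) (insert (orbit \<rho>' j) (cycles B \<rho> - {orbit \<rho> i}))"
  proof (intro equalityI subsetI)
    fix D assume "D \<in> cycles B \<rho>'"
    then obtain x where x: "x \<in> B" "D = orbit \<rho>' x" by (auto simp: cycles_def)
    show "D \<in> insert (orbit \<rho>' i) (insert (orbit \<rho>' j) (cycles B \<rho> - {orbit \<rho> i}))"
    proof (cases "x \<in> orbit \<rho> i")
      case True
      then show ?thesis using in_C x by blast
    next
      case False
      then have "orbit \<rho>' x = orbit \<rho> x" "orbit \<rho> x \<noteq> orbit \<rho> i" using cut(5) self_in_orbit by auto
      then show ?thesis using x by (auto simp: cycles_def)
    qed
  next
    fix D assume "D \<in> insert (orbit \<rho>' i) (insert (orbit \<rho>' j) (cycles B \<rho> - {orbit \<rho> i}))"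
    then consider "D = orbit \<rho>' i" | "D = orbit \<rho>' j" | x where "x \<in> B" "D = orbit \<rho> x" "orbit \<rho> x \<noteq> orbit \<rho> i"
      by (auto simp: cycles_def)
    then show "D \<in> cycles B \<rho>'"
    proof cases
      case (3 x)
      then have "orbit \<rho>' x = orbit \<rho> x" by (intro cut(5) out_C)
      then show ?thesis using 3 by (auto simp: cycles_def)
    qed (use i jB in \<open>auto simp: cycles_def\<close>)
  qed
  have si: "i \<in> orbit \<rho>' i" "j \<in> orbit \<rho>' j" using permutation_self_in_orbit[OF perm'] by auto
  show ne: "orbit \<rho>' i \<noteq> orbit \<rho>' j" using si cut(4) by blast
  have proper: "orbit \<rho>' i \<noteq> orbit \<rho> i" "orbit \<rho>' j \<noteq> orbit \<rho> i"
    using cut(3,4) si by blast+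
  show nin: "orbit \<rho>' i \<notin> cycles B \<rho>" "orbit \<rho>' j \<notin> cycles B \<rho>"
    using proper si jC cycle_eq_orbit orbit_eq_if_mem[OF perm_of_permutes] by (metis)+
  have "card (cycles B \<rho>) > 0" using C finite_cycles card_gt_0_iff by blast
  then show "card (cycles B \<rho>') = Suc (card (cycles B \<rho>))"
    unfolding eq using ne nin C finite_cycles by (simp add: card_Diff_singleton)
qed

lemma cycles_cut_prod:
  fixes G :: "'a set \<Rightarrow> real"
  assumes i: "i \<in> B" and d: "0 < d" "d < card (orbit \<rho> i)"
  defines "j \<equiv> (\<rho> ^^ d) i"
  defines "\<rho>' \<equiv> \<rho> \<circ> transposition i j"
  shows "(\<Prod>C\<in>cycles B \<rho>'. f (card C)) = f d * f (card (orbit \<rho> i) - d) * (\<Prod>C\<in>cycles B \<rho> - {orbit \<rho> i}. f (card C) :: real)"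
proof -
  note cyc = cycles_cut[OF i d, folded j_def, folded \<rho>'_def]
  note cut = cut_orbits[OF perm_of_permutes d j_def[THEN meta_eq_to_obj_eq], folded \<rho>'_def]
  show ?thesis unfolding cyc(1) using cyc(2-4) finite_cycles by (simp add: cut(1,2))
qed

lemma cycles_join:
  assumes i: "i \<in> B" "j \<in> B" "j \<notin> orbit \<rho> i"
  defines "\<rho>' \<equiv> \<rho> \<circ> transposition i j"
  shows "cycles B \<rho>' = insert (orbit \<rho> i \<union> orbit \<rho> j) (cycles B \<rho> - {orbit \<rho> i, orbit \<rho> j})"
    "orbit \<rho> i \<union> orbit \<rho> j \<notin> cycles B \<rho> - {orbit \<rho> i, orbit \<rho> j}"
    "Suc (card (cycles B \<rho>')) = card (cycles B \<rho>)"
proof -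
  note join = join_orbits[OF perm_of_permutes i(3), folded \<rho>'_def]
  have per': "\<rho>' permutes B" unfolding \<rho>'_def using i by (intro permutes_comp_transpose)
  have perm': "permutation \<rho>'" using fin per' permutation_permutes by blast
  show eq: "cycles B \<rho>' = insert (orbit \<rho> i \<union> orbit \<rho> j) (cycles B \<rho> - {orbit \<rho> i, orbit \<rho> j})"
  proof (intro equalityI subsetI)
    fix D assume "D \<in> cycles B \<rho>'"
    then obtain x where x: "x \<in> B" "D = orbit \<rho>' x" by (auto simp: cycles_def)
    show "D \<in> insert (orbit \<rho> i \<union> orbit \<rho> j) (cycles B \<rho> - {orbit \<rho> i, orbit \<rho> j})"
    proof (cases "x \<in> orbit \<rho> i \<union> orbit \<rho> j")
      case True
      then have "orbit \<rho>' x = orbit \<rho>' i" using join(1) orbit_eq_if_mem[OF perm'] by blast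
      then show ?thesis using join(1) x by simp
    next
      case False
      then have "orbit \<rho>' x = orbit \<rho> x" "orbit \<rho> x \<noteq> orbit \<rho> i" "orbit \<rho> x \<noteq> orbit \<rho> j"
        using join(3) self_in_orbit by auto
      then show ?thesis using x by (auto simp: cycles_def)
    qed
  next
    fix D assume "D \<in> insert (orbit \<rho> i \<union> orbit \<rho> j) (cycles B \<rho> - {orbit \<rho> i, orbit \<rho> j})"
    then consider "D = orbit \<rho>' i" | x where "x \<in> B" "D = orbit \<rho> x" "D \<noteq> orbit \<rho> i" "D \<noteq> orbit \<rho> j"
      using join(1) by (auto simp: cycles_def)
    then show "D \<in> cycles B \<rho>'"
    proof cases
      case 1
      then show ?thesis using i by (simp add: cycles_def)
    next
      case (2 x)
      then have "x \<notin> orbit \<rho> i \<union> orbit \<rho> j" using orbit_eq_if_mem[OF perm_of_permutes] by blast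
      then have "orbit \<rho>' x = orbit \<rho> x" by (rule join(3))
      then show ?thesis using 2 by (auto simp: cycles_def)
    qed
  qed
  show nin: "orbit \<rho> i \<union> orbit \<rho> j \<notin> cycles B \<rho> - {orbit \<rho> i, orbit \<rho> j}"
    using cycle_eq_orbit self_in_orbit by blast
  have "orbit \<rho> i \<noteq> orbit \<rho> j" using i(3) self_in_orbit by blast
  moreover have "{orbit \<rho> i, orbit \<rho> j} \<subseteq> cycles B \<rho>" using i by (simp add: cycles_def)
  ultimately have "card (cycles B \<rho> - {orbit \<rho> i, orbit \<rho> j}) = card (cycles B \<rho>) - 2" "card (cycles B \<rho>) \<ge> 2"
    using finite_cycles card_mono[of "cycles B \<rho>" "{orbit \<rho> i, orbit \<rho> j}"] by (auto simp: card_Diff_subset)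
  then show "Suc (card (cycles B \<rho>')) = card (cycles B \<rho>)"
    unfolding eq using nin finite_cycles by (subst card_insert_disjoint) auto
qed

end

section \<open>Counting factorizations into transpositions\<close>

text \<open>Transpositions are given by ordered pairs; the order is the orientation of an edge and accounts for the factors 2.\<close>

definition pairs :: "'a set \<Rightarrow> ('a \<times> 'a) set" where
  "pairs B = {(i, j). i \<in> B \<and> j \<in> B \<and> i \<noteq> j}"

text \<open>The product of \<open>\<rho>\<close> and the transpositions of the word, from left to right.\<close>

primrec act :: "('a \<Rightarrow> 'a) \<Rightarrow> ('a \<times> 'a) list \<Rightarrow> 'a \<Rightarrow> 'a" where
  "act \<rho> [] = \<rho>"
| "act \<rho> (p # ps) = act (\<rho> \<circ> transposition (fst p) (snd p)) ps"

definition words :: "'a set \<Rightarrow> nat \<Rightarrow> ('a \<times> 'a) list set" where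
  "words B s = {ps. length ps = s \<and> set ps \<subseteq> pairs B}"

lemma finite_words: "finite B \<Longrightarrow> finite (words B s)"
proof -
  assume "finite B"
  then have "finite (pairs B)" by (rule_tac finite_subset[of _ "B \<times> B"]) (auto simp: pairs_def)
  from finite_lists_length_eq[OF this, of s] show ?thesis by (simp add: words_def conj_commute)
qed

lemma words_0: "words B 0 = {[]}"
  by (auto simp: words_def)

lemma card_words_Suc:
  assumes "finite B"
  shows "card {ps \<in> words B (Suc s). P ps} = (\<Sum>p\<in>pairs B. card {ps \<in> words B s. P (p # ps)})"
proof -
  have "finite (pairs B)" using assms by (rule_tac finite_subset[of _ "B \<times> B"]) (auto simp: pairs_def)
  moreover have eq: "{ps \<in> words B (Suc s). P ps} = (\<Union>p\<in>pairs B. (#) p ` {ps \<in> words B s. P (p # ps)})"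
    by (auto simp: words_def length_Suc_conv)
  moreover have "card (\<Union>p\<in>pairs B. (#) p ` {ps \<in> words B s. P (p # ps)}) = (\<Sum>p\<in>pairs B. card ((#) p ` {ps \<in> words B s. P (p # ps)}))"
    by (rule card_UN_disjoint) (use calculation(1) finite_words[OF assms] in auto)
  ultimately show ?thesis by (simp add: card_image)
qed

lemma sum_pairs:
  assumes "finite B" "\<rho> permutes B"
  shows "(\<Sum>p\<in>pairs B. F p) = (\<Sum>i\<in>B. (\<Sum>d=1..<card (orbit \<rho> i). F (i, (\<rho> ^^ d) i)) + (\<Sum>j\<in>B - orbit \<rho> i. F (i, j)))"
proof -
  have "pairs B = Sigma B (\<lambda>i. B - {i})" by (auto simp: pairs_def)
  then have "(\<Sum>p\<in>pairs B. F p) = (\<Sum>i\<in>B. \<Sum>j\<in>B - {i}. F (i, j))"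
    using assms(1) by (simp add: sum.Sigma)
  also have "\<dots> = (\<Sum>i\<in>B. (\<Sum>j\<in>orbit \<rho> i - {i}. F (i, j)) + (\<Sum>j\<in>B - orbit \<rho> i. F (i, j)))"
  proof (intro sum.cong refl)
    fix i assume i: "i \<in> B"
    have sub: "orbit \<rho> i \<subseteq> B" "i \<in> orbit \<rho> i" using permutes_orbit_subset[OF assms(2) i] self_in_orbit[OF assms] by auto
    then have "B - {i} = (orbit \<rho> i - {i}) \<union> (B - orbit \<rho> i)" by blast
    then show "(\<Sum>j\<in>B - {i}. F (i, j)) = (\<Sum>j\<in>orbit \<rho> i - {i}. F (i, j)) + (\<Sum>j\<in>B - orbit \<rho> i. F (i, j))"
      using assms(1) finite_subset[OF sub(1)] by (subst sum.union_disjoint[symmetric]) auto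
  qed
  also have "\<dots> = (\<Sum>i\<in>B. (\<Sum>d=1..<card (orbit \<rho> i). F (i, (\<rho> ^^ d) i)) + (\<Sum>j\<in>B - orbit \<rho> i. F (i, j)))"
    by (intro sum.cong refl arg_cong2[where f="(+)"] sum_over_orbit[OF assms, where G="\<lambda>j. F (_, j)"])
  finally show ?thesis .
qed

definition invariant :: "('a \<Rightarrow> 'a) \<Rightarrow> 'a set \<Rightarrow> bool" where
  "invariant \<rho> S \<longleftrightarrow> (\<forall>x. \<rho> x \<in> S \<longleftrightarrow> x \<in> S)"

definition unseparated :: "'a set \<Rightarrow> ('a \<times> 'a) list \<Rightarrow> bool" where
  "unseparated S ps \<longleftrightarrow> (\<forall>(i, j)\<in>set ps. i \<in> S \<longleftrightarrow> j \<in> S)"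

text \<open>\<open>a\<close> and \<open>b\<close> lie in the same orbit of the group generated by \<open>\<rho>\<close> and the transpositions of the word.\<close>

definition linked :: "('a \<Rightarrow> 'a) \<Rightarrow> ('a \<times> 'a) list \<Rightarrow> 'a \<Rightarrow> 'a \<Rightarrow> bool" where
  "linked \<rho> ps a b \<longleftrightarrow> (\<forall>S. invariant \<rho> S \<and> unseparated S ps \<longrightarrow> (a \<in> S \<longleftrightarrow> b \<in> S))"

lemma invariant_transposition:
  assumes "i \<in> S \<longleftrightarrow> j \<in> S"
  shows "invariant (\<rho> \<circ> transposition i j) S \<longleftrightarrow> invariant \<rho> S"
proof -
  have t: "transposition i j x \<in> S \<longleftrightarrow> x \<in> S" for x
    using assms by (auto simp: Transposition.transpose_def)
  show ?thesis
  proof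
    assume "invariant (\<rho> \<circ> transposition i j) S"
    then have "\<rho> (transposition i j (transposition i j x)) \<in> S \<longleftrightarrow> transposition i j x \<in> S" for x
      unfolding invariant_def comp_apply by blast
    then show "invariant \<rho> S" using t by (simp add: invariant_def)
  qed (use t in \<open>simp add: invariant_def\<close>)
qed

lemma invariant_orbit_mem:
  assumes "invariant \<rho> S" "y \<in> orbit \<rho> x"
  shows "y \<in> S \<longleftrightarrow> x \<in> S"
  using assms(2) by induction (use assms(1) in \<open>auto simp: invariant_def\<close>)

context
  fixes B :: "'a set" and r m :: nat
  assumes fin: "finite B" and r: "r > 0" and cardB: "card B = r * m"
begin

lemma regular_iff_card:
  assumes "\<rho> permutes B"
  shows "regular r B \<rho> \<Longrightarrow> card (cycles B \<rho>) = m"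
proof -
  assume "regular r B \<rho>"
  then have "(\<Sum>C\<in>cycles B \<rho>. card C) = card (cycles B \<rho>) * r" by (simp add: regular_def)
  then show ?thesis using sum_card_cycles[OF fin assms] cardB r by simp
qed

lemma card_cycles_step:
  assumes "\<rho> permutes B" "(i, j) \<in> pairs B"
  shows "\<rho> \<circ> transposition i j permutes B"
    "j \<in> orbit \<rho> i \<Longrightarrow> card (cycles B (\<rho> \<circ> transposition i j)) = Suc (card (cycles B \<rho>))"
    "j \<notin> orbit \<rho> i \<Longrightarrow> Suc (card (cycles B (\<rho> \<circ> transposition i j))) = card (cycles B \<rho>)"
proof -
  have ij: "i \<in> B" "j \<in> B" "i \<noteq> j" using assms(2) by (auto simp: pairs_def)
  show "\<rho> \<circ> transposition i j permutes B" using ij by (intro permutes_comp_transpose[OF fin assms(1)])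
  show "card (cycles B (\<rho> \<circ> transposition i j)) = Suc (card (cycles B \<rho>))" if "j \<in> orbit \<rho> i"
  proof -
    from same_orbit_funpow[OF perm_of_permutes[OF fin assms(1)] that ij(3)]
    obtain d where d: "0 < d" "d < card (orbit \<rho> i)" "j = (\<rho> ^^ d) i" .
    then show ?thesis using cycles_cut(5)[OF fin assms(1) ij(1) d(1,2)] by simp
  qed
  show "Suc (card (cycles B (\<rho> \<circ> transposition i j))) = card (cycles B \<rho>)" if "j \<notin> orbit \<rho> i"
    using cycles_join(3)[OF fin assms(1) ij(1,2) that] .
qed

text \<open>Each letter raises the number of cycles by at most 1, and a regular permutation has \<open>m\<close> cycles.\<close>

lemma regular_act_length:
  assumes "\<rho> permutes B" "ps \<in> words B s" "regular r B (act \<rho> ps)"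
  shows "m \<le> s + card (cycles B \<rho>)"
  using assms
proof (induction ps arbitrary: \<rho> s)
  case Nil
  then show ?case using regular_iff_card[of \<rho>] by simp
next
  case (Cons p ps)
  obtain i j where p: "p = (i, j)" by (cases p)
  obtain s' where s: "s = Suc s'" "ps \<in> words B s'" "(i, j) \<in> pairs B" using Cons.prems(2) by (auto simp: words_def p)
  note step = card_cycles_step[OF Cons.prems(1) s(3)]
  have "m \<le> s' + card (cycles B (\<rho> \<circ> transposition i j))"
    by (rule Cons.IH[OF step(1) s(2)]) (use Cons.prems(3) p in \<open>simp add: comp_def\<close>)
  moreover have "card (cycles B (\<rho> \<circ> transposition i j)) \<le> Suc (card (cycles B \<rho>))"
    using step(2,3) by (cases "j \<in> orbit \<rho> i") auto
  ultimately show ?case using s by simp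
qed

lemma no_regular_words:
  assumes "\<rho> permutes B" "s + card (cycles B \<rho>) < m"
  shows "card {ps \<in> words B s. regular r B (act \<rho> ps)} = 0"
proof -
  have "{ps \<in> words B s. regular r B (act \<rho> ps)} = {}"
    using regular_act_length[OF assms(1), of _ s] assms(2) by fastforce
  then show ?thesis by (simp only: card.empty)
qed

text \<open>If all cycle lengths are multiples of \<open>r\<close>, then \<open>m\<close> cycles fill \<open>r m\<close> elements only if all have length \<open>r\<close>.\<close>

lemma prod_disc_coeff_of_full_rank:
  assumes "\<rho> permutes B" "card (cycles B \<rho>) = m"
  shows "(\<Prod>C\<in>cycles B \<rho>. disc_coeff r (card C)) = (if regular r B \<rho> then 1 else 0)"
proof (cases "regular r B \<rho>")
  case True
  then show ?thesis using r by (simp add: regular_def disc_coeff_def)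
next
  case False
  have "\<exists>C\<in>cycles B \<rho>. disc_coeff r (card C) = 0"
  proof (rule ccontr)
    assume "\<not> (\<exists>C\<in>cycles B \<rho>. disc_coeff r (card C) = 0)"
    then have "r dvd card C" if "C \<in> cycles B \<rho>" for C using that by (auto simp: disc_coeff_def split: if_splits)
    then have ge: "r \<le> card C" if "C \<in> cycles B \<rho>" for C
      using that cycle_card_pos[OF fin assms(1)] by (simp add: dvd_imp_le)
    have "(\<Sum>C\<in>cycles B \<rho>. card C) = (\<Sum>C\<in>cycles B \<rho>. r)"
      using sum_card_cycles[OF fin assms(1)] cardB assms(2) by simp
    then have "\<forall>C\<in>cycles B \<rho>. card C = r"
      using sum_mono_inv[of "\<lambda>_. r" "cycles B \<rho>" card] ge finite_cycles[OF fin assms(1)] by force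
    with False show False by (simp add: regular_def)
  qed
  then show ?thesis using False finite_cycles[OF fin assms(1)] by (auto intro: prod_zero)
qed

text \<open>As the length is minimal, every letter cuts a cycle. The recursion for the first letter is
\<open>disc_coeff_convolution\<close> for the cycle cut, and the total weight \<open>L / r - 1\<close> of the cycles is the number of letters.\<close>

theorem count_minimal_factorizations:
  assumes "\<rho> permutes B" "s + card (cycles B \<rho>) = m"
  shows "real (card {ps \<in> words B s. regular r B (act \<rho> ps)})
       = 2 ^ s * fact s * (\<Prod>C\<in>cycles B \<rho>. disc_coeff r (card C))"
  using assms
proof (induction s arbitrary: \<rho>)
  case 0
  have "{ps \<in> words B 0. regular r B (act \<rho> ps)} = (if regular r B \<rho> then {[]} else {})"
    by (auto simp: words_0)
  then show ?case using prod_disc_coeff_of_full_rank[of \<rho>] 0 by simp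
next
  case (Suc s)
  note per = Suc.prems(1)
  define t where "t = disc_coeff r"
  define K where "K = (2 ^ s * fact s :: real)"
  define P where "P C = (\<Prod>D\<in>cycles B \<rho> - {C}. t (card D))" for C
  let ?N = "\<lambda>p. real (card {ps \<in> words B s. regular r B (act \<rho> (p # ps))})"
  have tP: "t (card C) * P C = (\<Prod>D\<in>cycles B \<rho>. t (card D))" if "C \<in> cycles B \<rho>" for C
    unfolding P_def using prod.remove[OF finite_cycles[OF fin per] that, of "\<lambda>D. t (card D)"] by simp
  have cut: "?N (i, (\<rho> ^^ d) i) = K * (t d * t (card (orbit \<rho> i) - d)) * P (orbit \<rho> i)"
    if i: "i \<in> B" and d: "d \<in> {1..<card (orbit \<rho> i)}" for i d
  proof -
    have d': "0 < d" "d < card (orbit \<rho> i)" using d by auto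
    define \<rho>' where "\<rho>' = \<rho> \<circ> transposition i ((\<rho> ^^ d) i)"
    have "(\<rho> ^^ d) i \<in> B" using i permutes_in_funpow_image[OF per] by blast
    then have per': "\<rho>' permutes B" unfolding \<rho>'_def using i by (intro permutes_comp_transpose[OF fin per])
    have "s + card (cycles B \<rho>') = m" using cycles_cut(5)[OF fin per i d'] Suc.prems(2) by (simp add: \<rho>'_def)
    from Suc.IH[OF per' this] show ?thesis
      using cycles_cut_prod[OF fin per i d', of t] by (simp add: \<rho>'_def K_def t_def P_def comp_def)
  qed
  have join: "?N (i, j) = 0" if "i \<in> B" "j \<in> B - orbit \<rho> i" for i j
  proof -
    have ij: "(i, j) \<in> pairs B" using that self_in_orbit[OF fin per, of i] by (auto simp: pairs_def)
    note st = card_cycles_step[OF per ij]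
    have "s + card (cycles B (\<rho> \<circ> transposition i j)) < m" using st(3) that Suc.prems(2) by auto
    from no_regular_words[OF st(1) this] show ?thesis by simp
  qed
  have "real (card {ps \<in> words B (Suc s). regular r B (act \<rho> ps)}) = (\<Sum>p\<in>pairs B. ?N p)"
    by (subst card_words_Suc[OF fin]) simp
  also have "\<dots> = (\<Sum>i\<in>B. (\<Sum>d=1..<card (orbit \<rho> i). ?N (i, (\<rho> ^^ d) i)) + (\<Sum>j\<in>B - orbit \<rho> i. ?N (i, j)))"
    by (rule sum_pairs[OF fin per])
  also have "\<dots> = (\<Sum>i\<in>B. (\<Sum>d=1..<card (orbit \<rho> i). K * (t d * t (card (orbit \<rho> i) - d)) * P (orbit \<rho> i)))"
    by (intro sum.cong refl) (simp add: cut join del: act.simps)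
  also have "\<dots> = (\<Sum>C\<in>cycles B \<rho>. real (card C) * (\<Sum>d=1..<card C. K * (t d * t (card C - d)) * P C))"
    by (rule sum_by_cycles[OF fin per])
  also have "\<dots> = (\<Sum>C\<in>cycles B \<rho>. 2 * K * ((real (card C) / real r - 1) * (\<Prod>D\<in>cycles B \<rho>. t (card D))))"
  proof (intro sum.cong refl)
    fix C assume C: "C \<in> cycles B \<rho>"
    have "real (card C) * (\<Sum>d=1..<card C. K * (t d * t (card C - d)) * P C) = 2 * K * P C * (real (card C) / 2 * (\<Sum>d=1..<card C. t d * t (card C - d)))"
      by (simp add: sum_distrib_left sum_distrib_right mult_ac)
    also have "real (card C) / 2 * (\<Sum>d=1..<card C. t d * t (card C - d)) = (real (card C) / real r - 1) * t (card C)"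
      unfolding t_def by (rule disc_coeff_convolution[OF r cycle_card_pos[OF fin per C], symmetric])
    finally show "real (card C) * (\<Sum>d=1..<card C. K * (t d * t (card C - d)) * P C) = 2 * K * ((real (card C) / real r - 1) * (\<Prod>D\<in>cycles B \<rho>. t (card D)))"
      unfolding tP[OF C, symmetric] by (simp add: mult_ac)
  qed
  also have "\<dots> = 2 * K * (\<Prod>D\<in>cycles B \<rho>. t (card D)) * (\<Sum>C\<in>cycles B \<rho>. real (card C) / real r - 1)"
    by (simp add: sum_distrib_left mult_ac)
  also have "(\<Sum>C\<in>cycles B \<rho>. real (card C) / real r - 1) = real (\<Sum>C\<in>cycles B \<rho>. card C) / real r - real (card (cycles B \<rho>))"
    by (simp add: sum_subtractf sum_divide_distrib)
  also have "\<dots> = real (Suc s)"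
    using sum_card_cycles[OF fin per] cardB r Suc.prems(2) by (simp flip: of_nat_diff)
  finally show ?case by (simp add: K_def t_def mult_ac)
qed

lemma invariant_orbit:
  assumes "\<rho> permutes B"
  shows "invariant \<rho> (orbit \<rho> a)" "invariant \<rho> (- orbit \<rho> a)"
proof -
  note perm = perm_of_permutes[OF fin assms]
  have "\<rho> x \<in> orbit \<rho> a \<longleftrightarrow> x \<in> orbit \<rho> a" for x
    using permutation_orbit_step[OF perm] orbit_eq_if_mem[OF perm] permutation_self_in_orbit[OF perm] orbit.step by metis
  then show "invariant \<rho> (orbit \<rho> a)" "invariant \<rho> (- orbit \<rho> a)" by (simp_all add: invariant_def)
qed

text \<open>No letter of a minimal word joins cycles.\<close>

lemma minimal_words_respect_cycles:
  assumes "\<rho> permutes B" "ps \<in> words B s" "regular r B (act \<rho> ps)" "s + card (cycles B \<rho>) = m" "invariant \<rho> S"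
  shows "unseparated S ps"
  using assms
proof (induction ps arbitrary: \<rho> s)
  case (Cons p ps)
  obtain i j where p: "p = (i, j)" by (cases p)
  obtain s' where s: "s = Suc s'" "ps \<in> words B s'" "(i, j) \<in> pairs B" using Cons.prems(2) by (auto simp: words_def p)
  note step = card_cycles_step[OF Cons.prems(1) s(3)]
  have reg: "regular r B (act (\<rho> \<circ> transposition i j) ps)" using Cons.prems(3) p by simp
  have "j \<in> orbit \<rho> i"
  proof (rule ccontr)
    assume "j \<notin> orbit \<rho> i"
    then show False using regular_act_length[OF step(1) s(2) reg] step(3) Cons.prems(4) s(1) by simp
  qed
  then have "j \<in> S \<longleftrightarrow> i \<in> S" using invariant_orbit_mem[OF Cons.prems(5)] by blast
  moreover have "unseparated S ps"
    by (rule Cons.IH[OF step(1) s(2) reg])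
      (use step(2)[OF \<open>j \<in> orbit \<rho> i\<close>] Cons.prems(4,5) s(1) calculation invariant_transposition[of i S j \<rho>] in \<open>simp_all add: comp_def\<close>)
  ultimately show ?case by (simp add: unseparated_def p)
qed (simp add: unseparated_def)

text \<open>In a word with two letters more than a minimal one, exactly one letter \<open>(u v)\<close> joins two cycles; the letters
before it and after it only cut, so it is the only one that can be separated by an invariant set.\<close>

lemma one_join_words:
  assumes "\<rho> permutes B" "ps \<in> words B s" "regular r B (act \<rho> ps)" "s + card (cycles B \<rho>) = m + 2"
  shows "\<exists>u v. \<forall>S. invariant \<rho> S \<longrightarrow> (unseparated S ps \<longleftrightarrow> (u \<in> S \<longleftrightarrow> v \<in> S))"
  using assms
proof (induction ps arbitrary: \<rho> s)
  case Nil
  then show ?case using regular_iff_card[of \<rho>] by (simp add: words_def)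
next
  case (Cons p ps)
  obtain i j where p: "p = (i, j)" by (cases p)
  obtain s' where s: "s = Suc s'" "ps \<in> words B s'" "(i, j) \<in> pairs B" using Cons.prems(2) by (auto simp: words_def p)
  note step = card_cycles_step[OF Cons.prems(1) s(3)]
  have reg: "regular r B (act (\<rho> \<circ> transposition i j) ps)" using Cons.prems(3) p by simp
  show ?case
  proof (cases "j \<in> orbit \<rho> i")
    case True
    obtain u v where uv: "\<And>S. invariant (\<rho> \<circ> transposition i j) S \<Longrightarrow> (unseparated S ps \<longleftrightarrow> (u \<in> S \<longleftrightarrow> v \<in> S))"
      using Cons.IH[OF step(1) s(2) reg] step(2)[OF True] Cons.prems(4) s(1) by (auto simp: comp_def)
    have "unseparated S (p # ps) \<longleftrightarrow> (u \<in> S \<longleftrightarrow> v \<in> S)" if "invariant \<rho> S" for S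
    proof -
      have ij: "i \<in> S \<longleftrightarrow> j \<in> S" using invariant_orbit_mem[OF that True] by simp
      then show ?thesis using uv[of S] invariant_transposition[OF ij] that by (simp add: unseparated_def p)
    qed
    then show ?thesis by blast
  next
    case False
    have "unseparated S (p # ps) \<longleftrightarrow> (i \<in> S \<longleftrightarrow> j \<in> S)" if "invariant \<rho> S" for S
    proof
      assume ij: "i \<in> S \<longleftrightarrow> j \<in> S"
      have "unseparated S ps"
        by (rule minimal_words_respect_cycles[OF step(1) s(2) reg])
          (use step(3)[OF False] Cons.prems(4) s(1) invariant_transposition[OF ij] that in auto)
      then show "unseparated S (p # ps)" using ij by (simp add: unseparated_def p)
    qed (simp add: unseparated_def p)
    then show ?thesis by blast
  qed
qed

lemma linked_iff_orbits:
  assumes per: "\<rho> permutes B"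
    and uv: "\<And>S. invariant \<rho> S \<Longrightarrow> unseparated S ps \<longleftrightarrow> (u \<in> S \<longleftrightarrow> v \<in> S)"
    and ab: "b \<notin> orbit \<rho> a"
  shows "linked \<rho> ps a b \<longleftrightarrow> (u \<in> orbit \<rho> a \<and> v \<in> orbit \<rho> b) \<or> (v \<in> orbit \<rho> a \<and> u \<in> orbit \<rho> b)"
proof -
  note perm = perm_of_permutes[OF fin per]
  have self: "x \<in> orbit \<rho> x" for x by (rule permutation_self_in_orbit[OF perm])
  have disj: "x \<notin> orbit \<rho> b" if "x \<in> orbit \<rho> a" for x
    using that ab self orbit_eq_if_mem[OF perm] by metis
  have ba: "a \<notin> orbit \<rho> b" using disj self by blast
  show ?thesis
  proof
    assume l: "linked \<rho> ps a b"
    have "unseparated (orbit \<rho> a) ps \<longrightarrow> (a \<in> orbit \<rho> a \<longleftrightarrow> b \<in> orbit \<rho> a)"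
      using l invariant_orbit(1)[OF per] unfolding linked_def by blast
    then have "u \<in> orbit \<rho> a \<longleftrightarrow> v \<notin> orbit \<rho> a" using uv[OF invariant_orbit(1)[OF per]] ab self by blast
    moreover have "unseparated (orbit \<rho> b) ps \<longrightarrow> (a \<in> orbit \<rho> b \<longleftrightarrow> b \<in> orbit \<rho> b)"
      using l invariant_orbit(1)[OF per] unfolding linked_def by blast
    then have "u \<in> orbit \<rho> b \<longleftrightarrow> v \<notin> orbit \<rho> b" using uv[OF invariant_orbit(1)[OF per]] ba self by blast
    ultimately show "(u \<in> orbit \<rho> a \<and> v \<in> orbit \<rho> b) \<or> (v \<in> orbit \<rho> a \<and> u \<in> orbit \<rho> b)"
      using disj by blast
  next
    assume join: "(u \<in> orbit \<rho> a \<and> v \<in> orbit \<rho> b) \<or> (v \<in> orbit \<rho> a \<and> u \<in> orbit \<rho> b)"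
    show "linked \<rho> ps a b"
      unfolding linked_def
    proof (intro allI impI)
      fix S assume S: "invariant \<rho> S \<and> unseparated S ps"
      note mem = invariant_orbit_mem[OF conjunct1[OF S]]
      have "u \<in> S \<longleftrightarrow> v \<in> S" using S uv[of S] by blast
      with join show "a \<in> S \<longleftrightarrow> b \<in> S" using mem[of _ a] mem[of _ b] by auto
    qed
  qed
qed

text \<open>The letter \<open>(u v)\<close> that joins cycles later on decides which of the pieces are linked. If the first letter cuts the
cycle of \<open>a\<close>, a link from \<open>a\<close> to \<open>b\<close> passes to exactly one of the two pieces.\<close>

lemma linked_Cons_cut:
  assumes per: "\<rho> permutes B" and p: "(i, j) \<in> pairs B" "j \<in> orbit \<rho> i"
    and ps: "ps \<in> words B s" "regular r B (act (\<rho> \<circ> transposition i j) ps)" "Suc s + card (cycles B \<rho>) = m + 2"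
    and ab: "b \<notin> orbit \<rho> a"
  defines "\<rho>' \<equiv> \<rho> \<circ> transposition i j"
  shows "i \<notin> orbit \<rho> a \<Longrightarrow> i \<notin> orbit \<rho> b \<Longrightarrow> linked \<rho> ((i, j) # ps) a b \<longleftrightarrow> linked \<rho>' ps a b"
    "i \<in> orbit \<rho> a \<Longrightarrow> linked \<rho> ((i, j) # ps) a b \<longleftrightarrow> linked \<rho>' ps i b \<or> linked \<rho>' ps j b"
    "i \<in> orbit \<rho> a \<Longrightarrow> \<not> (linked \<rho>' ps i b \<and> linked \<rho>' ps j b)"
    "i \<in> orbit \<rho> b \<Longrightarrow> linked \<rho> ((i, j) # ps) a b \<longleftrightarrow> linked \<rho>' ps a i \<or> linked \<rho>' ps a j"
    "i \<in> orbit \<rho> b \<Longrightarrow> \<not> (linked \<rho>' ps a i \<and> linked \<rho>' ps a j)"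
proof -
  note perm = perm_of_permutes[OF fin per]
  note step = card_cycles_step[OF per p(1), folded \<rho>'_def]
  note perm' = perm_of_permutes[OF fin step(1)]
  have self: "x \<in> orbit \<rho> x" "x \<in> orbit \<rho>' x" for x
    using permutation_self_in_orbit perm perm' by metis+
  have ij: "i \<noteq> j" using p(1) by (auto simp: pairs_def)
  obtain d where d: "0 < d" "d < card (orbit \<rho> i)" "j = (\<rho> ^^ d) i"
    using p(2) ij by (rule same_orbit_funpow[OF perm])
  note cut = cut_orbits[OF perm d, folded \<rho>'_def]
  have "\<exists>u v. \<forall>S. invariant \<rho>' S \<longrightarrow> (unseparated S ps \<longleftrightarrow> (u \<in> S \<longleftrightarrow> v \<in> S))"
    by (rule one_join_words[OF step(1) ps(1) ps(2)[folded \<rho>'_def]]) (use step(2)[OF p(2)] ps(3) in simp)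
  then obtain u v where uv': "\<And>S. invariant \<rho>' S \<Longrightarrow> unseparated S ps \<longleftrightarrow> (u \<in> S \<longleftrightarrow> v \<in> S)" by blast
  have uv: "unseparated S ((i, j) # ps) \<longleftrightarrow> (u \<in> S \<longleftrightarrow> v \<in> S)" if "invariant \<rho> S" for S
  proof -
    have ij: "i \<in> S \<longleftrightarrow> j \<in> S" using invariant_orbit_mem[OF that p(2)] by simp
    then show ?thesis using uv'[of S] invariant_transposition[OF ij] that by (simp add: unseparated_def \<rho>'_def)
  qed
  have link: "linked \<rho> ((i, j) # ps) a b \<longleftrightarrow> (u \<in> orbit \<rho> a \<and> v \<in> orbit \<rho> b) \<or> (v \<in> orbit \<rho> a \<and> u \<in> orbit \<rho> b)"
    by (rule linked_iff_orbits[OF per _ ab]) (rule uv)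
  have link': "linked \<rho>' ps x y \<longleftrightarrow> (u \<in> orbit \<rho>' x \<and> v \<in> orbit \<rho>' y) \<or> (v \<in> orbit \<rho>' x \<and> u \<in> orbit \<rho>' y)"
    if "y \<notin> orbit \<rho>' x" for x y
    by (rule linked_iff_orbits[OF step(1) _ that]) (rule uv')
  have Ci: "orbit \<rho> x = orbit \<rho> i" if "i \<in> orbit \<rho> x" for x using orbit_eq_if_mem[OF perm that] by simp
  have sub: "orbit \<rho>' i \<subseteq> orbit \<rho> i" "orbit \<rho>' j \<subseteq> orbit \<rho> i" using cut(3) by auto
  have out: "orbit \<rho>' x = orbit \<rho> x" if "i \<notin> orbit \<rho> x" for x
  proof (rule cut(5))
    show "x \<notin> orbit \<rho> i" using that orbit_eq_if_mem[OF perm] self by metis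
  qed
  have ba: "a \<notin> orbit \<rho> b" using ab orbit_eq_if_mem[OF perm] self by metis
  show "linked \<rho> ((i, j) # ps) a b \<longleftrightarrow> linked \<rho>' ps a b" if "i \<notin> orbit \<rho> a" "i \<notin> orbit \<rho> b"
    unfolding link link'[of b a, unfolded out[OF that(1)], OF ab] out[OF that(1)] out[OF that(2)] ..
  {
    assume a: "i \<in> orbit \<rho> a"
    have b: "i \<notin> orbit \<rho> b" using a ab ba orbit_eq_if_mem[OF perm] self by metis
    have nb: "b \<notin> orbit \<rho>' i" "b \<notin> orbit \<rho>' j" using sub ab Ci[OF a] by auto
    show "linked \<rho> ((i, j) # ps) a b \<longleftrightarrow> linked \<rho>' ps i b \<or> linked \<rho>' ps j b"
      unfolding link link'[OF nb(1)] link'[OF nb(2)] Ci[OF a] out[OF b] cut(3)[symmetric] by blast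
    have "orbit \<rho> b \<inter> orbit \<rho> i = {}" using orbit_disjoint[OF perm] b self by metis
    then show "\<not> (linked \<rho>' ps i b \<and> linked \<rho>' ps j b)"
      unfolding link'[OF nb(1)] link'[OF nb(2)] out[OF b] using cut(4) sub by blast
  }
  {
    assume b: "i \<in> orbit \<rho> b"
    have a: "i \<notin> orbit \<rho> a" using b ab ba orbit_eq_if_mem[OF perm] self by metis
    have dis: "orbit \<rho> a \<inter> orbit \<rho> i = {}" using orbit_disjoint[OF perm] a self by metis
    have na: "i \<notin> orbit \<rho>' a" "j \<notin> orbit \<rho>' a" unfolding out[OF a] using dis p(2) self by blast+
    show "linked \<rho> ((i, j) # ps) a b \<longleftrightarrow> linked \<rho>' ps a i \<or> linked \<rho>' ps a j"
      unfolding link link'[OF na(1)] link'[OF na(2)] Ci[OF b] out[OF a] cut(3)[symmetric] by blast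
    show "\<not> (linked \<rho>' ps a i \<and> linked \<rho>' ps a j)"
      unfolding link'[OF na(1)] link'[OF na(2)] out[OF a] using cut(4) sub dis by blast
  }
qed

text \<open>The first letter is the only one that joins, hence it must connect the cycle of \<open>a\<close> to that of \<open>b\<close>.\<close>

lemma linked_Cons_join:
  assumes per: "\<rho> permutes B" and p: "(i, j) \<in> pairs B" "j \<notin> orbit \<rho> i"
    and ps: "ps \<in> words B s" "regular r B (act (\<rho> \<circ> transposition i j) ps)" "Suc s + card (cycles B \<rho>) = m + 2"
    and ab: "b \<notin> orbit \<rho> a"
  shows "linked \<rho> ((i, j) # ps) a b \<longleftrightarrow> (i \<in> orbit \<rho> a \<and> j \<in> orbit \<rho> b) \<or> (j \<in> orbit \<rho> a \<and> i \<in> orbit \<rho> b)"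
proof (rule linked_iff_orbits[OF per _ ab])
  note step = card_cycles_step[OF per p(1)]
  fix S assume S: "invariant \<rho> S"
  show "unseparated S ((i, j) # ps) \<longleftrightarrow> (i \<in> S \<longleftrightarrow> j \<in> S)"
  proof
    assume ij: "i \<in> S \<longleftrightarrow> j \<in> S"
    have "unseparated S ps"
      by (rule minimal_words_respect_cycles[OF step(1) ps(1,2)])
        (use step(3)[OF p(2)] ps(3) invariant_transposition[OF ij] S in auto)
    then show "unseparated S ((i, j) # ps)" using ij by (simp add: unseparated_def)
  qed (simp add: unseparated_def)
qed

end

context
  fixes B :: "'a set" and r m :: nat
  assumes fin: "finite B" and r: "r > 0" and cardB: "card B = r * m"
begin

text \<open>The case of the empty word. If no disc number vanishes, the \<open>m\<close> other cycles already fill all \<open>r m\<close> elements, leaving none for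
the cycles of \<open>a\<close> and \<open>b\<close>.\<close>

lemma annulus_coeff_times_disc_coeffs_eq_0:
  assumes "\<rho> permutes B" "card (cycles B \<rho>) = m + 2" "a \<in> B" "b \<in> B" "b \<notin> orbit \<rho> a"
  shows "annulus_coeff r (card (orbit \<rho> a)) (card (orbit \<rho> b)) * (\<Prod>C\<in>cycles B \<rho> - {orbit \<rho> a, orbit \<rho> b}. disc_coeff r (card C)) = 0"
proof (rule ccontr)
  let ?O = "cycles B \<rho> - {orbit \<rho> a, orbit \<rho> b}"
  assume "\<not> ?thesis"
  moreover have finO: "finite ?O" using finite_cycles[OF fin assms(1)] by simp
  ultimately have "r dvd card C" if "C \<in> ?O" for C
    using that by (auto simp: disc_coeff_def split: if_splits)
  then have ge: "r \<le> card C" if "C \<in> ?O" for C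
    using that cycle_card_pos[OF fin assms(1)] by (simp add: dvd_imp_le)
  have ab: "orbit \<rho> a \<in> cycles B \<rho>" "orbit \<rho> b \<in> cycles B \<rho>" "orbit \<rho> a \<noteq> orbit \<rho> b"
    using assms(3-5) self_in_orbit[OF fin assms(1)] by (auto simp: cycles_def)
  have "card ?O = m" using ab assms(2) finite_cycles[OF fin assms(1)] by (simp add: card_Diff_subset)
  then have "r * m \<le> (\<Sum>C\<in>?O. card C)" using sum_mono[of ?O "\<lambda>_. r" card] ge by (simp add: mult.commute)
  moreover have "(\<Sum>C\<in>cycles B \<rho>. card C) = card (orbit \<rho> a) + (\<Sum>C\<in>cycles B \<rho> - {orbit \<rho> a}. card C)"
    by (rule sum.remove[OF finite_cycles[OF fin assms(1)] ab(1)])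
  moreover have "(\<Sum>C\<in>cycles B \<rho> - {orbit \<rho> a}. card C) \<ge> (\<Sum>C\<in>?O. card C)"
    using finite_cycles[OF fin assms(1)] by (intro sum_mono2) auto
  ultimately show False
    using sum_card_cycles[OF fin assms(1)] cardB cycle_card_pos[OF fin assms(1) ab(1)] by linarith
qed

text \<open>Induction on the length by the choice of the first letter. A letter within a third cycle cuts that cycle; a letter within the cycle of
\<open>a\<close> or \<open>b\<close> cuts off a piece that is not linked to the other one; a letter between \<open>a\<close>'s and \<open>b\<close>'s cycles joins them and leaves a
minimal word; all other letters are impossible. Summed up, the three kinds are \<open>disc_coeff_convolution\<close> and the terms of
\<open>annulus_convolution\<close>.\<close>

theorem count_linked_factorizations:
  assumes "\<rho> permutes B" "s + card (cycles B \<rho>) = m + 2" "a \<in> B" "b \<in> B" "b \<notin> orbit \<rho> a"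
  shows "real (card {ps \<in> words B s. regular r B (act \<rho> ps) \<and> linked \<rho> ps a b})
       = 2 ^ s * fact s * (annulus_coeff r (card (orbit \<rho> a)) (card (orbit \<rho> b)) *
           (\<Prod>C\<in>cycles B \<rho> - {orbit \<rho> a, orbit \<rho> b}. disc_coeff r (card C)))"
  using assms
proof (induction s arbitrary: \<rho> a b)
  case 0
  have "\<not> linked \<rho> [] a b"
  proof
    assume l: "linked \<rho> [] a b"
    have "invariant \<rho> (orbit \<rho> a)" using invariant_orbit(1)[OF fin r cardB 0(1)] .
    then have "a \<in> orbit \<rho> a \<longleftrightarrow> b \<in> orbit \<rho> a" using l by (simp add: linked_def unseparated_def)
    then show False using 0 self_in_orbit[OF fin 0(1)] by simp
  qed
  then have empty: "{ps \<in> words B 0. regular r B (act \<rho> ps) \<and> linked \<rho> ps a b} = {}" by (auto simp: words_0)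
  have "card (cycles B \<rho>) = m + 2" using 0(2) by simp
  note zero = annulus_coeff_times_disc_coeffs_eq_0[OF 0(1) this 0(3-5)]
  show ?case unfolding empty zero by simp
next
  case (Suc s)
  note per = Suc.prems(1) and sn = Suc.prems(2) and aB = Suc.prems(3) and bB = Suc.prems(4) and ab = Suc.prems(5)
  note perm = perm_of_permutes[OF fin per]
  note fc = finite_cycles[OF fin per]
  have self: "x \<in> orbit \<rho> x" for x by (rule self_in_orbit[OF fin per])
  have IH: "real (card {ps \<in> words B s. regular r B (act \<rho>' ps) \<and> linked \<rho>' ps a b})
       = 2 ^ s * fact s * (annulus_coeff r (card (orbit \<rho>' a)) (card (orbit \<rho>' b)) *
           (\<Prod>C\<in>cycles B \<rho>' - {orbit \<rho>' a, orbit \<rho>' b}. disc_coeff r (card C)))"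
    if "\<rho>' permutes B" "s + card (cycles B \<rho>') = m + 2" "a \<in> B" "b \<in> B" "b \<notin> orbit \<rho>' a" for \<rho>' a b
    using Suc.IH[of \<rho>' a b] that by simp
  define t where "t = disc_coeff r"
  define w where "w = annulus_coeff r"
  define K where "K = (2 ^ s * fact s :: real)"
  define A C2 where "A = orbit \<rho> a" and "C2 = orbit \<rho> b"
  define Oth where "Oth = cycles B \<rho> - {A, C2}"
  define P where "P = (\<Prod>C\<in>Oth. t (card C))"
  define \<alpha> \<beta> where "\<alpha> = card A" and "\<beta> = card C2"
  let ?N = "\<lambda>p. real (card {ps \<in> words B s. regular r B (act \<rho> (p # ps)) \<and> linked \<rho> (p # ps) a b})"
  have AC: "A \<in> cycles B \<rho>" "C2 \<in> cycles B \<rho>" "A \<noteq> C2" "A \<inter> C2 = {}"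
    using aB bB ab self orbit_disjoint[OF perm] unfolding A_def C2_def cycles_def by blast+
  have cyc_split: "cycles B \<rho> = insert A (insert C2 Oth)" "A \<notin> insert C2 Oth" "C2 \<notin> Oth" "finite Oth"
    using AC fc by (auto simp: Oth_def)
  have pos: "0 < \<alpha>" "0 < \<beta>" unfolding \<alpha>_def \<beta>_def using cycle_card_pos[OF fin per] AC by auto
  have orb: "orbit \<rho> i = C" if "C \<in> cycles B \<rho>" "i \<in> C" for i C
    using cycle_eq_orbit[OF fin per that] by simp
  have b_not: "b \<notin> A" "a \<notin> C2" using ab self orbit_eq_if_mem[OF perm] unfolding A_def C2_def by metis+

  have cut_facts: "j \<in> B" "(i, j) \<in> pairs B" "j \<in> orbit \<rho> i" "\<rho>' permutes B" "s + card (cycles B \<rho>') = m + 2"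
    if i: "i \<in> B" and d: "d \<in> {1..<card (orbit \<rho> i)}" and j: "j = (\<rho> ^^ d) i" and \<rho>': "\<rho>' = \<rho> \<circ> transposition i j"
    for i j d \<rho>'
  proof -
    have d': "0 < d" "d < card (orbit \<rho> i)" using d by auto
    show jo: "j \<in> orbit \<rho> i" unfolding j by (intro funpow_in_orbit self)
    then show jB: "j \<in> B" using permutes_orbit_subset[OF per i] by auto
    show "\<rho>' permutes B" unfolding \<rho>' using i jB by (intro permutes_comp_transpose[OF fin per])
    have "(\<rho> ^^ d) i \<noteq> (\<rho> ^^ 0) i"
      using inj_onD[OF orbit_card_cycle(2)[OF perm self[of i]], of d 0] d' by auto
    then show "(i, j) \<in> pairs B" using i jB by (auto simp: pairs_def j)
    show "s + card (cycles B \<rho>') = m + 2" using cycles_cut(5)[OF fin per i d'] sn by (simp add: \<rho>' j)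
  qed

  have cut_other: "?N (i, (\<rho> ^^ d) i) = K * w \<alpha> \<beta> * (t d * t (card C - d)) * (\<Prod>D\<in>Oth - {C}. t (card D))"
    if C: "C \<in> Oth" and i: "i \<in> C" and d: "d \<in> {1..<card C}" for C i d
  proof -
    have Ci: "orbit \<rho> i = C" using C i by (intro orb) (auto simp: Oth_def)
    have iB: "i \<in> B" using C i cycle_subset[OF fin per] by (auto simp: Oth_def)
    define j where "j = (\<rho> ^^ d) i"
    define \<rho>' where "\<rho>' = \<rho> \<circ> transposition i j"
    have d': "d \<in> {1..<card (orbit \<rho> i)}" "0 < d" "d < card (orbit \<rho> i)" using d Ci by auto
    note cf = cut_facts[OF iB d'(1) j_def \<rho>'_def]
    note cut = cut_orbits[OF perm d'(2,3) j_def, folded \<rho>'_def]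
    note cc = cycles_cut[OF fin per iB d'(2,3), folded j_def, folded \<rho>'_def]
    have iAC: "i \<notin> orbit \<rho> a" "i \<notin> orbit \<rho> b"
      using C Ci orbit_eq_if_mem[OF perm] unfolding Oth_def A_def C2_def by blast+
    have ab_out: "a \<notin> orbit \<rho> i" "b \<notin> orbit \<rho> i"
      using C Ci orbit_eq_if_mem[OF perm] unfolding Oth_def A_def C2_def by blast+
    have oa: "orbit \<rho>' a = A" "orbit \<rho>' b = C2" using cut(5) ab_out by (simp_all add: A_def C2_def)
    have "?N (i, j) = real (card {ps \<in> words B s. regular r B (act \<rho>' ps) \<and> linked \<rho>' ps a b})"
    proof -
      have "{ps \<in> words B s. regular r B (act \<rho> ((i, j) # ps)) \<and> linked \<rho> ((i, j) # ps) a b}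
          = {ps \<in> words B s. regular r B (act \<rho>' ps) \<and> linked \<rho>' ps a b}"
        using linked_Cons_cut(1)[OF fin r cardB per cf(2,3) _ _ sn ab iAC] unfolding \<rho>'_def by auto
      then show ?thesis by simp
    qed
    also have "\<dots> = K * (w \<alpha> \<beta> * (\<Prod>C\<in>cycles B \<rho>' - {A, C2}. t (card C)))"
      using IH[OF cf(4,5) aB bB] ab unfolding oa K_def w_def \<alpha>_def \<beta>_def t_def by (simp add: A_def)
    also have "cycles B \<rho>' - {A, C2} = insert (orbit \<rho>' i) (insert (orbit \<rho>' j) (Oth - {C}))"
      unfolding cc(1) Ci Oth_def using cc(3,4) AC by auto
    also have "(\<Prod>C\<in>insert (orbit \<rho>' i) (insert (orbit \<rho>' j) (Oth - {C})). t (card C)) = t (card C - d) * (t d * (\<Prod>D\<in>Oth - {C}. t (card D)))"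
      using cc(2-4) cyc_split(4) cut(1,2) Ci by (subst prod.insert prod.insert; simp add: Oth_def)+
    finally show ?thesis unfolding j_def by (simp add: mult_ac)
  qed

  \<comment> \<open>Exactly one of the two pieces of \<open>A\<close> stays linked to \<open>b\<close>, so the words are counted by two disjoint sets.\<close>
  have cut_A: "?N (i, (\<rho> ^^ d) i) = K * P * (w (\<alpha> - d) \<beta> * t d + w d \<beta> * t (\<alpha> - d))"
    if i: "i \<in> A" and d: "d \<in> {1..<\<alpha>}" for i d
  proof -
    have Ci: "orbit \<rho> i = A" using AC i by (intro orb)
    have iB: "i \<in> B" using AC i cycle_subset[OF fin per] by auto
    define j where "j = (\<rho> ^^ d) i"
    define \<rho>' where "\<rho>' = \<rho> \<circ> transposition i j"
    have d': "d \<in> {1..<card (orbit \<rho> i)}" "0 < d" "d < card (orbit \<rho> i)" using d Ci by (auto simp: \<alpha>_def)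
    note cf = cut_facts[OF iB d'(1) j_def \<rho>'_def]
    note cut = cut_orbits[OF perm d'(2,3) j_def, folded \<rho>'_def]
    note cc = cycles_cut[OF fin per iB d'(2,3), folded j_def, folded \<rho>'_def]
    have oa: "orbit \<rho>' b = C2" using cut(5)[of b] b_not(1) Ci by (simp add: C2_def)
    have ia: "i \<in> orbit \<rho> a" using i by (simp add: A_def)
    have nb: "b \<notin> orbit \<rho>' i" "b \<notin> orbit \<rho>' j" using cut(3) b_not(1) Ci by auto
    define R where "R x = {ps \<in> words B s. regular r B (act \<rho>' ps) \<and> linked \<rho>' ps x b}" for x
    have "?N (i, j) = real (card (R i \<union> R j))"
    proof -
      have "{ps \<in> words B s. regular r B (act \<rho> ((i, j) # ps)) \<and> linked \<rho> ((i, j) # ps) a b} = R i \<union> R j"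
        using linked_Cons_cut(2)[OF fin r cardB per cf(2,3) _ _ sn ab ia] unfolding \<rho>'_def R_def by auto
      then show ?thesis by simp
    qed
    also have "\<dots> = real (card (R i)) + real (card (R j))"
    proof -
      have "R i \<inter> R j = {}"
        using linked_Cons_cut(3)[OF fin r cardB per cf(2,3) _ _ sn ab ia] unfolding \<rho>'_def R_def by auto
      then show ?thesis using finite_words[OF fin] by (simp add: R_def card_Un_disjoint)
    qed
    also have "real (card (R i)) = K * (w (\<alpha> - d) \<beta> * (\<Prod>C\<in>cycles B \<rho>' - {orbit \<rho>' i, C2}. t (card C)))"
      using IH[OF cf(4,5) iB bB nb(1)] cut(2) unfolding oa R_def K_def w_def \<alpha>_def \<beta>_def t_def Ci by simp
    also have "cycles B \<rho>' - {orbit \<rho>' i, C2} = insert (orbit \<rho>' j) Oth"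
      unfolding cc(1) Ci Oth_def using cc(2-4) AC by auto
    also have "(\<Prod>C\<in>insert (orbit \<rho>' j) Oth. t (card C)) = t d * P"
      using cc(4) cyc_split(4) cut(1) by (subst prod.insert) (auto simp: P_def Oth_def)
    also have "real (card (R j)) = K * (w d \<beta> * (\<Prod>C\<in>cycles B \<rho>' - {orbit \<rho>' j, C2}. t (card C)))"
      using IH[OF cf(4,5) cf(1) bB nb(2)] cut(1) unfolding oa R_def K_def w_def \<beta>_def t_def by simp
    also have "cycles B \<rho>' - {orbit \<rho>' j, C2} = insert (orbit \<rho>' i) Oth"
      unfolding cc(1) Ci Oth_def using cc(2-4) AC by auto
    also have "(\<Prod>C\<in>insert (orbit \<rho>' i) Oth. t (card C)) = t (\<alpha> - d) * P"
      using cc(3) cyc_split(4) cut(2) Ci by (subst prod.insert) (auto simp: P_def Oth_def \<alpha>_def)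
    finally show ?thesis unfolding j_def by (simp add: algebra_simps)
  qed

  have cut_C2: "?N (i, (\<rho> ^^ d) i) = K * P * (w \<alpha> (\<beta> - d) * t d + w \<alpha> d * t (\<beta> - d))"
    if i: "i \<in> C2" and d: "d \<in> {1..<\<beta>}" for i d
  proof -
    have Ci: "orbit \<rho> i = C2" using AC i by (intro orb)
    have iB: "i \<in> B" using AC i cycle_subset[OF fin per] by auto
    define j where "j = (\<rho> ^^ d) i"
    define \<rho>' where "\<rho>' = \<rho> \<circ> transposition i j"
    have d': "d \<in> {1..<card (orbit \<rho> i)}" "0 < d" "d < card (orbit \<rho> i)" using d Ci by (auto simp: \<beta>_def)
    note cf = cut_facts[OF iB d'(1) j_def \<rho>'_def]
    note cut = cut_orbits[OF perm d'(2,3) j_def, folded \<rho>'_def]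
    note cc = cycles_cut[OF fin per iB d'(2,3), folded j_def, folded \<rho>'_def]
    have oa: "orbit \<rho>' a = A" using cut(5)[of a] b_not(2) Ci by (simp add: A_def)
    have ib: "i \<in> orbit \<rho> b" using i by (simp add: C2_def)
    have na: "i \<notin> orbit \<rho>' a" "j \<notin> orbit \<rho>' a" unfolding oa using i cf(3) Ci AC(4) by auto
    define R where "R x = {ps \<in> words B s. regular r B (act \<rho>' ps) \<and> linked \<rho>' ps a x}" for x
    have "?N (i, j) = real (card (R i \<union> R j))"
    proof -
      have "{ps \<in> words B s. regular r B (act \<rho> ((i, j) # ps)) \<and> linked \<rho> ((i, j) # ps) a b} = R i \<union> R j"
        using linked_Cons_cut(4)[OF fin r cardB per cf(2,3) _ _ sn ab ib] unfolding \<rho>'_def R_def by auto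
      then show ?thesis by simp
    qed
    also have "\<dots> = real (card (R i)) + real (card (R j))"
    proof -
      have "R i \<inter> R j = {}"
        using linked_Cons_cut(5)[OF fin r cardB per cf(2,3) _ _ sn ab ib] unfolding \<rho>'_def R_def by auto
      then show ?thesis using finite_words[OF fin] by (simp add: R_def card_Un_disjoint)
    qed
    also have "real (card (R i)) = K * (w \<alpha> (\<beta> - d) * (\<Prod>C\<in>cycles B \<rho>' - {A, orbit \<rho>' i}. t (card C)))"
      using IH[OF cf(4,5) aB iB na(1)] cut(2) unfolding oa R_def K_def w_def \<alpha>_def \<beta>_def t_def Ci by simp
    also have "cycles B \<rho>' - {A, orbit \<rho>' i} = insert (orbit \<rho>' j) Oth"
      unfolding cc(1) Ci Oth_def using cc(2-4) AC by auto
    also have "(\<Prod>C\<in>insert (orbit \<rho>' j) Oth. t (card C)) = t d * P"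
      using cc(4) cyc_split(4) cut(1) by (subst prod.insert) (auto simp: P_def Oth_def)
    also have "real (card (R j)) = K * (w \<alpha> d * (\<Prod>C\<in>cycles B \<rho>' - {A, orbit \<rho>' j}. t (card C)))"
      using IH[OF cf(4,5) aB cf(1) na(2)] cut(1) unfolding oa R_def K_def w_def \<alpha>_def t_def by simp
    also have "cycles B \<rho>' - {A, orbit \<rho>' j} = insert (orbit \<rho>' i) Oth"
      unfolding cc(1) Ci Oth_def using cc(2-4) AC by auto
    also have "(\<Prod>C\<in>insert (orbit \<rho>' i) Oth. t (card C)) = t (\<beta> - d) * P"
      using cc(3) cyc_split(4) cut(2) Ci by (subst prod.insert) (auto simp: P_def Oth_def \<beta>_def)
    finally show ?thesis unfolding j_def by (simp add: algebra_simps)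
  qed

  have join: "?N (i, j) = (if (i \<in> A \<and> j \<in> C2) \<or> (j \<in> A \<and> i \<in> C2) then K * t (\<alpha> + \<beta>) * P else 0)"
    if i: "i \<in> B" and j: "j \<in> B - orbit \<rho> i" for i j
  proof -
    have ij: "(i, j) \<in> pairs B" "j \<notin> orbit \<rho> i" "j \<in> B" using i j self[of i] by (auto simp: pairs_def)
    define \<rho>' where "\<rho>' = \<rho> \<circ> transposition i j"
    note st = card_cycles_step[OF fin r cardB per ij(1), folded \<rho>'_def]
    have link: "linked \<rho> ((i, j) # ps) a b \<longleftrightarrow> (i \<in> A \<and> j \<in> C2) \<or> (j \<in> A \<and> i \<in> C2)"
      if "ps \<in> words B s" "regular r B (act \<rho>' ps)" for ps
      using linked_Cons_join[OF fin r cardB per ij(1,2) that(1) that(2)[unfolded \<rho>'_def] sn ab] by (simp add: A_def C2_def)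
    show ?thesis
    proof (cases "(i \<in> A \<and> j \<in> C2) \<or> (j \<in> A \<and> i \<in> C2)")
      case True
      have eq: "{ps \<in> words B s. regular r B (act \<rho> ((i, j) # ps)) \<and> linked \<rho> ((i, j) # ps) a b} = {ps \<in> words B s. regular r B (act \<rho>' ps)}"
        using link True by (auto simp: \<rho>'_def)
      have "s + card (cycles B \<rho>') = m" using st(3)[OF ij(2)] sn by simp
      note cnt = count_minimal_factorizations[OF fin r cardB st(1) this]
      have orbs: "{orbit \<rho> i, orbit \<rho> j} = {A, C2}" using True orb AC by auto
      then have "orbit \<rho> i \<union> orbit \<rho> j = A \<union> C2" by (auto simp: doubleton_eq_iff)
      then have cyc': "cycles B \<rho>' = insert (A \<union> C2) Oth" "A \<union> C2 \<notin> Oth"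
        using cycles_join(1,2)[OF fin per i ij(3,2)] orbs by (simp_all add: \<rho>'_def Oth_def)
      have "card (A \<union> C2) = \<alpha> + \<beta>"
        unfolding \<alpha>_def \<beta>_def using AC(4) finite_subset[OF cycle_subset[OF fin per AC(1)] fin] finite_subset[OF cycle_subset[OF fin per AC(2)] fin]
        by (intro card_Un_disjoint)
      then have "(\<Prod>C\<in>cycles B \<rho>'. t (card C)) = t (\<alpha> + \<beta>) * P"
        unfolding cyc'(1) using cyc'(2) cyc_split(4) by (simp add: P_def)
      then show ?thesis using cnt True unfolding eq by (simp add: K_def t_def)
    next
      case False
      have eq: "{ps \<in> words B s. regular r B (act \<rho> ((i, j) # ps)) \<and> linked \<rho> ((i, j) # ps) a b} = {}"
        using link False by (auto simp: \<rho>'_def)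
      show ?thesis unfolding if_not_P[OF False] eq by simp
    qed
  qed

  \<comment> \<open>\<open>G C\<close> counts the words whose first letter starts at a given element of \<open>C\<close>.\<close>
  define G where "G C = (if C = A then K * P * ((\<Sum>d=1..<\<alpha>. w (\<alpha> - d) \<beta> * t d + w d \<beta> * t (\<alpha> - d)) + \<beta> * t (\<alpha> + \<beta>))
      else if C = C2 then K * P * ((\<Sum>d=1..<\<beta>. w \<alpha> (\<beta> - d) * t d + w \<alpha> d * t (\<beta> - d)) + \<alpha> * t (\<alpha> + \<beta>))
      else K * w \<alpha> \<beta> * (\<Sum>d=1..<card C. t d * t (card C - d)) * (\<Prod>D\<in>Oth - {C}. t (card D)))" for C
  have inner: "(\<Sum>d=1..<card (orbit \<rho> i). ?N (i, (\<rho> ^^ d) i)) + (\<Sum>j\<in>B - orbit \<rho> i. ?N (i, j)) = G (orbit \<rho> i)"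
    if i: "i \<in> B" for i
  proof -
    have joinsum: "(\<Sum>j\<in>B - orbit \<rho> i. ?N (i, j)) = real (card {j \<in> B - orbit \<rho> i. (i \<in> A \<and> j \<in> C2) \<or> (j \<in> A \<and> i \<in> C2)}) * (K * t (\<alpha> + \<beta>) * P)"
    proof -
      have "(\<Sum>j\<in>B - orbit \<rho> i. ?N (i, j)) = (\<Sum>j\<in>B - orbit \<rho> i. if (i \<in> A \<and> j \<in> C2) \<or> (j \<in> A \<and> i \<in> C2) then K * t (\<alpha> + \<beta>) * P else 0)"
        by (intro sum.cong refl join i)
      also have "\<dots> = (\<Sum>j | j \<in> B - orbit \<rho> i \<and> ((i \<in> A \<and> j \<in> C2) \<or> (j \<in> A \<and> i \<in> C2)). K * t (\<alpha> + \<beta>) * P)"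
        using fin by (subst sum.inter_filter) auto
      finally show ?thesis by simp
    qed
    have sub: "A \<subseteq> B" "C2 \<subseteq> B" using AC cycle_subset[OF fin per] by auto
    consider (A) "i \<in> A" | (C2) "i \<in> C2" | (other) "orbit \<rho> i \<in> Oth"
      using i self[of i] by (auto simp: Oth_def cycles_def)
    then show ?thesis
    proof cases
      case A
      have o: "orbit \<rho> i = A" using A AC by (intro orb)
      have "{j \<in> B - orbit \<rho> i. (i \<in> A \<and> j \<in> C2) \<or> (j \<in> A \<and> i \<in> C2)} = C2"
        unfolding o using A AC sub by auto
      then have "(\<Sum>j\<in>B - orbit \<rho> i. ?N (i, j)) = \<beta> * (K * t (\<alpha> + \<beta>) * P)" unfolding joinsum by (simp add: \<beta>_def)
      moreover have "(\<Sum>d=1..<card (orbit \<rho> i). ?N (i, (\<rho> ^^ d) i)) = (\<Sum>d=1..<\<alpha>. K * P * (w (\<alpha> - d) \<beta> * t d + w d \<beta> * t (\<alpha> - d)))"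
        unfolding o \<alpha>_def[symmetric] using A by (intro sum.cong refl cut_A)
      ultimately show ?thesis unfolding o G_def by (simp add: sum_distrib_left algebra_simps)
    next
      case C2
      have o: "orbit \<rho> i = C2" using C2 AC by (intro orb)
      have "{j \<in> B - orbit \<rho> i. (i \<in> A \<and> j \<in> C2) \<or> (j \<in> A \<and> i \<in> C2)} = A"
        unfolding o using C2 AC sub by auto
      then have "(\<Sum>j\<in>B - orbit \<rho> i. ?N (i, j)) = \<alpha> * (K * t (\<alpha> + \<beta>) * P)" unfolding joinsum by (simp add: \<alpha>_def)
      moreover have "(\<Sum>d=1..<card (orbit \<rho> i). ?N (i, (\<rho> ^^ d) i)) = (\<Sum>d=1..<\<beta>. K * P * (w \<alpha> (\<beta> - d) * t d + w \<alpha> d * t (\<beta> - d)))"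
        unfolding o \<beta>_def[symmetric] using C2 by (intro sum.cong refl cut_C2)
      ultimately show ?thesis unfolding o G_def using AC(3) by (simp add: sum_distrib_left algebra_simps)
    next
      case other
      have ni: "i \<notin> A" "i \<notin> C2" using other orb AC by (auto simp: Oth_def)
      then have "{j \<in> B - orbit \<rho> i. (i \<in> A \<and> j \<in> C2) \<or> (j \<in> A \<and> i \<in> C2)} = {}" by blast
      then have "(\<Sum>j\<in>B - orbit \<rho> i. ?N (i, j)) = 0" unfolding joinsum by (simp only: card.empty)
      moreover have "(\<Sum>d=1..<card (orbit \<rho> i). ?N (i, (\<rho> ^^ d) i)) = (\<Sum>d=1..<card (orbit \<rho> i). K * w \<alpha> \<beta> * (t d * t (card (orbit \<rho> i) - d)) * (\<Prod>D\<in>Oth - {orbit \<rho> i}. t (card D)))"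
        using other self by (intro sum.cong refl cut_other)
      moreover have "orbit \<rho> i \<noteq> A" "orbit \<rho> i \<noteq> C2" using other by (auto simp: Oth_def)
      ultimately show ?thesis unfolding G_def by (simp add: sum_distrib_left sum_distrib_right mult_ac)
    qed
  qed

  have "real (card {ps \<in> words B (Suc s). regular r B (act \<rho> ps) \<and> linked \<rho> ps a b}) = (\<Sum>p\<in>pairs B. ?N p)"
    by (subst card_words_Suc[OF fin]) simp
  also have "\<dots> = (\<Sum>i\<in>B. (\<Sum>d=1..<card (orbit \<rho> i). ?N (i, (\<rho> ^^ d) i)) + (\<Sum>j\<in>B - orbit \<rho> i. ?N (i, j)))"
    by (rule sum_pairs[OF fin per])
  also have "\<dots> = (\<Sum>i\<in>B. G (orbit \<rho> i))"
    by (intro sum.cong refl inner)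
  also have "\<dots> = (\<Sum>C\<in>cycles B \<rho>. real (card C) * G C)"
    by (rule sum_by_cycles[OF fin per])
  also have "\<dots> = \<alpha> * G A + \<beta> * G C2 + (\<Sum>C\<in>Oth. real (card C) * G C)"
    unfolding cyc_split(1) using cyc_split(2-4) by (simp add: \<alpha>_def \<beta>_def)
  also have "(\<Sum>C\<in>Oth. real (card C) * G C) = (\<Sum>C\<in>Oth. 2 * K * w \<alpha> \<beta> * P * (real (card C) / real r - 1))"
  proof (intro sum.cong refl)
    fix C assume C: "C \<in> Oth"
    then have C': "C \<in> cycles B \<rho>" "C \<noteq> A" "C \<noteq> C2" by (auto simp: Oth_def)
    have PC: "P = t (card C) * (\<Prod>D\<in>Oth - {C}. t (card D))"
      unfolding P_def by (rule prod.remove[OF cyc_split(4) C])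
    have conv: "real (card C) * (\<Sum>d=1..<card C. t d * t (card C - d)) = 2 * ((real (card C) / real r - 1) * t (card C))"
      unfolding t_def disc_coeff_convolution[OF r cycle_card_pos[OF fin per C'(1)]] by simp
    have "real (card C) * G C = K * w \<alpha> \<beta> * (\<Prod>D\<in>Oth - {C}. t (card D)) * (real (card C) * (\<Sum>d=1..<card C. t d * t (card C - d)))"
      using C' by (simp add: G_def)
    also have "\<dots> = 2 * K * w \<alpha> \<beta> * P * (real (card C) / real r - 1)"
      unfolding conv PC by (simp add: mult_ac)
    finally show "real (card C) * G C = 2 * K * w \<alpha> \<beta> * P * (real (card C) / real r - 1)" .
  qed
  also have "\<dots> = 2 * K * w \<alpha> \<beta> * P * (\<Sum>C\<in>Oth. real (card C) / real r - 1)"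
    by (simp only: sum_distrib_left)
  also have "(\<Sum>C\<in>Oth. real (card C) / real r - 1) = real (Suc s) - real (\<alpha> + \<beta>) / real r"
  proof -
    have "(\<Sum>C\<in>cycles B \<rho>. card C) = \<alpha> + \<beta> + (\<Sum>C\<in>Oth. card C)"
      unfolding cyc_split(1) using cyc_split(2-4) by (simp add: \<alpha>_def \<beta>_def)
    then have "real r * real m = real (\<alpha> + \<beta>) + (\<Sum>C\<in>Oth. real (card C))"
      using sum_card_cycles[OF fin per] cardB by (simp flip: of_nat_sum of_nat_add of_nat_mult)
    then have m: "(\<Sum>C\<in>Oth. real (card C)) / real r = real m - real (\<alpha> + \<beta>) / real r" using r by (simp add: field_simps)
    have "card (cycles B \<rho>) = card Oth + 2" unfolding cyc_split(1) using cyc_split(2-4) by simp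
    then have "real m - real (card Oth) = real (Suc s)" using sn by simp
    then show ?thesis using m by (simp add: sum_subtractf sum_divide_distrib[symmetric])
  qed
  also have "\<alpha> * G A + \<beta> * G C2 = 2 * K * P * (real (\<alpha> + \<beta>) / real r * w \<alpha> \<beta>)"
  proof -
    have sA: "(\<Sum>d=1..<\<alpha>. w d \<beta> * t (\<alpha> - d)) = (\<Sum>d=1..<\<alpha>. t d * w (\<alpha> - d) \<beta>)"
      by (rule sum.reindex_bij_witness[of _ "\<lambda>d. \<alpha> - d" "\<lambda>d. \<alpha> - d"]) auto
    have sC: "(\<Sum>d=1..<\<beta>. w \<alpha> d * t (\<beta> - d)) = (\<Sum>d=1..<\<beta>. t d * w \<alpha> (\<beta> - d))"
      by (rule sum.reindex_bij_witness[of _ "\<lambda>d. \<beta> - d" "\<lambda>d. \<beta> - d"]) auto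
    have GA: "G A = K * P * (2 * (\<Sum>d=1..<\<alpha>. t d * w (\<alpha> - d) \<beta>) + \<beta> * t (\<alpha> + \<beta>))"
      unfolding G_def sum.distrib sA by (simp add: mult.commute[of _ "t _"])
    have GC: "G C2 = K * P * (2 * (\<Sum>d=1..<\<beta>. t d * w \<alpha> (\<beta> - d)) + \<alpha> * t (\<alpha> + \<beta>))"
      unfolding G_def sum.distrib sC using AC(3) by (simp add: mult.commute[of _ "t _"])
    show ?thesis
      unfolding GA GC w_def t_def annulus_convolution[OF r pos] by (simp add: algebra_simps)
  qed
  finally have "real (card {ps \<in> words B (Suc s). regular r B (act \<rho> ps) \<and> linked \<rho> ps a b}) = 2 * K * real (Suc s) * (w \<alpha> \<beta> * P)"
    by (simp add: algebra_simps)
  then show ?case by (simp add: K_def w_def P_def Oth_def \<alpha>_def \<beta>_def A_def C2_def t_def mult_ac)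
qed

end

section \<open>First return maps\<close>

definition return_time :: "('a \<Rightarrow> 'a) \<Rightarrow> 'a set \<Rightarrow> 'a \<Rightarrow> nat" where
  "return_time f M x = (LEAST k. 0 < k \<and> (f ^^ k) x \<in> M)"

definition return_map :: "('a \<Rightarrow> 'a) \<Rightarrow> 'a set \<Rightarrow> 'a \<Rightarrow> 'a" where
  "return_map f M x = (f ^^ return_time f M x) x"

context
  fixes f :: "'a \<Rightarrow> 'a" and M :: "'a set"
  assumes perm: "permutation f"
begin

lemma return_exists:
  assumes "x \<in> orbit f y" "x \<in> M"
  shows "\<exists>k. 0 < k \<and> (f ^^ k) y \<in> M"
  using assms by (auto simp: orbit_altdef)

lemma return_time_props:
  assumes "x \<in> M"
  shows "0 < return_time f M x" "return_map f M x \<in> M" "\<And>k. 0 < k \<Longrightarrow> k < return_time f M x \<Longrightarrow> (f ^^ k) x \<notin> M"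
proof -
  have ex: "\<exists>k. 0 < k \<and> (f ^^ k) x \<in> M"
    using return_exists[OF permutation_self_in_orbit[OF perm] assms] .
  show "0 < return_time f M x" "return_map f M x \<in> M"
    using LeastI_ex[OF ex] by (simp_all add: return_time_def return_map_def)
  show "\<And>k. 0 < k \<Longrightarrow> k < return_time f M x \<Longrightarrow> (f ^^ k) x \<notin> M"
    using not_less_Least by (fastforce simp: return_time_def)
qed

lemma return_time_eqI:
  assumes "0 < k" "(f ^^ k) x \<in> M" "\<And>l. 0 < l \<Longrightarrow> l < k \<Longrightarrow> (f ^^ l) x \<notin> M"
  shows "return_time f M x = k" "return_map f M x = (f ^^ k) x"
proof -
  show "return_time f M x = k"
    unfolding return_time_def using assms by (intro Least_equality) (auto simp: not_less[symmetric])
  then show "return_map f M x = (f ^^ k) x" by (simp add: return_map_def)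
qed

text \<open>Every point of an orbit is reached from the last visit to \<open>M\<close> before it.\<close>

lemma last_visit:
  assumes "x \<in> M"
  shows "\<exists>y\<in>M. \<exists>k < return_time f M y. (f ^^ n) x = (f ^^ k) y \<and> y \<in> insert x (orbit (return_map f M) x)"
proof (induction n)
  case 0
  then show ?case using assms return_time_props(1)[OF assms] by (intro bexI[of _ x] exI[of _ 0]) auto
next
  case (Suc n)
  then obtain y k where y: "y \<in> M" "k < return_time f M y" "(f ^^ n) x = (f ^^ k) y" "y \<in> insert x (orbit (return_map f M) x)" by blast
  show ?case
  proof (cases "Suc k < return_time f M y")
    case True
    then show ?thesis using y by (intro bexI[of _ y] exI[of _ "Suc k"]) auto
  next
    case False
    then have "Suc k = return_time f M y" using y(2) by simp
    then have "(f ^^ Suc n) x = return_map f M y" using y(3) by (simp add: return_map_def flip: \<open>Suc k = _\<close>)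
    moreover have "return_map f M y \<in> M" "0 < return_time f M (return_map f M y)"
      using return_time_props(1,2) y(1) by blast+
    moreover have "return_map f M y \<in> orbit (return_map f M) x"
      using y(4) by (auto intro: orbit.intros)
    ultimately show ?thesis by (intro bexI[of _ "return_map f M y"] exI[of _ 0]) auto
  qed
qed

lemma orbit_return_subset:
  assumes "x \<in> M"
  shows "orbit (return_map f M) x \<subseteq> orbit f x \<inter> M"
proof
  fix y assume "y \<in> orbit (return_map f M) x"
  then show "y \<in> orbit f x \<inter> M"
  proof induction
    case base
    have "return_map f M x \<in> orbit f x"
      unfolding return_map_def by (intro funpow_in_orbit permutation_self_in_orbit perm)
    then show ?case using return_time_props(2)[OF assms] by simp
  next
    case (step y)
    then have "return_map f M y \<in> orbit f x"
      unfolding return_map_def by (intro funpow_in_orbit) simp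
    then show ?case using return_time_props(2) step by simp
  qed
qed

lemma orbit_return_map:
  assumes "x \<in> M"
  shows "orbit (return_map f M) x = orbit f x \<inter> M"
proof -
  have *: "y \<in> insert x (orbit (return_map f M) x)" if "y \<in> orbit f x" "y \<in> M" "x \<in> M" for x y
  proof -
    from that(1) obtain n where n: "y = (f ^^ n) x" by (auto simp: orbit_altdef)
    from last_visit[OF that(3)]
    obtain z k where z: "z \<in> M" "k < return_time f M z" "(f ^^ n) x = (f ^^ k) z" "z \<in> insert x (orbit (return_map f M) x)"
      by blast
    have "k = 0" using return_time_props(3)[OF z(1), of k] z(2,3) that(2) n by (cases "k = 0") auto
    then show ?thesis using z n by simp
  qed
  let ?y = "return_map f M x"
  have y: "?y \<in> M" "?y \<in> orbit f x"
    using return_time_props(2)[OF assms] orbit_return_subset[OF assms] orbit.base[of "return_map f M" x] by auto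
  have "x \<in> orbit f ?y" using orbit_eq_if_mem[OF perm y(2)] permutation_self_in_orbit[OF perm] by simp
  then have "x \<in> insert ?y (orbit (return_map f M) ?y)" by (rule *[OF _ assms y(1)])
  moreover have "?y \<in> orbit (return_map f M) x" by (rule orbit.base)
  ultimately have "x \<in> orbit (return_map f M) x" using orbit_trans[of x "return_map f M" ?y x] by auto
  then show ?thesis using * orbit_return_subset[OF assms] assms by blast
qed

lemma inj_on_return_map: "inj_on (return_map f M) M"
proof (rule inj_onI)
  fix x y assume xy: "x \<in> M" "y \<in> M" "return_map f M x = return_map f M y"
  have gen: "x = y" if "x \<in> M" "y \<in> M" "(f ^^ return_time f M x) x = (f ^^ return_time f M y) y" "return_time f M x \<le> return_time f M y" for x y
  proof -
    define d where "d = return_time f M y - return_time f M x"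
    have "return_time f M y = return_time f M x + d" using that(4) by (simp add: d_def)
    then have "(f ^^ return_time f M x) x = (f ^^ return_time f M x) ((f ^^ d) y)" using that(3) by (simp add: funpow_add)
    moreover have "inj (f ^^ return_time f M x)"
      using perm by (intro inj_fn) (rule bij_is_inj[OF permutation_bijective])
    ultimately have "x = (f ^^ d) y" by (simp add: inj_eq)
    moreover have "d < return_time f M y" using return_time_props(1)[OF that(1)] return_time_props(1)[OF that(2)] by (simp add: d_def)
    ultimately show "x = y" using return_time_props(3)[OF that(2), of d] that(1) by (cases "d = 0") auto
  qed
  show "x = y"
    using gen[of x y] gen[of y x] xy unfolding return_map_def by (metis linorder_linear)
qed

text \<open>Kac's formula: the excursions from the points of \<open>M\<close> tile the orbit. It converts sums over corners, each of which is an
interval of positions, into sums over positions.\<close>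

lemma kac:
  fixes w :: "'a \<Rightarrow> nat"
  assumes "x \<in> M"
  shows "(\<Sum>y\<in>orbit f x \<inter> M. \<Sum>k<return_time f M y. w ((f ^^ k) y)) = (\<Sum>z\<in>orbit f x. w z)"
proof -
  let ?O = "orbit f x"
  let ?S = "SIGMA y:?O \<inter> M. {..<return_time f M y}"
  have fin: "finite ?O" by (intro finite_orbit permutation_self_in_orbit perm)
  have inj: "inj_on (\<lambda>(y, k). (f ^^ k) y) ?S"
  proof (rule inj_onI, clarify)
    fix y k y' k' assume *: "y \<in> ?O" "y \<in> M" "k < return_time f M y" "y' \<in> ?O" "y' \<in> M" "k' < return_time f M y'" "(f ^^ k) y = (f ^^ k') y'"
    have gen: "y = y' \<and> k = k'" if "y \<in> M" "y' \<in> M" "k' < return_time f M y'" "(f ^^ k) y = (f ^^ k') y'" "k \<le> k'" for y y' k k'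
    proof -
      have "k' = k + (k' - k)" using that(5) by simp
      then have "(f ^^ k) y = (f ^^ k) ((f ^^ (k' - k)) y')" using that(4) by (metis funpow_add o_apply)
      moreover have "inj (f ^^ k)"
        using perm by (intro inj_fn) (rule bij_is_inj[OF permutation_bijective])
      ultimately have y: "y = (f ^^ (k' - k)) y'" by (simp add: inj_eq)
      have "k' - k < return_time f M y'" using that(3) by simp
      then have "k' - k = 0" using return_time_props(3)[OF that(2), of "k' - k"] that(1) y by (cases "k' - k = 0") auto
      then show ?thesis using y that(5) by simp
    qed
    show "y = y' \<and> k = k'" using gen[of y y' k' k] gen[of y' y k k'] * by (metis linorder_linear)
  qed
  have img: "(\<lambda>(y, k). (f ^^ k) y) ` ?S = ?O"
  proof (intro equalityI subsetI)
    fix z assume "z \<in> ?O"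
    then obtain n where n: "z = (f ^^ n) x" by (auto simp: orbit_altdef)
    obtain y k where y: "y \<in> M" "k < return_time f M y" "(f ^^ n) x = (f ^^ k) y" "y \<in> insert x (orbit (return_map f M) x)"
      using last_visit[OF assms] by blast
    have "y \<in> ?O" using y(4) orbit_return_subset[OF assms] permutation_self_in_orbit[OF perm] by blast
    then show "z \<in> (\<lambda>(y, k). (f ^^ k) y) ` ?S" using y n by (intro image_eqI[of _ _ "(y, k)"]) auto
  qed (auto intro: funpow_in_orbit)
  have "(\<Sum>y\<in>?O \<inter> M. \<Sum>k<return_time f M y. w ((f ^^ k) y)) = (\<Sum>(y, k)\<in>?S. w ((f ^^ k) y))"
    using fin by (subst sum.Sigma) auto
  also have "\<dots> = (\<Sum>z\<in>(\<lambda>(y, k). (f ^^ k) y) ` ?S. w z)"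
    by (subst sum.reindex[OF inj]) (simp add: case_prod_unfold comp_def)
  finally show ?thesis by (simp only: img)
qed

end

lemma orbit_semiconj:
  assumes "\<And>y. y \<in> insert x (orbit f x) \<Longrightarrow> p (f y) = g (p y)"
  shows "orbit g (p x) = p ` orbit f x"
proof -
  have "(g ^^ n) (p x) = p ((f ^^ n) x)" for n
  proof (induction n)
    case (Suc n)
    have "(f ^^ n) x \<in> insert x (orbit f x)"
    proof (cases "n = 0")
      case False
      then show ?thesis unfolding orbit_altdef by blast
    qed simp
    then show ?case using Suc assms by simp
  qed simp
  then show ?thesis unfolding orbit_altdef by auto
qed

lemma card_image_eq_if_same_kernel:
  assumes "\<And>x y. x \<in> X \<Longrightarrow> y \<in> X \<Longrightarrow> f x = f y \<longleftrightarrow> g x = g y"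
  shows "card (f ` X) = card (g ` X)"
proof (rule bij_betw_same_card)
  show "bij_betw (\<lambda>u. g (SOME x. x \<in> X \<and> f x = u)) (f ` X) (g ` X)"
  proof -
    have c: "(SOME y. y \<in> X \<and> f y = f x) \<in> X \<and> f (SOME y. y \<in> X \<and> f y = f x) = f x" if "x \<in> X" for x
      by (rule someI[of "\<lambda>y. y \<in> X \<and> f y = f x" x]) (use that in simp)
    have e: "g (SOME y. y \<in> X \<and> f y = f x) = g x" if "x \<in> X" for x
      using c[OF that] assms that by blast
    show ?thesis
      unfolding bij_betw_def inj_on_def using assms by (auto simp: e image_image)
  qed
qed

section \<open>The graph of a word of transpositions\<close>

text \<open>Two vertices of degrees \<open>\<mu> 0\<close> and \<open>\<mu> 1\<close> and \<open>s\<close> edges. The sheets of the covering, called blocks, are numbered around each vertex: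
block \<open>(v, k)\<close> is the interval between two consecutive dots at vertex \<open>v\<close>. A state \<open>(b, i)\<close> is a position at which the edge with
index \<open>i\<close> may be attached in block \<open>b\<close>. The positions around a vertex form a cycle of length \<open>s * \<mu> v\<close>, and \<open>turn\<close> is the step
to the next one counterclockwise.\<close>

locale block_states =
  fixes \<mu> :: "nat \<Rightarrow> nat" and s :: nat
  assumes s_pos: "s > 0" and \<mu>_pos: "v < 2 \<Longrightarrow> \<mu> v > 0"
begin

definition blocks :: "(nat \<times> nat) set" where
  "blocks = {(v, k). v < 2 \<and> k < \<mu> v}"

definition block_shift :: "nat \<times> nat \<Rightarrow> nat \<times> nat" where
  "block_shift b = (if b \<in> blocks then (fst b, Suc (snd b) mod \<mu> (fst b)) else b)"

definition states :: "((nat \<times> nat) \<times> nat) set" where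
  "states = blocks \<times> {..<s}"

definition turn :: "(nat \<times> nat) \<times> nat \<Rightarrow> (nat \<times> nat) \<times> nat" where
  "turn z = (if z \<in> states then
     (if Suc (snd z) < s then (fst z, Suc (snd z)) else (block_shift (fst z), 0)) else z)"

text \<open>The positions around a vertex, indexed periodically.\<close>

definition at_position :: "nat \<Rightarrow> nat \<Rightarrow> (nat \<times> nat) \<times> nat" where
  "at_position v N = ((v, (N div s) mod \<mu> v), N mod s)"

lemma finite_blocks: "finite blocks"
proof -
  have "blocks = (SIGMA v:{..<2}. {..<\<mu> v})" by (auto simp: blocks_def)
  then show ?thesis by simp
qed

lemma card_blocks: "card blocks = \<mu> 0 + \<mu> 1"
proof -
  have "blocks = (SIGMA v:{..<2}. {..<\<mu> v})" by (auto simp: blocks_def)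
  then show ?thesis by (simp add: numeral_2_eq_2)
qed

lemma finite_states: "finite states"
  by (simp add: states_def finite_blocks)

lemma at_position_in_states: "v < 2 \<Longrightarrow> at_position v N \<in> states"
  using s_pos \<mu>_pos by (simp add: at_position_def states_def blocks_def)

lemma at_position_vertex [simp]: "fst (fst (at_position v N)) = v" "snd (at_position v N) = N mod s"
  by (simp_all add: at_position_def)

lemma at_position_eq_iff:
  "at_position v N = at_position v' N' \<longleftrightarrow> v = v' \<and> N mod (s * \<mu> v) = N' mod (s * \<mu> v)"
proof -
  have *: "N mod (s * \<mu> v) = s * ((N div s) mod \<mu> v) + N mod s" for N
    by (rule mod_mult2_eq)
  have "(s * a + b = s * a' + b') \<longleftrightarrow> a = a' \<and> b = b'" if "b < s" "b' < s" for a a' b b'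
  proof
    assume e: "s * a + b = s * a' + b'"
    have "(s * a + b) div s = a" "(s * a' + b') div s = a'" "(s * a + b) mod s = b" "(s * a' + b') mod s = b'"
      using that s_pos by simp_all
    then show "a = a' \<and> b = b'" using e by metis
  qed simp
  then show ?thesis unfolding * at_position_def using s_pos by auto
qed

lemma state_at_position:
  assumes "z \<in> states"
  shows "z = at_position (fst (fst z)) (s * snd (fst z) + snd z)" "fst (fst z) < 2"
    "s * snd (fst z) + snd z < s * \<mu> (fst (fst z))"
proof -
  obtain v k i where z: "z = ((v, k), i)" by (metis prod.exhaust)
  then have *: "v < 2" "k < \<mu> v" "i < s" using assms by (auto simp: states_def blocks_def)
  then show "z = at_position (fst (fst z)) (s * snd (fst z) + snd z)" "fst (fst z) < 2"
    unfolding z at_position_def by simp_all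
  have "s * k + i < s * Suc k" using *(3) by simp
  also have "\<dots> \<le> s * \<mu> v" using *(2) by (intro mult_le_mono2) simp
  finally show "s * snd (fst z) + snd z < s * \<mu> (fst (fst z))" by (simp add: z)
qed

lemma turn_at_position:
  assumes "v < 2"
  shows "turn (at_position v N) = at_position v (Suc N)"
proof (cases "Suc (N mod s) = s")
  case True
  then have "Suc N div s = Suc (N div s)" "Suc N mod s = 0" by (simp_all add: div_Suc mod_Suc)
  then show ?thesis
    using at_position_in_states[OF assms, of N] assms s_pos \<mu>_pos True
    by (simp add: turn_def at_position_def block_shift_def blocks_def mod_Suc_eq)
next
  case False
  then have "Suc (N mod s) < s" using s_pos mod_less_divisor[of s N] by linarith
  then have "Suc N div s = N div s" "Suc N mod s = Suc (N mod s)" by (simp_all add: div_Suc mod_Suc)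
  then show ?thesis
    using at_position_in_states[OF assms, of N] \<open>Suc (N mod s) < s\<close>
    by (simp add: turn_def at_position_def)
qed

lemma turn_funpow: "v < 2 \<Longrightarrow> (turn ^^ n) (at_position v N) = at_position v (N + n)"
  by (induction n) (simp_all add: turn_at_position)

lemma at_position_period: "at_position v (N + s * \<mu> v) = at_position v N"
  by (simp add: at_position_eq_iff)

lemma turn_permutes: "turn permutes states"
proof (rule bij_imp_permutes)
  have img: "turn ` states = states"
  proof (intro equalityI subsetI)
    fix z assume "z \<in> turn ` states"
    then obtain y where y: "y \<in> states" "z = turn y" by auto
    have "z = at_position (fst (fst y)) (Suc (s * snd (fst y) + snd y))"
      unfolding y(2) using state_at_position[OF y(1)] turn_at_position by metis
    then show "z \<in> states" using at_position_in_states state_at_position(2)[OF y(1)] by simp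
  next
    fix z assume z: "z \<in> states"
    define v N where "v = fst (fst z)" and "N = s * snd (fst z) + snd z"
    have zN: "z = at_position v N" "v < 2" using state_at_position[OF z] by (simp_all add: v_def N_def)
    have pos: "s * \<mu> v > 0" using s_pos \<mu>_pos[OF zN(2)] by simp
    have "turn (at_position v (N + s * \<mu> v - 1)) = z"
      unfolding turn_at_position[OF zN(2)] using pos zN(1) at_position_period by simp
    then show "z \<in> turn ` states" using at_position_in_states[OF zN(2)] by (metis image_eqI)
  qed
  then show "bij_betw turn states states"
    using finite_surj_inj[OF finite_states, of turn] by (simp add: bij_betw_def)
  show "turn z = z" if "z \<notin> states" for z using that by (simp add: turn_def)
qed

lemma turn_permutation: "permutation turn"
  using turn_permutes finite_states permutation_permutes by blast

lemma orbit_turn: "v < 2 \<Longrightarrow> orbit turn (at_position v N) = {z \<in> states. fst (fst z) = v}"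
proof (intro equalityI subsetI)
  fix z assume v: "v < 2"
  { assume "z \<in> orbit turn (at_position v N)"
    then obtain n where "z = (turn ^^ n) (at_position v N)" by (auto simp: orbit_altdef)
    then show "z \<in> {z \<in> states. fst (fst z) = v}" using v at_position_in_states by (simp add: turn_funpow) }
  { assume "z \<in> {z \<in> states. fst (fst z) = v}"
    then obtain N' where z: "z = at_position v N'" using state_at_position(1)[of z] by auto
    define L where "L = s * \<mu> v"
    have L: "L > 0" using s_pos \<mu>_pos[OF v] by (simp add: L_def)
    have "at_position v (N + (N' + L * Suc N - N)) = at_position v N'"
    proof -
      have "Suc N \<le> L * Suc N" using L by (cases L) auto
      then have "N \<le> N' + L * Suc N" by (rule le_trans[OF Suc_leD le_add2])
      then have "N + (N' + L * Suc N - N) = N' + L * Suc N" by simp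
      then show ?thesis by (simp add: at_position_eq_iff L_def[symmetric] del: mult_Suc_right)
    qed
    then have "z = (turn ^^ (N' + L * Suc N - N)) (at_position v N)" using v z by (simp add: turn_funpow)
    then show "z \<in> orbit turn (at_position v N)"
      using orbit_altdef_permutation[OF turn_permutation] by blast }
qed

lemma orbit_turn': "z \<in> states \<Longrightarrow> orbit turn z = {y \<in> states. fst (fst y) = fst (fst z)}"
  using orbit_turn[of "fst (fst z)" "s * snd (fst z) + snd z"] state_at_position[of z] by simp

text \<open>The indicator of the positions directly before a dot.\<close>

definition last_label :: "(nat \<times> nat) \<times> nat \<Rightarrow> nat" where
  "last_label z = (if Suc (snd z) = s then 1 else 0)"

lemma sum_last_label:
  assumes "z \<in> states"
  shows "(\<Sum>k<g. last_label ((turn ^^ k) z)) = (snd z + g) div s"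
proof -
  define v N where "v = fst (fst z)" and "N = s * snd (fst z) + snd z"
  have zN: "z = at_position v N" "v < 2" using state_at_position[OF assms] by (simp_all add: v_def N_def)
  have sz: "snd z < s" using assms by (auto simp: states_def)
  show ?thesis
  proof (induction g)
    case 0
    then show ?case using sz by simp
  next
    case (Suc g)
    have "snd ((turn ^^ g) z) = (snd z + g) mod s"
      unfolding zN(1) turn_funpow[OF zN(2)] by (simp add: mod_add_left_eq)
    then show ?case using Suc s_pos by (simp add: last_label_def div_Suc mod_Suc)
  qed
qed

lemma sum_last_label_vertex:
  assumes "v < 2"
  shows "(\<Sum>z | z \<in> states \<and> fst (fst z) = v. last_label z) = \<mu> v"
proof -
  have "(\<Sum>z | z \<in> states \<and> fst (fst z) = v. last_label z) = (\<Sum>z\<in>(\<lambda>k. ((v, k), s - 1)) ` {..<\<mu> v}. last_label z)"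
    by (rule sum.mono_neutral_right)
      (use assms s_pos finite_states in \<open>auto simp: states_def blocks_def last_label_def image_iff\<close>)
  also have "\<dots> = \<mu> v" using s_pos by (subst sum.reindex) (auto simp: inj_on_def last_label_def)
  finally show ?thesis .
qed

lemma block_shift_permutes: "block_shift permutes blocks"
proof (rule bij_imp_permutes)
  have "blocks \<subseteq> block_shift ` blocks"
  proof
    fix b assume "b \<in> blocks"
    then obtain v k where b: "b = (v, k)" "v < 2" "k < \<mu> v" by (auto simp: blocks_def)
    show "b \<in> block_shift ` blocks"
    proof (cases k)
      case 0
      have "(v, \<mu> v - 1) \<in> blocks" "block_shift (v, \<mu> v - 1) = b" using b \<mu>_pos 0 by (simp_all add: block_shift_def blocks_def)
      then show ?thesis by force
    next
      case (Suc k')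
      have "(v, k') \<in> blocks" "block_shift (v, k') = b" using b Suc by (simp_all add: block_shift_def blocks_def)
      then show ?thesis by force
    qed
  qed
  moreover have "block_shift ` blocks \<subseteq> blocks"
    using \<mu>_pos by (auto simp: block_shift_def blocks_def)
  ultimately have "block_shift ` blocks = blocks" by simp
  then show "bij_betw block_shift blocks blocks"
    using finite_surj_inj[OF finite_blocks, of block_shift] by (simp add: bij_betw_def)
qed (simp add: block_shift_def)

lemma block_shift_permutation: "permutation block_shift"
  using block_shift_permutes finite_blocks permutation_permutes by blast

lemma orbit_block_shift:
  assumes "v < 2" "k < \<mu> v"
  shows "orbit block_shift (v, k) = {v} \<times> {..<\<mu> v}"
proof -
  have f: "(block_shift ^^ n) (v, k) = (v, (k + n) mod \<mu> v)" for n
  proof (induction n)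
    case (Suc n)
    then show ?case using assms \<mu>_pos[OF assms(1)] by (simp add: block_shift_def blocks_def mod_Suc_eq)
  qed (use assms in simp)
  show ?thesis
  proof (intro equalityI subsetI)
    fix b assume "b \<in> orbit block_shift (v, k)"
    then show "b \<in> {v} \<times> {..<\<mu> v}" using \<mu>_pos[OF assms(1)] by (auto simp: orbit_altdef f)
  next
    fix b assume "b \<in> {v} \<times> {..<\<mu> v}"
    then obtain k' where b: "b = (v, k')" "k' < \<mu> v" by auto
    then have "(k + (k' + \<mu> v - k)) mod \<mu> v = k'" using assms by simp
    then have "b = (block_shift ^^ (k' + \<mu> v - k)) (v, k)" unfolding f b by simp
    then show "b \<in> orbit block_shift (v, k)"
      using orbit_altdef_permutation[OF block_shift_permutation] by blast
  qed
qed

end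

text \<open>The involution that exchanges the darts \<open>2 i\<close> and \<open>2 i + 1\<close>. It is the identity elsewhere, as a permutation of the darts has to be.\<close>

definition mate :: "nat \<Rightarrow> nat \<Rightarrow> nat" where
  "mate s x = (if x < 2 * s then if even x then x + 1 else x - 1 else x)"

text \<open>A word of \<open>s\<close> transpositions of blocks is read as a graph: the \<open>i\<close>-th letter \<open>(p, q)\<close> is the edge with the darts \<open>2 i\<close>, attached at
the position \<open>(p, i)\<close>, and \<open>2 i + 1\<close>, attached at \<open>(q, i)\<close>. A letter whose blocks belong to different vertices makes the graph
connected.\<close>

locale oriented_word = block_states +
  fixes ps :: "((nat \<times> nat) \<times> (nat \<times> nat)) list"
  assumes word: "ps \<in> words blocks s"
    and crossing: "\<exists>(p, q) \<in> set ps. fst p \<noteq> fst q"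
begin

definition end_block :: "nat \<Rightarrow> nat \<times> nat" where
  "end_block x = (if even x then fst else snd) (ps ! (x div 2))"

definition place :: "nat \<Rightarrow> (nat \<times> nat) \<times> nat" where
  "place x = (end_block x, x div 2)"

definition marked :: "((nat \<times> nat) \<times> nat) set" where
  "marked = place ` {..<2 * s}"

abbreviation opposite :: "nat \<Rightarrow> nat" where
  "opposite \<equiv> mate s"

text \<open>Crossing the edge with index \<open>i\<close>, extended by the identity to all positions to which no edge is attached.\<close>

definition swap :: "(nat \<times> nat) \<times> nat \<Rightarrow> (nat \<times> nat) \<times> nat" where
  "swap z = (if snd z < s then (transposition (fst (ps ! snd z)) (snd (ps ! snd z)) (fst z), snd z) else z)"

text \<open>The next dart at a vertex is found by turning until an edge is met.\<close>

definition word_rot :: "nat \<Rightarrow> nat" where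
  "word_rot x = (if x < 2 * s then inv_into {..<2 * s} place (return_map turn marked (place x)) else x)"

text \<open>The number of steps to the next dart.\<close>

definition gap :: "nat \<Rightarrow> nat" where
  "gap x = return_time turn marked (place x)"

text \<open>The position of the last dart before the return to block 0 from the last block.\<close>

definition last_position :: "nat \<Rightarrow> nat" where
  "last_position v = Max {N. N < s * \<mu> v \<and> at_position v N \<in> marked}"

text \<open>The dots in a corner are the passages from one block to the next in it. The arrow is on the dot between the last block
and block 0.
Its corner begins in the block \<open>last_position v div s\<close>, which gives the number of passages before it.\<close>

definition word_graph :: arrowed_hurwitz_graph where
  "word_graph = \<lparr>nedges = s, rot = word_rot, flip = opposite, vert = (\<lambda>x. fst (end_block x)),
     dots = (\<lambda>x. (x div 2 + gap x) div s),
     arrow = (\<lambda>v. (inv_into {..<2 * s} place (at_position v (last_position v)), \<mu> v - 1 - last_position v div s))\<rparr>"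

abbreviation "D \<equiv> {..<2 * s}"

lemma darts_word_graph [simp]: "darts word_graph = D"
  by (simp add: darts_def word_graph_def)

lemma word_graph_fields [simp]: "nedges word_graph = s" "rot word_graph = word_rot" "flip word_graph = opposite"
  "vert word_graph x = fst (end_block x)" "dots word_graph x = (x div 2 + gap x) div s"
  by (simp_all add: word_graph_def)

lemma letter: "i < s \<Longrightarrow> ps ! i \<in> pairs blocks" "length ps = s"
  using word nth_mem by (auto simp: words_def)

lemma dart_letter:
  assumes "x \<in> D"
  shows "x div 2 < s" "fst (ps ! (x div 2)) \<in> blocks" "snd (ps ! (x div 2)) \<in> blocks"
    "fst (ps ! (x div 2)) \<noteq> snd (ps ! (x div 2))"
proof -
  show i: "x div 2 < s" using assms by (simp add: less_mult_imp_div_less mult.commute)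
  show "fst (ps ! (x div 2)) \<in> blocks" "snd (ps ! (x div 2)) \<in> blocks"
    "fst (ps ! (x div 2)) \<noteq> snd (ps ! (x div 2))"
    using letter(1)[OF i] by (auto simp: pairs_def)
qed

lemma end_block_in: "x \<in> D \<Longrightarrow> end_block x \<in> blocks"
  using dart_letter by (simp add: end_block_def)

lemma place_in_states: "x \<in> D \<Longrightarrow> place x \<in> states"
  using end_block_in dart_letter(1) by (simp add: place_def states_def)

lemma opposite_in [simp]: "x \<in> D \<Longrightarrow> opposite x \<in> D"
  by (auto simp: mate_def elim!: oddE evenE)

lemma opposite_opposite [simp]: "opposite (opposite x) = x"
  by (auto simp: mate_def elim!: oddE evenE)

lemma opposite_div [simp]: "x \<in> D \<Longrightarrow> opposite x div 2 = x div 2"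
  by (auto simp: mate_def elim!: oddE evenE)

lemma opposite_neq: "x \<in> D \<Longrightarrow> opposite x \<noteq> x"
  by (auto simp: mate_def elim!: oddE evenE)

lemma dart_cases:
  fixes x :: nat
  obtains "x = 2 * (x div 2)" | "x = 2 * (x div 2) + 1"
  by (metis odd_two_times_div_two_succ even_two_times_div_two)

lemma same_edge:
  assumes "x \<in> D" "x div 2 = y div 2"
  shows "y = x \<or> y = opposite x"
proof -
  define i where "i = x div 2"
  have "x = 2 * i \<or> x = 2 * i + 1" "y = 2 * i \<or> y = 2 * i + 1"
    using dart_cases[of x] dart_cases[of y] assms(2) by (metis i_def)+
  then show ?thesis using assms(1) by (auto simp: mate_def)
qed

lemma end_block_opposite: "x \<in> D \<Longrightarrow> end_block (opposite x) \<noteq> end_block x"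
  using dart_letter(4)[of x] opposite_div[of x]
  by (auto simp: end_block_def mate_def)

lemma opposite_permutes: "opposite permutes D"
proof (rule bij_imp_permutes)
  show "bij_betw opposite D D"
    by (rule bij_betw_byWitness[where f'=opposite]) (use opposite_in in \<open>simp, simp, blast, blast\<close>)
qed (simp add: mate_def)

lemma inj_place: "inj_on place D"
proof (rule inj_onI)
  fix x y assume xy: "x \<in> D" "y \<in> D" "place x = place y"
  then have "y = x \<or> y = opposite x" by (intro same_edge) (auto simp: place_def)
  then show "x = y" using xy end_block_opposite[OF xy(1)] by (auto simp: place_def)
qed

lemma swap_place: "x \<in> D \<Longrightarrow> swap (place x) = place (opposite x)"
  using opposite_div[of x] dart_letter[of x]
  by (auto simp: swap_def place_def end_block_def mate_def)

lemma swap_unmarked: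
  assumes "z \<notin> marked" shows "swap z = z"
proof (cases "snd z < s")
  case True
  define i where "i = snd z"
  have "place (2 * i) = (fst (ps ! i), i)" "place (2 * i + 1) = (snd (ps ! i), i)"
    by (simp_all add: place_def end_block_def)
  moreover have "2 * i \<in> D" "2 * i + 1 \<in> D" using True by (auto simp: i_def)
  ultimately have "(fst (ps ! i), i) \<in> marked" "(snd (ps ! i), i) \<in> marked"
    unfolding marked_def by (metis image_eqI)+
  then have "fst z \<noteq> fst (ps ! i)" "fst z \<noteq> snd (ps ! i)" using assms by (metis i_def prod.collapse)+
  then show ?thesis by (simp add: swap_def i_def[symmetric] transpose_apply_other) (simp add: i_def)
qed (simp add: swap_def)

lemma swap_swap [simp]: "swap (swap z) = z"
  by (simp add: swap_def)

lemma swap_in_states: "z \<in> states \<Longrightarrow> swap z \<in> states"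
  using letter(1)[of "snd z"]
  by (auto simp: swap_def states_def pairs_def Transposition.transpose_def mem_Times_iff)

lemma marked_states: "marked \<subseteq> states"
  using place_in_states by (auto simp: marked_def)

lemma word_rot_place:
  assumes "x \<in> D"
  shows "word_rot x \<in> D" "place (word_rot x) = return_map turn marked (place x)"
proof -
  have "return_map turn marked (place x) \<in> marked"
    by (rule return_time_props(2)[OF turn_permutation]) (use assms in \<open>simp add: marked_def\<close>)
  then show "word_rot x \<in> D" "place (word_rot x) = return_map turn marked (place x)"
    using assms unfolding word_rot_def marked_def by (simp_all add: inv_into_into f_inv_into_f) (metis inv_into_into lessThan_iff)
qed

lemma word_rot_permutes: "word_rot permutes D"
proof (rule bij_imp_permutes)
  have "inj_on word_rot D"
  proof (rule inj_onI)
    fix x y assume xy: "x \<in> D" "y \<in> D" "word_rot x = word_rot y"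
    then have "return_map turn marked (place x) = return_map turn marked (place y)" using word_rot_place(2) by metis
    then have "place x = place y"
      using inj_onD[OF inj_on_return_map[OF turn_permutation]] xy by (auto simp: marked_def)
    then show "x = y" using inj_place xy by (auto dest: inj_onD)
  qed
  moreover have "word_rot ` D \<subseteq> D" using word_rot_place(1) by blast
  ultimately show "bij_betw word_rot D D" by (simp only: bij_betw_def endo_inj_surj finite_lessThan)
qed (simp add: word_rot_def)

lemma place_orbit_rot:
  assumes "x \<in> D"
  shows "place ` orbit word_rot x = orbit turn (place x) \<inter> marked"
proof -
  have sub: "insert x (orbit word_rot x) \<subseteq> D" using permutes_orbit_subset[OF word_rot_permutes assms] assms by simp
  have "orbit (return_map turn marked) (place x) = place ` orbit word_rot x"
    by (rule orbit_semiconj) (use word_rot_place(2) sub in auto)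
  then show ?thesis
    using orbit_return_map[OF turn_permutation, of "place x" marked] assms by (simp add: marked_def)
qed

lemma orbit_word_rot:
  assumes "x \<in> D"
  shows "orbit word_rot x = {y \<in> D. fst (end_block y) = fst (end_block x)}"
proof -
  have sub: "orbit word_rot x \<subseteq> D" using permutes_orbit_subset[OF word_rot_permutes assms] .
  have "place ` orbit word_rot x = place ` {y \<in> D. fst (end_block y) = fst (end_block x)}"
    unfolding place_orbit_rot[OF assms] orbit_turn'[OF place_in_states[OF assms]]
    using place_in_states by (auto simp: marked_def place_def)
  then show ?thesis
    by (rule inj_on_image_eq_iff[THEN iffD1, OF inj_place sub, rotated]) auto
qed

text \<open>The letter between the two vertices provides a dart at each of them.\<close>

lemma dart_at_vertex:
  assumes "v < 2"
  shows "\<exists>x\<in>D. fst (end_block x) = v"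
proof -
  from crossing obtain p q where pq: "(p, q) \<in> set ps" "fst p \<noteq> fst q" by blast
  then obtain i where i: "i < s" "ps ! i = (p, q)" using letter(2) by (auto simp: in_set_conv_nth)
  have e: "end_block (2 * i) = p" "end_block (2 * i + 1) = q" by (simp_all add: end_block_def i)
  have "2 * i \<in> D" "2 * i + 1 \<in> D" using i by auto
  moreover have "fst p < 2" "fst q < 2" using letter(1)[OF i(1)] i(2) by (auto simp: pairs_def blocks_def)
  then have "fst p = v \<or> fst q = v" using pq(2) assms by linarith
  ultimately show ?thesis using e by metis
qed

text \<open>The quotient by \<open>s\<close> counts the passages between blocks within the corner of \<open>x\<close>.\<close>

lemma dots_eq_sum: "x \<in> D \<Longrightarrow> (x div 2 + gap x) div s = (\<Sum>k<return_time turn marked (place x). last_label ((turn ^^ k) (place x)))"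
  by (subst sum_last_label[OF place_in_states]) (simp_all add: place_def gap_def)

text \<open>By Kac's formula the corners at a vertex contain each of its positions once, and \<open>\<mu> v\<close> of these precede a dot.\<close>

lemma vertex_dots_word_graph:
  assumes "v < 2"
  shows "vertex_dots word_graph v = \<mu> v"
proof -
  obtain x where x: "x \<in> D" "fst (end_block x) = v" using dart_at_vertex[OF assms] by blast
  have O: "{y \<in> D. fst (end_block y) = v} = orbit word_rot x" using orbit_word_rot[OF x(1)] x(2) by simp
  have sub: "orbit word_rot x \<subseteq> D" using permutes_orbit_subset[OF word_rot_permutes x(1)] .
  have "vertex_dots word_graph v = (\<Sum>y\<in>orbit word_rot x. (y div 2 + gap y) div s)"
    unfolding vertex_dots_def by (simp add: O[symmetric])
  also have "\<dots> = (\<Sum>y\<in>orbit word_rot x. (\<lambda>z. \<Sum>k<return_time turn marked z. last_label ((turn ^^ k) z)) (place y))"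
    using sub by (intro sum.cong refl) (simp add: dots_eq_sum subset_iff)
  also have "\<dots> = (\<Sum>z\<in>place ` orbit word_rot x. \<Sum>k<return_time turn marked z. last_label ((turn ^^ k) z))"
    using inj_on_subset[OF inj_place sub] by (simp add: sum.reindex)
  also have "\<dots> = (\<Sum>z\<in>orbit turn (place x). last_label z)"
    unfolding place_orbit_rot[OF x(1)] by (rule kac[OF turn_permutation]) (use x in \<open>simp add: marked_def\<close>)
  also have "\<dots> = \<mu> v"
    unfolding orbit_turn'[OF place_in_states[OF x(1)]] using sum_last_label_vertex[OF assms] x(2) by (simp add: place_def)
  finally show ?thesis .
qed

section \<open>Faces of the graph and cycles of the monodromy\<close>

text \<open>Face tracing on all positions: cross the edge attached at the position, if there is one, then turn one step
clockwise. Its first return map to the darts is \<open>next_dart\<close>, and every cycle of it passes the last index \<open>s - 1\<close> once per dot.\<close>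

definition advance :: "(nat \<times> nat) \<times> nat \<Rightarrow> (nat \<times> nat) \<times> nat" where
  "advance z = inv turn (swap z)"

abbreviation next_d :: "nat \<Rightarrow> nat" where
  "next_d \<equiv> next_dart word_graph"

lemma next_d_eq: "next_d x = inv word_rot (opposite x)"
  by (simp add: next_dart_def)

lemma advance_permutes: "advance permutes states"
proof -
  have "swap permutes states"
  proof (rule bij_imp_permutes)
    show "bij_betw swap states states"
      by (rule bij_betw_byWitness[where f'=swap]) (use swap_in_states in auto)
    show "swap z = z" if "z \<notin> states" for z
      using that swap_unmarked marked_states by blast
  qed
  then have "inv turn \<circ> swap permutes states"
    using permutes_inv[OF turn_permutes] by (rule permutes_compose)
  moreover have "advance = inv turn \<circ> swap" by (auto simp: advance_def)
  ultimately show ?thesis by simp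
qed

lemma advance_permutation: "permutation advance"
  using advance_permutes finite_states permutation_permutes by blast

lemma next_d_permutes: "next_d permutes D"
proof -
  have "inv word_rot \<circ> opposite permutes D"
    using opposite_permutes permutes_inv[OF word_rot_permutes] by (rule permutes_compose)
  moreover have "next_d = inv word_rot \<circ> opposite" by (auto simp: next_d_eq)
  ultimately show ?thesis by simp
qed

lemma next_d_in: "x \<in> D \<Longrightarrow> next_d x \<in> D"
  using permutes_in_image[OF next_d_permutes] by blast

lemma rot_next_d: "word_rot (next_d x) = opposite x"
  unfolding next_d_eq by (rule permutes_inverses(1)[OF word_rot_permutes])

lemma inv_turn_turn: "inv turn (turn z) = z"
  by (rule permutes_inverses(2)[OF turn_permutes])

lemma turn_gap:
  assumes "x \<in> D"
  shows "(turn ^^ gap x) (place x) = place (word_rot x)" "0 < gap x"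
    "\<And>k. 0 < k \<Longrightarrow> k < gap x \<Longrightarrow> (turn ^^ k) (place x) \<notin> marked"
  using word_rot_place(2)[OF assms] return_time_props[OF turn_permutation, of "place x" marked] assms
  by (simp_all add: gap_def return_map_def marked_def)

text \<open>On its way from \<open>x\<close> to the next dart \<open>y\<close> of the face, \<open>advance\<close> runs backwards through the corner of \<open>y\<close>.\<close>

lemma advance_path:
  assumes x: "x \<in> D" and k: "1 \<le> k" "k \<le> gap (next_d x)"
  shows "(advance ^^ k) (place x) = (turn ^^ (gap (next_d x) - k)) (place (next_d x))"
  using k
proof (induction k rule: nat_induct_at_least)
  case base
  let ?y = "next_d x"
  note g = turn_gap[OF next_d_in[OF x]]
  have "advance (place x) = inv turn ((turn ^^ gap ?y) (place ?y))"
    using g(1) swap_place[OF x] rot_next_d[of x] by (simp add: advance_def)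
  also have "(turn ^^ gap ?y) (place ?y) = turn ((turn ^^ (gap ?y - 1)) (place ?y))"
    using g(2) by (metis Suc_diff_1 funpow.simps(2) o_apply)
  finally show ?case by (simp add: inv_turn_turn)
next
  case (Suc k)
  let ?y = "next_d x"
  note g = turn_gap[OF next_d_in[OF x]]
  have "(advance ^^ Suc k) (place x) = advance ((turn ^^ (gap ?y - k)) (place ?y))" using Suc by simp
  also have "\<dots> = inv turn ((turn ^^ (gap ?y - k)) (place ?y))"
    unfolding advance_def using g(3)[of "gap ?y - k"] Suc by (subst swap_unmarked) auto
  also have "(turn ^^ (gap ?y - k)) (place ?y) = turn ((turn ^^ (gap ?y - Suc k)) (place ?y))"
    using Suc.prems by (metis Suc_diff_Suc Suc_le_lessD funpow.simps(2) o_apply)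
  finally show ?case by (simp add: inv_turn_turn)
qed

lemma advance_return:
  assumes "x \<in> D"
  shows "return_time advance marked (place x) = gap (next_d x)" "return_map advance marked (place x) = place (next_d x)"
proof -
  let ?y = "next_d x"
  note y = next_d_in[OF assms]
  note g = turn_gap[OF y]
  have e: "(advance ^^ gap ?y) (place x) = place ?y" using advance_path[OF assms, of "gap ?y"] g(2) by simp
  have 1: "(advance ^^ gap ?y) (place x) \<in> marked" using y by (simp add: e marked_def)
  have 2: "(advance ^^ l) (place x) \<notin> marked" if "0 < l" "l < gap ?y" for l
    using advance_path[OF assms, of l] g(3)[of "gap ?y - l"] that by simp
  show "return_time advance marked (place x) = gap ?y" "return_map advance marked (place x) = place ?y"
    using return_time_eqI[OF advance_permutation g(2) 1 2] e by simp_all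
qed

lemma dots_next_d:
  assumes "x \<in> D"
  shows "(next_d x div 2 + gap (next_d x)) div s
       = (\<Sum>k<return_time advance marked (place x). last_label (advance ((advance ^^ k) (place x))))"
proof -
  let ?y = "next_d x"
  have "(?y div 2 + gap ?y) div s = (\<Sum>k<gap ?y. last_label ((turn ^^ k) (place ?y)))"
    using dots_eq_sum[OF next_d_in[OF assms]] by (simp add: gap_def)
  also have "\<dots> = (\<Sum>k<gap ?y. last_label ((turn ^^ (gap ?y - Suc k)) (place ?y)))"
    by (rule sum.nat_diff_reindex[symmetric])
  also have "\<dots> = (\<Sum>k<gap ?y. last_label (advance ((advance ^^ k) (place x))))"
  proof (intro sum.cong refl)
    fix k assume "k \<in> {..<gap ?y}"
    then show "last_label ((turn ^^ (gap ?y - Suc k)) (place ?y)) = last_label (advance ((advance ^^ k) (place x)))"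
      using advance_path[OF assms, of "Suc k"] by simp
  qed
  finally show ?thesis by (simp add: advance_return[OF assms])
qed

lemma place_orbit_next:
  assumes "x \<in> D"
  shows "place ` orbit next_d x = orbit advance (place x) \<inter> marked"
proof -
  have sub: "insert x (orbit next_d x) \<subseteq> D" using permutes_orbit_subset[OF next_d_permutes assms] assms by simp
  have "orbit (return_map advance marked) (place x) = place ` orbit next_d x"
    by (rule orbit_semiconj) (use advance_return(2) sub in auto)
  then show ?thesis
    using orbit_return_map[OF advance_permutation, of "place x" marked] assms by (simp add: marked_def)
qed

text \<open>Sums over a face may be shifted by one step of \<open>f\<close>.\<close>

lemma bij_betw_orbit:
  assumes "permutation f"
  shows "bij_betw f (orbit f x) (orbit f x)"
proof -
  have "f ` orbit f x \<subseteq> orbit f x" by (auto intro: orbit.step)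
  moreover have "inj_on f (orbit f x)"
    using permutation_bijective[OF assms] by (meson bij_is_inj inj_on_subset subset_UNIV)
  moreover have "finite (orbit f x)" by (intro finite_orbit permutation_self_in_orbit assms)
  ultimately show ?thesis by (simp add: bij_betw_def endo_inj_surj)
qed

text \<open>By Kac's formula for \<open>advance\<close>, the dots of a face are the positions with the last index on the corresponding cycle.\<close>

lemma face_dots:
  assumes "x \<in> D"
  shows "(\<Sum>y\<in>orbit next_d x. dots word_graph y) = card (orbit advance (place x) \<inter> {z. Suc (snd z) = s})"
proof -
  have sub: "orbit next_d x \<subseteq> D" using permutes_orbit_subset[OF next_d_permutes assms] .
  have perm: "permutation next_d" using next_d_permutes finite_lessThan permutation_permutes by blast
  have "(\<Sum>y\<in>orbit next_d x. dots word_graph y) = (\<Sum>y\<in>orbit next_d x. dots word_graph (next_d y))"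
    by (rule sum.reindex_bij_betw[OF bij_betw_orbit[OF perm], symmetric])
  also have "\<dots> = (\<Sum>y\<in>orbit next_d x. (\<lambda>z. \<Sum>k<return_time advance marked z. last_label (advance ((advance ^^ k) z))) (place y))"
    using sub dots_next_d by (intro sum.cong refl) (simp add: subset_iff)
  also have "\<dots> = (\<Sum>z\<in>place ` orbit next_d x. \<Sum>k<return_time advance marked z. last_label (advance ((advance ^^ k) z)))"
    using inj_on_subset[OF inj_place sub] by (simp add: sum.reindex)
  also have "\<dots> = (\<Sum>z\<in>orbit advance (place x). last_label (advance z))"
    unfolding place_orbit_next[OF assms]
    by (rule kac[OF advance_permutation, where w="\<lambda>z. last_label (advance z)"]) (use assms in \<open>simp add: marked_def\<close>)
  also have "\<dots> = (\<Sum>z\<in>orbit advance (place x). last_label z)"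
    by (rule sum.reindex_bij_betw[OF bij_betw_orbit[OF advance_permutation]])
  also have "\<dots> = card (orbit advance (place x) \<inter> {z. Suc (snd z) = s})"
    using finite_orbit[OF permutation_self_in_orbit[OF advance_permutation]]
    by (simp add: last_label_def sum.If_cases)
  finally show ?thesis .
qed

text \<open>The product of the transpositions with a turn around each vertex, the monodromy around the common image of the face centers.\<close>

definition monodromy :: "nat \<times> nat \<Rightarrow> nat \<times> nat" where
  "monodromy = act (inv block_shift) ps"

definition letters_map :: "((nat \<times> nat) \<times> (nat \<times> nat)) list \<Rightarrow> nat \<times> nat \<Rightarrow> nat \<times> nat" where
  "letters_map qs = foldr (\<lambda>p f. transposition (fst p) (snd p) \<circ> f) qs id"

lemma act_letters_map: "act \<rho> qs = \<rho> \<circ> letters_map qs"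
proof (induction qs arbitrary: \<rho>)
  case (Cons p qs)
  have "act (\<rho> \<circ> transposition (fst p) (snd p)) qs = (\<rho> \<circ> transposition (fst p) (snd p)) \<circ> letters_map qs"
    by (rule Cons)
  then show ?case by (simp add: letters_map_def comp_assoc)
qed (simp add: letters_map_def)

lemma letters_map_in: "set qs \<subseteq> pairs blocks \<Longrightarrow> b \<in> blocks \<Longrightarrow> letters_map qs b \<in> blocks"
  by (induction qs) (auto simp: letters_map_def pairs_def Transposition.transpose_def)

lemma drop_letters: "set (drop k ps) \<subseteq> pairs blocks"
  using word set_drop_subset[of k ps] by (auto simp: words_def)

lemma turn_Suc_label: "b \<in> blocks \<Longrightarrow> Suc i < s \<Longrightarrow> turn (b, i) = (b, Suc i)"
  by (simp add: turn_def states_def)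

lemma turn_last_label: "b \<in> blocks \<Longrightarrow> turn (b, s - 1) = (block_shift b, 0)"
  using s_pos by (simp add: turn_def states_def)

lemma swap_apply: "i < s \<Longrightarrow> swap (b, i) = (transposition (fst (ps ! i)) (snd (ps ! i)) b, i)"
  by (simp add: swap_def)

text \<open>Starting from the last index, \<open>advance\<close> visits the indices in descending order and applies the letters from the last to the first.\<close>

lemma advance_from_last_label:
  assumes b: "b \<in> blocks" and k: "k < s"
  shows "(advance ^^ k) (b, s - 1) = (letters_map (drop (s - k) ps) b, s - 1 - k)"
  using k
proof (induction k)
  case 0
  then show ?case using letter(2) by (simp add: letters_map_def)
next
  case (Suc k)
  define i where "i = s - 1 - k"
  have i: "i < s" "i = Suc (s - 1 - Suc k)" "s - k = Suc i" "s - Suc k = i" using Suc.prems by (auto simp: i_def)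
  define c where "c = letters_map (drop (s - Suc k) ps) b"
  have "drop i ps = ps ! i # drop (Suc i) ps" using letter(2) i(1) by (simp add: Cons_nth_drop_Suc)
  then have c: "transposition (fst (ps ! i)) (snd (ps ! i)) (letters_map (drop (s - k) ps) b) = c"
    unfolding c_def i(3,4) by (simp add: letters_map_def)
  have cb: "c \<in> blocks" unfolding c_def by (rule letters_map_in[OF drop_letters b])
  have "(advance ^^ Suc k) (b, s - 1) = advance (letters_map (drop (s - k) ps) b, i)"
    using Suc by (simp add: i_def)
  also have "\<dots> = inv turn (c, i)" by (simp add: advance_def swap_apply[OF i(1)] c)
  also have "(c, i) = turn (c, s - 1 - Suc k)" using turn_Suc_label[OF cb, of "s - 1 - Suc k"] i by simp
  finally show ?case by (simp add: inv_turn_turn c_def)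
qed

lemma advance_full_round:
  assumes b: "b \<in> blocks"
  shows "(advance ^^ s) (b, s - 1) = (monodromy b, s - 1)"
proof -
  define c where "c = letters_map ps b"
  have cb: "c \<in> blocks" unfolding c_def using letters_map_in[OF _ b] drop_letters[of 0] by simp
  have mb: "monodromy b = inv block_shift c" by (simp add: monodromy_def act_letters_map c_def)
  have mbb: "inv block_shift c \<in> blocks" using permutes_in_image[OF permutes_inv[OF block_shift_permutes]] cb by blast
  have "ps = ps ! 0 # drop 1 ps" using letter(2) s_pos by (metis Cons_nth_drop_Suc One_nat_def drop0)
  then have c: "transposition (fst (ps ! 0)) (snd (ps ! 0)) (letters_map (drop 1 ps) b) = c"
    unfolding c_def by (metis (no_types, lifting) comp_apply foldr.simps(2) letters_map_def)
  have "(advance ^^ s) (b, s - 1) = advance ((advance ^^ (s - 1)) (b, s - 1))"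
    using s_pos by (metis Suc_diff_1 funpow.simps(2) o_apply)
  also have "\<dots> = inv turn (c, 0)"
    using advance_from_last_label[OF b, of "s - 1"] s_pos swap_apply[OF s_pos] c by (simp add: advance_def)
  also have "(c, 0) = turn (inv block_shift c, s - 1)"
    using turn_last_label[OF mbb] permutes_inverses(1)[OF block_shift_permutes] by simp
  finally show ?thesis by (simp add: inv_turn_turn mb)
qed

definition last_states :: "((nat \<times> nat) \<times> nat) set" where
  "last_states = {z. Suc (snd z) = s}"

lemma last_states_iff: "z \<in> last_states \<longleftrightarrow> (\<exists>b. z = (b, s - 1))"
  using s_pos by (cases z) (auto simp: last_states_def)

lemma monodromy_permutes: "monodromy permutes blocks"
proof -
  have "letters_map qs permutes blocks" if "set qs \<subseteq> pairs blocks" for qs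
    using that
  proof (induction qs)
    case Nil
    have "letters_map [] = id" by (simp add: letters_map_def)
    then show ?case by (simp only: permutes_id)
  next
    case (Cons p qs)
    have "transposition (fst p) (snd p) permutes blocks"
      using Cons.prems by (intro permutes_swap_id) (auto simp: pairs_def)
    moreover have eq: "letters_map (p # qs) = transposition (fst p) (snd p) \<circ> letters_map qs" by (simp add: letters_map_def)
    moreover have "letters_map qs permutes blocks" using Cons by simp
    ultimately show ?case unfolding eq by (intro permutes_compose)
  qed
  from this[of ps] have "letters_map ps permutes blocks" using drop_letters[of 0] by simp
  then show ?thesis
    unfolding monodromy_def act_letters_map by (rule permutes_compose[OF _ permutes_inv[OF block_shift_permutes]])
qed

text \<open>The monodromy is the first return map of \<open>advance\<close> to the positions with the last index, as \<open>s\<close> steps lead from one of them to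
the next.\<close>

lemma orbit_advance_last_states:
  assumes "b \<in> blocks"
  shows "orbit advance (b, s - 1) \<inter> last_states = (\<lambda>c. (c, s - 1)) ` orbit monodromy b"
proof -
  have ret: "return_map advance last_states (c, s - 1) = (monodromy c, s - 1)" if "c \<in> blocks" for c
  proof -
    have "(advance ^^ l) (c, s - 1) \<notin> last_states" if "0 < l" "l < s" for l
      using advance_from_last_label[OF \<open>c \<in> blocks\<close>, of l] that by (simp add: last_states_def)
    moreover have "(advance ^^ s) (c, s - 1) \<in> last_states"
      using advance_full_round[OF that] last_states_iff by blast
    ultimately show ?thesis
      using return_time_eqI(2)[OF advance_permutation s_pos, of "(c, s - 1)" last_states] advance_full_round[OF that] by simp
  qed
  have sub: "insert b (orbit monodromy b) \<subseteq> blocks"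
    using permutes_orbit_subset[OF monodromy_permutes assms] assms by simp
  have "orbit (return_map advance last_states) (b, s - 1) = (\<lambda>c. (c, s - 1)) ` orbit monodromy b"
    by (rule orbit_semiconj[where p="\<lambda>c. (c, s - 1)"]) (use ret sub in auto)
  moreover have "(b, s - 1) \<in> last_states" using last_states_iff by blast
  ultimately show ?thesis using orbit_return_map[OF advance_permutation] by metis
qed

lemma card_orbit_advance:
  assumes "b \<in> blocks"
  shows "card (orbit advance (b, s - 1) \<inter> last_states) = card (orbit monodromy b)"
  unfolding orbit_advance_last_states[OF assms] by (rule card_image) (auto simp: inj_on_def)

lemma advance_orbit_meets_last:
  assumes "z \<in> states"
  shows "\<exists>b\<in>blocks. orbit advance z = orbit advance (b, s - 1)"
proof -
  obtain b i where z: "z = (b, i)" "b \<in> blocks" "i < s" using assms by (auto simp: states_def)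
  have "\<exists>c\<in>blocks. (c, s - 1) \<in> orbit advance (b, i)" if "b \<in> blocks" "i < s" for b i
    using that
  proof (induction i arbitrary: b)
    case 0
    define c where "c = inv block_shift (fst (swap (b, 0)))"
    have sb: "swap (b, 0) \<in> states" using 0 by (intro swap_in_states) (simp add: states_def)
    then have "fst (swap (b, 0)) \<in> blocks" by (auto simp: states_def mem_Times_iff)
    then have c: "c \<in> blocks" using permutes_in_image[OF permutes_inv[OF block_shift_permutes]] by (simp add: c_def)
    have "swap (b, 0) = turn (c, s - 1)"
      unfolding turn_last_label[OF c] using permutes_inverses(1)[OF block_shift_permutes] swap_apply[OF s_pos]
      by (simp add: c_def)
    then have "advance (b, 0) = (c, s - 1)" by (simp add: advance_def inv_turn_turn)
    then have "(c, s - 1) \<in> orbit advance (b, 0)" using orbit.base[of advance "(b, 0)"] by simp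
    then show ?case using c by blast
  next
    case (Suc i)
    define c where "c = fst (swap (b, Suc i))"
    have sw: "swap (b, Suc i) = (c, Suc i)" using swap_apply[OF Suc.prems(2)] by (simp add: c_def)
    have "swap (b, Suc i) \<in> states" using Suc.prems by (intro swap_in_states) (simp add: states_def)
    then have c: "c \<in> blocks" unfolding sw by (simp add: states_def)
    have "advance (b, Suc i) = (c, i)"
      unfolding advance_def sw turn_Suc_label[OF c Suc.prems(2), symmetric] by (rule inv_turn_turn)
    moreover obtain c' where "c' \<in> blocks" "(c', s - 1) \<in> orbit advance (c, i)"
      using Suc.IH[OF c] Suc.prems(2) by auto
    ultimately show ?case using orbit_trans[OF _ orbit.base] by metis
  qed
  from this[OF z(2,3)] show ?thesis using orbit_eq_if_mem[OF advance_permutation] z(1) by metis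
qed

text \<open>A cycle of \<open>advance\<close> without darts would be all of the positions around a vertex, but every vertex carries a dart.\<close>

lemma advance_orbit_meets_marked:
  assumes "z \<in> states"
  shows "\<exists>x\<in>D. orbit advance z = orbit advance (place x)"
proof (rule ccontr)
  assume no: "\<not> ?thesis"
  have unm: "y \<notin> marked" if "y \<in> orbit advance z" for y
    using no orbit_eq_if_mem[OF advance_permutation that] by (auto simp: marked_def)
  have "orbit advance z = orbit (inv turn) z"
    by (rule orbit_cong_outside[OF advance_permutation, symmetric]) (use unm in \<open>simp add: advance_def swap_unmarked\<close>)
  also have "\<dots> = orbit turn z" by (rule orbit_inv_eq[OF turn_permutation])
  also have "\<dots> = {y \<in> states. fst (fst y) = fst (fst z)}" by (rule orbit_turn'[OF assms])
  finally have O: "orbit advance z = {y \<in> states. fst (fst y) = fst (fst z)}" .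
  obtain x where "x \<in> D" "fst (end_block x) = fst (fst z)"
    using dart_at_vertex[OF state_at_position(2)[OF assms]] by blast
  then have "place x \<in> orbit advance z" "place x \<in> marked"
    unfolding O using place_in_states by (auto simp: place_def marked_def)
  then show False using unm by blast
qed

text \<open>Faces with \<open>r\<close> dots correspond to cycles of length \<open>r\<close>.\<close>

lemma face_regular_iff:
  "(\<forall>F\<in>faces word_graph. (\<Sum>x\<in>F. dots word_graph x) = r) \<longleftrightarrow> regular r blocks monodromy"
proof -
  have fs: "faces word_graph = orbit next_d ` D" by (simp add: faces_def)
  have last: "{z. Suc (snd z) = s} = last_states" by (simp add: last_states_def)
  show ?thesis
  proof
    assume L: "\<forall>F\<in>faces word_graph. (\<Sum>x\<in>F. dots word_graph x) = r"
    show "regular r blocks monodromy"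
      unfolding regular_def cycles_def
    proof clarify
      fix v k assume b: "(v, k) \<in> blocks"
      have "((v, k), s - 1) \<in> states" using b s_pos by (simp add: states_def)
      then obtain x where x: "x \<in> D" "orbit advance ((v, k), s - 1) = orbit advance (place x)"
        using advance_orbit_meets_marked by blast
      have "card (orbit advance (place x) \<inter> last_states) = r"
        using L x(1) face_dots[OF x(1)] by (simp add: fs last)
      then show "card (orbit monodromy (v, k)) = r" using card_orbit_advance[OF b] x(2) by simp
    qed
  next
    assume R: "regular r blocks monodromy"
    show "\<forall>F\<in>faces word_graph. (\<Sum>x\<in>F. dots word_graph x) = r"
    proof
      fix F assume "F \<in> faces word_graph"
      then obtain x where x: "x \<in> D" "F = orbit next_d x" by (auto simp: fs)
      obtain b where b: "b \<in> blocks" "orbit advance (place x) = orbit advance (b, s - 1)"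
        using advance_orbit_meets_last[OF place_in_states[OF x(1)]] by blast
      have "(\<Sum>y\<in>F. dots word_graph y) = card (orbit monodromy b)"
        unfolding x(2) face_dots[OF x(1)] last b(2) by (rule card_orbit_advance[OF b(1)])
      then show "(\<Sum>x\<in>F. dots word_graph x) = r" using R b(1) by (simp add: regular_def cycles_def)
    qed
  qed
qed

lemma card_faces: "card (faces word_graph) = card (cycles blocks monodromy)"
proof -
  have perm: "permutation next_d" using next_d_permutes finite_lessThan permutation_permutes by blast
  have permm: "permutation monodromy" using monodromy_permutes finite_blocks permutation_permutes by blast
  have "card (faces word_graph) = card ((\<lambda>x. orbit advance (place x)) ` D)"
    unfolding faces_def darts_word_graph
  proof (rule card_image_eq_if_same_kernel)
    fix x y assume xy: "x \<in> D" "y \<in> D"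
    show "orbit next_d x = orbit next_d y \<longleftrightarrow> orbit advance (place x) = orbit advance (place y)"
    proof
      assume "orbit next_d x = orbit next_d y"
      then have "place x \<in> orbit advance (place y)"
        using place_orbit_next[OF xy(2)] permutation_self_in_orbit[OF perm, of x] by blast
      then show "orbit advance (place x) = orbit advance (place y)" by (rule orbit_eq_if_mem[OF advance_permutation])
    next
      assume "orbit advance (place x) = orbit advance (place y)"
      then have "place ` orbit next_d x = place ` orbit next_d y" using place_orbit_next xy by simp
      then show "orbit next_d x = orbit next_d y"
        using inj_on_image_eq_iff[OF inj_place] permutes_orbit_subset[OF next_d_permutes] xy by metis
    qed
  qed
  also have "(\<lambda>x. orbit advance (place x)) ` D = (\<lambda>b. orbit advance (b, s - 1)) ` blocks"
  proof (intro equalityI subsetI)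
    fix Q assume "Q \<in> (\<lambda>x. orbit advance (place x)) ` D"
    then show "Q \<in> (\<lambda>b. orbit advance (b, s - 1)) ` blocks"
      using advance_orbit_meets_last place_in_states by blast
  next
    fix Q assume "Q \<in> (\<lambda>b. orbit advance (b, s - 1)) ` blocks"
    then obtain b where "b \<in> blocks" "Q = orbit advance (b, s - 1)" by blast
    moreover have "(b, s - 1) \<in> states" using calculation(1) s_pos by (simp add: states_def)
    ultimately show "Q \<in> (\<lambda>x. orbit advance (place x)) ` D" using advance_orbit_meets_marked by blast
  qed
  also have "card \<dots> = card (cycles blocks monodromy)"
    unfolding cycles_def
  proof (rule card_image_eq_if_same_kernel)
    fix b c assume bc: "b \<in> blocks" "c \<in> blocks"
    show "orbit advance (b, s - 1) = orbit advance (c, s - 1) \<longleftrightarrow> orbit monodromy b = orbit monodromy c"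
    proof
      assume "orbit advance (b, s - 1) = orbit advance (c, s - 1)"
      then have "(\<lambda>c. (c, s - 1)) ` orbit monodromy b = (\<lambda>c. (c, s - 1)) ` orbit monodromy c"
        using orbit_advance_last_states bc by metis
      moreover have "inj (\<lambda>c :: nat \<times> nat. (c, s - 1))" by (auto simp: inj_on_def)
      ultimately show "orbit monodromy b = orbit monodromy c" by (simp add: inj_image_eq_iff)
    next
      assume "orbit monodromy b = orbit monodromy c"
      then have "b \<in> orbit monodromy c" using permutation_self_in_orbit[OF permm] by metis
      then have "(b, s - 1) \<in> orbit advance (c, s - 1)" using orbit_advance_last_states[OF bc(2)] by blast
      then show "orbit advance (b, s - 1) = orbit advance (c, s - 1)" by (rule orbit_eq_if_mem[OF advance_permutation])
    qed
  qed
  finally show ?thesis .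
qed

section \<open>The graph of a word is an arrowed Hurwitz graph\<close>

lemma end_block_vertex: "x \<in> D \<Longrightarrow> fst (end_block x) < 2"
  using end_block_in[of x] by (cases "end_block x") (simp add: blocks_def)

lemma index_rot:
  assumes "x \<in> D"
  shows "(x div 2 + gap x) mod s = word_rot x div 2"
proof -
  define v N where "v = fst (end_block x)" and "N = s * snd (end_block x) + x div 2"
  have x: "place x = at_position v N" "v < 2"
    using state_at_position[OF place_in_states[OF assms]] by (simp_all add: place_def v_def N_def)
  have "snd ((turn ^^ gap x) (place x)) = (x div 2 + gap x) mod s"
    unfolding x(1) turn_funpow[OF x(2)] by (simp add: N_def add.assoc)
  then show ?thesis unfolding turn_gap(1)[OF assms] by (simp add: place_def)
qed

text \<open>Division of the end position by \<open>s\<close>: the quotient counts the dots, the remainder is the index of the next dart.\<close>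

lemma gap_eq:
  assumes "x \<in> D"
  shows "x div 2 + gap x = s * dots word_graph x + word_rot x div 2"
  using index_rot[OF assms] mult_div_mod_eq[of s "x div 2 + gap x"] by simp

text \<open>Edges with index \<open>i\<close> get the label \<open>s - i\<close>, so that descending indices are ascending labels: without a dot in the corner of
\<open>y\<close>, the position of \<open>word_rot y\<close> lies in the same block as that of \<open>y\<close> and has a larger index.\<close>

lemma label_increases:
  assumes "x \<in> D" "dots word_graph (next_d x) = 0"
  shows "next_d x div 2 < x div 2"
  using gap_eq[OF next_d_in[OF assms(1)]] turn_gap(2)[OF next_d_in[OF assms(1)]] assms rot_next_d[of x] by simp

lemma label_increases_along_path:
  assumes "x \<in> D" "1 \<le> k" "(\<Sum>i=1..k. dots word_graph ((next_d ^^ i) x)) = 0"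
  shows "(next_d ^^ k) x div 2 < x div 2"
  using assms(2,3)
proof (induction k rule: nat_induct_at_least)
  case base
  then show ?case using label_increases[OF assms(1)] by simp
next
  case (Suc k)
  have "(next_d ^^ k) x \<in> D" using permutes_in_funpow_image[OF next_d_permutes assms(1)] .
  then have "(next_d ^^ Suc k) x div 2 < (next_d ^^ k) x div 2"
    using label_increases[of "(next_d ^^ k) x"] Suc.prems by simp
  moreover have "(next_d ^^ k) x div 2 < x div 2" using Suc by simp
  ultimately show ?case by simp
qed

text \<open>Each of the two arcs between the sides of an edge contains a dot: otherwise the labels would increase
strictly along the arc, which starts and ends with the same edge.\<close>

lemma dots_between_sides_bounds:
  assumes x: "x \<in> D" and o: "opposite x \<in> orbit next_d x"
    and r: "(\<Sum>y\<in>orbit next_d x. dots word_graph y) = r"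
  shows "0 < dots_between_sides word_graph x" "dots_between_sides word_graph x < r"
proof -
  let ?d = "\<lambda>i. dots word_graph ((next_d ^^ i) x)"
  define K where "K = (LEAST k. 1 \<le> k \<and> (next_d ^^ k) x = opposite x)"
  have perm: "permutation next_d" using next_d_permutes finite_lessThan permutation_permutes by blast
  note oc = orbit_card_cycle[OF perm permutation_self_in_orbit[OF perm, of x]]
  define n where "n = card (orbit next_d x)"
  have "opposite x \<in> (\<lambda>n. (next_d ^^ n) x) ` {0..<n}" using o oc(3) unfolding n_def by blast
  then obtain j where j: "j < n" "(next_d ^^ j) x = opposite x" by auto
  have "j \<noteq> 0" using j(2) opposite_neq[OF x] by (cases j) auto
  then have jP: "1 \<le> j \<and> (next_d ^^ j) x = opposite x" using j by simp
  have K: "1 \<le> K" "(next_d ^^ K) x = opposite x" unfolding K_def using LeastI[of "\<lambda>k. 1 \<le> k \<and> (next_d ^^ k) x = opposite x" j, OF jP] by blast+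
  have "K \<le> j" unfolding K_def using jP by (rule Least_le)
  then have Kn: "K < n" using j by simp
  have b: "dots_between_sides word_graph x = (\<Sum>i=1..K. ?d i)"
    by (simp add: dots_between_sides_def K_def)
  have pos1: "(\<Sum>i=1..K. ?d i) \<noteq> 0"
  proof
    assume "(\<Sum>i=1..K. ?d i) = 0"
    from label_increases_along_path[OF x K(1) this] show False using K(2) opposite_div[OF x] by simp
  qed
  then show "0 < dots_between_sides word_graph x" unfolding b by (rule neq0_conv[THEN iffD1])
  have per: "(next_d ^^ n) x = x" using oc(1) by (simp add: n_def)
  have "r = (\<Sum>i\<in>{0..<n}. ?d i)"
  proof -
    have "orbit next_d x = (\<lambda>n. (next_d ^^ n) x) ` {0..<n}" using oc(3) n_def by blast
    then have "(\<Sum>y\<in>orbit next_d x. dots word_graph y) = (\<Sum>y\<in>(\<lambda>n. (next_d ^^ n) x) ` {0..<n}. dots word_graph y)" by (simp only:)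
    also have "\<dots> = (\<Sum>i\<in>{0..<n}. ?d i)"
      using oc(2) by (subst sum.reindex) (simp_all only: n_def o_def)
    finally show ?thesis using r by simp
  qed
  also have "\<dots> = (\<Sum>i=1..n. ?d i)"
  proof -
    have n0: "0 < n" using Kn by simp
    have "(\<Sum>i\<in>{0..<n}. ?d i) = ?d 0 + (\<Sum>i\<in>{1..<n}. ?d i)" using n0 by (simp add: sum.atLeast_Suc_lessThan)
    moreover have "{1..n} = insert n {1..<n}" using n0 by auto
    ultimately show ?thesis using per by simp
  qed
  also have "\<dots> = (\<Sum>i=1..K. ?d i) + (\<Sum>i=K+1..n. ?d i)"
    using Kn sum.ub_add_nat[of 1 K ?d "n - K"] by simp
  also have "(\<Sum>i=K+1..n. ?d i) = (\<Sum>i=1..n-K. dots word_graph ((next_d ^^ i) (opposite x)))"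
    by (rule sum.reindex_bij_witness[of _ "\<lambda>i. i + K" "\<lambda>i. i - K"])
      (use Kn in \<open>auto simp: K(2)[symmetric] funpow_add[symmetric, unfolded o_def, THEN fun_cong]\<close>)
  finally have r: "r = (\<Sum>i=1..K. ?d i) + (\<Sum>i=1..n-K. dots word_graph ((next_d ^^ i) (opposite x)))" .
  have "(next_d ^^ (n - K)) (opposite x) = x"
  proof -
    have "(next_d ^^ (n - K)) ((next_d ^^ K) x) = (next_d ^^ (n - K + K)) x" by (simp only: funpow_add o_apply)
    then show ?thesis using Kn per K(2) by simp
  qed
  note return = this
  have "(\<Sum>i=1..n-K. dots word_graph ((next_d ^^ i) (opposite x))) \<noteq> 0"
  proof
    assume zero: "(\<Sum>i=1..n-K. dots word_graph ((next_d ^^ i) (opposite x))) = 0"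
    have "1 \<le> n - K" using Kn by simp
    from label_increases_along_path[OF opposite_in[OF x] this zero] show False
      using return opposite_div[OF x] by simp
  qed
  then show "dots_between_sides word_graph x < r" using r b by linarith
qed

lemma last_position:
  assumes "v < 2"
  shows "last_position v < s * \<mu> v" "at_position v (last_position v) \<in> marked"
    "\<And>N. N < s * \<mu> v \<Longrightarrow> at_position v N \<in> marked \<Longrightarrow> N \<le> last_position v"
proof -
  let ?A = "{N. N < s * \<mu> v \<and> at_position v N \<in> marked}"
  obtain x where x: "x \<in> D" "fst (end_block x) = v" using dart_at_vertex[OF assms] by blast
  define N0 where "N0 = s * snd (fst (place x)) + snd (place x)"
  have vv: "fst (fst (place x)) = v" using x(2) by (simp add: place_def)
  note px = state_at_position[OF place_in_states[OF x(1)], unfolded vv, folded N0_def]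
  have "place x \<in> marked" using x by (simp add: marked_def)
  then have "N0 \<in> ?A" using px(1,3) by simp
  then have "?A \<noteq> {}" by blast
  moreover have fin: "finite ?A" by (rule finite_subset[of _ "{..<s * \<mu> v}"]) auto
  ultimately have "Max ?A \<in> ?A" by (intro Max_in)
  moreover have "\<And>N. N \<in> ?A \<Longrightarrow> N \<le> Max ?A" using fin by (rule Max_ge)
  ultimately show "last_position v < s * \<mu> v" "at_position v (last_position v) \<in> marked"
    "\<And>N. N < s * \<mu> v \<Longrightarrow> at_position v N \<in> marked \<Longrightarrow> N \<le> last_position v"
    by (simp_all add: last_position_def)
qed

text \<open>The corner of the arrow extends from the last dart before block 0 at least to the beginning of block 0, so it contains the dot between the
last block and block 0.\<close>

lemma arrow_dart:
  assumes "v < 2"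
  defines "x \<equiv> fst (arrow word_graph v)" and "N \<equiv> last_position v"
  shows "x \<in> D" "place x = at_position v N" "snd (arrow word_graph v) = \<mu> v - 1 - N div s"
    "N div s < \<mu> v" "x div 2 = N mod s" "snd (arrow word_graph v) < dots word_graph x" "fst (end_block x) = v"
proof -
  note lp = last_position[OF assms(1), folded N_def]
  obtain y where y: "y \<in> D" "place y = at_position v N" using lp(2) by (auto simp: marked_def)
  have xy: "x = y" using y inv_into_f_f[OF inj_place y(1)] by (simp add: x_def word_graph_def N_def)
  then show x: "x \<in> D" "place x = at_position v N" using y by auto
  show a: "snd (arrow word_graph v) = \<mu> v - 1 - N div s" by (simp add: word_graph_def N_def)
  show Nd: "N div s < \<mu> v" using lp(1) by (simp add: less_mult_imp_div_less mult.commute)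
  show i: "x div 2 = N mod s" using arg_cong[OF x(2), of snd] by (simp add: place_def)
  show "fst (end_block x) = v" using arg_cong[OF x(2), of "fst \<circ> fst"] by (simp add: place_def)
  have "place (word_rot x) = at_position v (N + gap x)"
    using turn_gap(1)[OF x(1)] turn_funpow[OF assms(1)] x(2) by simp
  then have "at_position v (N + gap x) \<in> marked" using word_rot_place(1)[OF x(1)] unfolding marked_def by (metis image_eqI)
  then have "s * \<mu> v \<le> N + gap x" using lp(3)[of "N + gap x"] turn_gap(2)[OF x(1)] by fastforce
  moreover have "N = s * (N div s) + x div 2" unfolding i by simp
  moreover obtain e where e: "\<mu> v = N div s + e" using Nd less_imp_add_positive by metis
  ultimately have "s * (N div s) + s * e \<le> s * (N div s) + (x div 2 + gap x)"
    by (metis add.assoc distrib_left)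
  then have "e * s \<le> x div 2 + gap x" by (simp add: mult.commute)
  then have "e \<le> dots word_graph x" using s_pos by (simp add: less_eq_div_iff_mult_less_eq)
  then show "snd (arrow word_graph v) < dots word_graph x" using a e Nd by simp
qed

lemma connected_word_graph:
  assumes "x \<in> D" "y \<in> D"
  shows "(x, y) \<in> ({(u, word_rot u) |u. True} \<union> {(u, opposite u) |u. True})\<^sup>*"
proof -
  let ?R = "{(u, word_rot u) |u. True} \<union> {(u, opposite u) |u. True}"
  have vertex: "(x, y) \<in> ?R\<^sup>*" if "x \<in> D" "y \<in> D" "fst (end_block x) = fst (end_block y)" for x y
  proof -
    have "y \<in> orbit word_rot x" using orbit_word_rot[OF that(1)] that by simp
    then show ?thesis
      by induction (auto intro: rtrancl_into_rtrancl)
  qed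
  show ?thesis
  proof (cases "fst (end_block x) = fst (end_block y)")
    case False
    from crossing obtain p q where pq: "(p, q) \<in> set ps" "fst p \<noteq> fst q" by blast
    then obtain i where i: "i < s" "ps ! i = (p, q)" using letter(2) by (auto simp: in_set_conv_nth)
    have e: "end_block (2 * i) = p" "end_block (2 * i + 1) = q" by (simp_all add: end_block_def i)
    have d: "2 * i \<in> D" "2 * i + 1 \<in> D" "opposite (2 * i) = 2 * i + 1" "opposite (2 * i + 1) = 2 * i"
      using i by (auto simp: mate_def)
    note lt = end_block_vertex
    obtain z where z: "z \<in> D" "fst (end_block z) = fst (end_block x)" "fst (end_block (opposite z)) = fst (end_block y)"
    proof (cases "fst p = fst (end_block x)")
      case True
      then have "fst q = fst (end_block y)" using False pq(2) lt[OF assms(1)] lt[OF assms(2)] lt[OF d(2)] e by simp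
      then show ?thesis using that[of "2 * i"] True d e by simp
    next
      case F: False
      then have "fst p = fst (end_block y)" "fst q = fst (end_block x)"
        using False pq(2) lt[OF assms(1)] lt[OF assms(2)] lt[OF d(1)] lt[OF d(2)] e by simp_all
      then show ?thesis using that[of "2 * i + 1"] d e by simp
    qed
    have "(x, z) \<in> ?R\<^sup>*" using vertex assms(1) z by simp
    moreover have "(z, opposite z) \<in> ?R" by blast
    moreover have "(opposite z, y) \<in> ?R\<^sup>*" using vertex[OF opposite_in[OF z(1)] assms(2)] z by simp
    ultimately show ?thesis by (meson rtrancl_into_rtrancl rtrancl_trans)
  qed (use vertex assms in blast)
qed

theorem word_graph_arrowed:
  assumes r: "r > 0" and reg: "regular r blocks monodromy" and d: "\<mu> 0 + \<mu> 1 = r * s"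
  shows "arrowed_r_hurwitz_graph r 0 [\<mu> 0, \<mu> 1] word_graph"
proof -
  have faces: "card (faces word_graph) = s"
    unfolding card_faces by (rule regular_iff_card[OF finite_blocks r _ monodromy_permutes reg]) (use d in \<open>simp add: card_blocks\<close>)
  have vimg: "(\<lambda>x. fst (end_block x)) ` D = {..<2}"
  proof (intro equalityI subsetI)
    fix v assume "v \<in> {..<2::nat}"
    then show "v \<in> (\<lambda>x. fst (end_block x)) ` D" using dart_at_vertex[of v] by auto
  qed (use end_block_vertex in auto)
  have conn: "connected_cell_graph 0 2 word_graph"
    unfolding connected_cell_graph_def darts_word_graph word_graph_fields
    using word_rot_permutes opposite_permutes opposite_neq connected_word_graph vimg orbit_word_rot faces
    by auto
  have F: "\<forall>F\<in>faces word_graph. (\<Sum>x\<in>F. dots word_graph x) = r" using face_regular_iff reg by blast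
  have two: "v = 0 \<or> v = 1" if "v < 2" for v :: nat using that by auto
  have vd: "vertex_dots word_graph v = [\<mu> 0, \<mu> 1] ! v" if "v < 2" for v
    using vertex_dots_word_graph[OF that] two[OF that] by auto
  have sides: "0 < dots_between_sides word_graph x \<and> dots_between_sides word_graph x < r"
    if "x \<in> D" "opposite x \<in> orbit next_d x" for x
  proof -
    have "(\<Sum>y\<in>orbit next_d x. dots word_graph y) = r" using F that(1) by (simp add: faces_def)
    then show ?thesis using dots_between_sides_bounds[OF that] by blast
  qed
  have "r_hurwitz_graph r 0 2 (r * s) word_graph"
    unfolding r_hurwitz_graph_def using conn faces F vertex_dots_word_graph \<mu>_pos sides by simp
  moreover have "fst (arrow word_graph v) \<in> D \<and> fst (end_block (fst (arrow word_graph v))) = v \<and>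
      snd (arrow word_graph v) < dots word_graph (fst (arrow word_graph v))" if "v < 2" for v
    using arrow_dart[OF that] by blast
  ultimately show ?thesis
    unfolding arrowed_r_hurwitz_graph_def using d vd by (simp add: numeral_2_eq_2)
qed

end

text \<open>The arrow determines the block of one dart at each vertex, the edge indices and the numbers of dots then determine the blocks of
the following darts, and the blocks at the two ends of its edges spell the word.\<close>

lemma word_graph_inject:
  assumes "oriented_word \<mu> s ps" "oriented_word \<mu> s qs"
    and rot: "\<And>x. x < 2 * s \<Longrightarrow> rot (oriented_word.word_graph \<mu> s ps) x = rot (oriented_word.word_graph \<mu> s qs) x"
    and dots: "\<And>x. x < 2 * s \<Longrightarrow> dots (oriented_word.word_graph \<mu> s ps) x = dots (oriented_word.word_graph \<mu> s qs) x"
    and arrow: "\<And>v. v < 2 \<Longrightarrow> arrow (oriented_word.word_graph \<mu> s ps) v = arrow (oriented_word.word_graph \<mu> s qs) v"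
  shows "ps = qs"
proof -
  interpret P: oriented_word \<mu> s ps by fact
  interpret Q: oriented_word \<mu> s qs by fact
  have rot': "P.word_rot x = Q.word_rot x" if "x \<in> P.D" for x using rot[of x] that by simp
  have step: "P.place (P.word_rot x) = Q.place (P.word_rot x)" if x: "x \<in> P.D" "P.place x = Q.place x" for x
  proof -
    have "x div 2 + P.gap x = x div 2 + Q.gap x"
      unfolding P.gap_eq[OF x(1)] Q.gap_eq[OF x(1)] using dots[of x] rot'[OF x(1)] x(1) by simp
    then have "P.gap x = Q.gap x" by simp
    then show ?thesis
      unfolding P.turn_gap(1)[OF x(1), symmetric] using Q.turn_gap(1)[OF x(1)] rot'[OF x(1)] x(2) by simp
  qed
  have place: "P.place y = Q.place y" if y: "y \<in> P.D" for y
  proof -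
    define v where "v = fst (P.end_block y)"
    have v: "v < 2" using P.end_block_in[OF y] by (auto simp: v_def P.blocks_def)
    define x where "x = fst (arrow P.word_graph v)"
    note Pa = P.arrow_dart[OF v, folded x_def]
    note Qa = Q.arrow_dart[OF v, folded arrow[OF v], folded x_def]
    have "P.last_position v div s = Q.last_position v div s"
      using Pa(3,4) Qa(3,4) by linarith
    moreover have "P.last_position v mod s = Q.last_position v mod s" using Pa(5) Qa(5) by simp
    ultimately have "P.last_position v = Q.last_position v" by (metis div_mult_mod_eq)
    then have base: "P.place x = Q.place x" using Pa(2) Qa(2) by simp
    have "y \<in> orbit P.word_rot x" using P.orbit_word_rot[OF Pa(1)] Pa(7) y by (simp add: v_def)
    then have "y \<in> P.D \<and> P.place y = Q.place y"
    proof induction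
      case base
      then show ?case using step[OF Pa(1)] \<open>P.place x = Q.place x\<close> P.word_rot_place(1)[OF Pa(1)] by simp
    next
      case (step z)
      then show ?case using \<open>\<And>x. x \<in> P.D \<Longrightarrow> P.place x = Q.place x \<Longrightarrow> _\<close>[of z] P.word_rot_place(1)[of z] by blast
    qed
    then show ?thesis by simp
  qed
  show ?thesis
  proof (rule nth_equalityI)
    show "length ps = length qs" using P.letter(2) Q.letter(2) by simp
    fix i assume "i < length ps"
    then have i: "2 * i \<in> P.D" "2 * i + 1 \<in> P.D" using P.letter(2) by auto
    have "fst (ps ! i) = fst (qs ! i)" "snd (ps ! i) = snd (qs ! i)"
      using place[OF i(1)] place[OF i(2)] by (simp_all add: P.place_def Q.place_def P.end_block_def Q.end_block_def)
    then show "ps ! i = qs ! i" by (rule prod_eqI)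
  qed
qed

section \<open>The word of a labeled arrowed graph\<close>

lemma sum_funpow_orbit:
  assumes "permutation f"
  shows "(\<Sum>t<card (orbit f x). g ((f ^^ t) x)) = (\<Sum>y\<in>orbit f x. g y)"
proof -
  note oc = orbit_card_cycle[OF assms permutation_self_in_orbit[OF assms, of x]]
  define n where "n = card (orbit f x)"
  have "orbit f x = (\<lambda>t. (f ^^ t) x) ` {0..<n}" using oc(3) n_def by blast
  then have "(\<Sum>y\<in>orbit f x. g y) = (\<Sum>y\<in>(\<lambda>t. (f ^^ t) x) ` {0..<n}. g y)" by (simp only:)
  also have "\<dots> = (\<Sum>t\<in>{0..<n}. g ((f ^^ t) x))" using oc(2) by (subst sum.reindex) (simp_all only: n_def o_def)
  finally show ?thesis by (simp add: n_def atLeast0LessThan)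
qed

text \<open>The data of an arrowed graph with a compatible edge labeling, whose darts are numbered such that the edge
of the dart \<open>x\<close> has the index \<open>x div 2\<close> (and the label \<open>s - x div 2\<close>). The arrow at \<open>v\<close> is the dot \<open>off v\<close> in the corner of \<open>base v\<close>.\<close>

locale labeled_rotation = block_states +
  fixes R :: "nat \<Rightarrow> nat" and vt :: "nat \<Rightarrow> nat" and dt :: "nat \<Rightarrow> nat" and base :: "nat \<Rightarrow> nat" and off :: "nat \<Rightarrow> nat"
  assumes R_perm: "R permutes {..<2 * s}"
    and vt_img: "vt ` {..<2 * s} = {..<2}"
    and vt_orbit: "\<And>x y. x < 2 * s \<Longrightarrow> y < 2 * s \<Longrightarrow> vt x = vt y \<longleftrightarrow> y \<in> orbit R x"
    and compat: "\<And>y. y < 2 * s \<Longrightarrow> dt y = 0 \<Longrightarrow> y div 2 < R y div 2"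
    and total: "\<And>v. v < 2 \<Longrightarrow> (\<Sum>x | x < 2 * s \<and> vt x = v. dt x) = \<mu> v"
    and base: "\<And>v. v < 2 \<Longrightarrow> base v < 2 * s \<and> vt (base v) = v \<and> off v < dt (base v)"
    and cross: "\<exists>x < s. vt (2 * x) \<noteq> vt (2 * x + 1)"
begin

text \<open>Blocks are counted from the arrow: the block after it has number 0 modulo \<open>\<mu> v\<close>, so \<open>base v\<close>, which is followed by \<open>off v\<close> dots before the
arrow, lies in block \<open>\<mu> v - 1 - off v\<close>.\<close>

definition block_no :: "nat \<Rightarrow> nat \<Rightarrow> nat" where
  "block_no v i = \<mu> v - 1 - off v + (\<Sum>t<i. dt ((R ^^ t) (base v)))"

text \<open>The position of the \<open>i\<close>-th dart after \<open>base v\<close>; it increases over several turns around the vertex.\<close>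

definition posn :: "nat \<Rightarrow> nat \<Rightarrow> nat" where
  "posn v i = s * block_no v i + (R ^^ i) (base v) div 2"

definition degree :: "nat \<Rightarrow> nat" where
  "degree v = card (orbit R (base v))"

definition steps :: "nat \<Rightarrow> nat" where
  "steps x = (SOME i. i < degree (vt x) \<and> (R ^^ i) (base (vt x)) = x)"

definition locus :: "nat \<Rightarrow> (nat \<times> nat) \<times> nat" where
  "locus x = at_position (vt x) (posn (vt x) (steps x))"

definition code :: "((nat \<times> nat) \<times> (nat \<times> nat)) list" where
  "code = map (\<lambda>i. (fst (locus (2 * i)), fst (locus (2 * i + 1)))) [0..<s]"

abbreviation "D \<equiv> {..<2 * s}"

lemma R_permutation: "permutation R"
  using R_perm finite_lessThan permutation_permutes by blast

lemma R_in: "x \<in> D \<Longrightarrow> R x \<in> D"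
  using permutes_in_image[OF R_perm] by blast

lemma vt_less: "x \<in> D \<Longrightarrow> vt x < 2"
  using vt_img by blast

lemma base_orbit:
  assumes "v < 2"
  shows "orbit R (base v) = {x \<in> D. vt x = v}"
  using base[OF assms] vt_orbit[of "base v"] permutes_orbit_subset[OF R_perm, of "base v"] by auto

lemma cyc_in:
  assumes "v < 2"
  shows "(R ^^ i) (base v) \<in> D" "vt ((R ^^ i) (base v)) = v"
proof -
  have "(R ^^ i) (base v) \<in> orbit R (base v)"
    by (rule funpow_in_orbit[OF permutation_self_in_orbit[OF R_permutation]])
  then show "(R ^^ i) (base v) \<in> D" "vt ((R ^^ i) (base v)) = v" using base_orbit[OF assms] by auto
qed

lemma degree_props:
  assumes "v < 2"
  shows "(R ^^ degree v) (base v) = base v" "inj_on (\<lambda>i. (R ^^ i) (base v)) {0..<degree v}" "0 < degree v"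
    "{x \<in> D. vt x = v} = (\<lambda>i. (R ^^ i) (base v)) ` {0..<degree v}"
proof -
  note oc = orbit_card_cycle[OF R_permutation permutation_self_in_orbit[OF R_permutation, of "base v"]]
  show "(R ^^ degree v) (base v) = base v" "inj_on (\<lambda>i. (R ^^ i) (base v)) {0..<degree v}"
    using oc(1,2) by (simp_all add: degree_def)
  show "{x \<in> D. vt x = v} = (\<lambda>i. (R ^^ i) (base v)) ` {0..<degree v}"
    using oc(3) base_orbit[OF assms] unfolding degree_def by metis
  show "0 < degree v"
    unfolding degree_def base_orbit[OF assms] using base[OF assms] by (auto simp: card_gt_0_iff)
qed

lemma steps_props:
  assumes "x \<in> D"
  shows "steps x < degree (vt x)" "(R ^^ steps x) (base (vt x)) = x"
proof -
  have "x \<in> (\<lambda>i. (R ^^ i) (base (vt x))) ` {0..<degree (vt x)}"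
    using degree_props(4)[OF vt_less[OF assms]] assms by blast
  then obtain i where "x = (R ^^ i) (base (vt x))" "i \<in> {0..<degree (vt x)}" by (rule imageE)
  then have "i < degree (vt x) \<and> (R ^^ i) (base (vt x)) = x" by (metis atLeastLessThan_iff)
  then have "steps x < degree (vt x) \<and> (R ^^ steps x) (base (vt x)) = x"
    unfolding steps_def by (rule someI)
  then show "steps x < degree (vt x)" "(R ^^ steps x) (base (vt x)) = x" by auto
qed

lemma steps_unique:
  assumes "v < 2" "i < degree v"
  shows "steps ((R ^^ i) (base v)) = i"
proof -
  note c = cyc_in[OF assms(1), of i]
  show ?thesis
    using steps_props[OF c(1)] inj_onD[OF degree_props(2)[OF assms(1)], of "steps ((R ^^ i) (base v))" i] assms(2) c(2) by simp
qed

lemma dt_total: "v < 2 \<Longrightarrow> (\<Sum>t<degree v. dt ((R ^^ t) (base v))) = \<mu> v"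
  using sum_funpow_orbit[OF R_permutation, of dt "base v"] total base_orbit by (simp add: degree_def)

lemma off_less:
  assumes "v < 2"
  shows "off v < \<mu> v"
proof -
  have "dt (base v) \<le> (\<Sum>x | x < 2 * s \<and> vt x = v. dt x)"
    using base[OF assms] by (intro member_le_sum) auto
  then show ?thesis using total[OF assms] base[OF assms] by linarith
qed

lemma index_less: "x \<in> D \<Longrightarrow> x div 2 < s"
  by (simp add: less_mult_imp_div_less mult.commute)

text \<open>This is where the compatibility of the labeling is used: without a dot between two darts, the position increases because the
index does.\<close>

lemma posn_Suc:
  assumes "v < 2"
  shows "posn v i < posn v (Suc i)"
proof -
  let ?y = "(R ^^ i) (base v)"
  have y: "?y \<in> D" "R ?y \<in> D" using cyc_in(1)[OF assms, of i] R_in by blast+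
  have e: "posn v (Suc i) = s * block_no v i + s * dt ?y + R ?y div 2"
    by (simp add: posn_def block_no_def distrib_left)
  show ?thesis
  proof (cases "dt ?y = 0")
    case True
    then show ?thesis using compat[of ?y] y(1) unfolding e by (simp add: posn_def)
  next
    case False
    then have "s \<le> s * dt ?y" by (cases "dt ?y") auto
    then show ?thesis using index_less[OF y(1)] unfolding e unfolding posn_def by linarith
  qed
qed

lemma posn_less: "v < 2 \<Longrightarrow> i < j \<Longrightarrow> posn v i < posn v j"
  using lift_Suc_mono_less[of "posn v"] posn_Suc by blast

lemma posn_less_iff: "v < 2 \<Longrightarrow> posn v i < posn v j \<longleftrightarrow> i < j"
  by (rule strict_mono_less) (simp add: strict_mono_def posn_less)

lemma posn_degree:
  assumes "v < 2"
  shows "posn v (degree v) = posn v 0 + s * \<mu> v"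
  using dt_total[OF assms] degree_props(1)[OF assms]
  by (simp add: posn_def block_no_def distrib_left)

lemma posn_0: "v < 2 \<Longrightarrow> posn v 0 < s * \<mu> v"
proof -
  assume v: "v < 2"
  have "posn v 0 < s * (\<mu> v - 1 - off v) + s"
    using index_less[of "base v"] base[OF v] by (simp add: posn_def block_no_def)
  also have "\<dots> = s * Suc (\<mu> v - 1 - off v)" by simp
  also have "\<dots> \<le> s * \<mu> v" using off_less[OF v] by (intro mult_le_mono2) simp
  finally show ?thesis .
qed

lemma posn_1:
  assumes "v < 2"
  shows "s * \<mu> v \<le> posn v 1"
proof -
  have "block_no v 1 = \<mu> v - 1 - off v + dt (base v)" by (simp add: block_no_def)
  then have "\<mu> v \<le> block_no v 1" using base[OF assms] off_less[OF assms] by linarith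
  then have "s * \<mu> v \<le> s * block_no v 1" by (rule mult_le_mono2)
  then show ?thesis unfolding posn_def by (rule trans_le_add1)
qed

text \<open>The darts of one turn lie in an interval of the length of a period, hence at different positions.\<close>

lemma posn_window:
  assumes "v < 2" "i < degree v"
  shows "posn v 0 \<le> posn v i" "posn v i < posn v 0 + s * \<mu> v"
  using posn_less[OF assms] posn_less[OF assms(1), of 0 i] posn_degree[OF assms(1)] by (cases "i = 0"; simp)+

lemma mod_window_eq:
  fixes a b c L :: nat
  assumes "a mod L = b mod L" "c \<le> a" "a < c + L" "c \<le> b" "b < c + L"
  shows "a = b"
proof -
  have gen: "a = b" if "a mod L = b mod L" "c \<le> a" "b < c + L" "a \<le> b" for a b :: nat
  proof -
    have "L dvd b - a" using that(1,4) by (metis mod_eq_dvd_iff_nat)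
    moreover have "b - a < L" using that by linarith
    ultimately have "b - a = 0" using nat_dvd_not_less by (cases "b - a = 0") auto
    then show ?thesis using that(4) by simp
  qed
  show ?thesis using gen[of a b] gen[of b a] assms by (metis linorder_linear)
qed

lemma locus_cyc:
  assumes "v < 2" "i \<le> degree v"
  shows "locus ((R ^^ i) (base v)) = at_position v (posn v i)"
proof (cases "i = degree v")
  case True
  then have "(R ^^ i) (base v) = (R ^^ 0) (base v)" using degree_props(1)[OF assms(1)] by simp
  moreover have "locus ((R ^^ 0) (base v)) = at_position v (posn v 0)"
    unfolding locus_def steps_unique[OF assms(1) degree_props(3)[OF assms(1)]] cyc_in(2)[OF assms(1)] ..
  ultimately show ?thesis using True posn_degree[OF assms(1)] at_position_period by simp
next
  case False
  then have "i < degree v" using assms(2) by simp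
  show ?thesis unfolding locus_def steps_unique[OF assms(1) \<open>i < degree v\<close>] cyc_in(2)[OF assms(1)] ..
qed

lemma locus_props:
  assumes "x \<in> D"
  shows "locus x \<in> states" "fst (fst (locus x)) = vt x" "snd (locus x) = x div 2"
proof -
  note st = steps_props[OF assms] and v = vt_less[OF assms]
  show "locus x \<in> states" "fst (fst (locus x)) = vt x"
    unfolding locus_def using at_position_in_states[OF v] by simp_all
  show "snd (locus x) = x div 2"
    using st(2) index_less[OF assms] by (simp add: locus_def posn_def)
qed

lemma inj_locus: "inj_on locus D"
proof (rule inj_onI)
  fix x y assume xy: "x \<in> D" "y \<in> D" "locus x = locus y"
  then have v: "vt x = vt y" using locus_props(2) by metis
  note w = posn_window[OF vt_less[OF xy(1)] steps_props(1)[OF xy(1)]]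
    posn_window[OF vt_less[OF xy(2)] steps_props(1)[OF xy(2)], folded v]
  have "posn (vt x) (steps x) mod (s * \<mu> (vt x)) = posn (vt x) (steps y) mod (s * \<mu> (vt x))"
    using xy(3) v by (simp add: locus_def at_position_eq_iff)
  then have "posn (vt x) (steps x) = posn (vt x) (steps y)" by (rule mod_window_eq) (use w in auto)
  then have st: "steps x = steps y" using posn_less[OF vt_less[OF xy(1)]] by (metis less_irrefl linorder_neqE_nat)
  have "x = (R ^^ steps x) (base (vt x))" by (rule steps_props(2)[OF xy(1), symmetric])
  also have "\<dots> = (R ^^ steps y) (base (vt y))" by (simp only: st v)
  also have "\<dots> = y" by (rule steps_props(2)[OF xy(2)])
  finally show "x = y" .
qed

lemma code_nth: "i < s \<Longrightarrow> code ! i = (fst (locus (2 * i)), fst (locus (2 * i + 1)))"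
  by (simp add: code_def)

lemma code_end: "x \<in> D \<Longrightarrow> (if even x then fst else snd) (code ! (x div 2)) = fst (locus x)"
  using index_less[of x] by (auto simp: code_nth)

lemma code_oriented_word: "oriented_word \<mu> s code"
proof
  show "code \<in> words blocks s"
    unfolding words_def
  proof (intro CollectI conjI subsetI)
    show "length code = s" by (simp add: code_def)
    fix p assume "p \<in> set code"
    then obtain i where i: "i < s" "p = (fst (locus (2 * i)), fst (locus (2 * i + 1)))"
      by (auto simp: code_def)
    then have d: "2 * i \<in> D" "2 * i + 1 \<in> D" by auto
    have "fst (locus x) \<in> blocks" if "x \<in> D" for x using locus_props(1)[OF that] by (auto simp: states_def mem_Times_iff)
    moreover have "fst (locus (2 * i)) \<noteq> fst (locus (2 * i + 1))"
    proof
      assume "fst (locus (2 * i)) = fst (locus (2 * i + 1))"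
      then have "locus (2 * i) = locus (2 * i + 1)" using locus_props(3)[OF d(1)] locus_props(3)[OF d(2)] by (simp add: prod_eq_iff)
      then show False using inj_onD[OF inj_locus _ d] by simp
    qed
    ultimately show "p \<in> pairs blocks" using d i(2) by (simp add: pairs_def)
  qed
  obtain i where i: "i < s" "vt (2 * i) \<noteq> vt (2 * i + 1)" using cross by blast
  then have "2 * i \<in> D" "2 * i + 1 \<in> D" by auto
  then have "fst (fst (code ! i)) \<noteq> fst (snd (code ! i))" using i by (simp add: code_nth locus_props(2))
  moreover have "code ! i \<in> set code" using i(1) by (simp add: code_def)
  ultimately show "\<exists>(p, q)\<in>set code. fst p \<noteq> fst q" by (metis (mono_tags, lifting) case_prodI2 fst_conv snd_conv)
qed

sublocale W: oriented_word \<mu> s code by (rule code_oriented_word)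

lemma W_place: "x \<in> D \<Longrightarrow> W.place x = locus x"
  using locus_props(3)[of x] code_end[of x] by (simp add: W.place_def W.end_block_def prod_eq_iff)

lemma W_end_block: "x \<in> D \<Longrightarrow> fst (W.end_block x) = vt x"
  using W_place[of x] locus_props(2)[of x] by (simp add: W.place_def prod_eq_iff)

lemma marked_iff: "z \<in> W.marked \<longleftrightarrow> (\<exists>x\<in>D. z = locus x)"
  using W_place by (auto simp: W.marked_def)

text \<open>Positions strictly between those of consecutive darts carry no dart, as the darts of one turn lie within one period.\<close>

lemma W_rot_gap:
  assumes "x \<in> D"
  shows "W.word_rot x = R x" "W.gap x = posn (vt x) (Suc (steps x)) - posn (vt x) (steps x)"
proof -
  define v i where "v = vt x" and "i = steps x"
  have v: "v < 2" using vt_less[OF assms] by (simp add: v_def)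
  have i: "i < degree v" and x: "(R ^^ i) (base v) = x" using steps_props[OF assms] by (simp_all add: v_def i_def)
  define g where "g = posn v (Suc i) - posn v i"
  have lt: "posn v i < posn v (Suc i)" by (rule posn_Suc[OF v])
  have px: "W.place x = at_position v (posn v i)" using W_place[OF assms] by (simp add: locus_def v_def i_def)
  have pR: "W.place (R x) = at_position v (posn v (Suc i))"
    using W_place[OF R_in[OF assms]] locus_cyc[OF v, of "Suc i"] i x by simp
  have tg: "(turn ^^ k) (W.place x) = at_position v (posn v i + k)" for k
    unfolding px by (rule turn_funpow[OF v])
  have e: "(turn ^^ g) (W.place x) = W.place (R x)" unfolding tg pR using lt by (simp add: g_def)
  have 1: "(turn ^^ g) (W.place x) \<in> W.marked" unfolding e using R_in[OF assms] by (simp add: W.marked_def)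
  have 2: "(turn ^^ k) (W.place x) \<notin> W.marked" if k: "0 < k" "k < g" for k
  proof
    assume "(turn ^^ k) (W.place x) \<in> W.marked"
    then obtain y where y: "y \<in> D" "at_position v (posn v i + k) = locus y" unfolding tg marked_iff by blast
    have vy: "vt y = v" using arg_cong[OF y(2), of "fst \<circ> fst"] locus_props(2)[OF y(1)] by simp
    define j where "j = steps y"
    have j: "j < degree v" using steps_props(1)[OF y(1)] by (simp add: j_def vy)
    have m: "(posn v i + k) mod (s * \<mu> v) = posn v j mod (s * \<mu> v)"
      using y(2) by (simp add: locus_def vy j_def at_position_eq_iff)
    have up: "posn v (Suc i) \<le> posn v 0 + s * \<mu> v"
    proof (cases "Suc i = degree v")
      case True
      then show ?thesis using posn_degree[OF v] by simp
    next
      case False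
      then show ?thesis using posn_window(2)[OF v, of "Suc i"] i by simp
    qed
    have kk: "posn v i + k < posn v (Suc i)" using k(2) unfolding g_def by linarith
    have eq: "posn v i + k = posn v j"
      by (rule mod_window_eq[OF m, of "posn v 0"])
        (use posn_window[OF v i] posn_window[OF v j] up kk in linarith)+
    have "posn v i < posn v j" "posn v j < posn v (Suc i)" using k(1) kk eq by linarith+
    then have "i < j" "j < Suc i" by (simp_all only: posn_less_iff[OF v])
    then show False by simp
  qed
  have "0 < g" using lt by (simp add: g_def)
  note ret = return_time_eqI[OF turn_permutation this 1 2]
  show "W.gap x = posn (vt x) (Suc (steps x)) - posn (vt x) (steps x)"
    using ret(1) by (simp add: W.gap_def g_def v_def i_def)
  have "W.place (W.word_rot x) = W.place (R x)" using W.word_rot_place(2)[OF assms] ret(2) e by simp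
  then show "W.word_rot x = R x"
    using inj_onD[OF W.inj_place _ W.word_rot_place(1)[OF assms] R_in[OF assms]] by simp
qed

lemma W_dots:
  assumes "x \<in> D"
  shows "dots W.word_graph x = dt x"
proof -
  define v i where "v = vt x" and "i = steps x"
  have v: "v < 2" using vt_less[OF assms] by (simp add: v_def)
  have x: "(R ^^ i) (base v) = x" using steps_props[OF assms] by (simp add: v_def i_def)
  have "x div 2 + W.gap x = s * dt x + R x div 2"
  proof -
    have "posn v (Suc i) = posn v i + W.gap x"
      using posn_Suc[OF v, of i] W_rot_gap(2)[OF assms] by (simp add: v_def i_def)
    moreover have "posn v i = s * block_no v i + x div 2" "posn v (Suc i) = s * block_no v i + s * dt x + R x div 2"
      using x by (simp_all add: posn_def block_no_def distrib_left)
    ultimately show ?thesis by linarith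
  qed
  then show ?thesis using index_less[OF R_in[OF assms]] by simp
qed

text \<open>The dart after \<open>base v\<close> lies beyond the arrow, that is beyond the end of the last block, so \<open>base v\<close> is the last dart before block 0.\<close>

lemma W_arrow:
  assumes v: "v < 2"
  shows "arrow W.word_graph v = (base v, off v)"
proof -
  have b: "base v \<in> D" using base[OF v] by simp
  have lb: "locus (base v) = at_position v (posn v 0)" using locus_cyc[OF v, of 0] by simp
  have m: "at_position v (posn v 0) \<in> W.marked" using b lb marked_iff by metis
  have "W.last_position v = posn v 0"
  proof (rule antisym)
    show "posn v 0 \<le> W.last_position v" by (rule W.last_position(3)[OF v posn_0[OF v] m])
    obtain y where y: "y \<in> D" "at_position v (W.last_position v) = locus y"
      using W.last_position(2)[OF v] marked_iff by blast
    have vy: "vt y = v" using arg_cong[OF y(2), of "fst \<circ> fst"] locus_props(2)[OF y(1)] by simp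
    define j where "j = steps y"
    have j: "j < degree v" using steps_props(1)[OF y(1)] by (simp add: j_def vy)
    have e: "W.last_position v mod (s * \<mu> v) = posn v j mod (s * \<mu> v)"
      using y(2) by (simp add: locus_def vy j_def at_position_eq_iff)
    then have lp: "W.last_position v = posn v j mod (s * \<mu> v)" using W.last_position(1)[OF v] by simp
    show "W.last_position v \<le> posn v 0"
    proof (cases "j = 0")
      case True
      then show ?thesis using lp by simp
    next
      case False
      have "s * \<mu> v \<le> posn v j"
        using posn_1[OF v] posn_less[OF v, of 1 j] False by (cases "j = 1") auto
      moreover have "posn v j < posn v 0 + s * \<mu> v" using posn_window[OF v j] by simp
      ultimately show ?thesis unfolding lp using posn_0[OF v] by (subst le_mod_geq) auto
    qed
  qed
  moreover have "posn v 0 div s = \<mu> v - 1 - off v"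
    using index_less[OF b] by (simp add: posn_def block_no_def)
  moreover have "inv_into D W.place (at_position v (posn v 0)) = base v"
    using inv_into_f_f[OF W.inj_place b] W_place[OF b] lb by simp
  ultimately show ?thesis using off_less[OF v] by (simp add: W.word_graph_def)
qed

end

section \<open>Isomorphisms and parametrizations of arrowed graphs\<close>

lemma isos_D:
  assumes "p \<in> isos G H"
  shows "nedges G = nedges H" "p permutes darts G" "darts H = darts G"
    "\<And>x. x \<in> darts G \<Longrightarrow> p (rot G x) = rot H (p x)" "\<And>x. x \<in> darts G \<Longrightarrow> p (flip G x) = flip H (p x)"
    "\<And>x. x \<in> darts G \<Longrightarrow> vert H (p x) = vert G x" "\<And>x. x \<in> darts G \<Longrightarrow> dots H (p x) = dots G x"
    "\<And>i. i \<in> vert G ` darts G \<Longrightarrow> arrow H i = apfst p (arrow G i)"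
    "vert H ` darts H = vert G ` darts G"
proof -
  show n: "nedges G = nedges H" and p: "p permutes darts G"
    and v: "\<And>x. x \<in> darts G \<Longrightarrow> vert H (p x) = vert G x"
    using assms by (auto simp: isos_def)
  show d: "darts H = darts G" using n by (simp add: darts_def)
  show "\<And>x. x \<in> darts G \<Longrightarrow> p (rot G x) = rot H (p x)" "\<And>x. x \<in> darts G \<Longrightarrow> p (flip G x) = flip H (p x)"
     "\<And>x. x \<in> darts G \<Longrightarrow> dots H (p x) = dots G x"
    "\<And>i. i \<in> vert G ` darts G \<Longrightarrow> arrow H i = apfst p (arrow G i)"
    using assms by (auto simp: isos_def)
  have "vert H ` darts H = vert H ` p ` darts G" unfolding d permutes_image[OF p] ..
  also have "\<dots> = vert G ` darts G" unfolding image_image by (intro image_cong refl v)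
  finally show "vert H ` darts H = vert G ` darts G" .
qed

lemma isos_id: "id \<in> isos G G"
  by (simp add: isos_def permutes_id)

lemma isos_inv:
  assumes "p \<in> isos G H"
  shows "inv p \<in> isos H G"
proof -
  note D = isos_D[OF assms]
  have pinv: "inv p (p x) = x" "p (inv p x) = x" for x using permutes_inverses[OF D(2)] by auto
  have ip: "inv p permutes darts H" unfolding D(3) by (rule permutes_inv[OF D(2)])
  have darts: "inv p x \<in> darts G" if "x \<in> darts H" for x
    using permutes_in_image[OF ip] that D(3) by simp
  have "inv p (rot H x) = rot G (inv p x) \<and> inv p (flip H x) = flip G (inv p x) \<and>
     vert G (inv p x) = vert H x \<and> dots G (inv p x) = dots H x" if "x \<in> darts H" for x
    using D(4-7)[OF darts[OF that]] pinv by metis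
  moreover have "arrow G i = apfst (inv p) (arrow H i)" if "i \<in> vert H ` darts H" for i
    using D(8)[of i] that D(9) pinv by (cases "arrow G i") simp
  ultimately show ?thesis using D(1) ip by (simp add: isos_def)
qed

lemma isos_comp:
  assumes "p \<in> isos G H" "q \<in> isos H K"
  shows "q \<circ> p \<in> isos G K"
proof -
  note D = isos_D[OF assms(1)] and E = isos_D[OF assms(2)]
  have in_H: "p x \<in> darts H" if "x \<in> darts G" for x
    using permutes_in_image[OF D(2)] that D(3) by simp
  have "(q \<circ> p) permutes darts G" using D(2) E(2)[unfolded D(3)] by (rule permutes_compose)
  moreover have "arrow K i = apfst (q \<circ> p) (arrow G i)" if "i \<in> vert G ` darts G" for i
    using D(8)[OF that] E(8)[of i] D(9) that by (cases "arrow G i") simp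
  ultimately show ?thesis using D E in_H by (simp add: isos_def)
qed

text \<open>Two vertices with \<open>\<mu> 0 + \<mu> 1 = r * s\<close> dots. The number of faces is \<open>s\<close>, and by Euler's formula so is the number of edges.\<close>

locale two_vertex_degrees =
  fixes r :: nat and \<mu> :: "nat \<Rightarrow> nat" and s :: nat
  assumes r: "r > 0" and degrees_pos: "\<mu> 0 > 0" "\<mu> 1 > 0" and degree: "\<mu> 0 + \<mu> 1 = r * s"
begin

abbreviation "arrowed \<equiv> arrowed_r_hurwitz_graph r 0 [\<mu> 0, \<mu> 1]"
abbreviation "R \<equiv> iso_rel r 0 [\<mu> 0, \<mu> 1]"

lemma edges_pos: "s > 0"
  using degree degrees_pos by (cases s) auto

lemma block_states: "block_states \<mu> s"
proof
  fix v :: nat assume "v < 2"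
  then have "v = 0 \<or> v = 1" by auto
  then show "\<mu> v > 0" using degrees_pos by auto
qed (rule edges_pos)

sublocale block_states \<mu> s by (rule block_states)

lemma mu_nth: "v < 2 \<Longrightarrow> [\<mu> 0, \<mu> 1] ! v = \<mu> v"
  by (cases v) auto

lemma arrowed_D:
  assumes "arrowed G"
  shows "nedges G = s" "darts G = {..<2 * s}" "rot G permutes {..<2 * s}" "flip G permutes {..<2 * s}"
    "\<And>x. x < 2 * s \<Longrightarrow> flip G x \<noteq> x \<and> flip G (flip G x) = x"
    "\<And>x y. x < 2 * s \<Longrightarrow> y < 2 * s \<Longrightarrow> (x, y) \<in> ({(u, rot G u) |u. True} \<union> {(u, flip G u) |u. True})\<^sup>*"
    "vert G ` {..<2 * s} = {..<2}"
    "\<And>x y. x < 2 * s \<Longrightarrow> y < 2 * s \<Longrightarrow> vert G x = vert G y \<longleftrightarrow> y \<in> orbit (rot G) x"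
    "\<And>F. F \<in> faces G \<Longrightarrow> (\<Sum>x\<in>F. dots G x) = r"
    "\<And>v. v < 2 \<Longrightarrow> vertex_dots G v = \<mu> v"
    "\<And>v. v < 2 \<Longrightarrow> fst (arrow G v) < 2 * s \<and> vert G (fst (arrow G v)) = v \<and> snd (arrow G v) < dots G (fst (arrow G v))"
proof -
  have h: "r_hurwitz_graph r 0 2 (\<mu> 0 + \<mu> 1) G"
    and vd: "\<forall>i<2. vertex_dots G i = [\<mu> 0, \<mu> 1] ! i"
    and ar: "\<forall>i<2. fst (arrow G i) \<in> darts G \<and> vert G (fst (arrow G i)) = i \<and> snd (arrow G i) < dots G (fst (arrow G i))"
    using assms unfolding arrowed_r_hurwitz_graph_def by (auto simp: numeral_2_eq_2)
  have c: "connected_cell_graph 0 2 G" and d: "\<mu> 0 + \<mu> 1 = r * card (faces G)"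
    and f: "\<forall>f\<in>faces G. (\<Sum>x\<in>f. dots G x) = r"
    using h unfolding r_hurwitz_graph_def by blast+
  have "nedges G = card (faces G)" using c unfolding connected_cell_graph_def by simp
  then show n: "nedges G = s" using d degree r by simp
  then show D: "darts G = {..<2 * s}" by (simp add: darts_def)
  note c' = c[unfolded connected_cell_graph_def D]
  show "rot G permutes {..<2 * s}" "flip G permutes {..<2 * s}" "vert G ` {..<2 * s} = {..<2}" using c' by blast+
  show "flip G x \<noteq> x \<and> flip G (flip G x) = x" if "x < 2 * s" for x using c' that by simp
  show "(x, y) \<in> ({(u, rot G u) |u. True} \<union> {(u, flip G u) |u. True})\<^sup>*" if "x < 2 * s" "y < 2 * s" for x y
    using c' that by simp
  show "vert G x = vert G y \<longleftrightarrow> y \<in> orbit (rot G) x" if "x < 2 * s" "y < 2 * s" for x y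
    using c' that by simp
  show "\<And>F. F \<in> faces G \<Longrightarrow> (\<Sum>x\<in>F. dots G x) = r" using f by blast
  show "\<And>v. v < 2 \<Longrightarrow> vertex_dots G v = \<mu> v" using vd mu_nth by simp
  show "\<And>v. v < 2 \<Longrightarrow> fst (arrow G v) < 2 * s \<and> vert G (fst (arrow G v)) = v \<and> snd (arrow G v) < dots G (fst (arrow G v))"
    using ar D by simp
qed

lemma equiv_iso_rel: "equiv {G. arrowed G} R"
proof (rule equivI)
  show "R \<subseteq> {G. arrowed G} \<times> {G. arrowed G}" by (auto simp: iso_rel_def)
  show "refl_on {G. arrowed G} R" using isos_id by (fastforce simp: refl_on_def iso_rel_def)
  show "sym R" using isos_inv by (fastforce simp: sym_def iso_rel_def)
  show "trans R" using isos_comp by (fastforce simp: trans_def iso_rel_def)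
qed

text \<open>An isomorphism fixes the darts of the arrows, and a homeomorphism of a connected graph is determined by the image of one dart.\<close>

lemma isos_unique:
  assumes "arrowed G" "p \<in> isos G H" "q \<in> isos G H"
  shows "p = q"
proof -
  note A = arrowed_D[OF assms(1)]
  note P = isos_D[OF assms(2)] and Q = isos_D[OF assms(3)]
  define x0 where "x0 = fst (arrow G 0)"
  have x0: "x0 < 2 * s" using A(11)[of 0] by (simp add: x0_def)
  have "0 \<in> vert G ` darts G" using A(2,7) by simp
  then have "apfst p (arrow G 0) = apfst q (arrow G 0)" using P(8) Q(8) by metis
  then have base: "p x0 = q x0" by (cases "arrow G 0") (simp add: x0_def)
  have eq: "y < 2 * s \<and> p y = q y" if "(x0, y) \<in> ({(u, rot G u) |u. True} \<union> {(u, flip G u) |u. True})\<^sup>*" for y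
    using that
  proof (induction rule: rtrancl_induct)
    case base
    then show ?case using \<open>p x0 = q x0\<close> x0 by simp
  next
    case (step y z)
    then have y: "y \<in> darts G" "p y = q y" using A(2) by auto
    have z: "z = rot G y \<or> z = flip G y" using step(2) by auto
    moreover have "rot G y < 2 * s" "flip G y < 2 * s"
      using permutes_in_image[OF A(3), of y] permutes_in_image[OF A(4), of y] y(1) A(2) by auto
    moreover have "p (rot G y) = q (rot G y)" "p (flip G y) = q (flip G y)"
      using P(4,5)[OF y(1)] Q(4,5)[OF y(1)] y(2) by simp_all
    ultimately show ?case by auto
  qed
  show ?thesis
  proof
    fix y
    show "p y = q y"
    proof (cases "y < 2 * s")
      case True
      then show ?thesis using eq A(6)[OF x0] by blast
    next
      case False
      then show ?thesis using permutes_not_in[OF P(2), of y] permutes_not_in[OF Q(2), of y] A(2) by simp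
    qed
  qed
qed

lemma weight_arrowed: "arrowed G \<Longrightarrow> weight G = real (card (compatible_labelings G)) / fact s"
proof -
  assume G: "arrowed G"
  have "isos G G = {id}" using isos_id isos_unique[OF G] by blast
  then show ?thesis using arrowed_D(1)[OF G] by (simp add: weight_def)
qed

text \<open>A graph is determined up to isomorphism by its values on the darts and vertices, all of which lie in finite sets.\<close>

lemma finite_classes: "finite ({G. arrowed G} // R)"
proof -
  let ?D = "{..<2 * s}"
  define key where "key G = (rot G, flip G, restrict (vert G) ?D, restrict (dots G) ?D, restrict (arrow G) {..<2})"
    for G :: arrowed_hurwitz_graph
  define big where "big = \<mu> 0 + \<mu> 1"
  have dots_le: "dots G x < Suc big" if G: "arrowed G" and x: "x < 2 * s" for G x
  proof -
    have v: "vert G x < 2" using arrowed_D(7)[OF G] x by blast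
    have "dots G x \<le> vertex_dots G (vert G x)"
      unfolding vertex_dots_def using x arrowed_D(2)[OF G] by (intro member_le_sum) auto
    moreover have "vert G x = 0 \<or> vert G x = 1" using v by auto
    ultimately show ?thesis using arrowed_D(10)[OF G v] by (auto simp: big_def)
  qed
  have "key ` {G. arrowed G} \<subseteq> {p. p permutes ?D} \<times> {p. p permutes ?D} \<times> (?D \<rightarrow>\<^sub>E {..<2}) \<times> (?D \<rightarrow>\<^sub>E {..<Suc big})
      \<times> ({..<2} \<rightarrow>\<^sub>E ?D \<times> {..<Suc big})"
  proof
    fix k assume "k \<in> key ` {G. arrowed G}"
    then obtain G where G: "arrowed G" "k = key G" by blast
    note A = arrowed_D[OF G(1)]
    have "restrict (vert G) ?D \<in> ?D \<rightarrow>\<^sub>E {..<2}" using A(7) by auto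
    moreover have "restrict (dots G) ?D \<in> ?D \<rightarrow>\<^sub>E {..<Suc big}" using dots_le[OF G(1)] by simp
    moreover have "arrow G v \<in> ?D \<times> {..<Suc big}" if "v < 2" for v
      using A(11)[OF that] dots_le[OF G(1), of "fst (arrow G v)"] by (auto simp: mem_Times_iff)
    then have "restrict (arrow G) {..<2} \<in> {..<2} \<rightarrow>\<^sub>E ?D \<times> {..<Suc big}" by auto
    ultimately show "k \<in> {p. p permutes ?D} \<times> {p. p permutes ?D} \<times> (?D \<rightarrow>\<^sub>E {..<2}) \<times> (?D \<rightarrow>\<^sub>E {..<Suc big})
      \<times> ({..<2} \<rightarrow>\<^sub>E ?D \<times> {..<Suc big})"
      unfolding G(2) key_def using A(3,4) by blast
  qed
  moreover have "finite ({p. p permutes ?D} \<times> {p. p permutes ?D} \<times> (?D \<rightarrow>\<^sub>E {..<2::nat}) \<times> (?D \<rightarrow>\<^sub>E {..<Suc big})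
      \<times> ({..<2::nat} \<rightarrow>\<^sub>E ?D \<times> {..<Suc big}))"
    by (intro finite_cartesian_product finite_permutations finite_PiE) auto
  ultimately have fin: "finite (key ` {G. arrowed G})" by (rule finite_subset)
  have same: "R `` {G} = R `` {H}" if G: "arrowed G" and H: "arrowed H" and k: "key G = key H" for G H
  proof (rule equiv_class_eq[OF equiv_iso_rel])
    note A = arrowed_D[OF G] and B = arrowed_D[OF H]
    have "vert G x = vert H x" "dots G x = dots H x" if "x < 2 * s" for x
      using k that unfolding key_def by (metis (no_types, lifting) prod.inject lessThan_iff restrict_apply')+
    moreover have "arrow G v = arrow H v" if "v < 2" for v
      using k that unfolding key_def by (metis (no_types, lifting) prod.inject lessThan_iff restrict_apply')
    moreover have "rot G = rot H" "flip G = flip H" using k by (simp_all add: key_def)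
    ultimately have "id \<in> isos G H"
      using A(1,2,7) B(1) by (auto simp: isos_def permutes_id)
    then show "(G, H) \<in> R" using G H by (auto simp: iso_rel_def)
  qed
  have "{G. arrowed G} // R = (\<lambda>k. R `` {SOME G. arrowed G \<and> key G = k}) ` key ` {G. arrowed G}"
  proof -
    have c: "R `` {SOME H. arrowed H \<and> key H = key G} = R `` {G}" if "arrowed G" for G
    proof -
      have H: "arrowed (SOME H. arrowed H \<and> key H = key G) \<and> key (SOME H. arrowed H \<and> key H = key G) = key G"
        by (rule someI[of _ G]) (use that in simp)
      show ?thesis by (rule same[OF conjunct1[OF H] that conjunct2[OF H]])
    qed
    have "{G. arrowed G} // R = (\<lambda>G. R `` {G}) ` {G. arrowed G}" by (auto simp: quotient_def)
    also have "\<dots> = (\<lambda>G. R `` {SOME H. arrowed H \<and> key H = key G}) ` {G. arrowed G}"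
      by (intro image_cong refl) (use c in simp)
    finally show ?thesis by (simp add: image_image)
  qed
  then show ?thesis using fin by simp
qed

text \<open>A numbering of the darts for which the two darts of an edge are \<open>2 i\<close> and \<open>2 i + 1\<close>, and \<open>s - i\<close> is a
compatible label of the edge: a compatible labeling together with an orientation of all edges.\<close>

definition parametrizations :: "arrowed_hurwitz_graph \<Rightarrow> (nat \<Rightarrow> nat) set" where
  "parametrizations G = {q. q permutes {..<2 * s} \<and> (\<forall>x<2 * s. q (mate s x) = flip G (q x)) \<and>
     (\<forall>x<2 * s. dots G (next_dart G (q x)) = 0 \<longrightarrow> inv q (next_dart G (q x)) div 2 < x div 2)}"

lemma mate_in: "x < 2 * s \<Longrightarrow> mate s x < 2 * s"
  by (auto simp: mate_def elim!: oddE evenE)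

lemma mate_div: "mate s x div 2 = x div 2"
  by (auto simp: mate_def elim!: oddE evenE)

lemma half_less: "x < 2 * s \<Longrightarrow> x div 2 < s"
  by (simp add: less_mult_imp_div_less mult.commute)

lemma next_dart_in: "arrowed G \<Longrightarrow> x < 2 * s \<Longrightarrow> next_dart G x < 2 * s"
  using permutes_in_image[OF permutes_inv[OF arrowed_D(3)], of G "flip G x"] permutes_in_image[OF arrowed_D(4), of G x]
  by (simp add: next_dart_def)

text \<open>Every label is used by at least two darts, and there are only \<open>2 s\<close> darts for \<open>s\<close> labels.\<close>

lemma label_fiber:
  assumes G: "arrowed G" and l: "l \<in> edge_labelings G" and x: "x < 2 * s"
  shows "{y. y < 2 * s \<and> l y = l x} = {x, flip G x}"
proof -
  note A = arrowed_D[OF G]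
  let ?D = "{..<2 * s}"
  define F where "F j = {y \<in> ?D. l y = j}" for j
  have limg: "l ` ?D = {1..s}" and lflip: "\<And>x. x < 2 * s \<Longrightarrow> l (flip G x) = l x"
    using l A(1,2) by (auto simp: edge_labelings_def)
  have fl: "flip G y < 2 * s" if "y < 2 * s" for y using permutes_in_image[OF A(4), of y] that by simp
  have two: "2 \<le> card (F j)" if "j \<in> {1..s}" for j
  proof -
    from that have "j \<in> l ` ?D" using limg by simp
    then obtain y where y: "y < 2 * s" "l y = j" by auto
    have "{y, flip G y} \<subseteq> F j" using y fl lflip by (auto simp: F_def)
    moreover have "card {y, flip G y} = 2" using A(5)[OF y(1)] by auto
    ultimately show ?thesis using card_mono[of "F j" "{y, flip G y}"] by (simp add: F_def)
  qed
  have "(\<Sum>j\<in>{1..s}. card (F j)) = card ?D"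
  proof -
    have "?D = (\<Union>j\<in>{1..s}. F j)" using limg by (auto simp: F_def)
    then have "card ?D = card (\<Union>j\<in>{1..s}. F j)" by simp
    also have "\<dots> = (\<Sum>j\<in>{1..s}. card (F j))" by (rule card_UN_disjoint) (auto simp: F_def)
    finally show ?thesis by simp
  qed
  also have "\<dots> = (\<Sum>j\<in>{1..s}. 2)" by simp
  finally have "card (F j) = 2" if "j \<in> {1..s}" for j
    using sum_mono_inv[of "\<lambda>_. 2" "{1..s}" "\<lambda>j. card (F j)" j] two that by simp
  moreover have "l x \<in> {1..s}" using limg x by blast
  ultimately have c: "card (F (l x)) = 2" by blast
  have "{x, flip G x} = F (l x)"
    by (rule card_subset_eq) (use x fl lflip A(5)[OF x] c in \<open>auto simp: F_def\<close>)
  then show ?thesis by (auto simp: F_def)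
qed

text \<open>For each edge one of its two darts is chosen as the even one.\<close>

lemma card_parametrizations:
  assumes G: "arrowed G"
  shows "card (parametrizations G) = 2 ^ s * card (compatible_labelings G)"
proof -
  note A = arrowed_D[OF G]
  let ?D = "{..<2 * s}"
  define L where "L q = restrict (\<lambda>x. s - inv q x div 2) ?D" for q :: "nat \<Rightarrow> nat"
  define choice where "choice q = restrict (\<lambda>i. q (2 * i)) {..<s}" for q :: "nat \<Rightarrow> nat"
  define fib where "fib l = PiE {..<s} (\<lambda>i. {x. x < 2 * s \<and> l x = s - i})" for l :: "nat \<Rightarrow> nat"
  define unlabel where "unlabel = (\<lambda>(l :: nat \<Rightarrow> nat, c) x. if x < 2 * s then (if even x then c (x div 2) else flip G (c (x div 2))) else x)"
  have fl: "flip G y < 2 * s" if "y < 2 * s" for y using permutes_in_image[OF A(4), of y] that by simp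
  have Q: "q permutes ?D" "\<And>x. x < 2 * s \<Longrightarrow> q (mate s x) = flip G (q x)"
    "\<And>x. x < 2 * s \<Longrightarrow> dots G (next_dart G (q x)) = 0 \<Longrightarrow> inv q (next_dart G (q x)) div 2 < x div 2"
    "\<And>x. inv q (q x) = x" "\<And>x. q (inv q x) = x" "\<And>x. x < 2 * s \<Longrightarrow> q x < 2 * s" "\<And>x. x < 2 * s \<Longrightarrow> inv q x < 2 * s"
    if "q \<in> parametrizations G" for q
  proof -
    show q: "q permutes ?D" using that by (simp add: parametrizations_def)
    show "\<And>x. x < 2 * s \<Longrightarrow> q (mate s x) = flip G (q x)"
      "\<And>x. x < 2 * s \<Longrightarrow> dots G (next_dart G (q x)) = 0 \<Longrightarrow> inv q (next_dart G (q x)) div 2 < x div 2"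
      using that by (simp_all add: parametrizations_def)
    show "\<And>x. inv q (q x) = x" "\<And>x. q (inv q x) = x" using permutes_inverses[OF q] by auto
    show "\<And>x. x < 2 * s \<Longrightarrow> q x < 2 * s" "\<And>x. x < 2 * s \<Longrightarrow> inv q x < 2 * s"
      using permutes_in_image[OF q] permutes_in_image[OF permutes_inv[OF q]] by auto
  qed
  have bij: "bij_betw (\<lambda>q. (L q, choice q)) (parametrizations G) (Sigma (compatible_labelings G) fib)"
  proof (rule bij_betw_byWitness[where f'=unlabel])
    show "\<forall>q\<in>parametrizations G. unlabel (L q, choice q) = q"
    proof (intro ballI ext)
      fix q x assume q: "q \<in> parametrizations G"
      note q' = Q[OF q]
      show "unlabel (L q, choice q) x = q x"
      proof (cases "x < 2 * s")
        case True
        then have "x div 2 < s" by (rule half_less)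
        moreover have "q x = flip G (q (2 * (x div 2)))" if "odd x"
        proof -
          have "mate s (2 * (x div 2)) = x" using that True \<open>x div 2 < s\<close> by (simp add: mate_def)
          then show ?thesis using q'(2)[of "2 * (x div 2)"] \<open>x div 2 < s\<close> by simp
        qed
        ultimately show ?thesis using True by (auto simp: unlabel_def choice_def)
      next
        case False
        then show ?thesis using permutes_not_in[OF q'(1), of x] by (simp add: unlabel_def)
      qed
    qed
    show "(\<lambda>q. (L q, choice q)) ` parametrizations G \<subseteq> Sigma (compatible_labelings G) fib"
    proof (intro image_subsetI SigmaI)
      fix q assume q: "q \<in> parametrizations G"
      note q' = Q[OF q]
      have Lx: "L q x = s - inv q x div 2" if "x < 2 * s" for x using that by (simp add: L_def)
      have inv_flip: "inv q (flip G x) = mate s (inv q x)" if "x < 2 * s" for x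
        using q'(2)[OF q'(7)[OF that]] q'(4,5) by metis
      have "L q \<in> edge_labelings G"
        unfolding edge_labelings_def A(1,2)
      proof (intro CollectI conjI ballI)
        have range: "L q x \<in> {1..s}" if "x < 2 * s" for x
          using half_less[OF q'(7)[OF that]] by (simp add: Lx[OF that] Suc_le_eq)
        then show "L q \<in> ?D \<rightarrow>\<^sub>E {1..s}" by (auto simp: L_def)
        show "L q ` ?D = {1..s}"
        proof (intro equalityI subsetI)
          fix j assume j: "j \<in> {1..s}"
          then have d: "2 * (s - j) < 2 * s" by auto
          have "L q (q (2 * (s - j))) = j" using Lx[OF q'(6)[OF d]] q'(4) j by simp
          then show "j \<in> L q ` ?D" using q'(6)[OF d] by (metis imageI lessThan_iff)
        qed (use range in auto)
        show "L q (flip G x) = L q x" if "x \<in> ?D" for x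
          using that fl inv_flip by (simp add: Lx mate_div)
      qed
      moreover have "L q x < L q (next_dart G x)" if "x < 2 * s" "dots G (next_dart G x) = 0" for x
      proof -
        have "inv q (next_dart G x) div 2 < inv q x div 2"
          using q'(3)[OF q'(7)[OF that(1)]] q'(5) that(2) by simp
        moreover have "inv q x div 2 < s" by (rule half_less[OF q'(7)[OF that(1)]])
        ultimately show ?thesis unfolding Lx[OF that(1)] Lx[OF next_dart_in[OF G that(1)]] by linarith
      qed
      ultimately show "L q \<in> compatible_labelings G" by (simp add: compatible_labelings_def A(2))
      have "choice q i \<in> {x. x < 2 * s \<and> L q x = s - i}" if "i < s" for i
      proof -
        have d: "2 * i < 2 * s" using that by simp
        show ?thesis using q'(6)[OF d] Lx[OF q'(6)[OF d]] q'(4) that by (simp add: choice_def)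
      qed
      then show "choice q \<in> fib (L q)" by (auto simp: fib_def choice_def)
    qed
    have main: "unlabel (l, c) \<in> parametrizations G \<and> L (unlabel (l, c)) = l \<and> choice (unlabel (l, c)) = c"
      if lc: "l \<in> compatible_labelings G" "c \<in> fib l" for l c
    proof -
      have el: "l \<in> edge_labelings G"
        and lcomp: "\<And>x. x < 2 * s \<Longrightarrow> dots G (next_dart G x) = 0 \<Longrightarrow> l x < l (next_dart G x)"
        using lc(1) by (auto simp: compatible_labelings_def A(2))
      have lflip: "\<And>x. x < 2 * s \<Longrightarrow> l (flip G x) = l x" and lext: "l \<in> extensional ?D"
        and lrange: "\<And>x. x < 2 * s \<Longrightarrow> l x \<in> {1..s}"
        using el by (auto simp: edge_labelings_def A(1,2) PiE_def)
      have c: "c i < 2 * s" "l (c i) = s - i" if "i < s" for i using lc(2) that by (auto simp: fib_def)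
      define q where "q = unlabel (l, c)"
      have q_even: "q (2 * i) = c i" and q_odd: "q (2 * i + 1) = flip G (c i)" if "i < s" for i
        using that by (auto simp: q_def unlabel_def)
      have split: "x = 2 * (x div 2) \<or> x = 2 * (x div 2) + 1" for x :: nat by presburger
      have qx: "q x < 2 * s" "l (q x) = s - x div 2" if "x < 2 * s" for x
      proof -
        note i = half_less[OF that]
        have "q x = c (x div 2) \<or> q x = flip G (c (x div 2))" using split[of x] q_even[OF i] q_odd[OF i] by metis
        then show "q x < 2 * s" "l (q x) = s - x div 2" using c[OF i] fl lflip by auto
      qed
      have inj: "inj_on q ?D"
      proof (rule inj_onI)
        fix x y assume "x \<in> ?D" "y \<in> ?D" and e: "q x = q y"
        then have x: "x < 2 * s" and y: "y < 2 * s" by auto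
        have "s - x div 2 = s - y div 2" using qx(2)[OF x] qx(2)[OF y] e by simp
        then have i: "x div 2 = y div 2" using half_less[OF x] half_less[OF y] by linarith
        have "c (x div 2) \<noteq> flip G (c (x div 2))" using A(5)[OF c(1)[OF half_less[OF x]]] by metis
        then show "x = y" using e split[of x] split[of y] i q_even[OF half_less[OF x]] q_odd[OF half_less[OF x]] by metis
      qed
      have "q ` ?D = ?D" using inj qx(1) by (intro endo_inj_surj) auto
      then have perm: "q permutes ?D"
        using inj by (intro bij_imp_permutes) (auto simp: bij_betw_def q_def unlabel_def)
      have pinv: "inv q (q x) = x" "q (inv q x) = x" for x using permutes_inverses[OF perm] by auto
      have inv_in: "inv q x < 2 * s" if "x < 2 * s" for x
        using permutes_in_image[OF permutes_inv[OF perm], of x] that by simp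
      have lx: "l x = s - inv q x div 2" if "x < 2 * s" for x
        using qx(2)[OF inv_in[OF that]] pinv(2) by simp
      have mate: "q (mate s x) = flip G (q x)" if "x < 2 * s" for x
      proof -
        note i = half_less[OF that]
        show ?thesis
        proof (cases "even x")
          case True
          then have x: "x = 2 * (x div 2)" by simp
          have "mate s x = 2 * (x div 2) + 1" using True that by (simp add: mate_def)
          then show ?thesis using q_even[OF i] q_odd[OF i] x by metis
        next
          case False
          then have x: "x = 2 * (x div 2) + 1" by simp
          have "mate s x = 2 * (x div 2)" using False that by (simp add: mate_def)
          then show ?thesis using q_even[OF i] q_odd[OF i] x A(5)[OF c(1)[OF i]] by metis
        qed
      qed
      have "inv q (next_dart G (q x)) div 2 < x div 2" if "x < 2 * s" "dots G (next_dart G (q x)) = 0" for x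
      proof -
        have n: "next_dart G (q x) < 2 * s" using next_dart_in[OF G qx(1)[OF that(1)]] .
        have "s - x div 2 < s - inv q (next_dart G (q x)) div 2"
          using lcomp[OF qx(1)[OF that(1)] that(2)] qx(2)[OF that(1)] lx[OF n] by simp
        then show ?thesis by linarith
      qed
      then have "q \<in> parametrizations G" using perm mate by (simp add: parametrizations_def)
      moreover have "L q = l"
        using lx lext by (auto simp: L_def fun_eq_iff extensional_def)
      moreover have "choice q = c"
        using q_even lc(2) by (auto simp: choice_def fun_eq_iff fib_def PiE_def extensional_def)
      ultimately show ?thesis by (simp add: q_def)
    qed
    show "\<forall>u\<in>Sigma (compatible_labelings G) fib. (L (unlabel u), choice (unlabel u)) = u"
      using main by auto
    show "unlabel ` Sigma (compatible_labelings G) fib \<subseteq> parametrizations G"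
      using main by auto
  qed
  have fin: "finite (compatible_labelings G)"
  proof (rule finite_subset)
    show "compatible_labelings G \<subseteq> ?D \<rightarrow>\<^sub>E {1..s}" by (auto simp: compatible_labelings_def edge_labelings_def A(1,2))
  qed (auto intro: finite_PiE)
  have "card (fib l) = 2 ^ s" if "l \<in> compatible_labelings G" for l
  proof -
    have l: "l \<in> edge_labelings G" using that by (simp add: compatible_labelings_def)
    have "card {x. x < 2 * s \<and> l x = s - i} = 2" if "i < s" for i
    proof -
      have "s - i \<in> l ` ?D" using l that by (auto simp: edge_labelings_def A(1,2))
      then obtain x where x: "x < 2 * s" "l x = s - i" by auto
      have "{y. y < 2 * s \<and> l y = s - i} = {x, flip G x}" using label_fiber[OF G l x(1)] x(2) by simp
      then show ?thesis using A(5)[OF x(1)] by auto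
    qed
    then show ?thesis unfolding fib_def by (subst card_PiE) auto
  qed
  moreover have "finite (fib l)" for l
    unfolding fib_def by (intro finite_PiE) auto
  ultimately have "card (Sigma (compatible_labelings G) fib) = 2 ^ s * card (compatible_labelings G)"
    using fin by (simp add: card_SigmaI)
  then show ?thesis using bij_betw_same_card[OF bij] by simp
qed

section \<open>Hurwitz numbers as numbers of factorizations\<close>

definition factorizations :: "((nat \<times> nat) \<times> (nat \<times> nat)) list set" where
  "factorizations = {ps \<in> words blocks s.
     regular r blocks (act (inv block_shift) ps) \<and> (\<exists>(p, q)\<in>set ps. fst p \<noteq> fst q)}"

lemma orbit_inv_block_shift:
  assumes "v < 2" "k < \<mu> v"
  shows "orbit (inv block_shift) (v, k) = {v} \<times> {..<\<mu> v}"
proof -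
  have "orbit (inv block_shift) (v, k) = orbit block_shift (v, k)"
    by (rule orbit_inv_eq[OF block_shift_permutation])
  then show ?thesis using orbit_block_shift[OF assms] by simp
qed

text \<open>The blocks of a vertex are a cycle of \<open>block_shift\<close>, so the vertices are linked iff a letter leads from one to the other.\<close>

lemma linked_iff_crossing:
  assumes "ps \<in> words blocks s"
  shows "linked (inv block_shift) ps (0, 0) (1, 0) \<longleftrightarrow> (\<exists>(p, q)\<in>set ps. fst p \<noteq> fst q)"
proof
  assume L: "linked (inv block_shift) ps (0, 0) (1, 0)"
  show "\<exists>(p, q)\<in>set ps. fst p \<noteq> fst q"
  proof (rule ccontr)
    assume no: "\<not> (\<exists>(p, q)\<in>set ps. fst p \<noteq> fst q)"
    define S where "S = {b :: nat \<times> nat. fst b = 0}"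
    have fst_shift: "fst (block_shift b) = fst b" for b by (simp add: block_shift_def)
    have "fst (inv block_shift b) = fst b" for b
      using fst_shift[of "inv block_shift b"] permutes_inverses(1)[OF block_shift_permutes, of b] by simp
    then have "invariant (inv block_shift) S" by (simp add: invariant_def S_def)
    moreover have "unseparated S ps" using no by (force simp: unseparated_def S_def)
    ultimately have "(0, 0) \<in> S \<longleftrightarrow> (1, 0) \<in> S" using L unfolding linked_def by blast
    then show False by (simp add: S_def)
  qed
next
  assume "\<exists>(p, q)\<in>set ps. fst p \<noteq> fst q"
  then obtain p q where pq: "(p, q) \<in> set ps" "fst p \<noteq> fst q" by blast
  have "(p, q) \<in> pairs blocks" using assms pq(1) by (auto simp: words_def)
  then have pb: "p \<in> blocks" "q \<in> blocks" by (auto simp: pairs_def)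
  show "linked (inv block_shift) ps (0, 0) (1, 0)"
    unfolding linked_def
  proof (intro allI impI)
    fix S assume S: "invariant (inv block_shift) S \<and> unseparated S ps"
    have same: "b \<in> S \<longleftrightarrow> (fst b, 0) \<in> S" if "b \<in> blocks" for b
    proof (rule invariant_orbit_mem[OF conjunct1[OF S]])
      obtain v k where b: "b = (v, k)" "v < 2" "k < \<mu> v" using \<open>b \<in> blocks\<close> by (auto simp: blocks_def)
      then show "b \<in> orbit (inv block_shift) (fst b, 0)" using orbit_inv_block_shift[of v 0] by simp
    qed
    have "p \<in> S \<longleftrightarrow> q \<in> S" using S pq(1) unfolding unseparated_def by blast
    then have e: "(fst p, 0) \<in> S \<longleftrightarrow> (fst q, 0) \<in> S" using same[OF pb(1)] same[OF pb(2)] by blast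
    have "fst p < 2" "fst q < 2" using pb by (auto simp: blocks_def)
    then have "fst p = 0 \<and> fst q = 1 \<or> fst p = 1 \<and> fst q = 0" using pq(2) by linarith
    then show "(0, 0) \<in> S \<longleftrightarrow> (1, 0) \<in> S" using e by auto
  qed
qed

text \<open>The blocks of the two vertices are the only cycles, and \<open>s + 2\<close> is the number of letters and cycles in
\<open>count_linked_factorizations\<close>.\<close>

lemma card_factorizations:
  "real (card factorizations) = 2 ^ s * fact s * annulus_coeff r (\<mu> 0) (\<mu> 1)"
proof -
  let ?\<rho> = "inv block_shift"
  define C where "C v = {v} \<times> {..<\<mu> v}" for v :: nat
  have orb: "orbit ?\<rho> (0, 0) = C 0" "orbit ?\<rho> (1, 0) = C 1"
    using orbit_inv_block_shift[of 0 0] orbit_inv_block_shift[of 1 0] \<mu>_pos by (simp_all add: C_def)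
  have cyc: "cycles blocks ?\<rho> = {C 0, C 1}"
  proof (intro equalityI subsetI)
    fix X assume "X \<in> cycles blocks ?\<rho>"
    then obtain v k where b: "X = orbit ?\<rho> (v, k)" "v < 2" "k < \<mu> v" by (auto simp: cycles_def blocks_def)
    then have "X = C v" using orbit_inv_block_shift by (simp add: C_def)
    moreover have "v = 0 \<or> v = 1" using b(2) by auto
    ultimately show "X \<in> {C 0, C 1}" by auto
  next
    fix X assume "X \<in> {C 0, C 1}"
    moreover have "(0, 0) \<in> blocks" "(1, 0) \<in> blocks" using degrees_pos by (auto simp: blocks_def)
    ultimately show "X \<in> cycles blocks ?\<rho>" unfolding cycles_def orb[symmetric] by blast
  qed
  have ne: "C 0 \<noteq> C 1"
  proof
    assume "C 0 = C 1"
    moreover have "(0, 0) \<in> C 0" using degrees_pos by (simp add: C_def)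
    ultimately show False by (simp add: C_def)
  qed
  have cards: "card (C v) = \<mu> v" for v by (simp add: C_def)
  have eq: "factorizations = {ps \<in> words blocks s. regular r blocks (act ?\<rho> ps) \<and> linked ?\<rho> ps (0, 0) (1, 0)}"
    unfolding factorizations_def using linked_iff_crossing by auto
  have "real (card {ps \<in> words blocks s. regular r blocks (act ?\<rho> ps) \<and> linked ?\<rho> ps (0, 0) (1, 0)})
     = 2 ^ s * fact s * (annulus_coeff r (card (orbit ?\<rho> (0, 0))) (card (orbit ?\<rho> (1, 0)))
       * (\<Prod>C\<in>cycles blocks ?\<rho> - {orbit ?\<rho> (0, 0), orbit ?\<rho> (1, 0)}. disc_coeff r (card C)))"
  proof (rule count_linked_factorizations[OF finite_blocks r])
    show "card blocks = r * s" using card_blocks degree by simp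
    show "?\<rho> permutes blocks" by (rule permutes_inv[OF block_shift_permutes])
    show "s + card (cycles blocks ?\<rho>) = s + 2" unfolding cyc using ne by simp
    show "(0, 0) \<in> blocks" "(1, 0) \<in> blocks" using degrees_pos by (auto simp: blocks_def)
    show "(1, 0) \<notin> orbit ?\<rho> (0, 0)" unfolding orb by (simp add: C_def)
  qed
  then show ?thesis unfolding eq orb cyc cards by simp
qed

lemma factorization_word: "ps \<in> factorizations \<Longrightarrow> oriented_word \<mu> s ps"
  by (intro oriented_word.intro block_states oriented_word_axioms.intro) (auto simp: factorizations_def)

abbreviation graph_of :: "((nat \<times> nat) \<times> (nat \<times> nat)) list \<Rightarrow> arrowed_hurwitz_graph" where
  "graph_of \<equiv> oriented_word.word_graph \<mu> s"

lemma graph_of_arrowed: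
  assumes "ps \<in> factorizations"
  shows "arrowed (graph_of ps)"
proof -
  interpret P: oriented_word \<mu> s ps by (rule factorization_word[OF assms])
  show ?thesis
    by (rule P.word_graph_arrowed[OF r _ degree]) (use assms in \<open>simp add: factorizations_def P.monodromy_def\<close>)
qed

definition representative :: "arrowed_hurwitz_graph set \<Rightarrow> arrowed_hurwitz_graph" where
  "representative C = (SOME G. G \<in> C)"

definition iso_class :: "arrowed_hurwitz_graph \<Rightarrow> arrowed_hurwitz_graph set" where
  "iso_class G = R `` {G}"

text \<open>By uniqueness of isomorphisms the choice is forced; only the representative of the class is arbitrary.\<close>

definition to_representative :: "arrowed_hurwitz_graph \<Rightarrow> nat \<Rightarrow> nat" where
  "to_representative G = (SOME p. p \<in> isos G (representative (iso_class G)))"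

lemma representative_class:
  assumes "C \<in> {G. arrowed G} // R"
  shows "representative C \<in> C" "arrowed (representative C)" "iso_class (representative C) = C"
proof -
  obtain G where G: "arrowed G" "C = R `` {G}" using assms by (auto elim: quotientE)
  have "G \<in> C" using equiv_class_self[OF equiv_iso_rel] G by simp
  then show m: "representative C \<in> C" unfolding representative_def by (rule someI)
  then have rel: "(G, representative C) \<in> R" unfolding G(2) by blast
  then show "arrowed (representative C)" by (simp add: iso_rel_def)
  show "iso_class (representative C) = C"
    unfolding iso_class_def equiv_class_eq[OF equiv_iso_rel rel, symmetric] by (rule G(2)[symmetric])
qed

lemma iso_class_in: "arrowed G \<Longrightarrow> iso_class G \<in> {G. arrowed G} // R"
  by (simp add: iso_class_def quotientI)

lemma to_representative:
  assumes "arrowed G"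
  shows "to_representative G \<in> isos G (representative (iso_class G))"
proof -
  have "representative (iso_class G) \<in> R `` {G}"
    using representative_class(1)[OF iso_class_in[OF assms]] by (simp add: iso_class_def)
  then have "\<exists>p. p \<in> isos G (representative (iso_class G))" by (auto simp: iso_rel_def)
  then show ?thesis unfolding to_representative_def by (rule someI_ex)
qed

lemma isos_next_dart:
  assumes G: "arrowed G" and H: "arrowed H" and p: "p \<in> isos G H" and x: "x < 2 * s"
  shows "p (next_dart G x) = next_dart H (p x)"
proof -
  note D = isos_D[OF p]
  have x': "x \<in> darts G" "next_dart G x \<in> darts G" using x next_dart_in[OF G x] arrowed_D(2)[OF G] by simp_all
  have "rot H (p (next_dart G x)) = flip H (p x)"
    using D(4)[OF x'(2)] D(5)[OF x'(1)] permutes_inverses(1)[OF arrowed_D(3)[OF G], of "flip G x"] by (simp add: next_dart_def)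
  then show ?thesis
    using permutes_inverses(2)[OF arrowed_D(3)[OF H], of "p (next_dart G x)"] by (simp add: next_dart_def)
qed

lemma isos_graph_of_parametrizes:
  assumes ps: "ps \<in> factorizations" and G: "arrowed G" and p: "p \<in> isos (graph_of ps) G"
  shows "p \<in> parametrizations G"
proof -
  interpret P: oriented_word \<mu> s ps by (rule factorization_word[OF ps])
  note D = isos_D[OF p, simplified]
  have pinv: "inv p (p x) = x" for x using permutes_inverses[OF D(2)] by auto
  have n: "next_dart G (p x) = p (P.next_d x)" if "x < 2 * s" for x
    using isos_next_dart[OF graph_of_arrowed[OF ps] G p that] by (rule sym)
  have "inv p (next_dart G (p x)) div 2 < x div 2" if "x < 2 * s" "dots G (next_dart G (p x)) = 0" for x
  proof -
    have "dots (graph_of ps) (P.next_d x) = 0"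
      using that(2) D(7)[of "P.next_d x"] P.next_d_in[of x] that(1) unfolding n[OF that(1)] by simp
    then show ?thesis using P.label_increases[of x] that(1) by (simp add: n pinv)
  qed
  then show ?thesis using D(2,5) by (simp add: parametrizations_def)
qed

lemma graph_of_determined:
  assumes ps: "ps \<in> factorizations" and qs: "qs \<in> factorizations"
    and p: "p \<in> isos (graph_of ps) G" "p \<in> isos (graph_of qs) G"
  shows "ps = qs"
proof -
  interpret P: oriented_word \<mu> s ps by (rule factorization_word[OF ps])
  interpret Q: oriented_word \<mu> s qs by (rule factorization_word[OF qs])
  note D = isos_D[OF p(1)] and E = isos_D[OF p(2)]
  have inj: "p x = p y \<Longrightarrow> x = y" for x y using permutes_inj[OF D(2)] by (auto dest: injD)
  have dP: "darts (graph_of ps) = {..<2 * s}" and dQ: "darts (graph_of qs) = {..<2 * s}" by simp_all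
  have vP: "vert (graph_of ps) ` {..<2 * s} = {..<2}" and vQ: "vert (graph_of qs) ` {..<2 * s} = {..<2}"
    using arrowed_D(7)[OF graph_of_arrowed] ps qs by blast+
  show ?thesis
  proof (rule word_graph_inject[OF factorization_word[OF ps] factorization_word[OF qs]])
    fix x assume "x < 2 * s"
    then have x: "x \<in> {..<2 * s}" by simp
    have "p (rot (graph_of ps) x) = p (rot (graph_of qs) x)"
      using D(4)[unfolded dP, OF x] E(4)[unfolded dQ, OF x] by simp
    then show "rot (graph_of ps) x = rot (graph_of qs) x" by (rule inj)
    show "dots (graph_of ps) x = dots (graph_of qs) x"
      using D(7)[unfolded dP, OF x] E(7)[unfolded dQ, OF x] by simp
  next
    fix v :: nat assume "v < 2"
    then have v: "v \<in> {..<2}" by simp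
    have "apfst p (arrow (graph_of ps) v) = apfst p (arrow (graph_of qs) v)"
      using D(8)[unfolded dP vP, OF v] E(8)[unfolded dQ vQ, OF v] by simp
    then show "arrow (graph_of ps) v = arrow (graph_of qs) v"
      by (cases "arrow (graph_of ps) v"; cases "arrow (graph_of qs) v") (auto dest: inj)
  qed
qed

text \<open>Otherwise \<open>rot\<close> and \<open>flip\<close> would preserve the vertex of a dart, and the graph would not be connected.\<close>

lemma parametrization_crosses:
  assumes G: "arrowed G" and q: "q \<in> parametrizations G"
  shows "\<exists>i<s. vert G (q (2 * i)) \<noteq> vert G (q (2 * i + 1))"
proof (rule ccontr)
  assume no: "\<not> ?thesis"
  note A = arrowed_D[OF G]
  have perm: "q permutes {..<2 * s}" and m: "\<And>x. x < 2 * s \<Longrightarrow> q (mate s x) = flip G (q x)"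
    using q by (auto simp: parametrizations_def)
  have vf: "vert G (flip G x) = vert G x" if "x < 2 * s" for x
  proof -
    define y where "y = inv q x"
    have y: "y < 2 * s" "q y = x"
      using permutes_in_image[OF permutes_inv[OF perm], of x] permutes_inverses(1)[OF perm, of x] that by (simp_all add: y_def)
    have i: "y div 2 < s" by (rule half_less[OF y(1)])
    have e: "vert G (q (2 * (y div 2))) = vert G (q (2 * (y div 2) + 1))" using no i by blast
    have "y = 2 * (y div 2) \<and> mate s y = 2 * (y div 2) + 1 \<or> y = 2 * (y div 2) + 1 \<and> mate s y = 2 * (y div 2)"
      using y(1) by (cases "even y") (simp_all add: mate_def)
    then have "vert G (q (mate s y)) = vert G (q y)" using e by metis
    then show ?thesis using m[OF y(1)] y(2) by simp
  qed
  have vr: "vert G (rot G x) = vert G x" if "x < 2 * s" for x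
    using A(8)[of x "rot G x"] orbit.base[of "rot G" x] permutes_in_image[OF A(3), of x] that by simp
  have z: "(0::nat) < 2 * s" using edges_pos by simp
  have const: "y < 2 * s \<and> vert G y = vert G 0" if "(0, y) \<in> ({(u, rot G u) |u. True} \<union> {(u, flip G u) |u. True})\<^sup>*" for y
    using that
  proof (induction rule: rtrancl_induct)
    case (step y z)
    have "rot G y < 2 * s" "flip G y < 2 * s"
      using permutes_in_image[OF A(3), of y] permutes_in_image[OF A(4), of y] step(3) by auto
    then show ?case using step vf[of y] vr[of y] by auto
  qed (use z in simp)
  have "vert G ` {..<2 * s} \<subseteq> {vert G 0}"
  proof (rule image_subsetI)
    fix y assume "y \<in> {..<2 * s}"
    then have "y < 2 * s" by simp
    then have "vert G y = vert G 0" by (rule conjunct2[OF const[OF A(6)[OF z]]])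
    then show "vert G y \<in> {vert G 0}" by (simp only: singleton_iff)
  qed
  then have "{..<2} \<subseteq> {vert G 0}" using A(7) by simp
  then have "0 \<in> {vert G 0}" "1 \<in> {vert G 0}" by (auto simp only: subset_iff lessThan_iff)
  then show False by simp
qed

text \<open>Transported along \<open>q\<close>, the graph becomes a labeled rotation, and its word has a graph to which \<open>q\<close> is an isomorphism. That
all faces have \<open>r\<close> dots makes the word regular.\<close>

lemma parametrization_realized:
  assumes G: "arrowed G" and q: "q \<in> parametrizations G"
  shows "\<exists>ps\<in>factorizations. q \<in> isos (graph_of ps) G"
proof -
  note A = arrowed_D[OF G]
  have perm: "q permutes {..<2 * s}" and m: "\<And>x. x < 2 * s \<Longrightarrow> q (mate s x) = flip G (q x)"
    and comp: "\<And>x. x < 2 * s \<Longrightarrow> dots G (next_dart G (q x)) = 0 \<Longrightarrow> inv q (next_dart G (q x)) div 2 < x div 2"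
    using q by (simp_all add: parametrizations_def)
  have qi: "inv q (q x) = x" "q (inv q x) = x" for x using permutes_inverses[OF perm] by auto
  have q_in: "q x < 2 * s" if "x < 2 * s" for x using permutes_in_image[OF perm, of x] that by simp
  have inv_in: "inv q x < 2 * s" if "x < 2 * s" for x
    using permutes_in_image[OF permutes_inv[OF perm], of x] that by simp
  define T where "T = inv q \<circ> rot G \<circ> q"
  define base where "base v = inv q (fst (arrow G v))" for v
  have qT: "q (T x) = rot G (q x)" for x by (simp add: T_def qi)
  have T_perm: "T permutes {..<2 * s}"
    unfolding T_def by (intro permutes_compose perm A(3) permutes_inv[OF perm])
  have T_in: "T x < 2 * s" if "x < 2 * s" for x using permutes_in_image[OF T_perm, of x] that by simp
  have lr: "labeled_rotation \<mu> s T (\<lambda>x. vert G (q x)) (\<lambda>x. dots G (q x)) base (\<lambda>v. snd (arrow G v))"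
  proof
    show "T permutes {..<2 * s}" by (rule T_perm)
    have "(\<lambda>x. vert G (q x)) ` {..<2 * s} = vert G ` q ` {..<2 * s}" by (simp add: image_image)
    also have "\<dots> = {..<2}" unfolding permutes_image[OF perm] by (rule A(7))
    finally show "(\<lambda>x. vert G (q x)) ` {..<2 * s} = {..<2}" .
    show "vert G (q x) = vert G (q y) \<longleftrightarrow> y \<in> orbit T x" if "x < 2 * s" "y < 2 * s" for x y
    proof -
      have "orbit (rot G) (q x) = q ` orbit T x" by (rule orbit_semiconj) (rule qT)
      then show ?thesis
        using A(8)[OF q_in[OF that(1)] q_in[OF that(2)]] inj_image_mem_iff[OF permutes_inj[OF perm]] by simp
    qed
    show "y div 2 < T y div 2" if "y < 2 * s" "dots G (q y) = 0" for y
    proof -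
      \<comment> \<open>The dart before \<open>y\<close> on its face is the opposite of \<open>T y\<close>.\<close>
      define x where "x = mate s (T y)"
      have x: "x < 2 * s" unfolding x_def by (rule mate_in[OF T_in[OF that(1)]])
      have f: "q x = flip G (rot G (q y))" unfolding x_def m[OF T_in[OF that(1)]] qT ..
      have "rot G (q y) < 2 * s" using T_in[OF that(1)] q_in qT by metis
      then have "flip G (q x) = rot G (q y)" unfolding f using A(5) by blast
      then have n: "next_dart G (q x) = q y" by (simp add: next_dart_def permutes_inverses(2)[OF A(3)])
      show ?thesis using comp[OF x] that(2) unfolding n qi by (simp add: x_def mate_div)
    qed
    show "(\<Sum>x | x < 2 * s \<and> vert G (q x) = v. dots G (q x)) = \<mu> v" if "v < 2" for v
    proof -
      have "bij_betw q {x. x < 2 * s \<and> vert G (q x) = v} {x \<in> darts G. vert G x = v}"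
        by (rule bij_betw_byWitness[where f'="inv q"]) (use q_in inv_in qi A(2) in auto)
      then show ?thesis
        using A(10)[OF that] sum.reindex_bij_betw[of q _ _ "dots G"] by (simp add: vertex_dots_def)
    qed
    show "base v < 2 * s \<and> vert G (q (base v)) = v \<and> snd (arrow G v) < dots G (q (base v))" if "v < 2" for v
      using A(11)[OF that] inv_in by (simp add: base_def qi)
    show "\<exists>x<s. vert G (q (2 * x)) \<noteq> vert G (q (2 * x + 1))" by (rule parametrization_crosses[OF G q])
  qed
  interpret L: labeled_rotation \<mu> s T "\<lambda>x. vert G (q x)" "\<lambda>x. dots G (q x)" base "\<lambda>v. snd (arrow G v)" by (rule lr)
  have rotW: "q (L.W.word_rot x) = rot G (q x)" if "x < 2 * s" for x
    using L.W_rot_gap(1)[of x] that qT by simp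
  have dotsW: "dots (graph_of L.code) x = dots G (q x)" if "x < 2 * s" for x
    using L.W_dots[of x] that by simp
  have iso: "q \<in> isos (graph_of L.code) G"
    unfolding isos_def
  proof (intro CollectI conjI ballI)
    show "nedges (graph_of L.code) = nedges G" using A(1) by simp
    show "q permutes darts (graph_of L.code)" using perm by simp
    show "arrow G i = apfst q (arrow (graph_of L.code) i)" if "i \<in> vert (graph_of L.code) ` darts (graph_of L.code)" for i
    proof -
      have "i < 2" using that L.W.end_block_vertex by auto
      then show ?thesis using L.W_arrow[of i] by (simp add: base_def qi)
    qed
    fix x assume "x \<in> darts (graph_of L.code)"
    then have x: "x < 2 * s" by simp
    show "q (rot (graph_of L.code) x) = rot G (q x)" using rotW[OF x] by simp
    show "q (flip (graph_of L.code) x) = flip G (q x)" using m[OF x] by simp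
    show "vert G (q x) = vert (graph_of L.code) x" using L.W_end_block[of x] x by simp
    show "dots G (q x) = dots (graph_of L.code) x" using dotsW[OF x] by simp
  qed
  have next_q: "q (L.W.next_d x) = next_dart G (q x)" if "x < 2 * s" for x
  proof -
    have "L.W.next_d x < 2 * s" using L.W.next_d_in[of x] that by simp
    then have "rot G (q (L.W.next_d x)) = flip G (q x)"
      using rotW[of "L.W.next_d x"] L.W.rot_next_d[of x] m[OF that] by simp
    then show ?thesis using permutes_inverses(2)[OF A(3), of "q (L.W.next_d x)"] by (simp add: next_dart_def)
  qed
  have "(\<Sum>x\<in>F. dots (graph_of L.code) x) = r" if "F \<in> faces (graph_of L.code)" for F
  proof -
    obtain x where x: "x < 2 * s" "F = orbit L.W.next_d x" using \<open>F \<in> _\<close> by (auto simp: faces_def)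
    have sub: "F \<subseteq> {..<2 * s}" unfolding x(2) using permutes_orbit_subset[OF L.W.next_d_permutes] x(1) by simp
    have "orbit (next_dart G) (q x) = q ` F"
      unfolding x(2)
    proof (rule orbit_semiconj)
      fix y assume "y \<in> insert x (orbit L.W.next_d x)"
      then have "y < 2 * s" using x sub by auto
      then show "q (L.W.next_d y) = next_dart G (q y)" by (rule next_q)
    qed
    then have "q ` F \<in> faces G" using q_in[OF x(1)] A(2) by (force simp: faces_def)
    then have "(\<Sum>y\<in>q ` F. dots G y) = r" by (rule A(9))
    moreover have "(\<Sum>y\<in>q ` F. dots G y) = (\<Sum>y\<in>F. dots G (q y))"
      by (subst sum.reindex) (use permutes_inj[OF perm] in \<open>auto simp: inj_on_def dest: injD\<close>)
    moreover have "\<dots> = (\<Sum>y\<in>F. dots (graph_of L.code) y)"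
      by (intro sum.cong refl) (use dotsW sub in auto)
    ultimately show ?thesis by simp
  qed
  then have "regular r blocks L.W.monodromy" using L.W.face_regular_iff by blast
  then have "L.code \<in> factorizations"
    using L.W.word L.W.crossing by (simp add: factorizations_def L.W.monodromy_def)
  then show ?thesis using iso by blast
qed

text \<open>A word determines its graph and thereby a class and an isomorphism to the representative, which carries the numbering of the darts
over. Conversely, a parametrization of the representative has exactly one word.\<close>

lemma factorizations_bij:
  "bij_betw (\<lambda>ps. (iso_class (graph_of ps), to_representative (graph_of ps))) factorizations
     (SIGMA C:{G. arrowed G} // R. parametrizations (representative C))"
  unfolding bij_betw_def
proof (intro conjI equalityI subsetI)
  show "inj_on (\<lambda>ps. (iso_class (graph_of ps), to_representative (graph_of ps))) factorizations"
  proof (rule inj_onI)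
    fix ps qs
    assume f: "ps \<in> factorizations" "qs \<in> factorizations"
      and e: "(iso_class (graph_of ps), to_representative (graph_of ps)) = (iso_class (graph_of qs), to_representative (graph_of qs))"
    have "to_representative (graph_of ps) \<in> isos (graph_of ps) (representative (iso_class (graph_of ps)))"
      "to_representative (graph_of ps) \<in> isos (graph_of qs) (representative (iso_class (graph_of ps)))"
      using to_representative[OF graph_of_arrowed[OF f(1)]] to_representative[OF graph_of_arrowed[OF f(2)]] e by simp_all
    then show "ps = qs" by (rule graph_of_determined[OF f])
  qed
next
  fix u assume "u \<in> (\<lambda>ps. (iso_class (graph_of ps), to_representative (graph_of ps))) ` factorizations"
  then obtain ps where ps: "ps \<in> factorizations" "u = (iso_class (graph_of ps), to_representative (graph_of ps))" by blast
  note G = graph_of_arrowed[OF ps(1)]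
  have "iso_class (graph_of ps) \<in> {G. arrowed G} // R" by (rule iso_class_in[OF G])
  moreover have "to_representative (graph_of ps) \<in> parametrizations (representative (iso_class (graph_of ps)))"
    by (rule isos_graph_of_parametrizes[OF ps(1) representative_class(2)[OF iso_class_in[OF G]] to_representative[OF G]])
  ultimately show "u \<in> (SIGMA C:{G. arrowed G} // R. parametrizations (representative C))" by (simp add: ps(2))
next
  fix u assume "u \<in> (SIGMA C:{G. arrowed G} // R. parametrizations (representative C))"
  then obtain C q where u: "u = (C, q)" "C \<in> {G. arrowed G} // R" "q \<in> parametrizations (representative C)" by (rule SigmaE)
  note rep = representative_class[OF u(2)]
  obtain ps where ps: "ps \<in> factorizations" "q \<in> isos (graph_of ps) (representative C)"
    using parametrization_realized[OF rep(2) u(3)] by (rule bexE)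
  note G = graph_of_arrowed[OF ps(1)]
  have "(graph_of ps, representative C) \<in> R" using G rep(2) ps(2) by (auto simp: iso_rel_def)
  then have c: "iso_class (graph_of ps) = C"
    using equiv_class_eq[OF equiv_iso_rel] rep(3) by (simp add: iso_class_def)
  have "to_representative (graph_of ps) = q"
    by (rule isos_unique[OF G to_representative[OF G]]) (use ps(2) c in simp)
  then show "u \<in> (\<lambda>ps. (iso_class (graph_of ps), to_representative (graph_of ps))) ` factorizations"
    using ps(1) c u(1) by (intro image_eqI[of _ _ ps]) simp_all
qed

text \<open>In a class, \<open>2\<^sup>s\<close> words belong to each compatible labeling, and the weight divides the number of the latter by \<open>s!\<close>.\<close>

theorem hurwitz_number_eq_annulus_coeff: "hurwitz_number r 0 [\<mu> 0, \<mu> 1] = annulus_coeff r (\<mu> 0) (\<mu> 1)"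
proof -
  let ?Q = "{G. arrowed G} // R"
  let ?par = "\<lambda>C. parametrizations (representative C)"
  have fin: "finite (?par C)" for C
    by (rule finite_subset[OF _ finite_permutations[of "{..<2 * s}"]]) (auto simp: parametrizations_def)
  have "real (card (SIGMA C:?Q. ?par C)) = (\<Sum>C\<in>?Q. real (card (?par C)))"
    using finite_classes fin by (simp add: card_SigmaI)
  also have "\<dots> = (\<Sum>C\<in>?Q. 2 ^ s * fact s * weight (SOME G. G \<in> C))"
  proof (intro sum.cong refl)
    fix C assume "C \<in> ?Q"
    note rep = representative_class(2)[OF this]
    show "real (card (?par C)) = 2 ^ s * fact s * weight (SOME G. G \<in> C)"
      using card_parametrizations[OF rep] weight_arrowed[OF rep] by (simp add: representative_def)
  qed
  also have "\<dots> = 2 ^ s * fact s * hurwitz_number r 0 [\<mu> 0, \<mu> 1]"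
    by (simp add: hurwitz_number_def sum_distrib_left)
  finally have "real (card factorizations) = 2 ^ s * fact s * hurwitz_number r 0 [\<mu> 0, \<mu> 1]"
    using bij_betw_same_card[OF factorizations_bij] by simp
  then show ?thesis unfolding card_factorizations by simp
qed

end

section \<open>The generating function\<close>

text \<open>If \<open>r\<close> does not divide \<open>p + q\<close>, there are no graphs, since every face has \<open>r\<close> dots.\<close>

theorem hurwitz_number_annulus:
  assumes "r > 0" "p > 0" "q > 0"
  shows "hurwitz_number r 0 [p, q] = annulus_coeff r p q"
proof (cases "r dvd p + q")
  case True
  then obtain s where s: "p + q = r * s" by auto
  define \<mu> where "\<mu> v = (if v = 0 then p else q)" for v :: nat
  interpret two_vertex_degrees r \<mu> s by unfold_locales (use assms s in \<open>simp_all add: \<mu>_def\<close>)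
  show ?thesis using hurwitz_number_eq_annulus_coeff by (simp add: \<mu>_def)
next
  case False
  then have none: "{G. arrowed_r_hurwitz_graph r 0 [p, q] G} = {}"
    by (auto simp: arrowed_r_hurwitz_graph_def r_hurwitz_graph_def)
  show ?thesis using False unfolding hurwitz_number_def none by (simp add: annulus_coeff_def)
qed

lemma F02_term_annulus:
  assumes "r > 0" "p > 0" "q > 0"
  shows "F02_term r x y (p, q) = of_real (radial_annulus_coeff r p q) / of_nat (p + q) * x ^ p * y ^ q"
proof -
  have "annulus_coeff r p q = real p * real q * (radial_annulus_coeff r p q / (p + q))"
    by (simp add: annulus_coeff_def radial_annulus_coeff_def)
  then have "hurwitz_number r 0 [p, q] = real p * real q * (radial_annulus_coeff r p q / (p + q))"
    using hurwitz_number_annulus[OF assms] by simp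
  then show ?thesis using assms(2,3) by (simp add: F02_term_def)
qed

theorem proposition3p4:
  fixes r :: nat
  assumes "0 < r"
  shows "\<exists>\<epsilon>>0. \<forall>z1 z2 :: complex. norm z1 < \<epsilon> \<longrightarrow> norm z2 < \<epsilon> \<longrightarrow>
     F02_term r (lambert_x r z1) (lambert_x r z2) summable_on ({1..} \<times> {1..}) \<and>
     F02 r (lambert_x r z1) (lambert_x r z2) = Ln (inv_diff_quotient r z1 z2) - (z1 ^ r + z2 ^ r)"
proof -
  obtain \<epsilon> where \<epsilon>: "\<epsilon> > 0"
    and series: "\<And>z1 z2 :: complex. norm z1 < \<epsilon> \<Longrightarrow> norm z2 < \<epsilon> \<Longrightarrow>
      ((\<lambda>(p, q). of_real (radial_annulus_coeff r p q) / of_nat (p + q) * lambert_x r z1 ^ p * lambert_x r z2 ^ q)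
        has_sum (Ln (inv_diff_quotient r z1 z2) - (z1 ^ r + z2 ^ r))) ({1..} \<times> {1..})"
    by (rule annulus_series_closed_form[OF assms], rule that)
  show ?thesis
  proof (intro exI[of _ \<epsilon>] conjI[OF \<epsilon>] allI impI)
    fix z1 z2 :: complex
    assume z: "norm z1 < \<epsilon>" "norm z2 < \<epsilon>"
    have "(F02_term r (lambert_x r z1) (lambert_x r z2) has_sum
        (Ln (inv_diff_quotient r z1 z2) - (z1 ^ r + z2 ^ r))) ({1..} \<times> {1..})"
    proof (rule has_sum_cong[THEN iffD1, OF _ series[OF z]])
      fix u :: "nat \<times> nat" assume "u \<in> {1..} \<times> {1..}"
      then obtain p q where "u = (p, q)" "p > 0" "q > 0" by (cases u) auto
      then show "(case u of (p, q) \<Rightarrow> of_real (radial_annulus_coeff r p q) / of_nat (p + q) * lambert_x r z1 ^ p * lambert_x r z2 ^ q)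
          = F02_term r (lambert_x r z1) (lambert_x r z2) u"
        using F02_term_annulus[OF assms] by simp
    qed
    then show "F02_term r (lambert_x r z1) (lambert_x r z2) summable_on ({1..} \<times> {1..}) \<and>
        F02 r (lambert_x r z1) (lambert_x r z2) = Ln (inv_diff_quotient r z1 z2) - (z1 ^ r + z2 ^ r)"
      unfolding F02_def by (auto simp: summable_on_def infsumI)
  qed
qed

end
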